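(* Let $\Gamma$ be a metrized graph and let $\mu$ be a real-valued signed Borel measure on $\Gamma$ with $\mu(\Gamma)=1$ and $|\mu|(\Gamma)<\infty$. Let $0<\lambda_1\le\lambda_2\le\cdots$ be the eigenvalues (listed with multiplicity) of the Laplacian $\Delta$ on $\mathrm{Dir}_\mu(\Gamma)$, and let $f_1,f_2,\ldots$ be corresponding eigenfunctions, chosen to be $L^2$-orthonormal. Then the series $$\sum_{n=1}^\infty\frac{f_n(x)\overline{f_n(y)}}{\lambda_n}$$ converges uniformly to $g_\mu(x,y)$ for all $x,y\in\Gamma$.
   Context: A metrized graph $\Gamma$ is a compact connected metric space such that for each $p\in\Gamma$ there are a radius $r_p>0$ and an integer $n_p\ge 1$ such that $p$ has a neighborhood isometric to the star $\{te^{2\pi i k/n_p}\in\mathbb{C}: 0\le t<r_p,\ k\in\mathbb{Z}\}$ with the path metric. $\mathrm{Vec}(p)$ is the set of $n_p$ formal unit vectors at $p$ (one for each ray of the star); $p+t\vec v$ is the point at distance $t$ from $p$ in direction $\vec v$ (small $t\ge0$), and $d_{\vec v}f(p)=\lim_{t\to0^+}(f(p+t\vec v)-f(p))/t$. $dx$ is arc-length measure. A function $f$ is piecewise $\mathcal{C}^k$ if there is a finite set $X_f\subset\Gamma$ such that $\Gamma\setminus X_f$ is a finite union of open intervals and $f$ is $\mathcal{C}^k$ on each of them (in an isometric parametrization). $\mathrm{Zh}(\Gamma)$ is the space of continuous $f:\Gamma\to\mathbb{C}$ that are piecewise $\mathcal{C}^2$ with $f''\in L^1(\Gamma,dx)$,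 and $\mathrm{Zh}_\mu(\Gamma)=\{f\in\mathrm{Zh}(\Gamma):\int_\Gamma f\,d\mu=0\}$. On $\mathrm{Zh}(\Gamma)$, $\langle f,g\rangle_{\mathrm{Dir}}=\int_\Gamma f'\overline{g'}\,dx$; $\|f\|_{\mathrm{Dir}}=\langle f,f\rangle_{\mathrm{Dir}}^{1/2}$ is a norm on $\mathrm{Zh}_\mu(\Gamma)$. $\mathrm{Dir}_\mu(\Gamma)$ is the completion of $\mathrm{Zh}_\mu(\Gamma)$ for this norm; since Dirichlet-Cauchy sequences in $\mathrm{Zh}_\mu(\Gamma)$ converge uniformly, it is identified with a subspace of $\mathcal{C}(\Gamma)$ via uniform limits, and $\langle\cdot,\cdot\rangle_{\mathrm{Dir}}$ extends to it. $\langle f,g\rangle=\int_\Gamma f\overline{g}\,dx$. A nonzero $f\in\mathrm{Dir}_\mu(\Gamma)$ is an eigenfunction of $\Delta$ on $\mathrm{Dir}_\mu(\Gamma)$ with eigenvalue $\lambda$ if $\langle f,g\rangle_{\mathrm{Dir}}=\lambda\langle f,g\rangle$ for all $g\in\mathrm{Dir}_\mu(\Gamma)$; all eigenvalues are real and positive, each has finite multiplicity, and they form a sequence tending to $\infty$. Kernel $g_\mu$: $\mathrm{CPA}(\Gamma)$ is the space of continuous piecewise affine functions $f:\Gamma\to\mathbb{C}$; for such $f$, $\Delta f=-\sum_{p}\big(\sum_{\vec v\in\mathrm{Vec}(p)}d_{\vec v}f(p)\big)\delta_p$. For $\zeta,y\in\Gamma$, $x\mapsto j_\zeta(x,y)$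 is the unique function in $\mathrm{CPA}(\Gamma)$ with $\Delta_x j_\zeta(x,y)=\delta_y-\delta_\zeta$ and $j_\zeta(\zeta,y)=0$; $j_\zeta(x,y)$ is jointly continuous in $(\zeta,x,y)$ and symmetric in $x,y$. Put $j_\mu(x,y)=\int_\Gamma j_\zeta(x,y)\,d\mu(\zeta)$; the number $c_\mu=\int_\Gamma j_\mu(x,y)\,d\mu(x)$ does not depend on $y$, and $g_\mu(x,y)=j_\mu(x,y)-c_\mu$. *)

theory Defs
  imports "HOL-Analysis.Analysis" "HOL-Library.Function_Algebras"
begin

text \<open>
  A metrized graph is given by a type \<open>'a\<close> of class \<open>metric_space\<close>; the graph is the whole type,
  so that functions on the graph are functions on \<open>'a\<close> and Borel sets are \<open>sets borel\<close>.
\<close>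

section \<open>Metrized graphs\<close>

definition ray_directions :: "nat \<Rightarrow> complex set" where
  "ray_directions n = {cis (2 * pi * of_int k / of_nat n) | k :: int. True}"

definition star :: "nat \<Rightarrow> real \<Rightarrow> complex set" where
  "star n r = {of_real t * v | t v. 0 \<le> t \<and> t < r \<and> v \<in> ray_directions n}"

text \<open>
  The path metric of the star: two points on a common ray are joined by a straight segment, two
  points on different rays are joined through the centre. (\<open>sgn z\<close> is the direction of \<open>z\<close>, and
  \<open>sgn 0 = 0\<close>.)
\<close>

definition star_dist :: "complex \<Rightarrow> complex \<Rightarrow> real" where
  "star_dist z w = (if sgn z = sgn w then cmod (z - w) else cmod z + cmod w)"

definition star_chart :: "'a::metric_space \<Rightarrow> nat \<Rightarrow> real \<Rightarrow> (complex \<Rightarrow> 'a) \<Rightarrow> bool" where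
  "star_chart p n r \<phi> \<longleftrightarrow> 1 \<le> n \<and> 0 < r \<and> \<phi> 0 = p \<and>
     (\<forall>z\<in>star n r. \<forall>w\<in>star n r. dist (\<phi> z) (\<phi> w) = star_dist z w) \<and>
     p \<in> interior (\<phi> ` star n r)"

definition metrized_graph :: "'a::metric_space itself \<Rightarrow> bool" where
  "metrized_graph T \<longleftrightarrow> compact (UNIV :: 'a set) \<and> connected (UNIV :: 'a set) \<and>
     (\<forall>p::'a. \<exists>n r \<phi>. star_chart p n r \<phi>)"

text \<open>
  A chart is fixed at every point; the unit vectors at \<open>p\<close> are the directions of the rays of this
  chart, and \<open>move p t v\<close> is the point \<open>p + t v\<close>. For \<open>p\<close> interior to an edge
  (two rays, in the directions \<open>1\<close> and \<open>-1\<close>) the map \<open>\<lambda>t. move p t 1\<close>, with \<open>t\<close> of either sign, is an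
  isometric parametrization of a neighbourhood of \<open>p\<close>.
\<close>

definition chart_at :: "'a::metric_space \<Rightarrow> nat \<times> (complex \<Rightarrow> 'a)" where
  "chart_at p = (SOME (n, \<phi>). \<exists>r. star_chart p n r \<phi>)"

definition Vec :: "'a::metric_space \<Rightarrow> complex set" where
  "Vec p = ray_directions (fst (chart_at p))"

definition move :: "'a::metric_space \<Rightarrow> real \<Rightarrow> complex \<Rightarrow> 'a" where
  "move p t v = snd (chart_at p) (of_real t * v)"

definition dir_deriv :: "complex \<Rightarrow> ('a::metric_space \<Rightarrow> complex) \<Rightarrow> 'a \<Rightarrow> complex" where
  "dir_deriv v f p = Lim (at_right 0) (\<lambda>t. (f (move p t v) - f p) / of_real t)"

definition isometric_param :: "real set \<Rightarrow> (real \<Rightarrow> 'a::metric_space) \<Rightarrow> bool" where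
  "isometric_param I \<gamma> \<longleftrightarrow> (\<forall>s\<in>I. \<forall>t\<in>I. dist (\<gamma> s) (\<gamma> t) = \<bar>s - t\<bar>)"

text \<open>
  Arc-length measure is the unique Borel measure giving every isometrically embedded segment its
  length.
\<close>

definition arc_length :: "'a::metric_space measure" where
  "arc_length = (THE M. sets M = sets borel \<and>
     (\<forall>a b \<gamma>. a \<le> b \<and> isometric_param {a..b} \<gamma> \<longrightarrow> emeasure M (\<gamma> ` {a..b}) = ennreal (b - a)))"

section \<open>Piecewise regular functions\<close>

text \<open>
  The property \<open>P I h\<close> is required of the function \<open>h\<close> on the interval \<open>I\<close> obtained by
  isometrically parametrizing an open interval of the graph.
\<close>

definition piecewise ::
    "(real set \<Rightarrow> (real \<Rightarrow> complex) \<Rightarrow> bool) \<Rightarrow> ('a::metric_space \<Rightarrow> complex) \<Rightarrow> bool" where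
  "piecewise P f \<longleftrightarrow> (\<exists>X \<A>. finite X \<and> finite \<A> \<and> - X = \<Union>\<A> \<and>
     (\<forall>A\<in>\<A>. open A \<and> (\<exists>a b \<gamma>. a < b \<and> isometric_param {a<..<b} \<gamma> \<and> A = \<gamma> ` {a<..<b} \<and>
        P {a<..<b} (f \<circ> \<gamma>))))"

definition C2_on :: "real set \<Rightarrow> (real \<Rightarrow> complex) \<Rightarrow> bool" where
  "C2_on I h \<longleftrightarrow> (\<exists>h' h''. (\<forall>t\<in>I. (h has_vector_derivative h' t) (at t)) \<and>
     (\<forall>t\<in>I. (h' has_vector_derivative h'' t) (at t)) \<and> continuous_on I h'')"

definition affine_fun_on :: "real set \<Rightarrow> (real \<Rightarrow> complex) \<Rightarrow> bool" where
  "affine_fun_on I h \<longleftrightarrow> (\<exists>\<alpha> \<beta>. \<forall>t\<in>I. h t = \<alpha> + \<beta> * of_real t)"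

text \<open>
  First and second derivative in the parametrization \<open>\<lambda>t. move x t 1\<close>. The sign of \<open>graph_deriv\<close>
  depends on the orientation of this parametrization, but neither \<open>graph_deriv f x * cnj (graph_deriv g x)\<close>
  nor \<open>graph_deriv2 f x\<close> does. At vertices the values are irrelevant (a finite set of points, which is
  null for \<open>arc_length\<close>).
\<close>

definition graph_deriv :: "('a::metric_space \<Rightarrow> complex) \<Rightarrow> 'a \<Rightarrow> complex" where
  "graph_deriv f x = vector_derivative (\<lambda>t. f (move x t 1)) (at 0)"

definition graph_deriv2 :: "('a::metric_space \<Rightarrow> complex) \<Rightarrow> 'a \<Rightarrow> complex" where
  "graph_deriv2 f x =
     vector_derivative (\<lambda>s. vector_derivative (\<lambda>t. f (move x t 1)) (at s)) (at 0)"

definition Zh :: "('a::metric_space \<Rightarrow> complex) set" where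
  "Zh = {f. continuous_on UNIV f \<and> piecewise C2_on f \<and> integrable arc_length (graph_deriv2 f)}"

definition CPA :: "('a::metric_space \<Rightarrow> complex) set" where
  "CPA = {f. continuous_on UNIV f \<and> piecewise affine_fun_on f}"

section \<open>Signed measures\<close>

definition signed_borel_measure :: "('a::topological_space set \<Rightarrow> real) \<Rightarrow> bool" where
  "signed_borel_measure \<mu> \<longleftrightarrow> \<mu> {} = 0 \<and>
     (\<forall>A::nat \<Rightarrow> 'a set. range A \<subseteq> sets borel \<and> disjoint_family A \<longrightarrow>
        (\<lambda>n. \<mu> (A n)) sums \<mu> (\<Union>n. A n))"

definition total_variation :: "('a::topological_space set \<Rightarrow> real) \<Rightarrow> 'a set \<Rightarrow> ennreal" where
  "total_variation \<mu> E =
     (SUP A\<in>{A::nat \<Rightarrow> 'a set. range A \<subseteq> sets borel \<and> disjoint_family A \<and> (\<Union>n. A n) = E}.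
        \<Sum>n. ennreal \<bar>\<mu> (A n)\<bar>)"

text \<open>
  Positive part of the Jordan decomposition, \<open>\<mu>\<^sup>+ E = sup {\<mu> B | B \<subseteq> E}\<close>; the negative part of \<open>\<mu>\<close> is
  the positive part of \<open>- \<mu>\<close>.
\<close>

definition pos_variation :: "('a::topological_space set \<Rightarrow> real) \<Rightarrow> 'a measure" where
  "pos_variation \<mu> =
     measure_of UNIV (sets borel) (\<lambda>E. SUP B\<in>{B \<in> sets borel. B \<subseteq> E}. ennreal (\<mu> B))"

definition signed_integral ::
    "('a::topological_space set \<Rightarrow> real) \<Rightarrow> ('a \<Rightarrow> complex) \<Rightarrow> complex" where
  "signed_integral \<mu> f =
     integral\<^sup>L (pos_variation \<mu>) f - integral\<^sup>L (pos_variation (\<lambda>B. - \<mu> B)) f"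

section \<open>The Dirichlet space and the eigenfunctions of the Laplacian\<close>

definition L2_inner :: "('a::metric_space \<Rightarrow> complex) \<Rightarrow> ('a \<Rightarrow> complex) \<Rightarrow> complex" where
  "L2_inner f g = (LINT x|arc_length. f x * cnj (g x))"

definition Dir_inner_Zh :: "('a::metric_space \<Rightarrow> complex) \<Rightarrow> ('a \<Rightarrow> complex) \<Rightarrow> complex" where
  "Dir_inner_Zh f g = (LINT x|arc_length. graph_deriv f x * cnj (graph_deriv g x))"

definition Dir_norm_Zh :: "('a::metric_space \<Rightarrow> complex) \<Rightarrow> real" where
  "Dir_norm_Zh f = sqrt (Re (Dir_inner_Zh f f))"

definition Zh_mu :: "('a::metric_space set \<Rightarrow> real) \<Rightarrow> ('a \<Rightarrow> complex) set" where
  "Zh_mu \<mu> = {f \<in> Zh. signed_integral \<mu> f = 0}"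

definition Dir_approx ::
    "('a::metric_space set \<Rightarrow> real) \<Rightarrow> (nat \<Rightarrow> 'a \<Rightarrow> complex) \<Rightarrow> ('a \<Rightarrow> complex) \<Rightarrow> bool" where
  "Dir_approx \<mu> F f \<longleftrightarrow> (\<forall>n. F n \<in> Zh_mu \<mu>) \<and>
     (\<forall>e>0. \<exists>N. \<forall>m\<ge>N. \<forall>n\<ge>N. Dir_norm_Zh (\<lambda>x. F m x - F n x) < e) \<and>
     uniform_limit UNIV F f sequentially"

text \<open>
  The completion of \<open>Zh_mu \<mu>\<close> for the Dirichlet norm, realized inside the continuous functions by
  taking uniform limits of Dirichlet-Cauchy sequences, and the extended inner product.
\<close>

definition Dir_mu :: "('a::metric_space set \<Rightarrow> real) \<Rightarrow> ('a \<Rightarrow> complex) set" where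
  "Dir_mu \<mu> = {f. \<exists>F. Dir_approx \<mu> F f}"

definition Dir_inner ::
    "('a::metric_space set \<Rightarrow> real) \<Rightarrow> ('a \<Rightarrow> complex) \<Rightarrow> ('a \<Rightarrow> complex) \<Rightarrow> complex" where
  "Dir_inner \<mu> f g = (THE c. \<forall>F G. Dir_approx \<mu> F f \<and> Dir_approx \<mu> G g \<longrightarrow>
     (\<lambda>n. Dir_inner_Zh (F n) (G n)) \<longlonglongrightarrow> c)"

definition eigenfunction ::
    "('a::metric_space set \<Rightarrow> real) \<Rightarrow> complex \<Rightarrow> ('a \<Rightarrow> complex) \<Rightarrow> bool" where
  "eigenfunction \<mu> l f \<longleftrightarrow> f \<in> Dir_mu \<mu> \<and> f \<noteq> (\<lambda>x. 0) \<and>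
     (\<forall>g\<in>Dir_mu \<mu>. Dir_inner \<mu> f g = l * L2_inner f g)"

definition eigenvalue :: "('a::metric_space set \<Rightarrow> real) \<Rightarrow> complex \<Rightarrow> bool" where
  "eigenvalue \<mu> l \<longleftrightarrow> (\<exists>f. eigenfunction \<mu> l f)"

definition scale_fun :: "complex \<Rightarrow> ('a \<Rightarrow> complex) \<Rightarrow> ('a \<Rightarrow> complex)" where
  "scale_fun c f = (\<lambda>x. c * f x)"

lemma vector_space_scale_fun: "vector_space (scale_fun :: complex \<Rightarrow> ('a \<Rightarrow> complex) \<Rightarrow> _)"
  by unfold_locales (auto simp: scale_fun_def fun_eq_iff algebra_simps)

text \<open>
  The multiplicity is the complex dimension of the eigenspace (which consists of \<open>0\<close> and the
  eigenfunctions).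
\<close>

definition eigenvalue_mult :: "('a::metric_space set \<Rightarrow> real) \<Rightarrow> complex \<Rightarrow> nat" where
  "eigenvalue_mult \<mu> l = vector_space.dim scale_fun (insert (\<lambda>x. 0) {f. eigenfunction \<mu> l f})"

section \<open>The kernel\<close>

text \<open>
  For \<open>f \<in> CPA\<close> the Laplacian \<open>- \<Sum>p (\<Sum>v\<in>Vec p. d_v f(p)) \<delta>_p\<close> is a complex measure with
  finite support, represented as a set function.
\<close>

definition slope_sum :: "('a::metric_space \<Rightarrow> complex) \<Rightarrow> 'a \<Rightarrow> complex" where
  "slope_sum f p = (\<Sum>v\<in>Vec p. dir_deriv v f p)"

definition Laplacian_CPA :: "('a::metric_space \<Rightarrow> complex) \<Rightarrow> 'a set \<Rightarrow> complex" where
  "Laplacian_CPA f A = - (\<Sum>p\<in>{p\<in>A. slope_sum f p \<noteq> 0}. slope_sum f p)"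

definition j_kernel :: "'a::metric_space \<Rightarrow> 'a \<Rightarrow> 'a \<Rightarrow> complex" where
  "j_kernel \<zeta> x y = (THE h. h \<in> CPA \<and>
     (\<forall>A\<in>sets borel. Laplacian_CPA h A = indicator A y - indicator A \<zeta>) \<and> h \<zeta> = 0) x"

definition j_mu :: "('a::metric_space set \<Rightarrow> real) \<Rightarrow> 'a \<Rightarrow> 'a \<Rightarrow> complex" where
  "j_mu \<mu> x y = signed_integral \<mu> (\<lambda>\<zeta>. j_kernel \<zeta> x y)"

definition c_mu :: "('a::metric_space set \<Rightarrow> real) \<Rightarrow> complex" where
  "c_mu \<mu> = (THE c. \<forall>y. signed_integral \<mu> (\<lambda>x. j_mu \<mu> x y) = c)"

definition g_mu :: "('a::metric_space set \<Rightarrow> real) \<Rightarrow> 'a \<Rightarrow> 'a \<Rightarrow> complex" where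
  "g_mu \<mu> x y = j_mu \<mu> x y - c_mu \<mu>"

end

theory Submission
  imports Defs "HOL-Complex_Analysis.Great_Picard"
begin

text \<open>
  The series is the expansion of a reproducing kernel in an orthonormal basis, and its uniform
  convergence is that of Mercer's theorem.

  The increments of a smooth function are bounded by its Dirichlet norm: for each \<open>y\<close> there is a
  continuous piecewise affine function \<open>ker y\<close> whose Dirichlet product with any \<open>f\<close> in \<open>Zh\<close> is
  \<open>f y - f base\<close>, for a fixed base point (\<open>kernel_exists\<close>). By the Cauchy-Schwarz inequality,
  \<open>|f x - f y|\<close> is at most the norm of \<open>f\<close> times that of \<open>ker x - ker y\<close>, and the square of the latter
  is at most the distance of \<open>x\<close> and \<open>y\<close> when these are close (\<open>nrm_ker_diff\<close>). A function of
  \<open>\<mu>\<close>-mean \<open>0\<close> is the mean of its increments, so its values are bounded as well. Hence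
  Dirichlet-Cauchy sequences converge uniformly. An integration by parts shows that their limits in
  the Dirichlet norm are determined by the uniform limits (\<open>Dir_inner_Zh_le_sup\<close>), and \<open>Dir_mu\<close> is a
  Hilbert space of equicontinuous functions with bounded evaluations.

  In such a space, bounded sequences have subsequences that converge in \<open>L\<^sup>2\<close>. Minimizing the
  Rayleigh quotient on the orthogonal complement of the eigenfunctions \<open>f n\<close> would then produce a
  further eigenfunction; since the list exhausts each eigenspace, the complement is \<open>0\<close>
  (\<open>orthogonal_to_eigenfunctions_eq_0\<close>). So the functions \<open>e n = f n / sqrt (lam n)\<close> form an
  orthonormal basis for the Dirichlet product, and the series in question is
  \<open>\<Sum>n. e n x * cnj (e n y)\<close>. It converges pointwise, because the bound on evaluations bounds
  \<open>\<Sum>n. |e n x|\<^sup>2\<close>.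

  To identify the sum \<open>R x y\<close>, the function \<open>ker z\<close>, made of mean \<open>0\<close>, is expanded in this basis. This
  expresses \<open>R\<close> through \<open>ker\<close>, its two partial means and its double mean. On the other side, testing
  \<open>ker y - ker \<zeta>\<close> against small tents shows that its Laplacian is \<open>\<delta>_y - \<delta>_\<zeta>\<close>
  (\<open>slope_sum_of_reproducing\<close>), and by the maximum principle a piecewise affine function is determined
  by its Laplacian up to a constant. Therefore \<open>j_\<zeta>(x, y) = ker y x - ker \<zeta> x - ker y \<zeta> + ker \<zeta> \<zeta>\<close>
  (\<open>j_kernel_eq\<close>), and taking means gives \<open>g_\<mu> = R\<close> (\<open>eigenfunction_series_uniform\<close>).

  In particular \<open>R\<close> is continuous on the diagonal. There the terms are nonnegative, so the convergence
  is uniform by Dini's theorem, and the Cauchy-Schwarz inequality, applied to the tails of the series,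
  extends this to all pairs (\<open>series_uniform\<close>).
\<close>

section \<open>Semi-inner products\<close>

text \<open>
  Forms that are only positive semidefinite occur in two places: the Dirichlet form on \<open>Zh\<close> kills the
  constants, and the difference of the Dirichlet form and a multiple of the \<open>L\<^sup>2\<close> form vanishes at an
  eigenfunction.
\<close>

locale semi_inner = vector_space scale
  for scale :: "complex \<Rightarrow> 'v::ab_group_add \<Rightarrow> 'v" (infixr "\<cdot>" 75) +
  fixes W :: "'v set" and ip :: "'v \<Rightarrow> 'v \<Rightarrow> complex"
  assumes subspace_W: "subspace W"
    and ip_add: "\<lbrakk>f \<in> W; g \<in> W; h \<in> W\<rbrakk> \<Longrightarrow> ip (f + g) h = ip f h + ip g h"
    and ip_scale: "\<lbrakk>f \<in> W; h \<in> W\<rbrakk> \<Longrightarrow> ip (c \<cdot> f) h = c * ip f h"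
    and ip_cnj: "\<lbrakk>f \<in> W; g \<in> W\<rbrakk> \<Longrightarrow> cnj (ip f g) = ip g f"
    and ip_nonneg: "f \<in> W \<Longrightarrow> 0 \<le> Re (ip f f)"
begin

definition nrm :: "'v \<Rightarrow> real" where "nrm f = sqrt (Re (ip f f))"

lemma W_simps [simp, intro]:
  "0 \<in> W" "f \<in> W \<Longrightarrow> g \<in> W \<Longrightarrow> f + g \<in> W" "f \<in> W \<Longrightarrow> g \<in> W \<Longrightarrow> f - g \<in> W"
  "f \<in> W \<Longrightarrow> c \<cdot> f \<in> W" "f \<in> W \<Longrightarrow> - f \<in> W"
  using subspace_W by (auto simp: subspace_0 subspace_add subspace_diff subspace_scale subspace_neg)

lemma W_sum [simp, intro]: "(\<And>i. i \<in> I \<Longrightarrow> f i \<in> W) \<Longrightarrow> sum f I \<in> W"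
  using subspace_W by (rule subspace_sum)

lemma ip_add_right: "\<lbrakk>f \<in> W; g \<in> W; h \<in> W\<rbrakk> \<Longrightarrow> ip h (f + g) = ip h f + ip h g"
  using ip_add[of f g h] ip_cnj[of f h] ip_cnj[of g h] ip_cnj[of "f+g" h]
  by (metis W_simps(2) complex_cnj_add)

lemma ip_scale_right: "\<lbrakk>f \<in> W; h \<in> W\<rbrakk> \<Longrightarrow> ip h (c \<cdot> f) = cnj c * ip h f"
  by (metis W_simps(4) complex_cnj_mult ip_cnj ip_scale)

lemma ip_neg: "\<lbrakk>f \<in> W; h \<in> W\<rbrakk> \<Longrightarrow> ip (- f) h = - ip f h"
  using ip_scale[of f h "-1"] by simp

lemma ip_neg_right: "\<lbrakk>f \<in> W; h \<in> W\<rbrakk> \<Longrightarrow> ip h (- f) = - ip h f"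
  using ip_scale_right[of f h "-1"] by simp

lemma ip_diff: "\<lbrakk>f \<in> W; g \<in> W; h \<in> W\<rbrakk> \<Longrightarrow> ip (f - g) h = ip f h - ip g h"
  using ip_add[of f "-g" h] ip_neg[of g h] by simp

lemma ip_diff_right: "\<lbrakk>f \<in> W; g \<in> W; h \<in> W\<rbrakk> \<Longrightarrow> ip h (f - g) = ip h f - ip h g"
  using ip_add_right[of f "-g" h] ip_neg_right[of g h] by simp

lemma ip_zero: "h \<in> W \<Longrightarrow> ip 0 h = 0" "h \<in> W \<Longrightarrow> ip h 0 = 0"
  using ip_scale[of 0 h 0] ip_scale_right[of 0 h 0] by simp_all

lemma ip_sum: "\<lbrakk>\<And>i. i \<in> I \<Longrightarrow> f i \<in> W; h \<in> W\<rbrakk> \<Longrightarrow> ip (sum f I) h = (\<Sum>i\<in>I. ip (f i) h)"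
  by (induction I rule: infinite_finite_induct) (auto simp: ip_zero ip_add)

lemma ip_sum_right: "\<lbrakk>\<And>i. i \<in> I \<Longrightarrow> f i \<in> W; h \<in> W\<rbrakk> \<Longrightarrow> ip h (sum f I) = (\<Sum>i\<in>I. ip h (f i))"
  by (induction I rule: infinite_finite_induct) (auto simp: ip_zero ip_add_right)

lemmas ip_simps = ip_add ip_add_right ip_diff ip_diff_right ip_scale ip_scale_right ip_zero
  ip_neg ip_neg_right ip_sum ip_sum_right

lemma nrm_nonneg [simp]: "0 \<le> nrm f" if "f \<in> W"
  using that by (simp add: nrm_def ip_nonneg)

lemma nrm_sq: "f \<in> W \<Longrightarrow> (nrm f)\<^sup>2 = Re (ip f f)"
  by (simp add: nrm_def ip_nonneg)

lemma ip_self: "f \<in> W \<Longrightarrow> ip f f = of_real ((nrm f)\<^sup>2)"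
  using ip_cnj[of f f] by (simp add: nrm_sq complex_eq_iff)

lemma nrm_zero [simp]: "nrm 0 = 0"
  by (simp add: nrm_def ip_zero)

lemma nrm_scale: "f \<in> W \<Longrightarrow> nrm (c \<cdot> f) = norm c * nrm f"
proof -
  assume f: "f \<in> W"
  have "ip (c \<cdot> f) (c \<cdot> f) = (c * cnj c) * ip f f" using f by (simp add: ip_simps)
  also have "\<dots> = of_real ((norm c)\<^sup>2 * (nrm f)\<^sup>2)"
    using f by (simp add: ip_self complex_norm_square[symmetric])
  finally have "nrm (c \<cdot> f) = sqrt ((norm c * nrm f)\<^sup>2)"
    unfolding nrm_def[of "c \<cdot> f"] by (simp add: power_mult_distrib)
  then show ?thesis using f by simp
qed

lemma nrm_neg: "f \<in> W \<Longrightarrow> nrm (- f) = nrm f"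
  using nrm_scale[of f "-1"] by simp

lemma nrm_minus_commute: "f \<in> W \<Longrightarrow> g \<in> W \<Longrightarrow> nrm (f - g) = nrm (g - f)"
  using nrm_neg[of "f - g"] by simp

lemma nrm_diff_sq:
  assumes "f \<in> W" "g \<in> W"
  shows "(nrm (f - g))\<^sup>2 = (nrm f)\<^sup>2 - 2 * Re (ip f g) + (nrm g)\<^sup>2"
proof -
  have "Re (ip g f) = Re (ip f g)" using ip_cnj[OF assms] by (metis cnj.simps(1))
  then show ?thesis using assms by (simp add: nrm_sq ip_simps)
qed

lemma nrm_add_sq:
  assumes "f \<in> W" "g \<in> W"
  shows "(nrm (f + g))\<^sup>2 = (nrm f)\<^sup>2 + 2 * Re (ip f g) + (nrm g)\<^sup>2"
  using nrm_diff_sq[of f "- g"] assms by (simp add: ip_simps nrm_neg)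

text \<open>
  For a vector \<open>g\<close> of norm \<open>0\<close> the usual choice of the multiple of \<open>g\<close> to be subtracted from \<open>f\<close> is
  not available; there, all multiples are used.
\<close>

lemma Cauchy_Schwarz:
  assumes f: "f \<in> W" and g: "g \<in> W"
  shows "norm (ip f g) \<le> nrm f * nrm g"
proof -
  have key: "0 \<le> (nrm f)\<^sup>2 - 2 * t * (norm (ip f g))\<^sup>2 + t\<^sup>2 * (norm (ip f g))\<^sup>2 * (nrm g)\<^sup>2" for t
  proof -
    let ?c = "of_real t * ip f g"
    have "0 \<le> (nrm (f - ?c \<cdot> g))\<^sup>2" by simp
    also have "\<dots> = (nrm f)\<^sup>2 - 2 * Re (cnj ?c * ip f g) + (norm ?c * nrm g)\<^sup>2"
      using f g by (subst nrm_diff_sq) (auto simp: ip_simps nrm_scale)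
    also have "cnj ?c * ip f g = of_real (t * (norm (ip f g))\<^sup>2)"
      using complex_norm_square[of "ip f g"] by (simp add: mult_ac)
    finally show ?thesis by (simp add: power_mult_distrib norm_mult)
  qed
  have "(norm (ip f g))\<^sup>2 \<le> (nrm f * nrm g)\<^sup>2"
  proof (cases "nrm g = 0")
    case True
    show ?thesis
    proof (rule ccontr)
      assume "\<not> ?thesis"
      then have p: "(norm (ip f g))\<^sup>2 > 0" using True by auto
      then obtain t where t: "t * (norm (ip f g))\<^sup>2 = (nrm f)\<^sup>2 + 1"
        by (metis less_irrefl nonzero_eq_divide_eq)
      have "0 \<le> (nrm f)\<^sup>2 - 2 * ((nrm f)\<^sup>2 + 1)"
        using key[of t] True by (simp add: mult.assoc t)
      then show False by (smt (verit) zero_le_power2)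
    qed
  next
    case False
    then have p: "0 < (nrm g)\<^sup>2" by simp
    then obtain t where t: "t * (nrm g)\<^sup>2 = 1"
      by (metis less_irrefl nonzero_eq_divide_eq)
    have "t\<^sup>2 * (norm (ip f g))\<^sup>2 * (nrm g)\<^sup>2 = t * (norm (ip f g))\<^sup>2 * (t * (nrm g)\<^sup>2)"
      by (simp add: power2_eq_square)
    also have "\<dots> = t * (norm (ip f g))\<^sup>2" unfolding t by simp
    finally have "t * (norm (ip f g))\<^sup>2 \<le> (nrm f)\<^sup>2" using key[of t] by linarith
    then have "(t * (norm (ip f g))\<^sup>2) * (nrm g)\<^sup>2 \<le> (nrm f)\<^sup>2 * (nrm g)\<^sup>2"
      by (rule mult_right_mono) (rule zero_le_power2)
    moreover have "(t * (norm (ip f g))\<^sup>2) * (nrm g)\<^sup>2 = (norm (ip f g))\<^sup>2"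
      using t by (metis mult.commute mult.assoc mult.left_neutral)
    ultimately show ?thesis by (simp only: power_mult_distrib)
  qed
  then show ?thesis by (rule power2_le_imp_le) (use f g in auto)
qed

lemma nrm_triangle: "f \<in> W \<Longrightarrow> g \<in> W \<Longrightarrow> nrm (f + g) \<le> nrm f + nrm g"
proof -
  assume fg: "f \<in> W" "g \<in> W"
  have "Re (ip f g) \<le> nrm f * nrm g"
    using Cauchy_Schwarz[OF fg] complex_Re_le_cmod[of "ip f g"] by linarith
  then have "(nrm (f + g))\<^sup>2 \<le> (nrm f + nrm g)\<^sup>2"
    using fg by (simp add: nrm_add_sq power2_sum)
  then show ?thesis by (rule power2_le_imp_le) (use fg in auto)
qed

lemma nrm_triangle_diff: "f \<in> W \<Longrightarrow> g \<in> W \<Longrightarrow> nrm f \<le> nrm g + nrm (f - g)"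
  using nrm_triangle[of g "f - g"] by simp

lemma nrm_triangle3: "f \<in> W \<Longrightarrow> g \<in> W \<Longrightarrow> h \<in> W \<Longrightarrow> nrm (f - g) \<le> nrm (f - h) + nrm (h - g)"
  using nrm_triangle[of "f - h" "h - g"] by simp

lemma tendsto_ip:
  assumes "\<And>n. F n \<in> W" "\<And>n. G n \<in> W" "f \<in> W" "g \<in> W"
    and F: "(\<lambda>n::nat. nrm (F n - f)) \<longlonglongrightarrow> 0" and G: "(\<lambda>n. nrm (G n - g)) \<longlonglongrightarrow> 0"
  shows "(\<lambda>n. ip (F n) (G n)) \<longlonglongrightarrow> ip f g"
proof -
  have b: "norm (ip (F n) (G n) - ip f g) \<le>
      nrm (F n - f) * nrm (G n - g) + nrm (F n - f) * nrm g + nrm f * nrm (G n - g)" for n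
  proof -
    have "ip (F n) (G n) - ip f g = ip (F n - f) (G n - g) + ip (F n - f) g + ip f (G n - g)"
      using assms(1-4) by (simp add: ip_simps)
    also have "norm \<dots> \<le> norm (ip (F n - f) (G n - g)) + norm (ip (F n - f) g) + norm (ip f (G n - g))"
      using norm_triangle_ineq[of "ip (F n - f) (G n - g) + ip (F n - f) g" "ip f (G n - g)"]
        norm_triangle_ineq[of "ip (F n - f) (G n - g)" "ip (F n - f) g"] by linarith
    also have "\<dots> \<le> nrm (F n - f) * nrm (G n - g) + nrm (F n - f) * nrm g + nrm f * nrm (G n - g)"
      using assms(1-4) by (intro add_mono Cauchy_Schwarz) auto
    finally show ?thesis .
  qed
  have "(\<lambda>n. nrm (F n - f) * nrm (G n - g) + nrm (F n - f) * nrm g + nrm f * nrm (G n - g)) \<longlonglongrightarrow>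
      0 * 0 + 0 * nrm g + nrm f * 0"
    by (intro tendsto_intros F G)
  then have "(\<lambda>n. ip (F n) (G n) - ip f g) \<longlonglongrightarrow> 0"
    by (intro Lim_null_comparison[OF always_eventually[OF allI[OF b]]]) simp
  then show ?thesis using LIM_zero_iff by blast
qed

lemma span_subset_W: "B \<subseteq> W \<Longrightarrow> span B \<subseteq> W"
  using subspace_W by (simp add: span_minimal)

text \<open>
  The Riesz representation theorem on a space with a finite spanning set, by induction on this set:
  a new vector \<open>b\<close> is replaced by its component \<open>u\<close> orthogonal to the previous span, and a multiple
  of \<open>u\<close> corrects the value of the functional on \<open>u\<close>.
\<close>

lemma finite_Riesz:
  assumes "finite B" "B \<subseteq> W" and definite: "\<And>b. b \<in> span B \<Longrightarrow> nrm b = 0 \<Longrightarrow> b = 0"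
    and L: "\<And>f g. f \<in> W \<Longrightarrow> g \<in> W \<Longrightarrow> L (f + g) = L f + L g" "\<And>c f. f \<in> W \<Longrightarrow> L (c \<cdot> f) = c * L f"
  obtains h where "h \<in> span B" "\<And>f. f \<in> span B \<Longrightarrow> L f = ip f h"
proof -
  have "\<exists>h\<in>span B. \<forall>f\<in>span B. L f = ip f h"
    using assms
  proof (induction B arbitrary: L rule: finite_induct)
    case empty
    have "L 0 = 0" using empty(4)[of 0 0] by simp
    then show ?case by (auto simp: ip_zero)
  next
    case (insert b B)
    have bW: "b \<in> W" "B \<subseteq> W" using insert.prems by auto
    then have sW: "span B \<subseteq> W" by (rule_tac span_subset_W)
    have sub: "span B \<subseteq> span (insert b B)" by (simp add: span_mono subset_insertI)
    have IH: "\<exists>h\<in>span B. \<forall>f\<in>span B. M f = ip f h"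
      if "\<And>f g. f \<in> W \<Longrightarrow> g \<in> W \<Longrightarrow> M (f + g) = M f + M g" "\<And>c f. f \<in> W \<Longrightarrow> M (c \<cdot> f) = c * M f" for M
      using insert.IH[of M] insert.prems sub bW that by blast
    obtain p where p: "p \<in> span B" "\<forall>f\<in>span B. ip f b = ip f p"
      using IH[of "\<lambda>f. ip f b"] bW by (auto simp: ip_simps)
    obtain h where h: "h \<in> span B" "\<forall>f\<in>span B. L f = ip f h"
      using IH[of L] insert.prems by auto
    define u where "u = b - p"
    have pW: "p \<in> W" and hW: "h \<in> W" using p h sW by auto
    have uW: "u \<in> W" unfolding u_def using bW pW by auto
    have us: "u \<in> span (insert b B)"
      unfolding u_def using p sub by (meson insertI1 span_base span_diff subsetD)
    have orth: "ip f u = 0" "ip u f = 0" if "f \<in> span B" for f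
    proof -
      show *: "ip f u = 0" unfolding u_def using that p sW bW pW by (auto simp: ip_simps)
      have "cnj (ip f u) = ip u f" by (rule ip_cnj) (use that sW uW in auto)
      with * show "ip u f = 0" by simp
    qed
    \<comment> \<open>The span of \<open>insert b B\<close> is the orthogonal sum of the line through \<open>u\<close> and the span of \<open>B\<close>.\<close>
    have dec: "\<exists>c g. g \<in> span B \<and> f = c \<cdot> u + g" if fs: "f \<in> span (insert b B)" for f
    proof -
      obtain c where c: "f - c \<cdot> b \<in> span B" using fs unfolding span_breakdown_eq by blast
      have "f = c \<cdot> u + ((f - c \<cdot> b) + c \<cdot> p)" by (simp add: u_def scale_right_diff_distrib)
      then show ?thesis using c p by (metis span_add span_scale)
    qed
    \<comment> \<open>When \<open>b\<close> already lies in the span of \<open>B\<close>, \<open>u = 0\<close> and there is nothing to correct.\<close>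
    define \<alpha> where "\<alpha> = (if u = 0 then 0 else cnj (L u) / of_real ((nrm u)\<^sup>2))"
    have "u \<noteq> 0 \<Longrightarrow> nrm u \<noteq> 0" using insert.prems(2) us by blast
    then have Lu: "L u = ip u (\<alpha> \<cdot> u)"
    proof (cases "u = 0")
      case True
      then show ?thesis using insert.prems(4)[of 0 0] by (simp add: ip_zero)
    next
      case False
      then show ?thesis using \<open>u \<noteq> 0 \<Longrightarrow> nrm u \<noteq> 0\<close> uW by (simp add: \<alpha>_def ip_simps ip_self)
    qed
    show ?case
    proof (intro bexI ballI)
      show "h + \<alpha> \<cdot> u \<in> span (insert b B)"
        using h sub us by (meson span_add span_scale subsetD)
      fix f assume "f \<in> span (insert b B)"
      then obtain c g where g: "g \<in> span B" "f = c \<cdot> u + g" using dec by blast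
      have gW: "g \<in> W" using g sW by auto
      have "L f = c * L u + L g" using g uW gW by (simp add: insert.prems(3,4))
      also have "\<dots> = c * ip u (\<alpha> \<cdot> u) + ip g h" using Lu h g by simp
      also have "\<dots> = ip f (h + \<alpha> \<cdot> u)"
        using g uW gW hW orth[OF g(1)] orth[OF h(1)] by (simp add: ip_simps algebra_simps)
      finally show "L f = ip f (h + \<alpha> \<cdot> u)" .
    qed
  qed
  then show ?thesis using that by blast
qed

definition orthonormal :: "('i \<Rightarrow> 'v) \<Rightarrow> 'i set \<Rightarrow> bool" where
  "orthonormal e I \<longleftrightarrow> (\<forall>i\<in>I. e i \<in> W) \<and> (\<forall>i\<in>I. \<forall>j\<in>I. ip (e i) (e j) = (if i = j then 1 else 0))"

lemma orthonormal_subset: "orthonormal e I \<Longrightarrow> J \<subseteq> I \<Longrightarrow> orthonormal e J"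
  unfolding orthonormal_def by blast

lemma orthonormal_coeff:
  assumes "orthonormal e I" "finite I" "j \<in> I"
  shows "ip (\<Sum>i\<in>I. c i \<cdot> e i) (e j) = c j"
proof -
  have eW: "\<And>i. i \<in> I \<Longrightarrow> e i \<in> W" using assms(1) by (auto simp: orthonormal_def)
  have "ip (\<Sum>i\<in>I. c i \<cdot> e i) (e j) = (\<Sum>i\<in>I. c i * ip (e i) (e j))"
    using eW assms(3) by (simp add: ip_sum ip_scale)
  also have "\<dots> = (\<Sum>i\<in>I. if i = j then c i else 0)"
    by (rule sum.cong) (use assms in \<open>auto simp: orthonormal_def\<close>)
  also have "\<dots> = c j" using assms by simp
  finally show ?thesis .
qed

lemma orthonormal_nrm_sq:
  assumes "orthonormal e I" "finite I"
  shows "(nrm (\<Sum>i\<in>I. c i \<cdot> e i))\<^sup>2 = (\<Sum>i\<in>I. (norm (c i))\<^sup>2)"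
proof -
  let ?s = "\<Sum>i\<in>I. c i \<cdot> e i"
  have eW: "\<And>i. i \<in> I \<Longrightarrow> e i \<in> W" using assms(1) by (auto simp: orthonormal_def)
  have "ip ?s ?s = (\<Sum>i\<in>I. cnj (c i) * ip ?s (e i))"
    using eW by (simp add: ip_sum_right ip_scale_right)
  also have "\<dots> = (\<Sum>i\<in>I. cnj (c i) * c i)"
    using orthonormal_coeff[OF assms] by simp
  also have "\<dots> = of_real (\<Sum>i\<in>I. (norm (c i))\<^sup>2)"
    by (simp add: complex_norm_square mult.commute del: of_real_power)
  finally show ?thesis using eW by (simp add: nrm_sq)
qed

text \<open>
  The difference of \<open>f\<close> and its projection to the span of the \<open>e i\<close> has nonnegative square.
\<close>

lemma Bessel:
  assumes "orthonormal e I" "finite I" "f \<in> W"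
  shows "(\<Sum>i\<in>I. (norm (ip f (e i)))\<^sup>2) \<le> (nrm f)\<^sup>2"
proof -
  let ?s = "\<Sum>i\<in>I. ip f (e i) \<cdot> e i"
  have eW: "\<And>i. i \<in> I \<Longrightarrow> e i \<in> W" using assms(1) by (auto simp: orthonormal_def)
  then have sW: "?s \<in> W" by auto
  have "ip f ?s = (\<Sum>i\<in>I. cnj (ip f (e i)) * ip f (e i))"
    using eW assms(3) by (simp add: ip_sum_right ip_scale_right)
  also have "\<dots> = of_real (\<Sum>i\<in>I. (norm (ip f (e i)))\<^sup>2)"
    by (simp add: complex_norm_square mult.commute del: of_real_power)
  finally have "Re (ip f ?s) = (\<Sum>i\<in>I. (norm (ip f (e i)))\<^sup>2)" by simp
  moreover have "0 \<le> (nrm (f - ?s))\<^sup>2" by simp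
  ultimately show ?thesis
    using nrm_diff_sq[OF assms(3) sW] orthonormal_nrm_sq[OF assms(1,2), of "\<lambda>i. ip f (e i)"] by linarith
qed

text \<open>
  A space in which the orthonormal families have bounded size is finite-dimensional: one of maximal
  size spans, as otherwise a vector outside its span could be projected and normalized.
\<close>

lemma finite_spanning_of_bounded_orthonormal:
  assumes E: "subspace E" "E \<subseteq> W" and definite: "\<And>f. f \<in> E \<Longrightarrow> nrm f = 0 \<Longrightarrow> f = 0"
    and bound: "\<And>B. finite B \<Longrightarrow> B \<subseteq> E \<Longrightarrow> orthonormal id B \<Longrightarrow> card B \<le> K"
  obtains B where "finite B" "B \<subseteq> E" "E \<subseteq> span B"
proof -
  let ?P = "\<lambda>B. finite B \<and> B \<subseteq> E \<and> orthonormal id B"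
  have P0: "?P {}" by (simp add: orthonormal_def)
  have "\<exists>B. ?P B \<and> (\<forall>C. ?P C \<longrightarrow> card C \<le> card B)"
    by (rule ex_has_greatest_nat[of ?P "{}" card "Suc K"]) (use P0 bound le_imp_less_Suc in blast)+
  then obtain B where B: "finite B" "B \<subseteq> E" "orthonormal id B"
    and max: "\<And>C. ?P C \<Longrightarrow> card C \<le> card B" by blast
  have "E \<subseteq> span B"
  proof (rule ccontr)
    assume "\<not> E \<subseteq> span B"
    then obtain b where b: "b \<in> E" "b \<notin> span B" by blast
    have sE: "span B \<subseteq> E" using B E by (simp add: span_minimal)
    have BW: "B \<subseteq> W" and bW: "b \<in> W" using B E b by auto
    obtain p where p: "p \<in> span B" "\<And>f. f \<in> span B \<Longrightarrow> ip f b = ip f p"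
    proof (rule finite_Riesz[of B "\<lambda>f. ip f b"])
      show "c = 0" if "c \<in> span B" "nrm c = 0" for c
        using that sE by (intro definite) auto
    qed (use B(1) BW bW in \<open>auto simp: ip_simps\<close>)
    define u where "u = b - p"
    have uE: "u \<in> E" unfolding u_def using b p sE E subspace_diff by blast
    have uW: "u \<in> W" using uE E by auto
    have "u \<noteq> 0" using b p by (auto simp: u_def)
    then have n0: "nrm u \<noteq> 0" using definite uE by blast
    define w where "w = of_real (1 / nrm u) \<cdot> u"
    have wE: "w \<in> E" unfolding w_def using uE E subspace_scale by blast
    have wW: "w \<in> W" using wE E by auto
    have orth: "ip f w = 0" "ip w f = 0" if "f \<in> B" for f
    proof -
      have f: "f \<in> span B" "f \<in> W" using that BW by (auto simp: span_base)
      have pW: "p \<in> W" using p(1) sE E by auto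
      have "ip f u = 0" unfolding u_def using f p bW pW by (simp add: ip_simps)
      then show *: "ip f w = 0" unfolding w_def using f uW by (simp add: ip_simps)
      show "ip w f = 0" using ip_cnj[OF f(2) wW] * by simp
    qed
    have ww: "ip w w = 1"
    proof -
      have "nrm w = 1" unfolding w_def using uW n0 by (subst nrm_scale) (auto simp: norm_divide)
      then show ?thesis using wW by (simp add: ip_self)
    qed
    have "w \<notin> B" using orth ww by force
    have "?P (insert w B)"
      using B wE wW orth ww by (auto simp: orthonormal_def)
    then have "card (insert w B) \<le> card B" by (rule max)
    then show False using \<open>w \<notin> B\<close> B(1) by simp
  qed
  with B that show ?thesis by blast
qed

lemma orthonormal_independent:
  assumes "orthonormal e I" "finite I"
  shows "independent (e ` I)" "inj_on e I"
proof -
  show inj: "inj_on e I"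
  proof (rule inj_onI)
    fix i j assume "i \<in> I" "j \<in> I" "e i = e j"
    then have "ip (e i) (e i) = 1" "ip (e i) (e i) = (if i = j then 1 else 0)"
      using assms(1) unfolding orthonormal_def by (presburger, metis)
    then show "i = j" by (metis zero_neq_one)
  qed
  have "c i = 0" if "i \<in> I" "(\<Sum>i\<in>I. c i \<cdot> e i) = 0" for c i
    using orthonormal_coeff[OF assms that(1), of c] that assms(1) by (simp add: ip_zero orthonormal_def)
  then show "independent (e ` I)"
    unfolding independent_explicit_module
  proof safe
    fix T u v assume *: "finite T" "T \<subseteq> e ` I" "(\<Sum>v\<in>T. u v \<cdot> v) = 0" "v \<in> T"
    let ?J = "{i\<in>I. e i \<in> T}"
    have T: "T = e ` ?J" using * by auto
    have inj': "inj_on e ?J" using inj by (rule inj_on_subset) auto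
    have "(\<Sum>i\<in>?J. u (e i) \<cdot> e i) = 0"
      using *(3) by (subst (asm) T) (simp add: sum.reindex[OF inj'])
    moreover have "orthonormal e ?J" "finite ?J"
      using assms orthonormal_subset[of e I ?J] by auto
    moreover obtain j where j: "j \<in> ?J" "v = e j" using * by auto
    ultimately show "u v = 0"
      using orthonormal_coeff[of e ?J j "\<lambda>i. u (e i)"] assms(1) by (simp add: ip_zero orthonormal_def)
  qed
qed

text \<open>
  Stated for a set \<open>E\<close> with a finite spanning set, since the dimension of an infinite-dimensional
  space is \<open>0\<close> by convention and \<open>I\<close> could then be empty.
\<close>

lemma orthonormal_spans_if_card_eq_dim:
  assumes e: "orthonormal e I" "finite I" "e ` I \<subseteq> E" and fin: "finite B" "E \<subseteq> span B"
    and dim: "card I = dim E"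
  shows "E \<subseteq> span (e ` I)"
proof (rule ccontr)
  assume "\<not> E \<subseteq> span (e ` I)"
  then obtain x where x: "x \<in> E" "x \<notin> span (e ` I)" by blast
  note ind = orthonormal_independent[OF e(1,2)]
  have 1: "independent (insert x (e ` I))" using ind x by (simp add: independent_insertI)
  have "x \<notin> e ` I" using x span_base by blast
  then have 2: "card (insert x (e ` I)) = Suc (dim E)" using ind e dim by (simp add: card_image)
  obtain C where C: "C \<subseteq> E" "independent C" "E \<subseteq> span C" "card C = dim E"
    using basis_exists[of E] by blast
  have "finite C" using independent_span_bound[OF fin(1) C(2)] C fin by auto
  then have "card (insert x (e ` I)) \<le> card C"
    using independent_span_bound[OF _ 1, of C] C(3) e(3) x(1) by blast
  then show False using 2 C by simp
qed

end

section \<open>Reproducing kernel Hilbert spaces on a compact metric space\<close>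

lemma compact_countable_dense:
  assumes "compact (UNIV :: 'a::metric_space set)"
  obtains D :: "'a::metric_space set" where "countable D" "\<And>x e. 0 < e \<Longrightarrow> \<exists>y\<in>D. dist x y < e"
proof -
  have "\<exists>k. finite k \<and> UNIV \<subseteq> (\<Union>x\<in>k. ball (x::'a) (1 / real (Suc n)))" for n
    using assms[unfolded compact_eq_totally_bounded] by (metis of_nat_0_less_iff zero_less_Suc zero_less_divide_1_iff subset_UNIV)
  then obtain k where k: "\<And>n. finite (k n)" "\<And>n. UNIV \<subseteq> (\<Union>x\<in>k n. ball (x::'a) (1 / real (Suc n)))"
    by metis
  show ?thesis
  proof
    show "countable (\<Union>n. k n)" using k(1) by (simp add: countable_finite)
    fix x :: 'a and e :: real assume "0 < e"
    then obtain n where n: "1 / real (Suc n) < e" using nat_approx_posE by blast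
    obtain y where "y \<in> k n" "x \<in> ball y (1 / real (Suc n))" using k(2)[of n] by blast
    then show "\<exists>y\<in>\<Union>n. k n. dist x y < e" using n by (auto simp: dist_commute intro!: bexI[of _ y])
  qed
qed

interpretation fun_vs: vector_space "scale_fun :: complex \<Rightarrow> ('a \<Rightarrow> complex) \<Rightarrow> _"
  by (rule vector_space_scale_fun)

lemma scale_fun_apply [simp]: "scale_fun c f x = c * f x"
  by (simp add: scale_fun_def)

lemma sum_fun_apply [simp]: "(\<Sum>i\<in>I. f i) x = (\<Sum>i\<in>I. f i x :: complex)"
  by (induction I rule: infinite_finite_induct) auto

text \<open>
  Equicontinuity, uniform on the unit ball of the space, is an axiom besides the bound on evaluations:
  it makes bounded sets relatively compact for pointwise convergence.
\<close>

locale rkhs = semi_inner scale_fun H ip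
  for H :: "('a::metric_space \<Rightarrow> complex) set" and ip +
  fixes C :: real
  assumes eval_bound: "f \<in> H \<Longrightarrow> norm (f x) \<le> C * nrm f"
    and C_nonneg: "0 \<le> C"
    and equicontinuous: "0 < e \<Longrightarrow> \<exists>d>0. \<forall>y. dist x y < d \<longrightarrow> (\<forall>f\<in>H. norm (f x - f y) \<le> e * nrm f)"
    and complete: "\<lbrakk>\<And>n. F n \<in> H; \<And>e. 0 < e \<Longrightarrow> \<exists>N. \<forall>m\<ge>N. \<forall>n\<ge>N. nrm (F m - F n) < e\<rbrakk>
      \<Longrightarrow> \<exists>f\<in>H. (\<lambda>n::nat. nrm (F n - f)) \<longlonglongrightarrow> 0"
    and compact_UNIV: "compact (UNIV :: 'a set)"
begin

lemma H_continuous: "f \<in> H \<Longrightarrow> continuous_on UNIV f"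
  unfolding continuous_on_iff
proof (intro ballI allI impI)
  fix x :: 'a and e :: real assume f: "f \<in> H" and e: "0 < e"
  let ?e = "e / (nrm f + 1)"
  have "0 < ?e" using e f by (simp add: add_nonneg_pos)
  then obtain d where d: "d > 0" "\<And>y. dist x y < d \<Longrightarrow> norm (f x - f y) \<le> ?e * nrm f"
    using equicontinuous[of ?e x] f by blast
  have "?e * nrm f < e" using e nrm_nonneg[OF f] by (simp add: field_simps)
  then show "\<exists>d>0. \<forall>x'\<in>UNIV. dist x' x < d \<longrightarrow> dist (f x') (f x) < e"
    using d by (intro exI[of _ d]) (force simp: dist_norm dist_commute norm_minus_commute)
qed

lemma definite: "f \<in> H \<Longrightarrow> nrm f = 0 \<Longrightarrow> f = 0"
  using eval_bound[of f] by (auto simp: fun_eq_iff)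

lemma tendsto_eval:
  assumes "\<And>n. F n \<in> H" "f \<in> H" "(\<lambda>n::nat. nrm (F n - f)) \<longlonglongrightarrow> 0"
  shows "(\<lambda>n. F n x) \<longlonglongrightarrow> f x"
proof -
  have b: "norm (F n x - f x) \<le> C * nrm (F n - f)" for n
    using eval_bound[of "F n - f" x] assms by auto
  moreover have "(\<lambda>n. C * nrm (F n - f)) \<longlonglongrightarrow> 0" using tendsto_mult[OF tendsto_const assms(3), of C] by simp
  ultimately have "(\<lambda>n. F n x - f x) \<longlonglongrightarrow> 0"
    by (intro Lim_null_comparison[OF always_eventually[OF allI[OF b]]])
  then show ?thesis using LIM_zero_iff by blast
qed

text \<open>
  By Pythagoras, the squared norms of the differences of partial sums are differences of partial
  sums of \<open>\<Sum>n. |c n|\<^sup>2\<close>.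
\<close>

lemma orthonormal_series:
  assumes e: "orthonormal e (UNIV :: nat set)" and c: "summable (\<lambda>n. (norm (c n))\<^sup>2)"
  obtains f where "f \<in> H" "(\<lambda>N. nrm ((\<Sum>n<N. scale_fun (c n) (e n)) - f)) \<longlonglongrightarrow> 0"
proof -
  let ?S = "\<lambda>N. \<Sum>n<N. scale_fun (c n) (e n)"
  have eW: "e n \<in> H" for n using e by (simp add: orthonormal_def)
  have SH: "?S N \<in> H" for N using eW by auto
  have diff: "(nrm (?S n - ?S m))\<^sup>2 = (\<Sum>i=m..<n. (norm (c i))\<^sup>2)" if "m \<le> n" for m n
  proof -
    have 1: "?S n - ?S m = (\<Sum>i\<in>{..<n}-{..<m}. scale_fun (c i) (e i))"
      by (rule sum_diff[symmetric]) (use that in auto)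
    have 2: "{..<n}-{..<m} = {m..<n}" by auto
    show ?thesis unfolding 1 2
      by (rule orthonormal_nrm_sq[OF orthonormal_subset[OF e]]) auto
  qed
  have "\<exists>N. \<forall>m\<ge>N. \<forall>n\<ge>N. nrm (?S m - ?S n) < r" if r: "0 < r" for r
  proof -
    obtain N where N: "\<And>m n. m \<ge> N \<Longrightarrow> norm (\<Sum>i=m..<n. (norm (c i))\<^sup>2) < r\<^sup>2"
      using c[unfolded summable_Cauchy] r by (meson zero_less_power)
    have 1: "nrm (?S n - ?S m) < r" if "N \<le> m" "m \<le> n" for m n
    proof -
      have "(nrm (?S n - ?S m))\<^sup>2 < r\<^sup>2"
        using N[OF that(1), of n] diff[OF that(2)] by simp
      then show ?thesis using r by (simp add: power_less_imp_less_base)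
    qed
    have "nrm (?S m - ?S n) < r" if "N \<le> m" "N \<le> n" for m n
    proof (cases "m \<le> n")
      case True
      show ?thesis using 1[OF that(1) True] nrm_minus_commute[OF SH SH, of m n] by simp
    next
      case False
      then show ?thesis using 1[OF that(2), of m] by simp
    qed
    then show ?thesis by blast
  qed
  then show ?thesis using complete[of ?S, OF SH] that by blast
qed

text \<open>
  Pointwise convergence of a subsequence suffices for compactness in \<open>L\<^sup>2\<close>, by dominated
  convergence. A diagonal subsequence converges on a countable dense set; equicontinuity does the
  rest.
\<close>

lemma bounded_sequence_pointwise_convergent_subsequence:
  assumes F: "\<And>n::nat. F n \<in> H" and K: "\<And>n. nrm (F n) \<le> K"
  obtains k g where "strict_mono (k :: nat \<Rightarrow> nat)" "\<And>x. (\<lambda>n. F (k n) x) \<longlonglongrightarrow> g x"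
proof -
  obtain D :: "'a set" where D: "countable D" "\<And>x e. 0 < e \<Longrightarrow> \<exists>y\<in>D. dist x y < e"
    using compact_countable_dense[OF compact_UNIV] by blast
  have K0: "0 \<le> K" using K[of 0] nrm_nonneg[OF F, of 0] by linarith
  have "norm (F n x) \<le> C * K" for n x
    using eval_bound[OF F, of n x] mult_left_mono[OF K[of n] C_nonneg] by linarith
  then obtain k where k: "strict_mono (k :: nat \<Rightarrow> nat)" "\<And>x. x \<in> D \<Longrightarrow> \<exists>l. (\<lambda>n. F (k n) x) \<longlonglongrightarrow> l"
    using function_convergent_subsequence[OF D(1), of F "C * K"] by blast
  have "convergent (\<lambda>n. F (k n) x)" for x
    unfolding Cauchy_convergent_iff[symmetric]
  proof (rule metric_CauchyI)
    fix e :: real assume e: "0 < e"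
    let ?e = "e / 4 / (K + 1)"
    have e': "0 < ?e" using e K0 by simp
    obtain d where d: "d > 0" "\<And>y f. dist x y < d \<Longrightarrow> f \<in> H \<Longrightarrow> norm (f x - f y) \<le> ?e * nrm f"
      using equicontinuous[OF e', of x] by blast
    obtain y where y: "y \<in> D" "dist x y < d" using D(2)[OF d(1)] by blast
    have 1: "dist (F n x) (F n y) \<le> e / 4" for n
    proof -
      have "norm (F n x - F n y) \<le> ?e * nrm (F n)" by (rule d(2)[OF y(2) F])
      also have "\<dots> \<le> ?e * K" using e' K by (intro mult_left_mono) auto
      also have "\<dots> \<le> e / 4" using e K0 by (simp add: field_simps)
      finally show ?thesis by (simp add: dist_norm)
    qed
    have "Cauchy (\<lambda>n. F (k n) y)" using k(2)[OF y(1)] convergent_Cauchy convergentI by blast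
    then obtain N where N: "\<And>m n. m \<ge> N \<Longrightarrow> n \<ge> N \<Longrightarrow> dist (F (k m) y) (F (k n) y) < e / 4"
      using e unfolding Cauchy_def by (metis zero_less_divide_iff zero_less_numeral)
    have "dist (F (k m) x) (F (k n) x) < e" if "m \<ge> N" "n \<ge> N" for m n
    proof -
      have "dist (F (k m) x) (F (k n) x) \<le> dist (F (k m) x) (F (k m) y) + dist (F (k m) y) (F (k n) y) + dist (F (k n) y) (F (k n) x)"
        using dist_triangle[of "F (k m) x" "F (k n) x" "F (k m) y"] dist_triangle[of "F (k m) y" "F (k n) x" "F (k n) y"]
        by linarith
      also have "\<dots> < e" using 1[of "k m"] 1[of "k n"] N[OF that] e by (simp add: dist_commute)
      finally show ?thesis .
    qed
    then show "\<exists>M. \<forall>m\<ge>M. \<forall>n\<ge>M. dist (F (k m) x) (F (k n) x) < e" by blast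
  qed
  then obtain g where "\<And>x. (\<lambda>n. F (k n) x) \<longlonglongrightarrow> g x" unfolding convergent_def by metis
  with k(1) that show ?thesis by blast
qed

end

section \<open>Completeness of the eigenfunctions\<close>

text \<open>
  Nonempty open sets have positive measure, so that a continuous function of \<open>L\<^sup>2\<close> norm \<open>0\<close> vanishes
  and the \<open>L\<^sup>2\<close> form is definite on \<open>H\<close>.
\<close>

locale rkhs_L2 = rkhs H ip C + M: finite_measure M
  for H :: "('a::metric_space \<Rightarrow> complex) set" and ip C and M :: "'a measure" +
  assumes sets_M: "sets M = sets borel"
    and M_pos: "open U \<Longrightarrow> U \<noteq> {} \<Longrightarrow> emeasure M U \<noteq> 0"
begin

definition L2 :: "('a \<Rightarrow> complex) \<Rightarrow> ('a \<Rightarrow> complex) \<Rightarrow> complex" where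
  "L2 f g = (LINT x|M. f x * cnj (g x))"

lemma space_M: "space M = UNIV"
  using sets_eq_imp_space_eq[OF sets_M] by simp

lemma H_measurable: "f \<in> H \<Longrightarrow> f \<in> borel_measurable M"
  using borel_measurable_continuous_onI[OF H_continuous] measurable_cong_sets[OF sets_M refl] by blast

lemma integrable_L2: "f \<in> H \<Longrightarrow> g \<in> H \<Longrightarrow> integrable M (\<lambda>x. f x * cnj (g x))"
proof (rule M.integrable_const_bound[of _ "(C * nrm f) * (C * nrm g)"])
  assume f: "f \<in> H" and g: "g \<in> H"
  show "AE x in M. norm (f x * cnj (g x)) \<le> (C * nrm f) * (C * nrm g)"
    using eval_bound[OF f] eval_bound[OF g] f C_nonneg
    by (auto simp: norm_mult intro!: mult_mono AE_I2)
  have "continuous_on UNIV (\<lambda>x. f x * cnj (g x))"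
    by (intro continuous_intros H_continuous f g)
  then show "(\<lambda>x. f x * cnj (g x)) \<in> borel_measurable M"
    using borel_measurable_continuous_onI measurable_cong_sets[OF sets_M refl] by blast
qed

sublocale L2: semi_inner scale_fun H L2
proof unfold_locales
  show "fun_vs.subspace H" by (rule subspace_W)
  fix f g h :: "'a \<Rightarrow> complex" and c
  assume f: "f \<in> H"
  { assume "h \<in> H"
    then show "L2 (scale_fun c f) h = c * L2 f h"
      using f by (simp add: L2_def mult.assoc) }
  { assume "g \<in> H"
    show "cnj (L2 f g) = L2 g f"
      unfolding L2_def using Bochner_Integration.integral_cnj[of M "\<lambda>x. f x * cnj (g x)"]
      by (simp add: mult.commute del: Bochner_Integration.integral_cnj) }
  { assume "g \<in> H" "h \<in> H"
    then show "L2 (f + g) h = L2 f h + L2 g h"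
      using f by (simp add: L2_def distrib_right integrable_L2) }
  have "Re (L2 f f) = (LINT x|M. Re (f x * cnj (f x)))"
    using integral_Re[OF integrable_L2[OF f f]] by (simp only: L2_def)
  moreover have "0 \<le> (LINT x|M. Re (f x * cnj (f x)))" by (rule Bochner_Integration.integral_nonneg) simp
  ultimately show "0 \<le> Re (L2 f f)" by simp
qed

lemma L2_nrm_sq: "f \<in> H \<Longrightarrow> (L2.nrm f)\<^sup>2 = (LINT x|M. (norm (f x))\<^sup>2)"
proof -
  assume f: "f \<in> H"
  have "Re (L2 f f) = (LINT x|M. Re (f x * cnj (f x)))"
    using integral_Re[OF integrable_L2[OF f f]] by (simp only: L2_def)
  also have "\<dots> = (LINT x|M. (norm (f x))\<^sup>2)"
    by (simp add: complex_norm_square[symmetric] del: of_real_power)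
  finally show ?thesis using L2.nrm_sq[OF f] by simp
qed

lemma integrable_norm_sq: "f \<in> H \<Longrightarrow> integrable M (\<lambda>x. (norm (f x))\<^sup>2)"
  using integrable_Re[OF integrable_L2[of f f]]
  by (simp add: complex_norm_square[symmetric] del: of_real_power)

lemma L2_nrm_le: "f \<in> H \<Longrightarrow> L2.nrm f \<le> sqrt (measure M UNIV) * C * nrm f"
proof -
  assume f: "f \<in> H"
  have "(L2.nrm f)\<^sup>2 \<le> (LINT x|M. (C * nrm f)\<^sup>2)"
    unfolding L2_nrm_sq[OF f]
    by (rule integral_mono[OF integrable_norm_sq[OF f]]) (use eval_bound[OF f] in \<open>auto intro!: power_mono\<close>)
  also have "\<dots> = (sqrt (measure M UNIV) * C * nrm f)\<^sup>2"
    by (simp add: space_M power_mult_distrib)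
  finally show ?thesis
    by (rule power2_le_imp_le) (use f C_nonneg in auto)
qed

lemma L2_definite: "f \<in> H \<Longrightarrow> L2.nrm f = 0 \<Longrightarrow> f = 0"
proof -
  assume f: "f \<in> H" and 0: "L2.nrm f = 0"
  have "(LINT x|M. (norm (f x))\<^sup>2) = 0" using L2_nrm_sq[OF f] 0 by simp
  then have "AE x in M. (norm (f x))\<^sup>2 = 0"
    using integral_nonneg_eq_0_iff_AE[OF integrable_norm_sq[OF f]] by simp
  then have "AE x in M. \<not> f x \<noteq> 0" by simp
  moreover have o: "open {x. f x \<noteq> 0}"
    using H_continuous[OF f] by (intro open_Collect_neq continuous_on_const)
  ultimately have "emeasure M {x. f x \<noteq> 0} = 0"
    using AE_iff_measurable[of "{x. f x \<noteq> 0}" M "\<lambda>x. \<not> f x \<noteq> 0"] sets_M space_M by simp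
  then have "{x. f x \<noteq> 0} = {}" using M_pos[OF o] by blast
  then show "f = 0" by (auto simp: fun_eq_iff)
qed

lemma tendsto_L2_nrm:
  assumes "\<And>n. F n \<in> H" "f \<in> H" "(\<lambda>n::nat. nrm (F n - f)) \<longlonglongrightarrow> 0"
  shows "(\<lambda>n. L2.nrm (F n - f)) \<longlonglongrightarrow> 0"
proof -
  have "(\<lambda>n. sqrt (measure M UNIV) * C * nrm (F n - f)) \<longlonglongrightarrow> 0"
    using tendsto_mult[OF tendsto_const assms(3), of "sqrt (measure M UNIV) * C"] by simp
  then show ?thesis
    by (rule Lim_null_comparison[OF always_eventually, rotated])
      (use L2_nrm_le assms in auto)
qed

lemma L2_Cauchy_subsequence:
  assumes F: "\<And>n::nat. F n \<in> H" and K: "\<And>n. nrm (F n) \<le> K"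
  obtains k where "strict_mono (k :: nat \<Rightarrow> nat)"
    "\<And>e. 0 < e \<Longrightarrow> \<exists>N. \<forall>m\<ge>N. \<forall>n\<ge>N. (L2.nrm (F (k m) - F (k n)))\<^sup>2 < e"
proof -
  obtain k g where k: "strict_mono (k :: nat \<Rightarrow> nat)" and g: "\<And>x. (\<lambda>n. F (k n) x) \<longlonglongrightarrow> g x"
    using bounded_sequence_pointwise_convergent_subsequence[of F K] F K by blast
  have bd: "norm (F n x) \<le> C * K" for n x
    using eval_bound[OF F, of n x] mult_left_mono[OF K[of n] C_nonneg] by linarith
  have gb: "norm (g x) \<le> C * K" for x
    using LIMSEQ_le_const2[OF tendsto_norm[OF g]] bd by blast
  have Fm: "F n \<in> borel_measurable M" for n using F by (rule H_measurable)
  have gm: "g \<in> borel_measurable M"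
    by (rule borel_measurable_LIMSEQ_metric[of "\<lambda>n. F (k n)"]) (use Fm g in auto)
  let ?B = "(2 * (C * K))\<^sup>2"
  have bd2: "(norm (F n x - g x))\<^sup>2 \<le> ?B" for n x
  proof -
    have "norm (F n x - g x) \<le> 2 * (C * K)"
      using norm_triangle_ineq4[of "F n x" "g x"] bd[of n x] gb[of x] by linarith
    then show ?thesis by (rule power_mono) simp
  qed
  have int: "integrable M (\<lambda>x. (norm (F n x - g x))\<^sup>2)" for n
    by (rule M.integrable_const_bound[of _ ?B]) (use bd2 Fm gm in auto)
  have "(\<lambda>n. LINT x|M. (norm (F (k n) x - g x))\<^sup>2) \<longlonglongrightarrow> (LINT x|M. 0)"
  proof (rule integral_dominated_convergence[where w = "\<lambda>x. ?B"])
    show "AE x in M. (\<lambda>n. (norm (F (k n) x - g x))\<^sup>2) \<longlonglongrightarrow> 0"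
    proof (rule AE_I2)
      fix x
      have "(\<lambda>n. (norm (F (k n) x - g x))\<^sup>2) \<longlonglongrightarrow> (norm (g x - g x))\<^sup>2"
        by (intro tendsto_intros g)
      then show "(\<lambda>n. (norm (F (k n) x - g x))\<^sup>2) \<longlonglongrightarrow> 0" by simp
    qed
  qed (use bd2 Fm gm in auto)
  then have lim: "(\<lambda>n. LINT x|M. (norm (F (k n) x - g x))\<^sup>2) \<longlonglongrightarrow> 0" by simp
  \<comment> \<open>The pointwise limit \<open>g\<close> need not lie in \<open>H\<close>; so it is only compared with the \<open>F n\<close> under the integral.\<close>
  have le: "(L2.nrm (F m - F n))\<^sup>2 \<le> 2 * (LINT x|M. (norm (F m x - g x))\<^sup>2) + 2 * (LINT x|M. (norm (F n x - g x))\<^sup>2)" for m n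
  proof -
    have "(L2.nrm (F m - F n))\<^sup>2 = (LINT x|M. (norm ((F m - F n) x))\<^sup>2)"
      using F by (intro L2_nrm_sq) auto
    also have "\<dots> \<le> (LINT x|M. 2 * (norm (F m x - g x))\<^sup>2 + 2 * (norm (F n x - g x))\<^sup>2)"
    proof (rule integral_mono)
      show "integrable M (\<lambda>x. (norm ((F m - F n) x))\<^sup>2)" using F by (intro integrable_norm_sq[of "F m - F n"] W_simps(3))
      show "integrable M (\<lambda>x. 2 * (norm (F m x - g x))\<^sup>2 + 2 * (norm (F n x - g x))\<^sup>2)" using int by auto
      fix x
      have "norm (F m x - F n x) \<le> norm (F m x - g x) + norm (F n x - g x)"
        by (metis dist_norm dist_triangle2)
      then have "(norm (F m x - F n x))\<^sup>2 \<le> (norm (F m x - g x) + norm (F n x - g x))\<^sup>2"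
        by (rule power_mono) simp
      also have "\<dots> \<le> 2 * (norm (F m x - g x))\<^sup>2 + 2 * (norm (F n x - g x))\<^sup>2"
        using zero_le_power2[of "norm (F m x - g x) - norm (F n x - g x)"]
        by (simp add: power2_eq_square algebra_simps)
      finally show "(norm ((F m - F n) x))\<^sup>2 \<le> 2 * (norm (F m x - g x))\<^sup>2 + 2 * (norm (F n x - g x))\<^sup>2" by simp
    qed
    also have "\<dots> = 2 * (LINT x|M. (norm (F m x - g x))\<^sup>2) + 2 * (LINT x|M. (norm (F n x - g x))\<^sup>2)"
      using int by simp
    finally show ?thesis .
  qed
  have "\<exists>N. \<forall>m\<ge>N. \<forall>n\<ge>N. (L2.nrm (F (k m) - F (k n)))\<^sup>2 < e" if "0 < e" for e
  proof -
    obtain N where N: "\<And>n. n \<ge> N \<Longrightarrow> \<bar>LINT x|M. (norm (F (k n) x - g x))\<^sup>2\<bar> < e / 4"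
      using LIMSEQ_D[OF lim, of "e / 4"] \<open>0 < e\<close> by auto
    have "(L2.nrm (F (k m) - F (k n)))\<^sup>2 < e" if "m \<ge> N" "n \<ge> N" for m n
      using le[of "k m" "k n"] N[OF that(1)] N[OF that(2)] by linarith
    then show ?thesis by blast
  qed
  with k that show ?thesis by blast
qed

definition eig :: "complex \<Rightarrow> ('a \<Rightarrow> complex) \<Rightarrow> bool" where
  "eig l g \<longleftrightarrow> g \<in> H \<and> g \<noteq> 0 \<and> (\<forall>h\<in>H. ip g h = l * L2 g h)"

definition eigenspace :: "complex \<Rightarrow> ('a \<Rightarrow> complex) set" where
  "eigenspace l = insert 0 {g. eig l g}"

lemma eigenspace_iff: "g \<in> eigenspace l \<longleftrightarrow> g \<in> H \<and> (\<forall>h\<in>H. ip g h = l * L2 g h)"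
  by (auto simp: eigenspace_def eig_def ip_zero L2.ip_zero)

lemma subspace_eigenspace: "fun_vs.subspace (eigenspace l)"
  by (auto simp: fun_vs.subspace_def eigenspace_iff ip_simps L2.ip_simps ring_distribs)

text \<open>
  An \<open>L\<^sup>2\<close>-orthonormal family \<open>B\<close> in an eigenspace has bounded size: the evaluation bound at \<open>x\<close>,
  applied to the combination \<open>\<Sum>b. cnj (b x) b\<close>, bounds \<open>\<Sum>b. |b x|\<^sup>2\<close>, whose integral is the size.
\<close>

lemma card_orthonormal_eigenspace:
  assumes m: "0 < m" and B: "finite B" "B \<subseteq> eigenspace (of_real m)" "L2.orthonormal id B"
  shows "real (card B) \<le> C\<^sup>2 * m * measure M UNIV"
proof -
  have BH: "b \<in> H" if "b \<in> B" for b using B(2) that by (auto simp: eigenspace_iff)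
  have sum_le: "(\<Sum>b\<in>B. (norm (b x))\<^sup>2) \<le> C\<^sup>2 * m" for x
  proof -
    let ?v = "\<Sum>b\<in>B. scale_fun (cnj (b x)) (id b)"
    let ?s = "\<Sum>b\<in>B. (norm (b x))\<^sup>2"
    have s0: "0 \<le> ?s" by (simp add: sum_nonneg)
    have vE: "?v \<in> eigenspace (of_real m)"
      using B(2) subspace_eigenspace by (intro fun_vs.subspace_sum fun_vs.subspace_scale) auto
    then have vH: "?v \<in> H" by (simp add: eigenspace_iff)
    have "ip ?v ?v = of_real m * L2 ?v ?v" using vE vH by (simp add: eigenspace_iff)
    then have "(nrm ?v)\<^sup>2 = m * (L2.nrm ?v)\<^sup>2" using nrm_sq[OF vH] L2.nrm_sq[OF vH] by simp
    also have "(L2.nrm ?v)\<^sup>2 = ?s"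
      using L2.orthonormal_nrm_sq[OF B(3,1), of "\<lambda>b. cnj (b x)"] by simp
    finally have n: "(nrm ?v)\<^sup>2 = m * ?s" .
    have "?v x = of_real ?s" by (simp add: complex_norm_square mult.commute del: of_real_power)
    then have "norm (?v x) = ?s" by (simp only: norm_of_real abs_of_nonneg[OF s0])
    then have "?s \<le> C * nrm ?v" using eval_bound[OF vH, of x] by (simp only:)
    then have "?s\<^sup>2 \<le> (C * nrm ?v)\<^sup>2" using s0 by (rule power_mono)
    also have "\<dots> = C\<^sup>2 * m * ?s" by (simp only: power_mult_distrib n mult.assoc)
    finally have "?s * ?s \<le> (C\<^sup>2 * m) * ?s" by (simp add: power2_eq_square)
    then show ?thesis using s0 m by (cases "?s = 0") (auto simp: mult_le_cancel_right)
  qed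
  have one: "(LINT x|M. (norm (b x))\<^sup>2) = 1" if "b \<in> B" for b
    using B(3) that L2_nrm_sq[OF BH[OF that]] L2.nrm_sq[OF BH[OF that]] by (simp add: L2.orthonormal_def)
  have "real (card B) = (\<Sum>b\<in>B. LINT x|M. (norm (b x))\<^sup>2)" using one by simp
  also have "\<dots> = (LINT x|M. (\<Sum>b\<in>B. (norm (b x))\<^sup>2))"
    using BH integrable_norm_sq by (subst Bochner_Integration.integral_sum) auto
  also have "\<dots> \<le> (LINT x|M. C\<^sup>2 * m)"
    by (rule integral_mono) (use sum_le BH integrable_norm_sq in auto)
  also have "\<dots> = C\<^sup>2 * m * measure M UNIV" by (simp add: space_M)
  finally show ?thesis .
qed

lemma eigenspace_finite_spanning:
  assumes "0 < m"
  obtains B where "finite B" "eigenspace (of_real m) \<subseteq> fun_vs.span B"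
proof (rule L2.finite_spanning_of_bounded_orthonormal[of "eigenspace (of_real m)" "nat \<lceil>C\<^sup>2 * m * measure M UNIV\<rceil>"])
  fix B assume "finite B" "B \<subseteq> eigenspace (of_real m)" "L2.orthonormal id B"
  then have "real (card B) \<le> C\<^sup>2 * m * measure M UNIV" by (rule card_orthonormal_eigenspace[OF assms])
  then show "card B \<le> nat \<lceil>C\<^sup>2 * m * measure M UNIV\<rceil>" by linarith
qed (use subspace_eigenspace L2_definite that in \<open>auto simp: eigenspace_iff\<close>)

end

locale eigenbasis = rkhs_L2 H ip C M
  for H :: "('a::metric_space \<Rightarrow> complex) set" and ip C M +
  fixes lam :: "nat \<Rightarrow> real" and f :: "nat \<Rightarrow> 'a \<Rightarrow> complex"
  assumes eig_f: "eig (of_real (lam n)) (f n)"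
    and lam_pos: "0 < lam n"
    and f_orth: "L2 (f m) (f n) = (if m = n then 1 else 0)"
    and multiplicity: "eig l g \<Longrightarrow> card {n. of_real (lam n) = l} = fun_vs.dim (eigenspace l)"
begin

lemma f_H: "f n \<in> H"
  using eig_f by (simp add: eig_def)

lemma ip_f: "h \<in> H \<Longrightarrow> ip (f n) h = of_real (lam n) * L2 (f n) h"
  using eig_f by (simp add: eig_def)

lemma f_inj: "inj f"
  by (rule injI) (metis f_orth zero_neq_one)

text \<open>
  By the multiplicity hypothesis, the \<open>f n\<close> with eigenvalue \<open>m\<close> are as many as the dimension of the
  eigenspace, so they span it; a vector of the eigenspace that is orthogonal to them is orthogonal to
  itself.
\<close>

lemma eigenfunction_not_orthogonal_to_all:
  assumes m: "0 < m" and g: "eig (of_real m) g" and orth: "\<And>n. L2 g (f n) = 0"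
  shows False
proof -
  let ?I = "{n. complex_of_real (lam n) = of_real m}"
  let ?E = "eigenspace (of_real m)"
  have IE: "f ` ?I \<subseteq> ?E" using eig_f by (auto simp: eigenspace_def)
  have ortho: "L2.orthonormal f I" for I using f_H f_orth by (auto simp: L2.orthonormal_def)
  \<comment> \<open>An infinite set has cardinality \<open>0\<close>, so finiteness does not follow from the multiplicity.\<close>
  have fin: "finite ?I"
  proof (rule ccontr)
    assume "infinite ?I"
    then obtain J where J: "J \<subseteq> ?I" "finite J" "card J = Suc (nat \<lceil>C\<^sup>2 * m * measure M UNIV\<rceil>)"
      using infinite_arbitrarily_large by blast
    have "L2.orthonormal id (f ` J)"
      using f_H f_orth by (auto simp: L2.orthonormal_def inj_eq[OF f_inj])
    then have "real (card (f ` J)) \<le> C\<^sup>2 * m * measure M UNIV"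
      using J IE by (intro card_orthonormal_eigenspace[OF m]) auto
    moreover have "card (f ` J) = card J" using f_inj by (simp add: card_image inj_on_def)
    ultimately show False using J(3) by linarith
  qed
  obtain B where B: "finite B" "?E \<subseteq> fun_vs.span B" using eigenspace_finite_spanning[OF m] by blast
  have "?E \<subseteq> fun_vs.span (f ` ?I)"
    using L2.orthonormal_spans_if_card_eq_dim[OF ortho fin IE B] multiplicity[OF g] by simp
  then have gs: "g \<in> fun_vs.span (f ` ?I)" using g by (auto simp: eigenspace_def)
  have gH: "g \<in> H" using g by (simp add: eig_def)
  have "f ` ?I \<subseteq> {h \<in> H. L2 g h = 0}" using f_H orth by auto
  moreover have "fun_vs.subspace {h \<in> H. L2 g h = 0}"
    using gH by (auto simp: fun_vs.subspace_def L2.ip_simps)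
  ultimately have "fun_vs.span (f ` ?I) \<subseteq> {h \<in> H. L2 g h = 0}" by (rule fun_vs.span_minimal)
  then have "L2 g g = 0" using gs by auto
  then have "g = 0" using L2_definite[OF gH] by (simp add: L2.nrm_def)
  then show False using g by (simp add: eig_def)
qed

text \<open>
  The scaling turns the \<open>L\<^sup>2\<close>-orthonormal family \<open>f\<close> into one that is orthonormal for \<open>ip\<close>.
\<close>

definition e :: "nat \<Rightarrow> 'a \<Rightarrow> complex" where
  "e n = scale_fun (of_real (1 / sqrt (lam n))) (f n)"

lemma e_H [simp]: "e n \<in> H"
  using f_H by (auto simp: e_def)

lemma ip_e: "h \<in> H \<Longrightarrow> ip (e n) h = of_real (sqrt (lam n)) * L2 (f n) h"
proof -
  assume h: "h \<in> H"
  have "1 / sqrt (lam n) * lam n = sqrt (lam n)"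
    using real_div_sqrt[of "lam n"] lam_pos[of n] by simp
  then have "of_real (1 / sqrt (lam n)) * complex_of_real (lam n) = of_real (sqrt (lam n))"
    by (simp only: of_real_mult[symmetric])
  then show ?thesis using h f_H by (simp add: e_def ip_scale ip_f flip: mult.assoc)
qed

lemma e_orthonormal: "orthonormal e I"
proof -
  have "ip (e m) (e n) = (if m = n then 1 else 0)" for m n
  proof -
    have "ip (e m) (e n) = of_real (sqrt (lam m)) * (of_real (1 / sqrt (lam n)) * L2 (f m) (f n))"
      using f_H by (simp add: ip_e) (simp add: e_def L2.ip_scale_right)
    then show ?thesis using lam_pos[of m] by (cases "m = n") (simp_all add: f_orth)
  qed
  then show ?thesis by (simp add: orthonormal_def)
qed

text \<open>
  The projection \<open>p\<close> of \<open>h\<close> to the closed span of the \<open>e n\<close>. That \<open>p = h\<close> follows once the orthogonal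
  complement is known to vanish, and the proof of this uses the projection.
\<close>

lemma expansion_converges:
  assumes h: "h \<in> H"
  obtains p where "p \<in> H" "(\<lambda>N. nrm ((\<Sum>n<N. scale_fun (ip h (e n)) (e n)) - p)) \<longlonglongrightarrow> 0"
    "\<And>n. ip (h - p) (e n) = 0"
proof -
  have summ: "summable (\<lambda>n. (norm (ip h (e n)))\<^sup>2)"
  proof (rule summableI_nonneg_bounded)
    show "(\<Sum>n<N. (norm (ip h (e n)))\<^sup>2) \<le> (nrm h)\<^sup>2" for N
      using Bessel[OF e_orthonormal _ h] by simp
  qed simp
  obtain p where p: "p \<in> H" "(\<lambda>N. nrm ((\<Sum>n<N. scale_fun (ip h (e n)) (e n)) - p)) \<longlonglongrightarrow> 0"
    by (rule orthonormal_series[OF e_orthonormal summ])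
  have "ip p (e n) = ip h (e n)" for n
  proof -
    have 1: "(\<lambda>N. ip (\<Sum>n<N. scale_fun (ip h (e n)) (e n)) (e n)) \<longlonglongrightarrow> ip p (e n)"
      by (rule tendsto_ip) (use p in auto)
    have 2: "\<forall>\<^sub>F N in sequentially. ip (\<Sum>n<N. scale_fun (ip h (e n)) (e n)) (e n) = ip h (e n)"
      using eventually_gt_at_top[of n]
      by eventually_elim (auto intro!: orthonormal_coeff[OF e_orthonormal])
    show ?thesis using LIMSEQ_unique[OF 1 tendsto_eventually[OF 2]] .
  qed
  then have "ip (h - p) (e n) = 0" for n using h p by (simp add: ip_diff)
  with p that show ?thesis by blast
qed

text \<open>
  On the orthogonal complement \<open>W\<close> of the eigenfunctions, a nonzero element would give a minimizer of
  the Rayleigh quotient of \<open>ip\<close> by the \<open>L\<^sup>2\<close> form: a minimizing sequence has an \<open>L\<^sup>2\<close>-Cauchy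
  subsequence, which by the parallelogram law is Cauchy for \<open>ip\<close>. With \<open>m\<close> the minimum, the form
  \<open>ip - m L2\<close> is nonnegative on \<open>W\<close> and vanishes at the minimizer, so by the Cauchy-Schwarz
  inequality its product with the minimizer is \<open>0\<close> on \<open>W\<close>, and also on the span of the eigenfunctions.
  Thus the minimizer would be an eigenfunction that is missing from the list.
\<close>

lemma orthogonal_to_eigenfunctions_eq_0:
  assumes g0: "g0 \<in> H" "\<And>n. ip g0 (e n) = 0"
  shows "g0 = 0"
proof (rule ccontr)
  assume nz: "g0 \<noteq> 0"
  define W where "W = {g \<in> H. \<forall>n. ip g (e n) = 0}"
  have WH: "g \<in> H" if "g \<in> W" for g using that by (simp add: W_def)
  have subW: "fun_vs.subspace W" by (auto simp: fun_vs.subspace_def W_def ip_simps)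
  have L2W: "L2 g (f n) = 0" if "g \<in> W" for g n
  proof -
    have "ip (e n) g = 0" using that ip_cnj[of g "e n"] by (simp add: W_def)
    then have "L2 (f n) g = 0" using ip_e[OF WH[OF that], of n] lam_pos[of n] by simp
    then show ?thesis using L2.ip_cnj[OF f_H WH[OF that], of n] by simp
  qed
  have L2e: "L2 g (e n) = 0" if "g \<in> W" for g n
    using that WH[OF that] f_H L2W[OF that] by (simp add: e_def L2.ip_scale_right)
  define R where "R = {(nrm g)\<^sup>2 | g. g \<in> W \<and> L2.nrm g = 1}"
  define m where "m = Inf R"
  have bdd: "bdd_below R" unfolding R_def by (rule bdd_belowI[of _ 0]) auto
  have normalize: "(nrm g)\<^sup>2 / (L2.nrm g)\<^sup>2 \<in> R" if "g \<in> W" "L2.nrm g \<noteq> 0" for g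
  proof -
    let ?h = "scale_fun (of_real (1 / L2.nrm g)) g"
    have "?h \<in> W" using that subW by (simp add: fun_vs.subspace_scale)
    moreover have "L2.nrm ?h = 1" using that WH[OF that(1)] by (simp add: L2.nrm_scale norm_divide)
    moreover have "(nrm ?h)\<^sup>2 = (nrm g)\<^sup>2 / (L2.nrm g)\<^sup>2"
      using that WH[OF that(1)] by (simp add: nrm_scale norm_divide power_divide)
    ultimately show ?thesis unfolding R_def by force
  qed
  have R_ne: "R \<noteq> {}"
    using normalize[of g0] g0 nz L2_definite[of g0] by (force simp: W_def)
  have ray: "m * (L2.nrm g)\<^sup>2 \<le> (nrm g)\<^sup>2" if "g \<in> W" for g
  proof (cases "L2.nrm g = 0")
    case False
    then have "m \<le> (nrm g)\<^sup>2 / (L2.nrm g)\<^sup>2"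
      unfolding m_def using bdd normalize[OF that] by (intro cInf_lower)
    then show ?thesis using False by (simp add: field_simps)
  qed simp
  have "\<exists>g\<in>W. L2.nrm g = 1 \<and> (nrm g)\<^sup>2 < m + 1 / real (Suc n)" for n
  proof -
    have "Inf R < m + 1 / real (Suc n)" by (simp add: m_def)
    then obtain r where "r \<in> R" "r < m + 1 / real (Suc n)"
      using cInf_less_iff[OF R_ne bdd] by blast
    then show ?thesis by (auto simp: R_def)
  qed
  then obtain G where G: "\<And>n. G n \<in> W" "\<And>n. L2.nrm (G n) = 1" "\<And>n. (nrm (G n))\<^sup>2 < m + 1 / real (Suc n)"
    by metis
  have GH: "G n \<in> H" for n using G WH by blast
  have m0: "0 \<le> m" unfolding m_def by (rule cInf_greatest[OF R_ne]) (auto simp: R_def)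
  have "nrm (G n) \<le> sqrt (m + 1)" for n
  proof (rule real_le_rsqrt)
    show "(nrm (G n))\<^sup>2 \<le> m + 1"
      using G(3)[of n] by (smt (verit) divide_le_eq_1 of_nat_0_less_iff of_nat_Suc of_nat_0_le_iff zero_less_Suc)
  qed
  then obtain k where k: "strict_mono (k :: nat \<Rightarrow> nat)"
    and L2C: "\<And>e. 0 < e \<Longrightarrow> \<exists>N. \<forall>m\<ge>N. \<forall>n\<ge>N. (L2.nrm (G (k m) - G (k n)))\<^sup>2 < e"
    using L2_Cauchy_subsequence[of G, OF GH] by blast
  have small: "(nrm (G (k n)))\<^sup>2 < m + 1 / real (Suc n)" for n
  proof -
    have "1 / real (Suc (k n)) \<le> 1 / real (Suc n)"
      using strict_mono_imp_increasing[OF k, of n] by (intro divide_left_mono) auto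
    then show ?thesis using G(3)[of "k n"] by linarith
  qed
  \<comment> \<open>The parallelogram law, with \<open>ray\<close> as a lower bound for the norm of \<open>G i + G j\<close>.\<close>
  have par: "(nrm (G i - G j))\<^sup>2 \<le> 2 * ((nrm (G i))\<^sup>2 - m) + 2 * ((nrm (G j))\<^sup>2 - m) + m * (L2.nrm (G i - G j))\<^sup>2" for i j
  proof -
    have "m * (L2.nrm (G i + G j))\<^sup>2 \<le> (nrm (G i + G j))\<^sup>2"
      by (rule ray) (use G subW fun_vs.subspace_add in blast)
    moreover have "(L2.nrm (G i + G j))\<^sup>2 = 4 - (L2.nrm (G i - G j))\<^sup>2"
      using GH G(2) by (simp add: L2.nrm_add_sq L2.nrm_diff_sq)
    moreover have "(nrm (G i + G j))\<^sup>2 = 2 * (nrm (G i))\<^sup>2 + 2 * (nrm (G j))\<^sup>2 - (nrm (G i - G j))\<^sup>2"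
      using GH by (simp add: nrm_add_sq nrm_diff_sq)
    ultimately show ?thesis by (simp add: algebra_simps)
  qed
  have "\<exists>N. \<forall>i\<ge>N. \<forall>j\<ge>N. nrm (G (k i) - G (k j)) < r" if r: "0 < r" for r
  proof -
    let ?r = "r\<^sup>2 / 2"
    obtain N1 where N1: "\<And>i j. i \<ge> N1 \<Longrightarrow> j \<ge> N1 \<Longrightarrow> (L2.nrm (G (k i) - G (k j)))\<^sup>2 < ?r / (m + 1)"
      using L2C[of "?r / (m + 1)"] r m0 by auto
    obtain N2 where N2: "1 / real (Suc N2) < r\<^sup>2 / 8" using nat_approx_posE[of "r\<^sup>2 / 8"] r by auto
    have "nrm (G (k i) - G (k j)) < r" if ij: "i \<ge> max N1 N2" "j \<ge> max N1 N2" for i j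
    proof -
      have s: "(nrm (G (k n)))\<^sup>2 - m < r\<^sup>2 / 8" if "n \<ge> N2" for n
      proof -
        have "1 / real (Suc n) \<le> 1 / real (Suc N2)" using that by (intro divide_left_mono) auto
        then show ?thesis using small[of n] N2 by linarith
      qed
      have "m * (L2.nrm (G (k i) - G (k j)))\<^sup>2 \<le> m * (?r / (m + 1))"
        using N1[of i j] ij m0 by (intro mult_left_mono) auto
      also have "\<dots> \<le> ?r" using m0 r by (simp add: field_simps)
      finally have "m * (L2.nrm (G (k i) - G (k j)))\<^sup>2 \<le> ?r" .
      then have "(nrm (G (k i) - G (k j)))\<^sup>2 < r\<^sup>2"
        using par[of "k i" "k j"] s[of i] s[of j] ij by simp
      then show ?thesis using r by (simp add: power_less_imp_less_base)
    qed
    then show ?thesis by blast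
  qed
  then obtain g where g: "g \<in> H" "(\<lambda>n. nrm (G (k n) - g)) \<longlonglongrightarrow> 0"
    using complete[of "\<lambda>n. G (k n)"] GH by blast
  have "ip g (e n) = 0" for n
  proof -
    have "(\<lambda>i. ip (G (k i)) (e n)) \<longlonglongrightarrow> ip g (e n)"
      by (rule tendsto_ip) (use g GH in auto)
    moreover have "ip (G (k i)) (e n) = 0" for i using G(1) by (simp add: W_def)
    ultimately show ?thesis by (simp add: LIMSEQ_const_iff)
  qed
  then have gW: "g \<in> W" using g by (simp add: W_def)
  have "(\<lambda>i. L2 (G (k i)) (G (k i))) \<longlonglongrightarrow> L2 g g"
    by (rule L2.tendsto_ip) (use g GH tendsto_L2_nrm[of "\<lambda>i. G (k i)" g] in auto)
  moreover have "L2 (G (k i)) (G (k i)) = 1" for i using L2.ip_self[OF GH] G(2) by simp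
  ultimately have L2g: "L2 g g = 1" by (simp add: LIMSEQ_const_iff)
  have "(\<lambda>i. Re (ip (G (k i)) (G (k i)))) \<longlonglongrightarrow> Re (ip g g)"
    by (intro tendsto_Re tendsto_ip) (use g GH in auto)
  then have lim: "(\<lambda>i. (nrm (G (k i)))\<^sup>2) \<longlonglongrightarrow> (nrm g)\<^sup>2" using nrm_sq GH g by simp
  have "(\<lambda>i. m + 1 / real (Suc i)) \<longlonglongrightarrow> m + 0" by (intro tendsto_add tendsto_const LIMSEQ_Suc[OF lim_1_over_n])
  then have "(nrm g)\<^sup>2 \<le> m + 0"
    by (rule LIMSEQ_le[OF lim]) (use small less_imp_le in blast)
  moreover have "m * (L2.nrm g)\<^sup>2 \<le> (nrm g)\<^sup>2" by (rule ray[OF gW])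
  moreover have "L2.nrm g = 1" using L2g by (simp add: L2.nrm_def)
  ultimately have gm: "(nrm g)\<^sup>2 = m" by simp
  \<comment> \<open>The Rayleigh quotient is at least \<open>m\<close> on \<open>W\<close>, with equality at \<open>g\<close>.\<close>
  interpret Q: semi_inner scale_fun W "\<lambda>f g. ip f g - of_real m * L2 f g"
  proof unfold_locales
    fix f g h c assume f: "f \<in> W"
    show "0 \<le> Re (ip f f - of_real m * L2 f f)"
      using ray[OF f] nrm_sq[OF WH[OF f]] L2.nrm_sq[OF WH[OF f]] by simp
  qed (use subW WH in \<open>auto simp: ip_simps L2.ip_simps ip_cnj L2.ip_cnj algebra_simps\<close>)
  have Qg: "Q.nrm g = 0"
  proof -
    have "Re (ip g g - of_real m * L2 g g) = 0" using nrm_sq[OF g(1)] gm L2g by simp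
    then show ?thesis unfolding Q.nrm_def by (simp only: real_sqrt_zero)
  qed
  have eigW: "ip g h = of_real m * L2 g h" if "h \<in> W" for h
    using Q.Cauchy_Schwarz[OF gW that] Qg by simp
  \<comment> \<open>From \<open>W\<close> to \<open>H\<close>: \<open>g\<close> is orthogonal, for both forms, to the projection \<open>p\<close> of \<open>h\<close>.\<close>
  have "ip g h = of_real m * L2 g h" if h: "h \<in> H" for h
  proof -
    obtain p where p: "p \<in> H" "(\<lambda>N. nrm ((\<Sum>n<N. scale_fun (ip h (e n)) (e n)) - p)) \<longlonglongrightarrow> 0"
      "\<And>n. ip (h - p) (e n) = 0" using expansion_converges[OF h] by blast
    let ?S = "\<lambda>N. \<Sum>n<N. scale_fun (ip h (e n)) (e n)"
    have z: "ip g (?S N) = 0" "L2 g (?S N) = 0" for N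
      using g gW L2e[OF gW] by (simp_all add: ip_sum_right L2.ip_sum_right ip_scale_right L2.ip_scale_right W_def)
    have "(\<lambda>N. ip g (?S N)) \<longlonglongrightarrow> ip g p"
      by (rule tendsto_ip) (use g p in auto)
    then have ipp: "ip g p = 0" unfolding z by (simp add: LIMSEQ_const_iff)
    have "(\<lambda>N. L2 g (?S N)) \<longlonglongrightarrow> L2 g p"
      by (rule L2.tendsto_ip) (use g p tendsto_L2_nrm[of ?S p] in auto)
    then have L2p: "L2 g p = 0" unfolding z by (simp add: LIMSEQ_const_iff)
    have "h - p \<in> W" using h p by (auto simp: W_def)
    then have "ip g (h - p) = of_real m * L2 g (h - p)" by (rule eigW)
    then show ?thesis using g h p ipp L2p by (simp add: ip_diff_right L2.ip_diff_right)
  qed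
  moreover have "g \<noteq> 0" using L2g by (auto simp: L2.ip_zero)
  ultimately have "eig (of_real m) g" using g by (simp add: eig_def)
  moreover have "0 < m" using gm definite[OF g(1)] \<open>g \<noteq> 0\<close> by (metis m0 power2_eq_iff less_eq_real_def zero_eq_power2)
  ultimately show False
    using eigenfunction_not_orthogonal_to_all L2W[OF gW] by blast
qed

lemma expansion:
  assumes h: "h \<in> H"
  shows "(\<lambda>N. \<Sum>n<N. ip h (e n) * e n x) \<longlonglongrightarrow> h x"
proof -
  obtain p where p: "p \<in> H" "(\<lambda>N. nrm ((\<Sum>n<N. scale_fun (ip h (e n)) (e n)) - p)) \<longlonglongrightarrow> 0"
    "\<And>n. ip (h - p) (e n) = 0" using expansion_converges[OF h] by blast
  have "h - p = 0" by (rule orthogonal_to_eigenfunctions_eq_0) (use h p in auto)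
  then have "h = p" by simp
  have "(\<lambda>N. (\<Sum>n<N. scale_fun (ip h (e n)) (e n)) x) \<longlonglongrightarrow> p x"
    by (rule tendsto_eval[OF _ p(1,2)]) auto
  then show ?thesis using \<open>h = p\<close> by simp
qed

text \<open>
  As for eigenspaces above: the evaluation bound at \<open>x\<close> is applied to \<open>\<Sum>n<N. cnj (e n x) * e n\<close>, whose
  squared norm and whose value at \<open>x\<close> are both the sum to be bounded.
\<close>

lemma sum_norm_e_sq_le: "(\<Sum>n<N. (norm (e n x))\<^sup>2) \<le> C\<^sup>2"
proof -
  let ?v = "\<Sum>n<N. scale_fun (cnj (e n x)) (e n)"
  let ?s = "\<Sum>n<N. (norm (e n x))\<^sup>2"
  have s0: "0 \<le> ?s" by (simp add: sum_nonneg)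
  have vH: "?v \<in> H" by auto
  have n: "(nrm ?v)\<^sup>2 = ?s" using orthonormal_nrm_sq[OF e_orthonormal, of "{..<N}" "\<lambda>n. cnj (e n x)"] by simp
  have "?v x = of_real ?s" by (simp add: complex_norm_square mult.commute del: of_real_power)
  then have "norm (?v x) = ?s" by (simp only: norm_of_real abs_of_nonneg[OF s0])
  then have "?s \<le> C * nrm ?v" using eval_bound[OF vH, of x] by (simp only:)
  then have "?s\<^sup>2 \<le> (C * nrm ?v)\<^sup>2" using s0 by (rule power_mono)
  also have "\<dots> = C\<^sup>2 * ?s" by (simp only: power_mult_distrib n mult.assoc)
  finally have "?s * ?s \<le> C\<^sup>2 * ?s" by (simp add: power2_eq_square)
  then show ?thesis using s0 by (cases "?s = 0") (auto simp: mult_le_cancel_right)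
qed

end

section \<open>The Jordan decomposition of a signed measure\<close>

lemma signed_borel_measure_uminus:
  "signed_borel_measure \<mu> \<Longrightarrow> signed_borel_measure (\<lambda>B. - \<mu> B)"
  by (auto simp: signed_borel_measure_def intro: sums_minus)

lemma total_variation_uminus: "total_variation (\<lambda>B. - \<mu> B) = total_variation \<mu>"
  by (simp add: total_variation_def fun_eq_iff)

lemma signed_measure_Un:
  assumes "signed_borel_measure \<mu>" "A \<in> sets borel" "B \<in> sets borel" "A \<inter> B = {}"
  shows "\<mu> (A \<union> B) = \<mu> A + \<mu> B"
proof -
  let ?A = "\<lambda>n::nat. if n = 0 then A else if n = 1 then B else {}"
  have "disjoint_family ?A" "range ?A \<subseteq> sets borel"
    using assms by (auto simp: disjoint_family_on_def)
  then have 1: "(\<lambda>n. \<mu> (?A n)) sums \<mu> (\<Union>n. ?A n)"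
    using assms(1) unfolding signed_borel_measure_def by blast
  have 2: "(\<Union>n. ?A n) = A \<union> B" by (auto split: if_splits)
  have 3: "(\<lambda>n. \<mu> (?A n)) sums (\<Sum>n\<in>{0,1}. \<mu> (?A n))"
    using assms(1) by (intro sums_finite) (auto simp: signed_borel_measure_def)
  show ?thesis using sums_unique2[OF 1 3] unfolding 2 by simp
qed

definition pos_var :: "('a::topological_space set \<Rightarrow> real) \<Rightarrow> 'a set \<Rightarrow> ennreal" where
  "pos_var \<mu> E = (SUP B\<in>{B \<in> sets borel. B \<subseteq> E}. ennreal (\<mu> B))"

lemma pos_var_upper: "B \<in> sets borel \<Longrightarrow> B \<subseteq> E \<Longrightarrow> ennreal (\<mu> B) \<le> pos_var \<mu> E"
  unfolding pos_var_def by (rule SUP_upper) auto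

lemma pos_var_least:
  "(\<And>B. B \<in> sets borel \<Longrightarrow> B \<subseteq> E \<Longrightarrow> ennreal (\<mu> B) \<le> c) \<Longrightarrow> pos_var \<mu> E \<le> c"
  unfolding pos_var_def by (rule SUP_least) auto

lemma pos_var_mono: "E \<subseteq> F \<Longrightarrow> pos_var \<mu> E \<le> pos_var \<mu> F"
  by (rule pos_var_least) (auto intro: pos_var_upper)

text \<open>
  The suprema for \<open>E\<close> and \<open>F\<close> are approached by sets \<open>A\<close> and \<open>B\<close>, and \<open>A \<union> B\<close> competes for \<open>E \<union> F\<close>,
  unless one of the two values is nonpositive, hence truncated to \<open>0\<close>; then the other set competes alone.
\<close>

lemma pos_var_superadditive:
  assumes \<mu>: "signed_borel_measure \<mu>" and "E \<inter> F = {}"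
  shows "pos_var \<mu> E + pos_var \<mu> F \<le> pos_var \<mu> (E \<union> F)"
proof -
  have 1: "ennreal (\<mu> A) + ennreal (\<mu> B) \<le> pos_var \<mu> (E \<union> F)"
    if AB: "A \<in> sets borel" "A \<subseteq> E" "B \<in> sets borel" "B \<subseteq> F" for A B
  proof -
    have un: "\<mu> (A \<union> B) = \<mu> A + \<mu> B"
      using AB assms by (intro signed_measure_Un) auto
    show ?thesis
    proof (cases "\<mu> A \<le> 0 \<or> \<mu> B \<le> 0")
      case True
      then show ?thesis
        using AB pos_var_upper[of A "E \<union> F" \<mu>] pos_var_upper[of B "E \<union> F" \<mu>]
        by (auto simp: ennreal_neg le_supI1 le_supI2)
    next
      case False
      then have "ennreal (\<mu> A) + ennreal (\<mu> B) = ennreal (\<mu> (A \<union> B))" by (simp add: un)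
      also have "\<dots> \<le> pos_var \<mu> (E \<union> F)" using AB by (intro pos_var_upper) auto
      finally show ?thesis .
    qed
  qed
  let ?S = "\<lambda>E. {B \<in> sets borel. B \<subseteq> E}"
  have ne: "?S E \<noteq> {}" for E :: "'a set" by auto
  have 2: "ennreal (\<mu> A) + pos_var \<mu> F \<le> pos_var \<mu> (E \<union> F)" if "A \<in> sets borel" "A \<subseteq> E" for A
    unfolding pos_var_def[of \<mu> F]
    by (subst ennreal_SUP_add_right[OF ne]) (rule SUP_least, use 1 that in auto)
  have "pos_var \<mu> E + pos_var \<mu> F = (SUP A\<in>?S E. ennreal (\<mu> A) + pos_var \<mu> F)"
    unfolding pos_var_def[of \<mu> E] by (rule ennreal_SUP_add_left[OF ne, symmetric])
  also have "\<dots> \<le> pos_var \<mu> (E \<union> F)" by (rule SUP_least) (use 2 in auto)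
  finally show ?thesis .
qed

lemma ennreal_add_le: "ennreal (a + b) \<le> ennreal a + ennreal b"
proof -
  have "ennreal (a + b) \<le> ennreal (max 0 a + max 0 b)" by (intro ennreal_leI) simp
  also have "\<dots> = ennreal a + ennreal b" by (simp add: ennreal_plus max_def ennreal_neg)
  finally show ?thesis .
qed

text \<open>
  One inequality is superadditivity; for the other, each competitor \<open>B\<close> is cut into the pieces
  \<open>B \<inter> A i\<close>, which compete for the \<open>A i\<close>.
\<close>

lemma pos_var_countably_additive:
  fixes \<mu> :: "'a::topological_space set \<Rightarrow> real"
  assumes \<mu>: "signed_borel_measure \<mu>"
  shows "countably_additive (sets borel) (pos_var \<mu>)"
proof (rule countably_additiveI)
  fix A :: "nat \<Rightarrow> 'a set"
  assume A: "range A \<subseteq> sets borel" "disjoint_family A"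
  have "(\<Sum>i. pos_var \<mu> (A i)) \<le> pos_var \<mu> (\<Union>i. A i)"
  proof (rule suminf_le_const)
    fix n
    have "(\<Sum>i<n. pos_var \<mu> (A i)) \<le> pos_var \<mu> (\<Union>i<n. A i)"
    proof (induction n)
      case (Suc n)
      have "(\<Union>i<n. A i) \<inter> A n = {}"
        using disjoint_family_onD[OF A(2), of _ n] by fastforce
      then have "pos_var \<mu> (\<Union>i<n. A i) + pos_var \<mu> (A n) \<le> pos_var \<mu> ((\<Union>i<n. A i) \<union> A n)"
        by (rule pos_var_superadditive[OF \<mu>])
      also have "(\<Union>i<n. A i) \<union> A n = (\<Union>i<Suc n. A i)" by (auto simp: less_Suc_eq)
      finally show ?case
        using order_trans[OF add_right_mono[OF Suc, of "pos_var \<mu> (A n)"]] by (simp add: lessThan_Suc add.commute)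
    qed simp
    also have "\<dots> \<le> pos_var \<mu> (\<Union>i. A i)" by (rule pos_var_mono) auto
    finally show "(\<Sum>i<n. pos_var \<mu> (A i)) \<le> pos_var \<mu> (\<Union>i. A i)" .
  qed auto
  moreover have "pos_var \<mu> (\<Union>i. A i) \<le> (\<Sum>i. pos_var \<mu> (A i))"
  proof (rule pos_var_least)
    fix B assume B: "B \<in> sets borel" "B \<subseteq> (\<Union>i. A i)"
    have "(\<lambda>i. \<mu> (B \<inter> A i)) sums \<mu> (\<Union>i. B \<inter> A i)"
    proof -
      have "range (\<lambda>i. B \<inter> A i) \<subseteq> sets borel" "disjoint_family (\<lambda>i. B \<inter> A i)"
        using A B(1) by (auto simp: disjoint_family_on_def)
      then show ?thesis using \<mu> unfolding signed_borel_measure_def by blast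
    qed
    moreover have "(\<Union>i. B \<inter> A i) = B" using B by auto
    ultimately have lim: "(\<lambda>n. \<Sum>i<n. \<mu> (B \<inter> A i)) \<longlonglongrightarrow> \<mu> B" by (simp add: sums_def)
    have "ennreal (\<Sum>i<n. \<mu> (B \<inter> A i)) \<le> (\<Sum>i. pos_var \<mu> (A i))" for n
    proof -
      have "ennreal (\<Sum>i<n. \<mu> (B \<inter> A i)) \<le> (\<Sum>i<n. ennreal (\<mu> (B \<inter> A i)))"
      proof (induction n)
        case (Suc n)
        then show ?case
          using ennreal_add_le[of "\<Sum>i<n. \<mu> (B \<inter> A i)" "\<mu> (B \<inter> A n)"]
          by (simp add: add_right_mono order_trans)
      qed simp
      also have "\<dots> \<le> (\<Sum>i<n. pos_var \<mu> (A i))"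
        using A B(1) by (intro sum_mono pos_var_upper) auto
      also have "\<dots> \<le> (\<Sum>i. pos_var \<mu> (A i))" by (rule sum_le_suminf) auto
      finally show ?thesis .
    qed
    then show "ennreal (\<mu> B) \<le> (\<Sum>i. pos_var \<mu> (A i))"
      by (intro LIMSEQ_le_const2[OF tendsto_ennrealI[OF lim]]) auto
  qed
  ultimately show "(\<Sum>i. pos_var \<mu> (A i)) = pos_var \<mu> (\<Union>i. A i)" by (rule antisym)
qed

lemma sets_pos_variation [simp, measurable_cong]: "sets (pos_variation \<mu>) = sets borel"
  unfolding pos_variation_def using sets.sigma_sets_eq[of borel] by simp

lemma space_pos_variation [simp]: "space (pos_variation \<mu>) = UNIV"
  unfolding pos_variation_def by simp

lemma emeasure_pos_variation:
  assumes "signed_borel_measure \<mu>" "E \<in> sets borel"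
  shows "emeasure (pos_variation \<mu>) E = pos_var \<mu> E"
proof -
  have 0: "pos_var \<mu> {} = 0"
    using assms(1) by (auto intro!: antisym pos_var_least simp: signed_borel_measure_def)
  have "pos_variation \<mu> = measure_of UNIV (sets borel) (pos_var \<mu>)"
    unfolding pos_variation_def pos_var_def ..
  moreover have "emeasure (measure_of UNIV (sets borel) (pos_var \<mu>)) E = pos_var \<mu> E"
  proof (rule emeasure_measure_of_sigma)
    show "sigma_algebra UNIV (sets (borel :: 'a measure))"
      using sets.sigma_algebra_axioms[of borel] by simp
  qed (use assms 0 pos_var_countably_additive in \<open>auto simp: positive_def\<close>)
  ultimately show ?thesis by simp
qed

text \<open>
  A set and its complement form a partition that enters the supremum defining the total variation.
\<close>

lemma pos_var_le_total_variation:
  assumes \<mu>: "signed_borel_measure \<mu>"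
  shows "pos_var \<mu> UNIV \<le> total_variation \<mu> UNIV"
proof (rule pos_var_least)
  fix B :: "'a set" assume B: "B \<in> sets borel"
  let ?A = "\<lambda>n::nat. if n = 0 then B else if n = 1 then - B else {}"
  have "ennreal (\<mu> B) \<le> (\<Sum>n\<in>{0}. ennreal \<bar>\<mu> (?A n)\<bar>)" by (simp add: ennreal_leI)
  also have "\<dots> \<le> (\<Sum>n. ennreal \<bar>\<mu> (?A n)\<bar>)" by (rule sum_le_suminf) auto
  also have "\<dots> \<le> total_variation \<mu> UNIV"
    unfolding total_variation_def
  proof (rule SUP_upper)
    have "(\<Union>n. ?A n) = UNIV" by (auto split: if_splits)
    moreover have "disjoint_family ?A" "range ?A \<subseteq> sets borel" using B by (auto simp: disjoint_family_on_def)
    ultimately show "?A \<in> {A. range A \<subseteq> sets borel \<and> disjoint_family A \<and> \<Union> (range A) = UNIV}" by blast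
  qed
  finally show "ennreal (\<mu> B) \<le> total_variation \<mu> UNIV" .
qed

locale signed_probability =
  fixes \<mu> :: "'a::metric_space set \<Rightarrow> real"
  assumes signed: "signed_borel_measure \<mu>"
    and total: "\<mu> UNIV = 1"
    and finite_variation: "total_variation \<mu> UNIV < \<infinity>"
    and compact_UNIV: "compact (UNIV :: 'a set)"
begin

sublocale P: finite_measure "pos_variation \<mu>"
proof
  have "pos_var \<mu> UNIV < \<infinity>"
    using pos_var_le_total_variation[OF signed] finite_variation by (rule le_less_trans)
  then show "emeasure (pos_variation \<mu>) (space (pos_variation \<mu>)) \<noteq> \<infinity>"
    using emeasure_pos_variation[OF signed] by simp
qed

sublocale N: finite_measure "pos_variation (\<lambda>B. - \<mu> B)"
proof
  have "pos_var (\<lambda>B. - \<mu> B) UNIV \<le> total_variation (\<lambda>B. - \<mu> B) UNIV"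
    by (rule pos_var_le_total_variation[OF signed_borel_measure_uminus[OF signed]])
  then have "pos_var (\<lambda>B. - \<mu> B) UNIV < \<infinity>"
    using finite_variation unfolding total_variation_uminus by (rule le_less_trans)
  then show "emeasure (pos_variation (\<lambda>B. - \<mu> B)) (space (pos_variation (\<lambda>B. - \<mu> B))) \<noteq> \<infinity>"
    using emeasure_pos_variation[OF signed_borel_measure_uminus[OF signed]] by simp
qed

definition variation :: real where
  "variation = measure (pos_variation \<mu>) UNIV + measure (pos_variation (\<lambda>B. - \<mu> B)) UNIV"

lemma variation_nonneg: "0 \<le> variation"
  by (simp add: variation_def)

text \<open>
  The Jordan decomposition at the whole space. As \<open>\<mu> B = 1 - \<mu> (- B)\<close>, the supremum of \<open>\<mu>\<close> exceeds
  that of \<open>- \<mu>\<close> by \<open>1\<close>, complements taking competitors to competitors. The consequence is that the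
  mean of a constant is this constant.
\<close>

lemma measure_pos_minus_neg:
  "measure (pos_variation \<mu>) UNIV - measure (pos_variation (\<lambda>B. - \<mu> B)) UNIV = 1"
proof -
  have compl: "\<mu> B = 1 - \<mu> (- B)" if "B \<in> sets borel" for B
    using signed_measure_Un[OF signed that, of "- B"] that total by (simp add: Compl_partition)
  have "pos_var \<mu> UNIV \<le> 1 + pos_var (\<lambda>B. - \<mu> B) UNIV"
  proof (rule pos_var_least)
    fix B :: "'a set" assume B: "B \<in> sets borel"
    have "ennreal (\<mu> B) \<le> ennreal (1 + max 0 (- \<mu> (- B)))"
      using compl[OF B] by (intro ennreal_leI) auto
    also have "\<dots> = 1 + ennreal (- \<mu> (- B))"
      by (subst ennreal_plus) (auto simp: max_def ennreal_neg)
    also have "ennreal (- \<mu> (- B)) \<le> pos_var (\<lambda>B. - \<mu> B) UNIV"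
      using pos_var_upper[of "- B" UNIV "\<lambda>B. - \<mu> B"] B by auto
    finally show "ennreal (\<mu> B) \<le> 1 + pos_var (\<lambda>B. - \<mu> B) UNIV" by (simp add: add_left_mono)
  qed
  moreover have "1 + pos_var (\<lambda>B. - \<mu> B) UNIV \<le> pos_var \<mu> UNIV"
  proof -
    have "1 + pos_var (\<lambda>B. - \<mu> B) UNIV = (SUP B\<in>{B \<in> sets borel. B \<subseteq> UNIV}. 1 + ennreal (- \<mu> B))"
      unfolding pos_var_def by (rule ennreal_SUP_add_right) auto
    also have "\<dots> \<le> pos_var \<mu> UNIV"
    proof (rule SUP_least)
      fix B :: "'a set" assume "B \<in> {B \<in> sets borel. B \<subseteq> UNIV}"
      then have B: "B \<in> sets borel" by simp
      \<comment> \<open>When \<open>\<mu> B\<close> is positive, \<open>ennreal\<close> truncates \<open>- \<mu> B\<close> to \<open>0\<close> and the whole space is the competitor.\<close>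
      show "1 + ennreal (- \<mu> B) \<le> pos_var \<mu> UNIV"
      proof (cases "\<mu> B \<le> 0")
        case True
        then have "1 + ennreal (- \<mu> B) = ennreal (1 - \<mu> B)"
          using ennreal_plus[of 1 "- \<mu> B"] by simp
        also have "1 - \<mu> B = \<mu> (- B)" using compl[OF B] by simp
        also have "ennreal \<dots> \<le> pos_var \<mu> UNIV" using B by (intro pos_var_upper) auto
        finally show ?thesis .
      next
        case False
        then show ?thesis using pos_var_upper[of UNIV UNIV \<mu>] total by (simp add: ennreal_neg)
      qed
    qed
    finally show ?thesis .
  qed
  ultimately have "pos_var \<mu> UNIV = 1 + pos_var (\<lambda>B. - \<mu> B) UNIV" by (rule antisym)
  then have "emeasure (pos_variation \<mu>) UNIV = 1 + emeasure (pos_variation (\<lambda>B. - \<mu> B)) UNIV"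
    using emeasure_pos_variation[OF signed] emeasure_pos_variation[OF signed_borel_measure_uminus[OF signed]]
    by simp
  then have "ennreal (measure (pos_variation \<mu>) UNIV) = ennreal (1 + measure (pos_variation (\<lambda>B. - \<mu> B)) UNIV)"
    by (simp add: P.emeasure_eq_measure N.emeasure_eq_measure ennreal_plus)
  then have "measure (pos_variation \<mu>) UNIV = 1 + measure (pos_variation (\<lambda>B. - \<mu> B)) UNIV"
    by (subst (asm) ennreal_inj) (auto intro: add_nonneg_nonneg)
  then show ?thesis by simp
qed

lemma continuous_bounded:
  fixes f :: "'a \<Rightarrow> complex"
  assumes "continuous_on UNIV f"
  obtains B where "\<And>x. norm (f x) \<le> B"
  using compact_imp_bounded[OF compact_continuous_image[OF assms compact_UNIV]]
  by (auto simp: bounded_iff)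

lemma integrable_variations:
  fixes f :: "'a \<Rightarrow> complex"
  assumes "continuous_on UNIV f"
  shows "integrable (pos_variation \<mu>) f" "integrable (pos_variation (\<lambda>B. - \<mu> B)) f"
proof -
  obtain B where B: "\<And>x. norm (f x) \<le> B" using continuous_bounded[OF assms] by blast
  have f: "f \<in> borel_measurable borel" using assms by (rule borel_measurable_continuous_onI)
  show "integrable (pos_variation \<mu>) f"
    by (rule P.integrable_const_bound[of _ B]) (use B f in auto)
  show "integrable (pos_variation (\<lambda>B. - \<mu> B)) f"
    by (rule N.integrable_const_bound[of _ B]) (use B f in auto)
qed

abbreviation sint :: "('a \<Rightarrow> complex) \<Rightarrow> complex" where "sint \<equiv> signed_integral \<mu>"

lemma sint_add: "continuous_on UNIV f \<Longrightarrow> continuous_on UNIV g \<Longrightarrow> sint (\<lambda>x. f x + g x) = sint f + sint g"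
  unfolding signed_integral_def by (simp add: integrable_variations)

lemma sint_diff: "continuous_on UNIV f \<Longrightarrow> continuous_on UNIV g \<Longrightarrow> sint (\<lambda>x. f x - g x) = sint f - sint g"
  unfolding signed_integral_def by (simp add: integrable_variations)

lemma sint_scale: "sint (\<lambda>x. c * f x) = c * sint f"
  unfolding signed_integral_def by (simp add: right_diff_distrib)

lemma sint_const: "sint (\<lambda>x. c) = c"
proof -
  have "sint (\<lambda>x. c) = of_real (measure (pos_variation \<mu>) UNIV - measure (pos_variation (\<lambda>B. - \<mu> B)) UNIV) * c"
    unfolding signed_integral_def by (simp add: scaleR_conv_of_real left_diff_distrib)
  then show ?thesis by (simp only: measure_pos_minus_neg) simp
qed

lemma sint_cnj: "sint (\<lambda>x. cnj (f x)) = cnj (sint f)"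
  unfolding signed_integral_def by (simp add: integral_cnj)

lemma sint_sum:
  "(\<And>i. i \<in> I \<Longrightarrow> continuous_on UNIV (f i)) \<Longrightarrow> sint (\<lambda>x. \<Sum>i\<in>I. f i x) = (\<Sum>i\<in>I. sint (f i))"
  unfolding signed_integral_def by (simp add: integrable_variations sum_subtractf)

lemma norm_sint_le:
  assumes "continuous_on UNIV f" "\<And>x. norm (f x) \<le> B"
  shows "norm (sint f) \<le> variation * B"
proof -
  have 1: "norm (integral\<^sup>L (pos_variation \<mu>) f) \<le> (\<integral>x. B \<partial>pos_variation \<mu>)"
    by (rule order_trans[OF integral_norm_bound integral_mono]) (use integrable_variations assms in auto)
  have 2: "norm (integral\<^sup>L (pos_variation (\<lambda>B. - \<mu> B)) f) \<le> (\<integral>x. B \<partial>pos_variation (\<lambda>B. - \<mu> B))"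
    by (rule order_trans[OF integral_norm_bound integral_mono]) (use integrable_variations assms in auto)
  have "norm (sint f) \<le> norm (integral\<^sup>L (pos_variation \<mu>) f) + norm (integral\<^sup>L (pos_variation (\<lambda>B. - \<mu> B)) f)"
    unfolding signed_integral_def by (rule norm_triangle_ineq4)
  then show ?thesis using 1 2 by (simp add: variation_def distrib_right)
qed

lemma tendsto_sint:
  assumes "\<And>n. continuous_on UNIV (F n)" and lim: "uniform_limit UNIV F f sequentially"
  shows "(\<lambda>n::nat. sint (F n)) \<longlonglongrightarrow> sint f"
proof (rule LIMSEQ_I)
  fix r :: real assume r: "0 < r"
  have fc: "continuous_on UNIV f" by (rule uniform_limit_theorem[OF _ lim]) (use assms in auto)
  let ?e = "r / (variation + 1)"
  have e: "0 < ?e" using r variation_nonneg by simp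
  obtain N where N: "\<And>n x. n \<ge> N \<Longrightarrow> dist (F n x) (f x) < ?e"
    using uniform_limitD[OF lim e] by (auto simp: eventually_sequentially)
  have "norm (sint (F n) - sint f) < r" if "n \<ge> N" for n
  proof -
    have "norm (sint (\<lambda>x. F n x - f x)) \<le> variation * ?e"
      by (rule norm_sint_le) (use assms fc N[OF that] in \<open>auto intro!: continuous_intros simp: dist_norm less_imp_le\<close>)
    also have "\<dots> < r" using r variation_nonneg by (simp add: field_simps)
    finally show ?thesis using assms fc by (simp add: sint_diff)
  qed
  then show "\<exists>no. \<forall>n\<ge>no. norm (sint (F n) - sint f) < r" by blast
qed

end

section \<open>Isometric parametrizations\<close>

lemma isometric_paramD: "isometric_param I \<gamma> \<Longrightarrow> s \<in> I \<Longrightarrow> t \<in> I \<Longrightarrow> dist (\<gamma> s) (\<gamma> t) = \<bar>s - t\<bar>"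
  by (simp add: isometric_param_def)

lemma isometric_param_subset: "isometric_param I \<gamma> \<Longrightarrow> J \<subseteq> I \<Longrightarrow> isometric_param J \<gamma>"
  by (auto simp: isometric_param_def)

lemma isometric_param_inj: "isometric_param I \<gamma> \<Longrightarrow> inj_on \<gamma> I"
  by (rule inj_onI) (metis isometric_paramD abs_eq_0 diff_self dist_self eq_iff_diff_eq_0)

lemma isometric_param_continuous: "isometric_param I \<gamma> \<Longrightarrow> continuous_on I \<gamma>"
  unfolding continuous_on_iff by (metis dist_real_def isometric_paramD)

lemma isometric_param_shift: "isometric_param I \<gamma> \<Longrightarrow> (\<And>t. t \<in> J \<Longrightarrow> c + t \<in> I) \<Longrightarrow> isometric_param J (\<lambda>t. \<gamma> (c + t))"
  by (auto simp: isometric_param_def)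

text \<open>
  Two points of \<open>S\<close> fix the slope \<open>\<epsilon>\<close>, and a third one is determined by its distances to these two.
\<close>

lemma real_isometry_affine:
  fixes u :: "real \<Rightarrow> real"
  assumes u: "\<And>s t. s \<in> S \<Longrightarrow> t \<in> S \<Longrightarrow> \<bar>u s - u t\<bar> = \<bar>s - t\<bar>"
  obtains \<epsilon> k where "\<epsilon> = 1 \<or> \<epsilon> = -1" "\<And>t. t \<in> S \<Longrightarrow> u t = k + \<epsilon> * t"
proof (cases "\<exists>t0\<in>S. \<exists>t1\<in>S. t0 \<noteq> t1")
  case False
  show ?thesis
  proof (cases "S = {}")
    case True then show ?thesis using that[of 1 0] by auto
  next
    case False
    then obtain t0 where "t0 \<in> S" by blast
    with \<open>\<not> (\<exists>t0\<in>S. \<exists>t1\<in>S. t0 \<noteq> t1)\<close> have "S = {t0}" by blast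
    then show ?thesis using that[of 1 "u t0 - t0"] by auto
  qed
next
  case True
  then obtain t0 t1 where t: "t0 \<in> S" "t1 \<in> S" "t0 \<noteq> t1" by blast
  define \<epsilon> where "\<epsilon> = (u t1 - u t0) / (t1 - t0)"
  have "\<bar>\<epsilon>\<bar> = 1" unfolding \<epsilon>_def using u[OF t(2,1)] t(3) by (simp add: abs_divide)
  then have e: "\<epsilon> = 1 \<or> \<epsilon> = -1" by linarith
  have d1: "u t1 - u t0 = \<epsilon> * (t1 - t0)" using t(3) by (simp add: \<epsilon>_def)
  have "u s = (u t0 - \<epsilon> * t0) + \<epsilon> * s" if s: "s \<in> S" for s
    using e u[OF s t(1)] u[OF s t(2)] d1 t(3) by (auto simp: abs_if split: if_splits)
  with e that show ?thesis by blast
qed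

text \<open>
  Two parametrizations of a neighbourhood of the same point differ by a distance-preserving change of
  parameter, which is a shift, possibly combined with a reflection. This is how charts, rays and segments
  are compared throughout.
\<close>

lemma isometric_params_agree:
  assumes \<gamma>: "isometric_param {a<..<b} \<gamma>" "open (\<gamma> ` {a<..<b})" "c \<in> {a<..<b}"
    and \<sigma>: "isometric_param {-\<rho><..<\<rho>} \<sigma>" "0 < \<rho>" "\<sigma> 0 = \<gamma> c"
  obtains \<delta> \<epsilon> where "0 < \<delta>" "\<epsilon> = 1 \<or> \<epsilon> = -1"
    "\<And>t. \<bar>t\<bar> < \<delta> \<Longrightarrow> c + \<epsilon> * t \<in> {a<..<b}" "\<And>t. \<bar>t\<bar> < \<delta> \<Longrightarrow> \<sigma> t = \<gamma> (c + \<epsilon> * t)"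
proof -
  obtain d where d: "0 < d" "ball (\<gamma> c) d \<subseteq> \<gamma> ` {a<..<b}"
    using \<gamma> by (meson imageI open_contains_ball)
  define \<delta> where "\<delta> = min d \<rho>"
  have \<delta>: "0 < \<delta>" using d \<sigma> by (simp add: \<delta>_def)
  have "\<exists>u\<in>{a<..<b}. \<sigma> t = \<gamma> u" if "\<bar>t\<bar> < \<delta>" for t
  proof -
    have "dist (\<gamma> c) (\<sigma> t) = \<bar>0 - t\<bar>"
      unfolding \<sigma>(3)[symmetric] by (rule isometric_paramD[OF \<sigma>(1)]) (use that \<sigma>(2) in \<open>auto simp: \<delta>_def\<close>)
    then have "\<sigma> t \<in> ball (\<gamma> c) d" using that by (simp add: \<delta>_def)
    then show ?thesis using d by blast
  qed
  then obtain u where u: "\<And>t. \<bar>t\<bar> < \<delta> \<Longrightarrow> u t \<in> {a<..<b}" "\<And>t. \<bar>t\<bar> < \<delta> \<Longrightarrow> \<sigma> t = \<gamma> (u t)"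
    by metis
  have "\<bar>u s - u t\<bar> = \<bar>s - t\<bar>" if "\<bar>s\<bar> < \<delta>" "\<bar>t\<bar> < \<delta>" for s t
  proof -
    have "\<bar>u s - u t\<bar> = dist (\<sigma> s) (\<sigma> t)"
      using isometric_paramD[OF \<gamma>(1) u(1)[OF that(1)] u(1)[OF that(2)]] u(2) that by simp
    also have "\<dots> = \<bar>s - t\<bar>"
      by (rule isometric_paramD[OF \<sigma>(1)]) (use that in \<open>auto simp: \<delta>_def\<close>)
    finally show ?thesis .
  qed
  then obtain \<epsilon> k where e: "\<epsilon> = 1 \<or> \<epsilon> = -1" "\<And>t. \<bar>t\<bar> < \<delta> \<Longrightarrow> u t = k + \<epsilon> * t"
    using real_isometry_affine[of "{t. \<bar>t\<bar> < \<delta>}" u] by (metis mem_Collect_eq)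
  have "\<gamma> (u 0) = \<gamma> c" using u(2)[of 0] \<delta> \<sigma>(3) by simp
  then have "u 0 = c" using isometric_param_inj[OF \<gamma>(1)] u(1)[of 0] \<delta> \<gamma>(3) by (simp add: inj_on_eq_iff)
  then have "k = c" using e(2)[of 0] \<delta> by simp
  then show ?thesis using that[of \<delta> \<epsilon>] \<delta> e u by metis
qed

section \<open>The local structure of a metrized graph\<close>

lemma ray_directions_mult: "v \<in> ray_directions n \<Longrightarrow> w \<in> ray_directions n \<Longrightarrow> v * w \<in> ray_directions n"
proof -
  assume "v \<in> ray_directions n" "w \<in> ray_directions n"
  then obtain k l :: int where "v = cis (2 * pi * of_int k / of_nat n)" "w = cis (2 * pi * of_int l / of_nat n)"
    by (auto simp: ray_directions_def)
  then have "v * w = cis (2 * pi * of_int (k + l) / of_nat n)"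
    by (simp add: cis_mult add_divide_distrib distrib_left)
  then show ?thesis unfolding ray_directions_def by blast
qed

lemma one_in_ray_directions: "1 \<in> ray_directions n"
  unfolding ray_directions_def by (auto intro!: exI[of _ 0])

lemma norm_ray_direction: "v \<in> ray_directions n \<Longrightarrow> cmod v = 1"
  by (auto simp: ray_directions_def)

lemma finite_ray_directions: "1 \<le> n \<Longrightarrow> finite (ray_directions n)"
proof (rule finite_subset)
  assume n: "1 \<le> n"
  show "ray_directions n \<subseteq> {z. z ^ n = 1}"
  proof
    fix v assume "v \<in> ray_directions n"
    then obtain k :: int where "v = cis (2 * pi * of_int k / of_nat n)" by (auto simp: ray_directions_def)
    then have "v ^ n = cis (real n * (2 * pi * of_int k / of_nat n))" by (simp only: Complex.DeMoivre)
    also have "real n * (2 * pi * of_int k / of_nat n) = 2 * pi * of_int k" using n by simp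
    finally show "v \<in> {z. z ^ n = 1}" by (simp add: cis_multiple_2pi)
  qed
  show "finite {z::complex. z ^ n = 1}" using n by (rule finite_roots_unity)
qed

text \<open>The directions form a group, so two of them can only be \<open>1\<close> and \<open>-1\<close>.\<close>

lemma ray_directions_card_2: "card (ray_directions n) = 2 \<Longrightarrow> ray_directions n = {1, -1}"
proof -
  assume c: "card (ray_directions n) = 2"
  then obtain w where w: "ray_directions n = {1, w}" "w \<noteq> 1"
    using one_in_ray_directions[of n] by (auto simp: card_2_iff doubleton_eq_iff)
  have "w * w \<in> {1, w}" using ray_directions_mult[of w n w] w by simp
  then have "w * w = 1" using w norm_ray_direction[of w n] by auto
  then have "w = -1" using w(2) by (metis square_eq_1_iff)
  then show ?thesis using w by simp
qed

locale graph =
  fixes ty :: "'a::metric_space itself"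
  assumes metrized: "metrized_graph ty"
begin

lemma compact_UNIV: "compact (UNIV :: 'a set)"
  and connected_UNIV: "connected (UNIV :: 'a set)"
  using metrized by (auto simp: metrized_graph_def)

lemma chart_at: "case chart_at p of (n, \<phi>) \<Rightarrow> \<exists>r. star_chart (p :: 'a) n r \<phi>"
proof -
  have "\<exists>n r \<phi>. star_chart p n r \<phi>" using metrized unfolding metrized_graph_def by blast
  then have "\<exists>c. case c of (n, \<phi>) \<Rightarrow> \<exists>r. star_chart p n r \<phi>" by auto
  then show ?thesis unfolding chart_at_def by (rule someI_ex)
qed

lemma finite_Vec: "finite (Vec p)" and one_in_Vec: "1 \<in> Vec p" and norm_Vec: "v \<in> Vec p \<Longrightarrow> cmod v = 1"
  for p :: 'a
proof -
  have "1 \<le> fst (chart_at p)" using chart_at[of p] by (auto simp: star_chart_def)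
  then show "finite (Vec p)" by (simp add: Vec_def finite_ray_directions)
  show "1 \<in> Vec p" by (simp add: Vec_def one_in_ray_directions)
  show "v \<in> Vec p \<Longrightarrow> cmod v = 1" by (simp add: Vec_def norm_ray_direction)
qed

text \<open>
  Such a radius isolates what is used of the chart at \<open>p\<close>: the distances between points of the star,
  and that small balls about \<open>p\<close> are smaller stars.
\<close>

definition star_radius :: "'a \<Rightarrow> real \<Rightarrow> bool" where
  "star_radius p \<rho> \<longleftrightarrow> 0 < \<rho> \<and>
     (\<forall>v\<in>Vec p. \<forall>w\<in>Vec p. \<forall>s t. 0 \<le> s \<and> s < \<rho> \<and> 0 \<le> t \<and> t < \<rho> \<longrightarrow>
        dist (move p s v) (move p t w) = (if v = w then \<bar>s - t\<bar> else s + t)) \<and>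
     (\<forall>x\<in>ball p \<rho>. \<exists>v\<in>Vec p. x = move p (dist p x) v)"

lemma move_0 [simp]: "move p 0 v = (p :: 'a)"
proof -
  show ?thesis using chart_at[of p] by (auto simp: star_chart_def move_def)
qed

lemma star_radius_exists: "\<exists>\<rho>. star_radius (p :: 'a) \<rho>"
proof -
  obtain n \<phi> r where c: "chart_at p = (n, \<phi>)" "star_chart p n r \<phi>" using chart_at[of p] by (cases "chart_at p") auto
  have V: "Vec p = ray_directions n" and mv: "move p t v = \<phi> (of_real t * v)" for t v
    using c by (simp_all add: Vec_def move_def)
  have in_star: "of_real t * v \<in> star n r" if "v \<in> Vec p" "0 \<le> t" "t < r" for t v
    using that by (auto simp: star_def V)
  have sd: "star_dist (of_real s * v) (of_real t * w) = (if v = w then \<bar>s - t\<bar> else s + t)"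
    if "v \<in> Vec p" "w \<in> Vec p" "0 \<le> s" "0 \<le> t" for s t v w
  proof -
    have n: "cmod v = 1" "cmod w = 1" using that norm_Vec by auto
    have sg: "sgn (of_real u * z) = (if u = 0 then 0 else z)" if "0 \<le> u" "cmod z = 1" for u z
      using that by (auto simp: sgn_mult sgn_of_real sgn_div_norm[of z])
    have "cmod (of_real s * v - of_real t * v) = \<bar>s - t\<bar>"
      using n by (metis left_diff_distrib mult.right_neutral norm_mult norm_of_real of_real_diff)
    then show ?thesis
      using that n by (auto simp: star_dist_def sg norm_mult split: if_splits)
  qed
  have D: "dist (move p s v) (move p t w) = (if v = w then \<bar>s - t\<bar> else s + t)"
    if "v \<in> Vec p" "w \<in> Vec p" "0 \<le> s" "s < r" "0 \<le> t" "t < r" for s t v w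
    using c(2) in_star[of v s] in_star[of w t] sd[of v w s t] that unfolding star_chart_def mv by simp
  have "p \<in> interior (\<phi> ` star n r)" "0 < r" using c by (auto simp: star_chart_def)
  then obtain d where d: "0 < d" "ball p d \<subseteq> \<phi> ` star n r" by (auto simp: mem_interior)
  have "\<exists>v\<in>Vec p. x = move p (dist p x) v" if xd: "x \<in> ball p d" for x
  proof -
    have "\<exists>t v. 0 \<le> t \<and> t < r \<and> v \<in> Vec p \<and> x = move p t v"
    proof -
      obtain z where "z \<in> star n r" "x = \<phi> z" using xd d(2) by blast
      then show ?thesis by (auto simp: star_def V mv)
    qed
    then obtain t v where tv: "0 \<le> t" "t < r" "v \<in> Vec p" "x = move p t v" by blast
    have "dist (move p 0 v) (move p t v) = t" using D[of v v 0 t] tv \<open>0 < r\<close> by simp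
    then show ?thesis using tv by auto
  qed
  then have "star_radius p (min d r)"
    using D d \<open>0 < r\<close> unfolding star_radius_def by auto
  then show ?thesis ..
qed

lemma star_radius_pos: "star_radius p \<rho> \<Longrightarrow> 0 < \<rho>"
  by (simp add: star_radius_def)

lemma star_radius_mono: "star_radius p \<rho> \<Longrightarrow> 0 < \<rho>' \<Longrightarrow> \<rho>' \<le> \<rho> \<Longrightarrow> star_radius p \<rho>'"
  unfolding star_radius_def by auto

lemma star_radius_dist:
  "\<lbrakk>star_radius p \<rho>; v \<in> Vec p; w \<in> Vec p; 0 \<le> s; s < \<rho>; 0 \<le> t; t < \<rho>\<rbrakk> \<Longrightarrow>
    dist (move p s v) (move p t w) = (if v = w then \<bar>s - t\<bar> else s + t)"
  unfolding star_radius_def by blast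

lemma star_radius_dist_center:
  "\<lbrakk>star_radius p \<rho>; v \<in> Vec p; 0 \<le> t; t < \<rho>\<rbrakk> \<Longrightarrow> dist p (move p t v) = t"
  using star_radius_dist[of p \<rho> v v 0 t] by (simp add: star_radius_pos)

lemma star_radius_ball:
  assumes "star_radius p \<rho>" "dist p x < \<rho>"
  obtains v where "v \<in> Vec p" "x = move p (dist p x) v"
  using assms unfolding star_radius_def by (metis mem_ball)

lemma star_ray_isometric:
  "star_radius p \<rho> \<Longrightarrow> v \<in> Vec p \<Longrightarrow> isometric_param {0..<\<rho>} (\<lambda>t. move p t v)"
  unfolding isometric_param_def using star_radius_dist[of p \<rho> v v] by auto

lemma open_star_ray:
  assumes \<rho>: "star_radius p \<rho>" and v: "v \<in> Vec p" and "r \<le> \<rho>"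
  shows "open ((\<lambda>t. move p t v) ` {0<..<r})"
  unfolding open_contains_ball
proof
  fix x assume "x \<in> (\<lambda>t. move p t v) ` {0<..<r}"
  then obtain t where t: "0 < t" "t < r" "x = move p t v" by auto
  let ?e = "min t (r - t)"
  have "y \<in> (\<lambda>t. move p t v) ` {0<..<r}" if y: "dist x y < ?e" for y
  proof -
    have px: "dist p x = t" using star_radius_dist_center[OF \<rho> v] t assms(3) by simp
    then have py: "dist p y < r" using y dist_triangle[of p y x] by linarith
    then obtain w where w: "w \<in> Vec p" "y = move p (dist p y) w"
      using star_radius_ball[OF \<rho>, of y] assms(3) by auto
    have xy: "dist x y = (if v = w then \<bar>t - dist p y\<bar> else t + dist p y)"
      using star_radius_dist[OF \<rho> v w(1), of t "dist p y"] t w py assms(3) by simp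
    then have "w = v" using y zero_le_dist[of p y] by (auto split: if_splits)
    then have "0 < dist p y" using xy y by auto
    then show ?thesis using w \<open>w = v\<close> py by auto
  qed
  then show "\<exists>e>0. ball x e \<subseteq> (\<lambda>t. move p t v) ` {0<..<r}"
    using t by (intro exI[of _ ?e]) auto
qed

text \<open>
  At an interior point of an open segment there are exactly two points at any small distance, so the
  star has two rays and \<open>\<lambda>t. move x t 1\<close> parametrizes a neighbourhood.
\<close>

lemma move_isometric_at_edge_point:
  assumes \<gamma>: "isometric_param {a<..<b} \<gamma>" "open (\<gamma> ` {a<..<b})" "c \<in> {a<..<b}" and x: "(x :: 'a) = \<gamma> c"
  obtains \<rho> where "star_radius x \<rho>" "Vec x = {1, -1}" "isometric_param {-\<rho><..<\<rho>} (\<lambda>t. move x t 1)"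
proof -
  obtain \<rho>0 where \<rho>0: "star_radius x \<rho>0" using star_radius_exists by blast
  obtain d where d: "0 < d" "ball x d \<subseteq> \<gamma> ` {a<..<b}" using \<gamma> x by (meson imageI open_contains_ball)
  define \<rho> where "\<rho> = Min {\<rho>0, d, c - a, b - c}"
  have pos: "0 < \<rho>" using star_radius_pos[OF \<rho>0] d \<gamma>(3) by (simp add: \<rho>_def)
  have le: "\<rho> \<le> \<rho>0" "\<rho> \<le> d" "\<rho> \<le> c - a" "\<rho> \<le> b - c" by (simp_all add: \<rho>_def)
  have \<rho>: "star_radius x \<rho>" using star_radius_mono[OF \<rho>0 pos le(1)] .
  let ?t = "\<rho> / 2"
  have sphere1: "{y. dist x y = ?t} = {\<gamma> (c - ?t), \<gamma> (c + ?t)}"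
  proof (intro equalityI subsetI)
    fix y assume y: "y \<in> {y. dist x y = ?t}"
    then have "y \<in> ball x d" using pos le by simp
    then obtain s where s: "s \<in> {a<..<b}" "y = \<gamma> s" using d by blast
    then have "\<bar>c - s\<bar> = ?t" using y x isometric_paramD[OF \<gamma>(1,3) s(1)] by simp
    then have "s = c - ?t \<or> s = c + ?t" by linarith
    then show "y \<in> {\<gamma> (c - ?t), \<gamma> (c + ?t)}" using s by auto
  next
    fix y assume "y \<in> {\<gamma> (c - ?t), \<gamma> (c + ?t)}"
    then obtain s where s: "s = c - ?t \<or> s = c + ?t" "y = \<gamma> s" by auto
    have "s \<in> {a<..<b}" using s(1) pos le by auto
    then have "dist x y = \<bar>c - s\<bar>" using x s(2) isometric_paramD[OF \<gamma>(1,3)] by simp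
    then show "y \<in> {y. dist x y = ?t}" using s(1) pos by auto
  qed
  have sphere2: "{y. dist x y = ?t} = (\<lambda>v. move x ?t v) ` Vec x"
  proof (intro equalityI subsetI)
    fix y assume "y \<in> {y. dist x y = ?t}"
    then have y: "dist x y = ?t" by simp
    obtain v where "v \<in> Vec x" "y = move x (dist x y) v"
      by (rule star_radius_ball[OF \<rho>, of y]) (use y pos in auto)
    then show "y \<in> (\<lambda>v. move x ?t v) ` Vec x" unfolding y by blast
  next
    fix y assume "y \<in> (\<lambda>v. move x ?t v) ` Vec x"
    then show "y \<in> {y. dist x y = ?t}" using star_radius_dist_center[OF \<rho>] pos by auto
  qed
  have "inj_on (\<lambda>v. move x ?t v) (Vec x)"
  proof (rule inj_onI)
    fix v w assume vw: "v \<in> Vec x" "w \<in> Vec x" "move x ?t v = move x ?t w"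
    then show "v = w" using star_radius_dist[OF \<rho> vw(1,2), of ?t ?t] pos by (simp split: if_splits)
  qed
  then have "card (Vec x) = card {\<gamma> (c - ?t), \<gamma> (c + ?t)}"
    using sphere1 sphere2 card_image by metis
  also have "\<dots> = 2"
  proof -
    have "c - ?t \<in> {a<..<b}" "c + ?t \<in> {a<..<b}" using pos le by auto
    then have "\<gamma> (c - ?t) \<noteq> \<gamma> (c + ?t)"
      using isometric_param_inj[OF \<gamma>(1)] pos by (auto simp: inj_on_eq_iff)
    then show ?thesis by simp
  qed
  finally have V: "Vec x = {1, -1}" unfolding Vec_def by (rule ray_directions_card_2)
  have neg: "move x t 1 = move x (- t) (-1)" for t by (simp add: move_def)
  have "dist (move x s 1) (move x t 1) = \<bar>s - t\<bar>" if "s \<in> {-\<rho><..<\<rho>}" "t \<in> {-\<rho><..<\<rho>}" for s t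
  proof -
    note D = star_radius_dist[OF \<rho>]
    consider "0 \<le> s" "0 \<le> t" | "0 \<le> s" "t < 0" | "s < 0" "0 \<le> t" | "s < 0" "t < 0" by linarith
    then show ?thesis
    proof cases
      case 1 then show ?thesis using D[of 1 1 s t] that V by simp
    next
      case 2 then show ?thesis using D[of 1 "-1" s "-t"] that V neg[of t] by simp
    next
      case 3 then show ?thesis using D[of "-1" 1 "-s" t] that V neg[of s] by simp
    next
      case 4 then show ?thesis using D[of "-1" "-1" "-s" "-t"] that V neg[of s] neg[of t] by simp
    qed
  qed
  then have "isometric_param {-\<rho><..<\<rho>} (\<lambda>t. move x t 1)" by (simp add: isometric_param_def)
  with \<rho> V that show ?thesis by blast
qed

lemma move_eq_param:
  assumes "isometric_param {a<..<b} \<gamma>" "open (\<gamma> ` {a<..<b})" "c \<in> {a<..<b}" "(x :: 'a) = \<gamma> c"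
  obtains \<delta> \<epsilon> where "0 < \<delta>" "\<epsilon> = 1 \<or> \<epsilon> = -1"
    "\<And>t. \<bar>t\<bar> < \<delta> \<Longrightarrow> c + \<epsilon> * t \<in> {a<..<b}" "\<And>t. \<bar>t\<bar> < \<delta> \<Longrightarrow> move x t 1 = \<gamma> (c + \<epsilon> * t)"
proof -
  obtain \<rho> where \<rho>: "star_radius x \<rho>" "isometric_param {-\<rho><..<\<rho>} (\<lambda>t. move x t 1)"
    using move_isometric_at_edge_point[OF assms] by blast
  show ?thesis
    by (rule isometric_params_agree[OF assms(1-3) \<rho>(2) star_radius_pos[OF \<rho>(1)]])
       (use assms(4) that in auto)
qed

section \<open>Decomposition into segments\<close>

text \<open>
  The parametrization extends to the endpoints of the open segment \<open>E\<close>, since boundary terms there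
  occur in the integrals over \<open>E\<close>.
\<close>

definition segment :: "'a set \<Rightarrow> (real \<Rightarrow> 'a) \<Rightarrow> real \<Rightarrow> bool" where
  "segment E \<gamma> l \<longleftrightarrow> 0 < l \<and> isometric_param {0..l} \<gamma> \<and> E = \<gamma> ` {0<..<l} \<and> open E"

definition segmentation :: "'a set \<Rightarrow> 'a set set \<Rightarrow> bool" where
  "segmentation V \<E> \<longleftrightarrow> finite V \<and> finite \<E> \<and> disjoint \<E> \<and> \<Union>\<E> = - V \<and> (\<forall>E\<in>\<E>. \<exists>\<gamma> l. segment E \<gamma> l)"

text \<open>
  An endpoint in another segment \<open>E'\<close> would have a neighbourhood in \<open>E'\<close>, which meets \<open>E\<close>.
\<close>

lemma segment_endpoints:
  assumes V: "segmentation V \<E>" and E: "E \<in> \<E>" "segment E \<gamma> l"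
  shows "\<gamma> 0 \<in> V" "\<gamma> l \<in> V"
proof -
  have l: "0 < l" "isometric_param {0..l} \<gamma>" "E = \<gamma> ` {0<..<l}" using E by (auto simp: segment_def)
  have key: "\<gamma> s \<in> V" if s: "s = 0 \<or> s = l" for s
  proof (rule ccontr)
    assume "\<gamma> s \<notin> V"
    then obtain E' where E': "E' \<in> \<E>" "\<gamma> s \<in> E'" using V by (auto simp: segmentation_def)
    have notE: "\<gamma> s \<notin> E" using s l inj_on_eq_iff[OF isometric_param_inj[OF l(2)]] by auto
    have "open E'" using V E' by (auto simp: segmentation_def segment_def)
    then obtain e where e: "0 < e" "ball (\<gamma> s) e \<subseteq> E'" using E' open_contains_ball by blast
    define h where "h = min (e / 2) (l / 2)"
    define u where "u = (if s = 0 then h else l - h)"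
    have h: "0 < h" "h < e" "h < l" using e l by (auto simp: h_def)
    have u: "u \<in> {0<..<l}" "\<bar>s - u\<bar> = h" using h s by (auto simp: u_def)
    have "dist (\<gamma> s) (\<gamma> u) = h" using isometric_paramD[OF l(2), of s u] u s l by auto
    then have "\<gamma> u \<in> E'" using e h by auto
    moreover have "\<gamma> u \<in> E" using u l by auto
    moreover have "E \<noteq> E'" using notE E' by auto
    ultimately show False using V E E' by (auto simp: segmentation_def disjoint_def)
  qed
  show "\<gamma> 0 \<in> V" "\<gamma> l \<in> V" using key by auto
qed

lemma finite_closed_segment_cover:
  obtains G :: "((real \<Rightarrow> 'a) \<times> real) set" where "finite G"
    "\<And>\<sigma> \<rho>. (\<sigma>, \<rho>) \<in> G \<Longrightarrow> 0 < \<rho> \<and> isometric_param {0..\<rho>} \<sigma> \<and> open (\<sigma> ` {0<..<\<rho>})"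
    "\<And>x. \<exists>(\<sigma>, \<rho>)\<in>G. x \<in> \<sigma> ` {0..\<rho>}"
proof -
  obtain R where R: "\<And>p :: 'a. star_radius p (R p)" using star_radius_exists by metis
  have Rp: "0 < R p" for p using R star_radius_pos by blast
  obtain P where P: "finite P" "UNIV \<subseteq> (\<Union>p\<in>P. ball p (R p / 2))"
    by (rule compactE_image[OF compact_UNIV, of UNIV "\<lambda>p. ball p (R p / 2)"])
       (use Rp in \<open>auto intro!: exI\<close>)
  let ?G = "(\<Union>p\<in>P. (\<lambda>v. (\<lambda>t. move p t v, R p / 2)) ` Vec p)"
  show ?thesis
  proof
    show "finite ?G" using P finite_Vec by auto
    fix \<sigma> \<rho> assume "(\<sigma>, \<rho>) \<in> ?G"
    then obtain p v where pv: "v \<in> Vec p" "\<sigma> = (\<lambda>t. move p t v)" "\<rho> = R p / 2" by auto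
    have "isometric_param {0..\<rho>} \<sigma>"
      using star_ray_isometric[OF R pv(1)] unfolding pv(2)
      by (rule isometric_param_subset) (use pv Rp[of p] in auto)
    moreover have "open (\<sigma> ` {0<..<\<rho>})"
      unfolding pv(2) by (rule open_star_ray[OF R pv(1)]) (use pv Rp[of p] in auto)
    moreover have "0 < \<rho>" using pv Rp[of p] by simp
    ultimately show "0 < \<rho> \<and> isometric_param {0..\<rho>} \<sigma> \<and> open (\<sigma> ` {0<..<\<rho>})" by blast
  next
    fix x
    have "x \<in> (\<Union>p\<in>P. ball p (R p / 2))" using P(2) by blast
    then obtain p where p: "p \<in> P" "dist p x < R p / 2" by auto
    then obtain v where "v \<in> Vec p" "x = move p (dist p x) v"
      using star_radius_ball[OF R, of p x] Rp[of p] by auto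
    then show "\<exists>(\<sigma>, \<rho>)\<in>?G. x \<in> \<sigma> ` {0..\<rho>}"
      using p by (intro bexI[of _ "(\<lambda>t. move p t v, R p / 2)"]) auto
  qed
qed

text \<open>
  Finitely many closed segments cover the graph. When their endpoints are among the finitely many
  points \<open>V\<close>, a component of \<open>- V\<close> cannot leave an open segment that it meets, and is therefore an
  open subsegment of it, with endpoints in \<open>V\<close>.
\<close>

lemma component_is_subsegment:
  assumes V: "finite V" and \<sigma>: "0 < \<rho>" "isometric_param {0..\<rho>} \<sigma>" "open (\<sigma> ` {0<..<\<rho>})" "\<sigma> 0 \<in> V" "\<sigma> \<rho> \<in> V"
    and C: "C \<in> components (- V)" and meet: "x \<in> C" "x \<in> \<sigma> ` {0..\<rho>}"
  obtains c d where "c < d" "c \<in> {0..\<rho>}" "d \<in> {0..\<rho>}" "\<sigma> c \<in> V" "\<sigma> d \<in> V" "C = \<sigma> ` {c<..<d}" "open C"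
proof -
  let ?A = "\<sigma> ` {0<..<\<rho>}"
  have CV: "C \<subseteq> - V" and conn: "connected C" and ne: "C \<noteq> {}"
    using C in_components_subset in_components_connected in_components_nonempty by blast+
  have maximal: "B \<subseteq> C" if "connected B" "B \<subseteq> - V" "C \<inter> B \<noteq> {}" for B
    using components_maximal[OF C that(1,2)] that(3) by blast
  have icont: "continuous_on {0..\<rho>} \<sigma>" using \<sigma>(2) by (rule isometric_param_continuous)
  have inj: "inj_on \<sigma> {0..\<rho>}" using \<sigma>(2) by (rule isometric_param_inj)
  have xA: "x \<in> ?A"
  proof -
    obtain t where t: "t \<in> {0..\<rho>}" "x = \<sigma> t" using meet by blast
    then have "t \<noteq> 0" "t \<noteq> \<rho>" using meet CV \<sigma> by auto
    then show ?thesis using t by auto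
  qed
  \<comment> \<open>\<open>C\<close> is connected and avoids the frontier of \<open>?A\<close>, which consists of points of \<open>V\<close>.\<close>
  have CA: "C \<subseteq> ?A"
  proof -
    have "closed (\<sigma> ` {0..\<rho>})"
      by (intro compact_imp_closed compact_continuous_image icont) simp
    then have "closure ?A \<subseteq> \<sigma> ` {0..\<rho>}" by (intro closure_minimal image_mono) auto
    moreover have "\<sigma> ` {0..\<rho>} \<subseteq> ?A \<union> {\<sigma> 0, \<sigma> \<rho>}" by (force simp: less_le)
    ultimately have "frontier ?A \<subseteq> {\<sigma> 0, \<sigma> \<rho>}"
      using \<sigma>(3) by (auto simp: frontier_def interior_open)
    then have "C \<inter> frontier ?A = {}" using CV \<sigma> by auto
    then show ?thesis using connected_Int_frontier[OF conn, of ?A] meet xA by blast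
  qed
  define J where "J = {t \<in> {0<..<\<rho>}. \<sigma> t \<in> C}"
  have CJ: "C = \<sigma> ` J" using CA by (auto simp: J_def)
  have local: "\<exists>e>0. \<forall>s. \<bar>s - t\<bar> < e \<longrightarrow> s \<in> {0<..<\<rho>} \<and> \<sigma> s \<notin> V" if t: "t \<in> {0<..<\<rho>}" "\<sigma> t \<notin> V" for t
  proof -
    have "finite {s \<in> {0..\<rho>}. \<sigma> s \<in> V}"
      using finite_vimage_IntI[OF V inj] by (auto simp: vimage_def Int_def conj_commute)
    then have o: "open ({0<..<\<rho>} - {s \<in> {0..\<rho>}. \<sigma> s \<in> V})"
      by (intro open_Diff finite_imp_closed) auto
    have "t \<in> {0<..<\<rho>} - {s \<in> {0..\<rho>}. \<sigma> s \<in> V}" using t by auto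
    then obtain e where "e > 0" "ball t e \<subseteq> {0<..<\<rho>} - {s \<in> {0..\<rho>}. \<sigma> s \<in> V}"
      using o open_contains_ball by blast
    then show ?thesis by (intro exI[of _ e]) (auto simp: subset_iff dist_real_def abs_minus_commute)
  qed
  \<comment> \<open>By maximality, a component contains each connected set that meets it and avoids \<open>V\<close>.\<close>
  have grow: "s \<in> J" if "u \<in> J" "\<And>r. min u s \<le> r \<Longrightarrow> r \<le> max u s \<Longrightarrow> r \<in> {0<..<\<rho>} \<and> \<sigma> r \<notin> V" for u s
  proof -
    let ?B = "\<sigma> ` {min u s..max u s}"
    have "connected ?B"
      by (intro connected_continuous_image continuous_on_subset[OF icont]) (use that in force)+
    moreover have "?B \<subseteq> - V" using that(2) by auto
    moreover have "\<sigma> u \<in> C \<inter> ?B" using that(1) by (auto simp: J_def)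
    ultimately have "?B \<subseteq> C" using maximal by blast
    then show "s \<in> J" using that(2)[of s] by (auto simp: J_def)
  qed
  have openJ: "\<exists>e>0. \<forall>s. \<bar>s - t\<bar> < e \<longrightarrow> s \<in> J" if "t \<in> J" for t
  proof -
    have "t \<in> {0<..<\<rho>}" "\<sigma> t \<notin> V" using that CV by (auto simp: J_def)
    then obtain e where e: "e > 0" "\<And>s. \<bar>s - t\<bar> < e \<Longrightarrow> s \<in> {0<..<\<rho>} \<and> \<sigma> s \<notin> V" using local by blast
    have "s \<in> J" if s: "\<bar>s - t\<bar> < e" for s
      by (rule grow[OF \<open>t \<in> J\<close>]) (use e s in auto)
    then show ?thesis using e by blast
  qed
  have Jne: "J \<noteq> {}" using CJ ne by auto
  have Jb: "bdd_below J" "bdd_above J" by (auto simp: J_def intro!: bdd_belowI[of _ 0] bdd_aboveI[of _ \<rho>])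
  define c d where "c = Inf J" and "d = Sup J"
  have interval: "s \<in> J" if "t \<in> J" "u \<in> J" "t \<le> s" "s \<le> u" for s t u
  proof (rule ccontr)
    assume s: "s \<notin> J"
    \<comment> \<open>Otherwise \<open>\<sigma> s\<close> separates \<open>C\<close>.\<close>
    have "s \<in> {0<..<\<rho>}" using that by (auto simp: J_def)
    let ?U = "\<sigma> ` {0<..<s}" and ?W = "\<sigma> ` {s<..<\<rho>}"
    have oU: "open (\<sigma> ` {p<..<q})" if pq: "0 \<le> p" "q \<le> \<rho>" for p q
      unfolding open_contains_ball
    proof
      fix y assume "y \<in> \<sigma> ` {p<..<q}"
      then obtain r where r: "p < r" "r < q" "y = \<sigma> r" by auto
      then have "y \<in> ?A" using pq by auto
      then obtain e where e: "e > 0" "ball y e \<subseteq> ?A" using \<sigma>(3) open_contains_ball by blast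
      have "z \<in> \<sigma> ` {p<..<q}" if z: "dist y z < min e (min (r - p) (q - r))" for z
      proof -
        have "z \<in> ?A" using e z by auto
        then obtain v where v: "v \<in> {0<..<\<rho>}" "z = \<sigma> v" by blast
        have "dist y z = \<bar>r - v\<bar>" using isometric_paramD[OF \<sigma>(2), of r v] r v pq by auto
        then have "v \<in> {p<..<q}" using z by (auto simp: abs_if split: if_splits)
        then show ?thesis using v by blast
      qed
      then show "\<exists>e>0. ball y e \<subseteq> \<sigma> ` {p<..<q}"
        using e r by (intro exI[of _ "min e (min (r - p) (q - r))"]) auto
    qed
    have "\<sigma> s \<notin> C" using s \<open>s \<in> {0<..<\<rho>}\<close> by (simp add: J_def)
    have cover: "C \<subseteq> ?U \<union> ?W"
    proof
      fix y assume y: "y \<in> C"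
      then obtain r where r: "r \<in> {0<..<\<rho>}" "y = \<sigma> r" using CA by blast
      then have "r < s \<or> s < r" using y \<open>\<sigma> s \<notin> C\<close> by (cases "r = s") auto
      then show "y \<in> ?U \<union> ?W" using r by auto
    qed
    moreover have "?U \<inter> ?W \<inter> C = {}"
    proof -
      have "{0<..<s} \<subseteq> {0..\<rho>}" "{s<..<\<rho>} \<subseteq> {0..\<rho>}" using \<open>s \<in> {0<..<\<rho>}\<close> by auto
      then have "?U \<inter> ?W = \<sigma> ` ({0<..<s} \<inter> {s<..<\<rho>})" by (rule inj_on_image_Int[OF inj, symmetric])
      then show ?thesis by auto
    qed
    moreover have "\<sigma> t \<in> ?U \<inter> C" "\<sigma> u \<in> ?W \<inter> C"
      using that s by (auto simp: J_def less_le)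
    ultimately show False
      using connectedD[OF conn oU[of 0 s] oU[of s \<rho>]] \<open>s \<in> {0<..<\<rho>}\<close> by auto
  qed
  have cd: "c < d"
  proof -
    obtain t where t: "t \<in> J" using Jne by blast
    then obtain e where "e > 0" "\<And>s. \<bar>s - t\<bar> < e \<Longrightarrow> s \<in> J" using openJ by blast
    then have "t + e / 2 \<in> J" by auto
    then have "t + e / 2 \<le> d" "c \<le> t" unfolding c_def d_def using t Jb by (auto intro: cSup_upper cInf_lower)
    then show ?thesis using \<open>e > 0\<close> by linarith
  qed
  have cnot: "c \<notin> J" "d \<notin> J"
  proof -
    show "c \<notin> J"
    proof
      assume "c \<in> J"
      then obtain e where "e > 0" "\<And>s. \<bar>s - c\<bar> < e \<Longrightarrow> s \<in> J" using openJ by blast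
      then have "c - e / 2 \<in> J" by auto
      then have "c \<le> c - e / 2" unfolding c_def using Jb by (intro cInf_lower)
      then show False using \<open>e > 0\<close> by linarith
    qed
    show "d \<notin> J"
    proof
      assume "d \<in> J"
      then obtain e where "e > 0" "\<And>s. \<bar>s - d\<bar> < e \<Longrightarrow> s \<in> J" using openJ by blast
      then have "d + e / 2 \<in> J" by auto
      then have "d + e / 2 \<le> d" unfolding d_def using Jb by (intro cSup_upper)
      then show False using \<open>e > 0\<close> by linarith
    qed
  qed
  have Jcd: "J = {c<..<d}"
  proof (intro equalityI subsetI)
    fix t assume t: "t \<in> J"
    then have "c \<le> t" "t \<le> d" unfolding c_def d_def using Jb by (auto intro: cSup_upper cInf_lower)
    then show "t \<in> {c<..<d}" using cnot t by (auto simp: less_le)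
  next
    fix t assume t: "t \<in> {c<..<d}"
    obtain p where "p \<in> J" "p < t" using t cInf_less_iff[OF Jne Jb(1), of t] by (auto simp: c_def)
    moreover obtain q where "q \<in> J" "t < q" using t less_cSup_iff[OF Jne Jb(2), of t] by (auto simp: d_def)
    ultimately show "t \<in> J" using interval[of p q t] by auto
  qed
  have range: "c \<in> {0..\<rho>}" "d \<in> {0..\<rho>}"
  proof -
    have J0: "0 \<le> t" "t \<le> \<rho>" if "t \<in> J" for t using that by (auto simp: J_def)
    have "0 \<le> c" "d \<le> \<rho>"
      unfolding c_def d_def by (rule cInf_greatest[OF Jne J0(1)], assumption, rule cSup_least[OF Jne J0(2)])
    then show "c \<in> {0..\<rho>}" "d \<in> {0..\<rho>}" using cd by auto
  qed
  have endV: "\<sigma> s \<in> V" if s: "s = c \<or> s = d" for s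
  proof (rule ccontr)
    assume nV: "\<sigma> s \<notin> V"
    then have "s \<noteq> 0" "s \<noteq> \<rho>" using \<sigma> by auto
    then have "s \<in> {0<..<\<rho>}" using s range by auto
    then obtain e where e: "e > 0" "\<And>r. \<bar>r - s\<bar> < e \<Longrightarrow> r \<in> {0<..<\<rho>} \<and> \<sigma> r \<notin> V"
      using local nV by blast
    define h where "h = min (e / 2) ((d - c) / 2)"
    define u where "u = (if s = c then c + h else d - h)"
    have "h \<le> e / 2" "h \<le> (d - c) / 2"
      unfolding h_def by (rule min.cobounded1, rule min.cobounded2)
    moreover have "0 < h" using e(1) cd by (simp add: h_def)
    moreover have "(d - c) / 2 < d - c" using cd by simp
    moreover have "e / 2 < e" using e(1) by simp
    ultimately have h: "0 < h" "h < e" "h < d - c"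
      by (blast intro: order_le_less_trans)+
    have u: "u \<in> J" "\<bar>u - s\<bar> = h" using h s Jcd by (auto simp: u_def)
    have "s \<in> J" by (rule grow[OF u(1)]) (use e(2) u h in \<open>auto simp: abs_if min_def max_def split: if_splits\<close>)
    then show False using cnot s by auto
  qed
  have "open C"
    unfolding open_contains_ball
  proof
    fix y assume "y \<in> C"
    then obtain t where t: "t \<in> J" "y = \<sigma> t" using CJ by blast
    then obtain e where e: "e > 0" "\<And>s. \<bar>s - t\<bar> < e \<Longrightarrow> s \<in> J" using openJ by blast
    have "y \<in> ?A" using t by (auto simp: J_def)
    then obtain e' where e': "e' > 0" "ball y e' \<subseteq> ?A" using \<sigma>(3) open_contains_ball by blast
    have "z \<in> C" if z: "dist y z < min e e'" for z
    proof -
      have "z \<in> ?A" using e' z by auto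
      then obtain s where s: "s \<in> {0<..<\<rho>}" "z = \<sigma> s" by blast
      have "dist y z = \<bar>t - s\<bar>" using isometric_paramD[OF \<sigma>(2), of t s] s t by (auto simp: J_def)
      then show ?thesis using e(2)[of s] s z CJ by (auto simp: abs_minus_commute)
    qed
    then show "\<exists>e>0. ball y e \<subseteq> C" using e e' by (intro exI[of _ "min e e'"]) auto
  qed
  then show ?thesis using that[OF cd range] endV CJ Jcd by auto
qed

text \<open>
  The segments are the components of \<open>- V\<close>, for \<open>V\<close> consisting of \<open>F\<close> and the endpoints of the segments
  of a finite cover. There are finitely many, because each is given by a segment of the cover and two
  points of \<open>V\<close>. The set \<open>F\<close> serves to make finitely many given functions regular on each segment.
\<close>

theorem segmentation_exists:
  assumes "finite (F :: 'a set)"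
  obtains V \<E> where "segmentation V \<E>" "F \<subseteq> V"
proof -
  obtain G :: "((real \<Rightarrow> 'a) \<times> real) set" where G: "finite G"
    "\<And>\<sigma> \<rho>. (\<sigma>, \<rho>) \<in> G \<Longrightarrow> 0 < \<rho> \<and> isometric_param {0..\<rho>} \<sigma> \<and> open (\<sigma> ` {0<..<\<rho>})"
    "\<And>x. \<exists>(\<sigma>, \<rho>)\<in>G. x \<in> \<sigma> ` {0..\<rho>}"
    by (rule finite_closed_segment_cover) blast
  define V where "V = F \<union> (\<Union>(\<sigma>, \<rho>)\<in>G. {\<sigma> 0, \<sigma> \<rho>})"
  have finV: "finite V" using assms G(1) by (auto simp: V_def)
  let ?E = "components (- V)"
  have ex: "\<exists>\<sigma> \<rho> c d. (\<sigma>, \<rho>) \<in> G \<and> c < d \<and> c \<in> {0..\<rho>} \<and> d \<in> {0..\<rho>} \<and> \<sigma> c \<in> V \<and> \<sigma> d \<in> V \<and> C = \<sigma> ` {c<..<d} \<and> open C"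
    if C: "C \<in> ?E" for C
  proof -
    obtain x where x: "x \<in> C" using in_components_nonempty[OF C] by blast
    obtain \<sigma> \<rho> where \<sigma>: "(\<sigma>, \<rho>) \<in> G" "x \<in> \<sigma> ` {0..\<rho>}" using G(3)[of x] by auto
    have "\<sigma> 0 \<in> V" "\<sigma> \<rho> \<in> V" using \<sigma> by (auto simp: V_def)
    then obtain c d where "c < d" "c \<in> {0..\<rho>}" "d \<in> {0..\<rho>}" "\<sigma> c \<in> V" "\<sigma> d \<in> V" "C = \<sigma> ` {c<..<d}" "open C"
      using component_is_subsegment[OF finV _ _ _ _ _ C x \<sigma>(2)] G(2)[OF \<sigma>(1)] by metis
    then show ?thesis using \<sigma>(1) by blast
  qed
  have "finite ?E"
  proof (rule finite_subset)
    let ?f = "\<lambda>((\<sigma>, \<rho>), x, y). \<sigma> ` {the_inv_into {0..\<rho>::real} \<sigma> x<..<the_inv_into {0..\<rho>} \<sigma> (y::'a)}"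
    show "?E \<subseteq> ?f ` (G \<times> V \<times> V)"
    proof
      fix C assume "C \<in> ?E"
      then obtain \<sigma> \<rho> c d where *: "(\<sigma>, \<rho>) \<in> G" "c < d" "c \<in> {0..\<rho>}" "d \<in> {0..\<rho>}" "\<sigma> c \<in> V" "\<sigma> d \<in> V" "C = \<sigma> ` {c<..<d}"
        using ex by blast
      have inj: "inj_on \<sigma> {0..\<rho>}" using G(2)[OF *(1)] isometric_param_inj by blast
      have "C = ?f ((\<sigma>, \<rho>), \<sigma> c, \<sigma> d)" using * by (simp add: the_inv_into_f_f[OF inj])
      then show "C \<in> ?f ` (G \<times> V \<times> V)" using * by blast
    qed
    show "finite (?f ` (G \<times> V \<times> V))" using G(1) finV by simp
  qed
  moreover have "\<exists>\<gamma> l. segment C \<gamma> l" if C: "C \<in> ?E" for C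
  proof -
    obtain \<sigma> \<rho> c d where *: "(\<sigma>, \<rho>) \<in> G" "c < d" "c \<in> {0..\<rho>}" "d \<in> {0..\<rho>}" "C = \<sigma> ` {c<..<d}" "open C"
      using ex[OF C] by blast
    have iso: "isometric_param {0..\<rho>} \<sigma>" using G(2)[OF *(1)] by blast
    have "isometric_param {0..d - c} (\<lambda>t. \<sigma> (c + t))"
      by (rule isometric_param_shift[OF iso]) (use * in auto)
    moreover have "C = (\<lambda>t. \<sigma> (c + t)) ` {0<..<d - c}"
    proof -
      have "{c<..<d} = (\<lambda>t. c + t) ` {0<..<d - c}"
      proof (intro equalityI subsetI)
        fix t assume "t \<in> {c<..<d}"
        then show "t \<in> (\<lambda>t. c + t) ` {0<..<d - c}" by (intro image_eqI[of _ _ "t - c"]) auto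
      qed auto
      then show ?thesis using *(5) by (simp add: image_image)
    qed
    ultimately have "segment C (\<lambda>t. \<sigma> (c + t)) (d - c)" using * by (simp add: segment_def)
    then show ?thesis by blast
  qed
  moreover have "disjoint ?E" using components_nonoverlap by (auto simp: disjoint_def)
  moreover have "\<Union>?E = - V" by (simp add: Union_components)
  ultimately have "segmentation V ?E" using finV by (simp add: segmentation_def)
  moreover have "F \<subseteq> V" by (simp add: V_def)
  ultimately show ?thesis using that by blast
qed

end

section \<open>Arc length\<close>

definition is_arc_length :: "'a::metric_space measure \<Rightarrow> bool" where
  "is_arc_length M \<longleftrightarrow> sets M = sets borel \<and>
     (\<forall>a b \<gamma>. a \<le> b \<and> isometric_param {a..b} \<gamma> \<longrightarrow> emeasure M (\<gamma> ` {a..b}) = ennreal (b - a))"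

lemma is_arc_lengthD:
  "is_arc_length M \<Longrightarrow> a \<le> b \<Longrightarrow> isometric_param {a..b} \<gamma> \<Longrightarrow> emeasure M (\<gamma> ` {a..b}) = ennreal (b - a)"
  unfolding is_arc_length_def by blast

lemma is_arc_length_sets: "is_arc_length M \<Longrightarrow> sets M = sets borel"
  unfolding is_arc_length_def by blast

text \<open>
  A point is an isometric image of a degenerate interval.
\<close>

lemma is_arc_length_singleton:
  assumes "is_arc_length (M :: 'a::metric_space measure)" shows "emeasure M {x} = 0"
proof -
  have "emeasure M ((\<lambda>t. x) ` {0..0::real}) = ennreal (0 - 0)"
    by (rule is_arc_lengthD[OF assms]) (auto simp: isometric_param_def)
  then show ?thesis by simp
qed

lemma is_arc_length_finite_null:
  assumes M: "is_arc_length (M :: 'a::metric_space measure)" and "finite F" shows "F \<in> null_sets M"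
  using assms(2)
proof induction
  case (insert x F)
  have "{x} \<in> null_sets M"
    using is_arc_length_singleton[OF M] is_arc_length_sets[OF M] by (simp add: null_sets_def)
  then have "{x} \<union> F \<in> null_sets M" using insert by (intro null_sets.Un)
  then show ?case by simp
qed simp

lemma compact_isometric_image: "isometric_param {a..b} \<gamma> \<Longrightarrow> compact (\<gamma> ` {a..b})"
  by (intro compact_continuous_image isometric_param_continuous) simp_all

lemma isometric_image_borel: "isometric_param {a..b} \<gamma> \<Longrightarrow> \<gamma> ` {a..b} \<in> sets borel"
  using compact_isometric_image by (metis borel_closed compact_imp_closed)

lemma isometric_preimage_borel:
  assumes "isometric_param {a..b::real} (\<gamma> :: real \<Rightarrow> 'a::metric_space)" "B \<in> sets borel"
  shows "{t \<in> {a..b}. \<gamma> t \<in> B} \<in> sets borel"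
proof -
  have "\<gamma> \<in> borel_measurable (restrict_space borel {a..b})"
    by (rule borel_measurable_continuous_on_restrict[OF isometric_param_continuous[OF assms(1)]])
  then have "\<gamma> -` B \<inter> space (restrict_space borel {a..b}) \<in> sets (restrict_space borel {a..b})"
    using assms(2) by (rule measurable_sets)
  then have "\<gamma> -` B \<inter> {a..b} \<in> sets borel"
    by (auto simp: sets_restrict_space space_restrict_space)
  moreover have "\<gamma> -` B \<inter> {a..b} = {t \<in> {a..b}. \<gamma> t \<in> B}" by auto
  ultimately show ?thesis by simp
qed

text \<open>
  The measure is transported by the inverse of the parametrization to a measure on the line, which
  has the right values on half-lines.
\<close>

lemma emeasure_on_segment:
  fixes M :: "'a::metric_space measure"
  assumes M: "is_arc_length M" and ab: "a \<le> b" and \<gamma>: "isometric_param {a..b} \<gamma>" and B: "B \<in> sets borel"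
  shows "emeasure M (B \<inter> \<gamma> ` {a..b}) = emeasure lborel {t \<in> {a..b}. \<gamma> t \<in> B}"
proof -
  let ?K = "\<gamma> ` {a..b}" and ?I = "{a..b}"
  define \<tau> where "\<tau> = the_inv_into ?I \<gamma>"
  have inj: "inj_on \<gamma> ?I" using \<gamma> by (rule isometric_param_inj)
  have \<tau>: "\<tau> (\<gamma> t) = t" if "t \<in> ?I" for t unfolding \<tau>_def using inj that by (rule the_inv_into_f_f)
  have KM: "?K \<in> sets M" using isometric_image_borel[OF \<gamma>] is_arc_length_sets[OF M] by simp
  have spM: "space M = UNIV" using sets_eq_imp_space_eq[OF is_arc_length_sets[OF M]] by simp
  have "continuous_on ?K \<tau>"
    unfolding continuous_on_iff
  proof (intro ballI allI impI)
    fix x and e :: real assume "x \<in> ?K" "0 < e"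
    have "dist (\<tau> y) (\<tau> x) = dist y x" if "y \<in> ?K" for y
      using that \<open>x \<in> ?K\<close> \<tau> isometric_paramD[OF \<gamma>] by (auto simp: dist_real_def)
    then show "\<exists>d>0. \<forall>x'\<in>?K. dist x' x < d \<longrightarrow> dist (\<tau> x') (\<tau> x) < e" using \<open>0 < e\<close> by metis
  qed
  then have "\<tau> \<in> borel_measurable (restrict_space borel ?K)"
    by (rule borel_measurable_continuous_on_restrict)
  then have \<tau>m: "\<tau> \<in> borel_measurable (restrict_space M ?K)"
    using measurable_cong_sets[OF sets_restrict_space_cong[OF is_arc_length_sets[OF M], of ?K] refl] by blast
  \<comment> \<open>The two measures on the line to be compared: the given one, transported by \<open>\<tau>\<close>, and length.\<close>
  define N1 where "N1 = distr (restrict_space M ?K) borel \<tau>"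
  define N2 where "N2 = distr (restrict_space lborel ?I) borel (\<lambda>t. t)"
  have idm: "(\<lambda>t. t) \<in> borel_measurable (restrict_space lborel ?I)"
    by (intro measurable_restrict_space1) simp
  have N1: "emeasure N1 S = emeasure M (\<gamma> ` (?I \<inter> S))" if S: "S \<in> sets borel" for S
  proof -
    have "emeasure N1 S = emeasure (restrict_space M ?K) (\<tau> -` S \<inter> ?K)"
      unfolding N1_def using emeasure_distr[OF \<tau>m S] by (simp add: space_restrict_space spM)
    also have "\<dots> = emeasure M (\<tau> -` S \<inter> ?K)"
      by (rule emeasure_restrict_space) (use KM spM in auto)
    also have "\<tau> -` S \<inter> ?K = \<gamma> ` (?I \<inter> S)" using \<tau> by auto
    finally show ?thesis .
  qed
  have N2: "emeasure N2 S = emeasure lborel (?I \<inter> S)" if S: "S \<in> sets borel" for S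
  proof -
    have "emeasure N2 S = emeasure (restrict_space lborel ?I) (S \<inter> ?I)"
      unfolding N2_def using emeasure_distr[OF idm S] by (simp add: space_restrict_space)
    also have "\<dots> = emeasure lborel (S \<inter> ?I)" by (rule emeasure_restrict_space) auto
    finally show ?thesis by (simp add: Int_commute)
  qed
  have half: "emeasure N1 {x<..} = emeasure N2 {x<..}" for x
  proof -
    consider "x < a" | "a \<le> x" "x < b" | "b \<le> x" by linarith
    then show ?thesis
    proof cases
      case 1
      then have "?I \<inter> {x<..} = ?I" by auto
      then show ?thesis using N1[of "{x<..}"] N2[of "{x<..}"] is_arc_lengthD[OF M ab \<gamma>] ab by simp
    next
      case 2
      then have I: "?I \<inter> {x<..} = {x<..b}" by auto
      have iso: "isometric_param {x..b} \<gamma>" using isometric_param_subset[OF \<gamma>] 2 by auto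
      have "{x<..b} = {x..b} - {x}" using 2 by auto
      then have "\<gamma> ` {x<..b} = \<gamma> ` {x..b} - {\<gamma> x}"
        using inj_on_image_set_diff[OF isometric_param_inj[OF iso], of "{x..b}" "{x}"] 2 by simp
      then have "emeasure M (\<gamma> ` {x<..b}) = emeasure M (\<gamma> ` {x..b}) - emeasure M {\<gamma> x}"
        using 2 isometric_image_borel[OF iso] is_arc_length_sets[OF M] is_arc_length_singleton[OF M]
        by (simp add: emeasure_Diff)
      also have "\<dots> = ennreal (b - x)"
        using is_arc_lengthD[OF M _ iso] 2 is_arc_length_singleton[OF M] by simp
      finally show ?thesis using N1[of "{x<..}"] N2[of "{x<..}"] I 2 by simp
    next
      case 3
      then have "?I \<inter> {x<..} = {}" by auto
      then show ?thesis using N1[of "{x<..}"] N2[of "{x<..}"] by simp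
    qed
  qed
  have N12: "N1 = N2"
  proof (rule measure_eqI_lessThan)
    fix x
    have "emeasure N2 {x<..} = emeasure lborel (?I \<inter> {x<..})" by (rule N2) simp
    also have "\<dots> \<le> emeasure lborel ?I" by (rule emeasure_mono) auto
    also have "\<dots> < \<infinity>" using ab by simp
    finally show "emeasure N1 {x<..} < \<infinity>" using half by simp
  qed (use half in \<open>auto simp: N1_def N2_def\<close>)
  have S: "{t \<in> ?I. \<gamma> t \<in> B} \<in> sets borel" by (rule isometric_preimage_borel[OF \<gamma> B])
  have "emeasure M (\<gamma> ` (?I \<inter> {t \<in> ?I. \<gamma> t \<in> B})) = emeasure lborel (?I \<inter> {t \<in> ?I. \<gamma> t \<in> B})"
    using N1[OF S] N2[OF S] N12 by simp
  moreover have "\<gamma> ` (?I \<inter> {t \<in> ?I. \<gamma> t \<in> B}) = B \<inter> ?K" "?I \<inter> {t \<in> ?I. \<gamma> t \<in> B} = {t \<in> ?I. \<gamma> t \<in> B}" by auto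
  ultimately show ?thesis by simp
qed

lemma emeasure_lborel_isometric_image:
  fixes u :: "real \<Rightarrow> real"
  assumes S: "S \<in> sets borel" and u: "\<And>s t. s \<in> S \<Longrightarrow> t \<in> S \<Longrightarrow> \<bar>u s - u t\<bar> = \<bar>s - t\<bar>"
  shows "emeasure lborel (u ` S) = emeasure lborel S"
proof -
  obtain \<epsilon> k where e: "\<epsilon> = 1 \<or> \<epsilon> = -1" "\<And>t. t \<in> S \<Longrightarrow> u t = k + \<epsilon> * t"
    using real_isometry_affine[of S u] u by metis
  have ee: "\<epsilon> * \<epsilon> = 1" using e by auto
  have "u ` S = (\<lambda>t. k + \<epsilon> * t) ` S" using e(2) by (auto intro!: image_cong)
  also have "\<dots> = (\<lambda>t. - \<epsilon> * k + \<epsilon> * t) -` S"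
  proof (intro equalityI subsetI)
    fix x assume "x \<in> (\<lambda>t. k + \<epsilon> * t) ` S"
    then show "x \<in> (\<lambda>t. - \<epsilon> * k + \<epsilon> * t) -` S" using ee by (auto simp: algebra_simps mult.assoc[symmetric])
  next
    fix x assume "x \<in> (\<lambda>t. - \<epsilon> * k + \<epsilon> * t) -` S"
    then show "x \<in> (\<lambda>t. k + \<epsilon> * t) ` S"
      using ee by (intro image_eqI[of _ _ "- \<epsilon> * k + \<epsilon> * x"]) (auto simp: algebra_simps mult.assoc[symmetric])
  qed
  finally have im: "u ` S = (\<lambda>t. - \<epsilon> * k + \<epsilon> * t) -` S" .
  have "lborel = density (distr lborel borel (\<lambda>x. - \<epsilon> * k + \<epsilon> * x)) (\<lambda>_. ennreal \<bar>\<epsilon>\<bar>)"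
    by (rule lborel_real_affine) (use e in auto)
  then have "lborel = distr lborel borel (\<lambda>x. - \<epsilon> * k + \<epsilon> * x)"
    using e density_1[of "distr lborel borel (\<lambda>x. - \<epsilon> * k + \<epsilon> * x)"] by auto
  then have "emeasure lborel S = emeasure (distr lborel borel (\<lambda>x. - \<epsilon> * k + \<epsilon> * x)) S" by metis
  also have "\<dots> = emeasure lborel ((\<lambda>x. - \<epsilon> * k + \<epsilon> * x) -` S)"
    using S by (subst emeasure_distr) auto
  finally show ?thesis using im by simp
qed

context graph
begin

lemma segmentation_choice:
  assumes "segmentation V \<E>"
  obtains \<gamma> l where "\<And>E. E \<in> \<E> \<Longrightarrow> segment E (\<gamma> E) (l E)"
proof -
  have "\<forall>E\<in>\<E>. \<exists>\<gamma> l. segment E \<gamma> l" using assms by (simp add: segmentation_def)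
  then show ?thesis using that by metis
qed

lemma segment_borel: "segment E \<gamma> l \<Longrightarrow> E \<in> sets borel"
  unfolding segment_def by (metis borel_open)

lemma closed_segment_eq: "segment E \<gamma> l \<Longrightarrow> \<gamma> ` {0..l} = E \<union> {\<gamma> 0, \<gamma> l}"
  unfolding segment_def by (force simp: less_le)

lemma emeasure_segmentation:
  assumes M: "is_arc_length M" and V: "segmentation V \<E>"
    and \<gamma>: "\<And>E. E \<in> \<E> \<Longrightarrow> segment E (\<gamma> E) (l E)" and B: "B \<in> sets borel"
  shows "emeasure M B = (\<Sum>E\<in>\<E>. emeasure lborel {t \<in> {0..l E}. \<gamma> E t \<in> B \<inter> E})"
proof -
  have fin: "finite V" "finite \<E>" "disjoint \<E>" "\<Union>\<E> = - V" using V by (auto simp: segmentation_def)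
  have EM: "E \<in> sets borel" if "E \<in> \<E>" for E using segment_borel[OF \<gamma>[OF that]] .
  have BE: "emeasure M (B \<inter> E) = emeasure lborel {t \<in> {0..l E}. \<gamma> E t \<in> B \<inter> E}" if E: "E \<in> \<E>" for E
  proof -
    have s: "0 \<le> l E" "isometric_param {0..l E} (\<gamma> E)" "E = \<gamma> E ` {0<..<l E}"
      using \<gamma>[OF E] by (auto simp: segment_def)
    have "E \<subseteq> \<gamma> E ` {0..l E}" by (subst s(3)) auto
    then have "emeasure M (B \<inter> E) = emeasure M ((B \<inter> E) \<inter> \<gamma> E ` {0..l E})"
      by (intro arg_cong[where f = "emeasure M"]) auto
    also have "\<dots> = emeasure lborel {t \<in> {0..l E}. \<gamma> E t \<in> B \<inter> E}"
      by (rule emeasure_on_segment[OF M s(1,2)]) (use B EM[OF E] in auto)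
    finally show ?thesis .
  qed
  have "B \<inter> V \<in> null_sets M" using fin(1) by (intro is_arc_length_finite_null[OF M]) auto
  moreover have "(\<Union>E\<in>\<E>. B \<inter> E) \<in> sets M"
    using fin(2) EM B is_arc_length_sets[OF M] by auto
  ultimately have "emeasure M ((\<Union>E\<in>\<E>. B \<inter> E) \<union> (B \<inter> V)) = emeasure M (\<Union>E\<in>\<E>. B \<inter> E)"
    by (simp add: emeasure_Un_null_set)
  moreover have "(\<Union>E\<in>\<E>. B \<inter> E) \<union> (B \<inter> V) = B" using fin(4) by auto
  moreover have "emeasure M (\<Union>E\<in>\<E>. B \<inter> E) = (\<Sum>E\<in>\<E>. emeasure M (B \<inter> E))"
  proof (rule sum_emeasure[symmetric])
    show "disjoint_family_on (\<lambda>E. B \<inter> E) \<E>"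
      using fin(3) by (auto simp: disjoint_family_on_def disjoint_def)
  qed (use fin EM B is_arc_length_sets[OF M] in auto)
  ultimately show ?thesis using BE by simp
qed

lemma is_arc_length_unique:
  assumes "is_arc_length M" "is_arc_length (M' :: 'a measure)" shows "M = M'"
proof -
  obtain V \<E> where V: "segmentation V \<E>" using segmentation_exists[of "{}"] by blast
  obtain \<gamma> l where \<gamma>: "\<And>E. E \<in> \<E> \<Longrightarrow> segment E (\<gamma> E) (l E)" using segmentation_choice[OF V] by blast
  show ?thesis
    using emeasure_segmentation[OF assms(1) V \<gamma>] emeasure_segmentation[OF assms(2) V \<gamma>]
      is_arc_length_sets[OF assms(1)] is_arc_length_sets[OF assms(2)]
    by (intro measure_eqI) auto
qed

text \<open>
  Existence: the sum of the Lebesgue measures of the segments of a decomposition. For an arbitrary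
  isometric segment, the passage from its own parameter to that of a segment of the decomposition
  preserves distances, and so preserves Lebesgue measure.
\<close>

lemma is_arc_length_exists: "\<exists>M :: 'a measure. is_arc_length M"
proof -
  obtain V \<E> where V: "segmentation V \<E>" using segmentation_exists[of "{}"] by blast
  obtain \<gamma> l where \<gamma>: "\<And>E. E \<in> \<E> \<Longrightarrow> segment E (\<gamma> E) (l E)" using segmentation_choice[OF V] by blast
  have fin: "finite V" "finite \<E>" "disjoint \<E>" "\<Union>\<E> = - V" using V by (auto simp: segmentation_def)
  have g: "0 < l E" "isometric_param {0..l E} (\<gamma> E)" "E = \<gamma> E ` {0<..<l E}" "open E" if "E \<in> \<E>" for E
    using \<gamma>[OF that] by (auto simp: segment_def)
  define S where "S E B = {t \<in> {0..l E}. \<gamma> E t \<in> B \<inter> E}" for E B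
  define m where "m B = (\<Sum>E\<in>\<E>. emeasure lborel (S E B))" for B
  have Sb: "S E B \<in> sets borel" if "E \<in> \<E>" "B \<in> sets borel" for E B
    unfolding S_def using isometric_preimage_borel[OF g(2)[OF that(1)], of "B \<inter> E"] g(4)[OF that(1)] that(2) by auto
  define M where "M = measure_of UNIV (sets borel) m"
  have sM: "sets M = sets borel" unfolding M_def using sets.sigma_sets_eq[of borel] by simp
  have eM: "emeasure M B = m B" if B: "B \<in> sets borel" for B
    unfolding M_def
  proof (rule emeasure_measure_of_sigma)
    show "sigma_algebra UNIV (sets (borel :: 'a measure))"
      using sets.sigma_algebra_axioms[of borel] by simp
    show "positive (sets borel) m" by (auto simp: positive_def m_def S_def)
    show "countably_additive (sets borel) m"
    proof (rule countably_additiveI)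
      fix A :: "nat \<Rightarrow> 'a set" assume A: "range A \<subseteq> sets borel" "disjoint_family A"
      have "(\<Sum>i. emeasure lborel (S E (A i))) = emeasure lborel (S E (\<Union>i. A i))" if E: "E \<in> \<E>" for E
      proof -
        have "S E (\<Union>i. A i) = (\<Union>i. S E (A i))" by (auto simp: S_def)
        moreover have "(\<Sum>i. emeasure lborel (S E (A i))) = emeasure lborel (\<Union>i. S E (A i))"
        proof (rule suminf_emeasure)
          show "range (\<lambda>i. S E (A i)) \<subseteq> sets lborel" using Sb[OF E] A(1) by auto
          show "disjoint_family (\<lambda>i. S E (A i))" using A(2) by (fastforce simp: disjoint_family_on_def S_def)
        qed
        ultimately show ?thesis by simp
      qed
      then show "(\<Sum>i. m (A i)) = m (\<Union>i. A i)" unfolding m_def by (subst suminf_sum) auto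
    qed
  qed (rule B)
  have "emeasure M (\<sigma> ` {a..b}) = ennreal (b - a)" if ab: "a \<le> b" and \<sigma>: "isometric_param {a..b} \<sigma>" for a b \<sigma>
  proof -
    define T where "T E = {t \<in> {a..b}. \<sigma> t \<in> E}" for E
    have Tb: "T E \<in> sets borel" if "E \<in> \<E>" for E
      unfolding T_def by (rule isometric_preimage_borel[OF \<sigma>]) (use g(4)[OF that] in auto)
    have ST: "emeasure lborel (S E (\<sigma> ` {a..b})) = emeasure lborel (T E)" if E: "E \<in> \<E>" for E
    proof -
      have "\<exists>u\<in>{0..l E}. \<gamma> E u = \<sigma> t" if "t \<in> T E" for t
      proof -
        have "\<sigma> t \<in> \<gamma> E ` {0<..<l E}" using that g(3)[OF E] by (simp add: T_def)
        then obtain r where "r \<in> {0<..<l E}" "\<sigma> t = \<gamma> E r" by blast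
        then show ?thesis by (intro bexI[of _ r]) auto
      qed
      then obtain u where u: "\<And>t. t \<in> T E \<Longrightarrow> u t \<in> {0..l E} \<and> \<gamma> E (u t) = \<sigma> t" by metis
      have "S E (\<sigma> ` {a..b}) = u ` T E"
      proof (intro equalityI subsetI)
        fix r assume "r \<in> S E (\<sigma> ` {a..b})"
        then obtain t where t: "r \<in> {0..l E}" "\<gamma> E r = \<sigma> t" "t \<in> {a..b}" "\<sigma> t \<in> E" by (auto simp: S_def)
        then have tT: "t \<in> T E" by (simp add: T_def)
        then have "\<gamma> E (u t) = \<gamma> E r" "u t \<in> {0..l E}" using u t by auto
        then have "u t = r" using isometric_param_inj[OF g(2)[OF E]] t(1) by (simp add: inj_on_eq_iff)
        then show "r \<in> u ` T E" using tT by blast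
      next
        fix r assume "r \<in> u ` T E"
        then show "r \<in> S E (\<sigma> ` {a..b})" using u by (force simp: S_def T_def)
      qed
      moreover have "emeasure lborel (u ` T E) = emeasure lborel (T E)"
      proof (rule emeasure_lborel_isometric_image[OF Tb[OF E]])
        fix s t assume st: "s \<in> T E" "t \<in> T E"
        have "\<bar>u s - u t\<bar> = dist (\<gamma> E (u s)) (\<gamma> E (u t))"
          using isometric_paramD[OF g(2)[OF E], of "u s" "u t"] u st by simp
        also have "\<dots> = \<bar>s - t\<bar>" using isometric_paramD[OF \<sigma>, of s t] u st by (simp add: T_def)
        finally show "\<bar>u s - u t\<bar> = \<bar>s - t\<bar>" .
      qed
      ultimately show ?thesis by simp
    qed
    have "emeasure M (\<sigma> ` {a..b}) = (\<Sum>E\<in>\<E>. emeasure lborel (T E))"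
      using eM[OF isometric_image_borel[OF \<sigma>]] ST by (simp add: m_def)
    also have "\<dots> = emeasure lborel (\<Union>E\<in>\<E>. T E)"
    proof (rule sum_emeasure)
      show "disjoint_family_on T \<E>"
        using fin(3) by (auto simp: disjoint_family_on_def disjoint_def T_def)
    qed (use fin Tb in auto)
    also have "\<dots> = emeasure lborel {a..b}"
    proof -
      let ?F = "{t \<in> {a..b}. \<sigma> t \<in> V}"
      have "finite ?F" using finite_vimage_IntI[OF fin(1) isometric_param_inj[OF \<sigma>]]
        by (auto simp: vimage_def Int_def conj_commute)
      then have F: "?F \<in> null_sets lborel" by (rule finite_imp_null_set_lborel)
      have "\<sigma> t \<in> V \<or> (\<exists>E\<in>\<E>. \<sigma> t \<in> E)" for t using fin(4) by blast
      then have "(\<Union>E\<in>\<E>. T E) \<union> ?F = {a..b}" unfolding T_def by blast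
      moreover have "(\<Union>E\<in>\<E>. T E) \<in> sets lborel" using fin(2) Tb by (auto intro!: sets.finite_UN)
      ultimately show ?thesis using emeasure_Un_null_set[OF _ F, of "\<Union>E\<in>\<E>. T E"] by simp
    qed
    also have "\<dots> = ennreal (b - a)" using ab by simp
    finally show ?thesis .
  qed
  then have "is_arc_length M" using sM by (simp add: is_arc_length_def)
  then show ?thesis ..
qed

lemma is_arc_length_arc_length: "is_arc_length (arc_length :: 'a measure)"
proof -
  have "\<exists>!M :: 'a measure. is_arc_length M"
    using is_arc_length_exists is_arc_length_unique by blast
  then show ?thesis unfolding arc_length_def is_arc_length_def by (rule theI')
qed

lemma sets_arc_length [simp, measurable_cong]: "sets (arc_length :: 'a measure) = sets borel"
  by (rule is_arc_length_sets[OF is_arc_length_arc_length])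

lemma space_arc_length [simp]: "space (arc_length :: 'a measure) = UNIV"
  using sets_eq_imp_space_eq[OF sets_arc_length] by simp

lemma finite_null_arc_length: "finite (F :: 'a set) \<Longrightarrow> F \<in> null_sets arc_length"
  by (rule is_arc_length_finite_null[OF is_arc_length_arc_length])

lemma AE_not_in_finite: "finite (F :: 'a set) \<Longrightarrow> AE x in arc_length. x \<notin> F"
  by (rule AE_not_in[OF finite_null_arc_length])

lemma finite_measure_arc_length: "finite_measure (arc_length :: 'a measure)"
proof
  obtain V \<E> where V: "segmentation V \<E>" using segmentation_exists[of "{}"] by blast
  obtain \<gamma> l where \<gamma>: "\<And>E. E \<in> \<E> \<Longrightarrow> segment E (\<gamma> E) (l E)" using segmentation_choice[OF V] by blast
  have "emeasure lborel {t \<in> {0..l E}. \<gamma> E t \<in> UNIV \<inter> E} < top" if "E \<in> \<E>" for E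
  proof -
    have "emeasure lborel {t \<in> {0..l E}. \<gamma> E t \<in> UNIV \<inter> E} \<le> emeasure lborel {0..l E}"
      by (rule emeasure_mono) auto
    also have "\<dots> < top" using \<gamma>[OF that] by (simp add: segment_def)
    finally show ?thesis .
  qed
  then have "emeasure (arc_length :: 'a measure) UNIV < top"
    using emeasure_segmentation[OF is_arc_length_arc_length V \<gamma>, of UNIV] V
    by (simp add: ennreal_sum_less_top segmentation_def)
  then show "emeasure (arc_length :: 'a measure) (space arc_length) \<noteq> \<infinity>" by simp
qed

lemma arc_length_open_pos:
  assumes "open (U :: 'a set)" "U \<noteq> {}" shows "emeasure arc_length U \<noteq> 0"
proof -
  obtain p where p: "p \<in> U" using assms by blast
  obtain e where e: "0 < e" "ball p e \<subseteq> U" using assms p open_contains_ball by blast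
  obtain \<rho> where \<rho>: "star_radius p \<rho>" using star_radius_exists by blast
  define r where "r = min (e / 2) (\<rho> / 2)"
  have r: "0 < r" "r < e" "r < \<rho>" using e star_radius_pos[OF \<rho>] by (auto simp: r_def min_def)
  have iso: "isometric_param {0..r} (\<lambda>t. move p t 1)"
    by (rule isometric_param_subset[OF star_ray_isometric[OF \<rho> one_in_Vec]]) (use r in auto)
  have "(\<lambda>t. move p t 1) ` {0..r} \<subseteq> U"
    using e r star_radius_dist_center[OF \<rho> one_in_Vec] by (auto simp: subset_iff)
  then have "emeasure arc_length ((\<lambda>t. move p t 1) ` {0..r}) \<le> emeasure arc_length U"
    using assms by (intro emeasure_mono) auto
  moreover have "emeasure arc_length ((\<lambda>t. move p t 1) ` {0..r}) = ennreal (r - 0)"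
    by (rule is_arc_lengthD[OF is_arc_length_arc_length _ iso]) (use r in auto)
  ultimately show ?thesis using r by (auto simp: ennreal_eq_0_iff)
qed

lemma integral_on_segment:
  fixes F :: "'a \<Rightarrow> complex"
  assumes ab: "a \<le> b" and \<gamma>: "isometric_param {a..b} \<gamma>" and F: "F \<in> borel_measurable borel"
  shows "(LINT x:\<gamma> ` {a..b}|arc_length. F x) = (LINT t:{a..b}|lborel. F (\<gamma> t))"
    and "set_integrable arc_length (\<gamma> ` {a..b}) F \<longleftrightarrow> set_integrable lborel {a..b} (\<lambda>t. F (\<gamma> t))"
proof -
  let ?K = "\<gamma> ` {a..b}" and ?I = "{a..b}"
  let ?R = "restrict_space lborel ?I"
  have K: "?K \<in> sets borel" by (rule isometric_image_borel[OF \<gamma>])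
  have "\<gamma> \<in> borel_measurable (restrict_space borel ?I)"
    by (rule borel_measurable_continuous_on_restrict[OF isometric_param_continuous[OF \<gamma>]])
  then have gm: "\<gamma> \<in> borel_measurable ?R"
    using measurable_cong_sets[OF sets_restrict_space_cong[OF sets_lborel, of ?I] refl] by blast
  have eq: "density arc_length (\<lambda>x. ennreal (indicator ?K x)) = distr ?R borel \<gamma>"
  proof (rule measure_eqI)
    fix B assume "B \<in> sets (density arc_length (\<lambda>x. ennreal (indicator ?K x)))"
    then have B: "B \<in> sets borel" by simp
    have "emeasure (density arc_length (\<lambda>x. ennreal (indicator ?K x))) B
        = (\<integral>\<^sup>+x. ennreal (indicator ?K x) * indicator B x \<partial>arc_length)"
      by (rule emeasure_density) (use B K in auto)
    also have "\<dots> = (\<integral>\<^sup>+x. indicator (B \<inter> ?K) x \<partial>arc_length)"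
      by (rule nn_integral_cong) (auto split: split_indicator)
    also have "\<dots> = emeasure arc_length (B \<inter> ?K)" using B K by (subst nn_integral_indicator) auto
    also have "\<dots> = emeasure lborel {t \<in> ?I. \<gamma> t \<in> B}"
      by (rule emeasure_on_segment[OF is_arc_length_arc_length ab \<gamma> B])
    also have "\<dots> = emeasure ?R (\<gamma> -` B \<inter> ?I)"
    proof -
      have "emeasure ?R (\<gamma> -` B \<inter> ?I) = emeasure lborel (\<gamma> -` B \<inter> ?I)"
        by (rule emeasure_restrict_space) auto
      moreover have "\<gamma> -` B \<inter> ?I = {t \<in> ?I. \<gamma> t \<in> B}" by auto
      ultimately show ?thesis by simp
    qed
    also have "\<dots> = emeasure (distr ?R borel \<gamma>) B"
      using emeasure_distr[OF gm B] by (simp add: space_restrict_space)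
    finally show "emeasure (density arc_length (\<lambda>x. ennreal (indicator ?K x))) B = emeasure (distr ?R borel \<gamma>) B" .
  qed simp
  have Fa: "F \<in> borel_measurable arc_length" using F by simp
  have Ka: "(indicator ?K :: 'a \<Rightarrow> real) \<in> borel_measurable arc_length" using K by simp
  have "(LINT x:?K|arc_length. F x) = integral\<^sup>L (density arc_length (\<lambda>x. ennreal (indicator ?K x))) F"
    unfolding set_lebesgue_integral_def using integral_density[OF Fa Ka] by simp
  also have "\<dots> = (LINT t|?R. F (\<gamma> t))" unfolding eq by (rule integral_distr[OF gm F])
  also have "\<dots> = (LINT t:?I|lborel. F (\<gamma> t))"
    unfolding set_lebesgue_integral_def by (rule integral_restrict_space) auto
  finally show "(LINT x:?K|arc_length. F x) = (LINT t:?I|lborel. F (\<gamma> t))" .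
  have "set_integrable arc_length ?K F \<longleftrightarrow> integrable (density arc_length (\<lambda>x. ennreal (indicator ?K x))) F"
    unfolding set_integrable_def using integrable_density[OF Fa Ka] by simp
  also have "\<dots> \<longleftrightarrow> integrable ?R (\<lambda>t. F (\<gamma> t))" unfolding eq by (rule integrable_distr_eq[OF gm F])
  also have "\<dots> \<longleftrightarrow> set_integrable lborel ?I (\<lambda>t. F (\<gamma> t))"
    unfolding set_integrable_def by (rule integrable_restrict_space) auto
  finally show "set_integrable arc_length ?K F \<longleftrightarrow> set_integrable lborel ?I (\<lambda>t. F (\<gamma> t))" .
qed

lemma integral_segmentation:
  fixes F :: "'a \<Rightarrow> complex"
  assumes V: "segmentation V \<E>" and \<gamma>: "\<And>E. E \<in> \<E> \<Longrightarrow> segment E (\<gamma> E) (l E)"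
    and F: "integrable arc_length F"
  shows "(LINT x|arc_length. F x) = (\<Sum>E\<in>\<E>. LINT t:{0..l E}|lborel. F (\<gamma> E t))"
proof -
  have fin: "finite V" "finite \<E>" "disjoint \<E>" "\<Union>\<E> = - V" using V by (auto simp: segmentation_def)
  have Fm: "F \<in> borel_measurable borel" using borel_measurable_integrable[OF F] by simp
  have g: "0 \<le> l E" "isometric_param {0..l E} (\<gamma> E)" if "E \<in> \<E>" for E
    using \<gamma>[OF that] by (auto simp: segment_def)
  let ?K = "\<lambda>E. \<gamma> E ` {0..l E}"
  have K: "?K E \<in> sets borel" if "E \<in> \<E>" for E using isometric_image_borel[OF g(2)[OF that]] .
  have int: "integrable arc_length (\<lambda>x. indicator (?K E) x *\<^sub>R F x)" if "E \<in> \<E>" for E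
    by (rule integrable_mult_indicator[OF _ F]) (use K[OF that] in simp)
  have "AE x in arc_length. x \<notin> V" by (rule AE_not_in_finite[OF fin(1)])
  then have "AE x in arc_length. F x = (\<Sum>E\<in>\<E>. indicator (?K E) x *\<^sub>R F x)"
  proof (rule AE_mp, intro AE_I2 impI)
    fix x assume x: "x \<notin> V"
    then obtain E where E: "E \<in> \<E>" "x \<in> E" using fin(4) by blast
    have "indicator (?K E') x *\<^sub>R F x = (if E' = E then F x else 0)" if E': "E' \<in> \<E>" for E'
    proof -
      have "x \<in> ?K E' \<longleftrightarrow> x \<in> E'"
        using closed_segment_eq[OF \<gamma>[OF E']] segment_endpoints[OF V E' \<gamma>[OF E']] x by auto
      also have "\<dots> \<longleftrightarrow> E' = E" using E E' fin(3) by (auto simp: disjoint_def)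
      finally show ?thesis by (simp add: indicator_def)
    qed
    then have "(\<Sum>E'\<in>\<E>. indicator (?K E') x *\<^sub>R F x) = (\<Sum>E'\<in>\<E>. if E' = E then F x else 0)"
      by (rule sum.cong[OF refl])
    also have "\<dots> = F x" using E fin(2) by simp
    finally show "F x = (\<Sum>E\<in>\<E>. indicator (?K E) x *\<^sub>R F x)" by simp
  qed
  then have "(LINT x|arc_length. F x) = (LINT x|arc_length. (\<Sum>E\<in>\<E>. indicator (?K E) x *\<^sub>R F x))"
    using F int by (intro integral_cong_AE) (auto intro!: borel_measurable_sum borel_measurable_integrable)
  also have "\<dots> = (\<Sum>E\<in>\<E>. LINT x:?K E|arc_length. F x)"
    unfolding set_lebesgue_integral_def using int by (rule Bochner_Integration.integral_sum)
  also have "\<dots> = (\<Sum>E\<in>\<E>. LINT t:{0..l E}|lborel. F (\<gamma> E t))"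
    by (rule sum.cong[OF refl]) (use integral_on_segment(1)[OF g Fm] in auto)
  finally show ?thesis .
qed

end

section \<open>Piecewise regular functions\<close>

text \<open>
  What the two instances, \<open>C2_on\<close> and \<open>affine_fun_on\<close>, have in common: regularity on an interval is
  a local matter and is preserved by reparametrization.
\<close>

definition local_regularity :: "(real set \<Rightarrow> (real \<Rightarrow> complex) \<Rightarrow> bool) \<Rightarrow> bool" where
  "local_regularity P \<longleftrightarrow>
     (\<forall>a b h. (\<forall>t\<in>{a<..<b}. \<exists>\<delta>>0. P {t - \<delta><..<t + \<delta>} h) \<longrightarrow> P {a<..<b} h) \<and>
     (\<forall>a b a' b' h c \<epsilon>. P {a<..<b} h \<and> (\<epsilon> = 1 \<or> \<epsilon> = -1) \<and> (\<forall>t\<in>{a'<..<b'}. c + \<epsilon> * t \<in> {a<..<b}) \<longrightarrow>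
        P {a'<..<b'} (\<lambda>t. h (c + \<epsilon> * t))) \<and>
     (\<forall>a b h k. P {a<..<b} h \<and> (\<forall>t\<in>{a<..<b}. h t = k t) \<longrightarrow> P {a<..<b} k)"

lemma local_regularityD:
  assumes "local_regularity P"
  shows "(\<And>t. t \<in> {a<..<b} \<Longrightarrow> \<exists>\<delta>>0. P {t - \<delta><..<t + \<delta>} h) \<Longrightarrow> P {a<..<b} h"
    and "P {a<..<b} h \<Longrightarrow> \<epsilon> = 1 \<or> \<epsilon> = -1 \<Longrightarrow> (\<And>t. t \<in> {a'<..<b'} \<Longrightarrow> c + \<epsilon> * t \<in> {a<..<b}) \<Longrightarrow>
      P {a'<..<b'} (\<lambda>t. h (c + \<epsilon> * t))"
    and "P {a<..<b} h \<Longrightarrow> (\<And>t. t \<in> {a<..<b} \<Longrightarrow> h t = k t) \<Longrightarrow> P {a<..<b} k"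
proof -
  note R = assms[unfolded local_regularity_def]
  show "P {a<..<b} h" if "\<And>t. t \<in> {a<..<b} \<Longrightarrow> \<exists>\<delta>>0. P {t - \<delta><..<t + \<delta>} h"
    by (rule conjunct1[OF R, rule_format]) (rule that)
  show "P {a'<..<b'} (\<lambda>t. h (c + \<epsilon> * t))"
    if "P {a<..<b} h" "\<epsilon> = 1 \<or> \<epsilon> = -1" "\<And>t. t \<in> {a'<..<b'} \<Longrightarrow> c + \<epsilon> * t \<in> {a<..<b}"
    by (rule conjunct1[OF conjunct2[OF R], rule_format, of a b]) (use that in simp)
  show "P {a<..<b} k" if "P {a<..<b} h" "\<And>t. t \<in> {a<..<b} \<Longrightarrow> h t = k t"
    by (rule conjunct2[OF conjunct2[OF R], rule_format, of a b h]) (use that in simp)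
qed

abbreviation deriv1 :: "(real \<Rightarrow> complex) \<Rightarrow> real \<Rightarrow> complex" where
  "deriv1 h \<equiv> \<lambda>t. vector_derivative h (at t)"

lemma has_vector_derivative_cong_open:
  assumes "open I" "t \<in> I" "\<And>s. s \<in> I \<Longrightarrow> h s = k s" "(h has_vector_derivative d) (at t)"
  shows "(k has_vector_derivative d) (at t)"
  by (rule has_vector_derivative_transform_within_open[OF assms(4,1,2)]) (use assms(3) in auto)

text \<open>
  The derivatives whose existence \<open>C2_on\<close> asserts are the iterated derivatives.
\<close>

lemma C2_on_deriv:
  assumes I: "open I" and h: "C2_on I h"
  shows "t \<in> I \<Longrightarrow> (h has_vector_derivative deriv1 h t) (at t)"
    and "t \<in> I \<Longrightarrow> (deriv1 h has_vector_derivative deriv1 (deriv1 h) t) (at t)"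
    and "continuous_on I (deriv1 (deriv1 h))"
proof -
  obtain h' h'' where h': "\<And>t. t \<in> I \<Longrightarrow> (h has_vector_derivative h' t) (at t)"
    and h'': "\<And>t. t \<in> I \<Longrightarrow> (h' has_vector_derivative h'' t) (at t)" and c: "continuous_on I h''"
    using h unfolding C2_on_def by blast
  have 1: "deriv1 h t = h' t" if "t \<in> I" for t using h'[OF that] by (rule vector_derivative_at)
  have 2: "(deriv1 h has_vector_derivative h'' t) (at t)" if "t \<in> I" for t
    by (rule has_vector_derivative_cong_open[OF I that _ h''[OF that]]) (simp add: 1)
  have 3: "deriv1 (deriv1 h) t = h'' t" if "t \<in> I" for t using 2[OF that] by (rule vector_derivative_at)
  show "t \<in> I \<Longrightarrow> (h has_vector_derivative deriv1 h t) (at t)" using h' 1 by simp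
  show "t \<in> I \<Longrightarrow> (deriv1 h has_vector_derivative deriv1 (deriv1 h) t) (at t)" using 2 3 by simp
  show "continuous_on I (deriv1 (deriv1 h))" using c 3 by (simp cong: continuous_on_cong)
qed

lemma C2_onI:
  assumes "\<And>t. t \<in> I \<Longrightarrow> (h has_vector_derivative h' t) (at t)"
    "\<And>t. t \<in> I \<Longrightarrow> (h' has_vector_derivative h'' t) (at t)" "continuous_on I h''"
  shows "C2_on I h"
  using assms unfolding C2_on_def by blast

lemma C2_on_glue:
  assumes I: "open I" and loc: "\<And>t. t \<in> I \<Longrightarrow> \<exists>J. open J \<and> t \<in> J \<and> C2_on J h"
  shows "C2_on I h"
proof (rule C2_onI)
  fix t assume "t \<in> I"
  then obtain J where J: "open J" "t \<in> J" "C2_on J h" using loc by blast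
  show "(h has_vector_derivative deriv1 h t) (at t)" by (rule C2_on_deriv(1)[OF J(1,3,2)])
  show "(deriv1 h has_vector_derivative deriv1 (deriv1 h) t) (at t)" by (rule C2_on_deriv(2)[OF J(1,3,2)])
next
  show "continuous_on I (deriv1 (deriv1 h))"
    unfolding continuous_on_eq_continuous_at[OF I]
  proof
    fix t assume "t \<in> I"
    then obtain J where J: "open J" "t \<in> J" "C2_on J h" using loc by blast
    then show "isCont (deriv1 (deriv1 h)) t"
      using C2_on_deriv(3)[OF J(1,3)] continuous_on_eq_continuous_at by blast
  qed
qed

lemma has_vector_derivative_reparam:
  assumes "(h has_vector_derivative d) (at (c + \<epsilon> * t))"
  shows "((\<lambda>t. h (c + \<epsilon> * t)) has_vector_derivative (\<epsilon> *\<^sub>R d)) (at t)"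
proof -
  have "((\<lambda>t. c + \<epsilon> * t) has_vector_derivative \<epsilon>) (at t)"
    by (auto intro!: derivative_eq_intros simp: has_real_derivative_iff_has_vector_derivative[symmetric])
  then show ?thesis using vector_diff_chain_at[of "\<lambda>t. c + \<epsilon> * t" \<epsilon> t h d] assms by (simp add: o_def)
qed

lemma C2_on_reparam:
  assumes I: "open I" and h: "C2_on I h" and sub: "\<And>t. t \<in> J \<Longrightarrow> c + \<epsilon> * t \<in> I"
  shows "C2_on J (\<lambda>t. h (c + \<epsilon> * t))"
proof (rule C2_onI)
  fix t assume "t \<in> J"
  then have t: "c + \<epsilon> * t \<in> I" by (rule sub)
  show "((\<lambda>t. h (c + \<epsilon> * t)) has_vector_derivative \<epsilon> *\<^sub>R deriv1 h (c + \<epsilon> * t)) (at t)"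
    by (rule has_vector_derivative_reparam[OF C2_on_deriv(1)[OF I h t]])
  have "((\<lambda>t. deriv1 h (c + \<epsilon> * t)) has_vector_derivative \<epsilon> *\<^sub>R deriv1 (deriv1 h) (c + \<epsilon> * t)) (at t)"
    by (rule has_vector_derivative_reparam[OF C2_on_deriv(2)[OF I h t]])
  then show "((\<lambda>t. \<epsilon> *\<^sub>R deriv1 h (c + \<epsilon> * t)) has_vector_derivative \<epsilon> *\<^sub>R (\<epsilon> *\<^sub>R deriv1 (deriv1 h) (c + \<epsilon> * t))) (at t)"
    by (rule bounded_linear.has_vector_derivative[OF bounded_linear_scaleR_right])
next
  show "continuous_on J (\<lambda>t. \<epsilon> *\<^sub>R (\<epsilon> *\<^sub>R deriv1 (deriv1 h) (c + \<epsilon> * t)))"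
    using sub by (intro continuous_intros continuous_on_compose2[OF C2_on_deriv(3)[OF I h]]) auto
qed

lemma local_regularity_C2: "local_regularity C2_on"
  unfolding local_regularity_def
proof (intro conjI allI impI; (elim conjE)?)
  fix a b h assume "\<forall>t\<in>{a<..<b}. \<exists>\<delta>>0. C2_on {t - \<delta><..<t + \<delta>} h"
  then show "C2_on {a<..<b} h"
    by (intro C2_on_glue open_greaterThanLessThan) (metis greaterThanLessThan_iff less_add_same_cancel1 diff_less_eq open_greaterThanLessThan)
next
  fix a b a' b' h c \<epsilon> assume "C2_on {a<..<b} h" "\<forall>t\<in>{a'<..<b'}. c + \<epsilon> * t \<in> {a<..<b}"
  then show "C2_on {a'<..<b'} (\<lambda>t. h (c + \<epsilon> * t))"
    by (intro C2_on_reparam[OF open_greaterThanLessThan]) auto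
next
  fix a b h k assume h: "C2_on {a<..<b} h" and hk: "\<forall>t\<in>{a<..<b}. h t = k t"
  show "C2_on {a<..<b} k"
  proof (rule C2_onI)
    fix t assume t: "t \<in> {a<..<b}"
    show "(k has_vector_derivative deriv1 h t) (at t)"
      by (rule has_vector_derivative_cong_open[OF open_greaterThanLessThan t _ C2_on_deriv(1)[OF open_greaterThanLessThan h t]]) (use hk in auto)
    show "(deriv1 h has_vector_derivative deriv1 (deriv1 h) t) (at t)"
      by (rule C2_on_deriv(2)[OF open_greaterThanLessThan h t])
  qed (rule C2_on_deriv(3)[OF open_greaterThanLessThan h])
qed

lemma has_vector_derivative_affine:
  "((\<lambda>t. \<alpha> + \<beta> * of_real t) has_vector_derivative \<beta>) (at t)" for \<alpha> \<beta> :: complex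
  by (auto intro!: derivative_eq_intros simp: has_vector_derivative_def scaleR_conv_of_real mult.commute)

lemma affine_imp_C2_on:
  assumes "affine_fun_on {a<..<b} h" shows "C2_on {a<..<b} h"
proof -
  obtain \<alpha> \<beta> where h: "\<And>t. t \<in> {a<..<b} \<Longrightarrow> h t = \<alpha> + \<beta> * of_real t"
    using assms by (auto simp: affine_fun_on_def)
  show ?thesis
  proof (rule C2_onI[where h' = "\<lambda>_. \<beta>" and h'' = "\<lambda>_. 0"])
    fix t assume t: "t \<in> {a<..<b}"
    show "(h has_vector_derivative \<beta>) (at t)"
      by (rule has_vector_derivative_cong_open[OF open_greaterThanLessThan t _ has_vector_derivative_affine[of \<alpha>]])
         (simp add: h)
  qed auto
qed

lemma zero_derivative_constant_on_interval:
  fixes h :: "real \<Rightarrow> complex"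
  assumes "\<And>t. t \<in> {a<..<b} \<Longrightarrow> (h has_vector_derivative 0) (at t)"
  obtains c where "\<And>t. t \<in> {a<..<b} \<Longrightarrow> h t = c"
proof -
  have "\<exists>c. \<forall>t\<in>{a<..<b}. h t = c"
  proof (rule has_vector_derivative_zero_constant[OF convex_real_interval(8)])
    show "(h has_vector_derivative 0) (at t within {a<..<b})" if "t \<in> {a<..<b}" for t
      using assms[OF that] has_vector_derivative_at_within by blast
  qed blast
  then show ?thesis using that by blast
qed

text \<open>
  The derivative is locally constant, hence constant, and so is the difference from the linear
  function with this slope.
\<close>

lemma affine_fun_on_glue:
  assumes loc: "\<And>t. t \<in> {a<..<b} \<Longrightarrow> \<exists>\<delta>>0. affine_fun_on {t - \<delta><..<t + \<delta>} h"
  shows "affine_fun_on {a<..<b} h"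
proof -
  have d: "(h has_vector_derivative deriv1 h t) (at t) \<and> (deriv1 h has_vector_derivative 0) (at t)"
    if t: "t \<in> {a<..<b}" for t
  proof -
    obtain \<delta> \<alpha> \<beta> where \<delta>: "\<delta> > 0" and h: "\<And>s. s \<in> {t - \<delta><..<t + \<delta>} \<Longrightarrow> h s = \<alpha> + \<beta> * of_real s"
      using loc[OF t] by (auto simp: affine_fun_on_def)
    have D: "(h has_vector_derivative \<beta>) (at s)" if "s \<in> {t - \<delta><..<t + \<delta>}" for s
      by (rule has_vector_derivative_cong_open[OF open_greaterThanLessThan that _ has_vector_derivative_affine[of \<alpha>]])
         (simp add: h)
    have tt: "t \<in> {t - \<delta><..<t + \<delta>}" using \<delta> by simp
    have e: "deriv1 h s = \<beta>" if "s \<in> {t - \<delta><..<t + \<delta>}" for s using D[OF that] by (rule vector_derivative_at)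
    have "(deriv1 h has_vector_derivative 0) (at t)"
      by (rule has_vector_derivative_cong_open[OF open_greaterThanLessThan tt, of "\<lambda>_. \<beta>"]) (auto simp: e)
    then show ?thesis using D[OF tt] e[OF tt] by simp
  qed
  obtain \<beta> where \<beta>: "\<And>t. t \<in> {a<..<b} \<Longrightarrow> deriv1 h t = \<beta>"
    by (rule zero_derivative_constant_on_interval[of a b "deriv1 h"]) (use d in auto)
  have D0: "((\<lambda>t. h t - \<beta> * of_real t) has_vector_derivative 0) (at t)" if "t \<in> {a<..<b}" for t
    using has_vector_derivative_diff[OF conjunct1[OF d[OF that]] has_vector_derivative_affine[of 0 \<beta> t]] \<beta>[OF that]
    by simp
  have "\<exists>\<alpha>. \<forall>t\<in>{a<..<b}. h t - \<beta> * of_real t = \<alpha>"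
    by (rule zero_derivative_constant_on_interval[OF D0]) blast+
  then obtain \<alpha> where "\<forall>t\<in>{a<..<b}. h t - \<beta> * of_real t = \<alpha>" by blast
  then have "\<forall>t\<in>{a<..<b}. h t = \<alpha> + \<beta> * of_real t" by (metis diff_add_cancel)
  then show ?thesis unfolding affine_fun_on_def by blast
qed

lemma local_regularity_affine: "local_regularity affine_fun_on"
  unfolding local_regularity_def
proof (intro conjI allI impI; (elim conjE)?)
  fix a b h assume "\<forall>t\<in>{a<..<b}. \<exists>\<delta>>0. affine_fun_on {t - \<delta><..<t + \<delta>} h"
  then show "affine_fun_on {a<..<b} h" by (intro affine_fun_on_glue) blast
next
  fix a b a' b' h c \<epsilon> assume "affine_fun_on {a<..<b} h" and sub: "\<forall>t\<in>{a'<..<b'}. c + \<epsilon> * t \<in> {a<..<b}"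
  then obtain \<alpha> \<beta> where "\<And>t. t \<in> {a<..<b} \<Longrightarrow> h t = \<alpha> + \<beta> * of_real t" by (auto simp: affine_fun_on_def)
  then have "\<forall>t\<in>{a'<..<b'}. h (c + \<epsilon> * t) = (\<alpha> + \<beta> * of_real c) + (\<beta> * of_real \<epsilon>) * of_real t"
    using sub by (simp add: algebra_simps)
  then show "affine_fun_on {a'<..<b'} (\<lambda>t. h (c + \<epsilon> * t))" unfolding affine_fun_on_def by blast
next
  fix a b h k assume "affine_fun_on {a<..<b} h" and hk: "\<forall>t\<in>{a<..<b}. h t = k t"
  then obtain \<alpha> \<beta> where "\<forall>t\<in>{a<..<b}. h t = \<alpha> + \<beta> * of_real t" unfolding affine_fun_on_def by blast
  then have "\<forall>t\<in>{a<..<b}. k t = \<alpha> + \<beta> * of_real t" using hk by simp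
  then show "affine_fun_on {a<..<b} k" unfolding affine_fun_on_def by blast
qed

context graph
begin

lemma segment_params:
  assumes "segment E \<gamma> l"
  shows "isometric_param {0<..<l} \<gamma>" "open (\<gamma> ` {0<..<l})" "isometric_param {0..l} \<gamma>" "0 < l"
proof -
  show "isometric_param {0..l} \<gamma>" "open (\<gamma> ` {0<..<l})" "0 < l" using assms by (auto simp: segment_def)
  then show "isometric_param {0<..<l} \<gamma>" by (rule_tac isometric_param_subset) auto
qed

text \<open>
  The pointwise form of \<open>piecewise\<close>: it removes the reference to a particular choice of intervals, which
  allows the passage to the segments of any decomposition with the exceptional points among its
  endpoints.
\<close>

definition regular_point :: "(real set \<Rightarrow> (real \<Rightarrow> complex) \<Rightarrow> bool) \<Rightarrow> ('a \<Rightarrow> complex) \<Rightarrow> 'a \<Rightarrow> bool" where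
  "regular_point P f x \<longleftrightarrow> (\<exists>a b c \<gamma>. isometric_param {a<..<b} \<gamma> \<and> open (\<gamma> ` {a<..<b}) \<and> c \<in> {a<..<b} \<and>
      x = \<gamma> c \<and> P {a<..<b} (f \<circ> \<gamma>))"

lemma piecewise_regular_points:
  assumes "piecewise P (f :: 'a \<Rightarrow> complex)"
  obtains X where "finite X" "\<And>x. x \<notin> X \<Longrightarrow> regular_point P f x"
proof -
  obtain X \<A> where X: "finite X" "- X = \<Union>\<A>"
    and A: "\<And>A. A \<in> \<A> \<Longrightarrow> open A \<and> (\<exists>a b \<gamma>. a < b \<and> isometric_param {a<..<b} \<gamma> \<and> A = \<gamma> ` {a<..<b} \<and> P {a<..<b} (f \<circ> \<gamma>))"
    using assms unfolding piecewise_def by metis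
  have "regular_point P f x" if x: "x \<notin> X" for x
  proof -
    have "x \<in> \<Union>\<A>" using X(2) x by blast
    then obtain B where B: "B \<in> \<A>" "x \<in> B" by blast
    then obtain a b \<gamma> where g: "isometric_param {a<..<b} \<gamma>" "B = \<gamma> ` {a<..<b}" "P {a<..<b} (f \<circ> \<gamma>)" "open B"
      using A[OF B(1)] by blast
    then show ?thesis using B(2) unfolding regular_point_def by blast
  qed
  with X that show ?thesis by blast
qed

text \<open>
  By \<open>isometric_params_agree\<close>, regularity in one parametrization implies it in any other.
\<close>

lemma regular_point_param:
  assumes P: "local_regularity P" and x: "regular_point P f x"
    and \<sigma>: "isometric_param {-\<rho><..<\<rho>} \<sigma>" "0 < \<rho>" "\<sigma> 0 = x"
  obtains \<delta> where "0 < \<delta>" "P {-\<delta><..<\<delta>} (f \<circ> \<sigma>)"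
proof -
  obtain a b c \<gamma> where g: "isometric_param {a<..<b} \<gamma>" "open (\<gamma> ` {a<..<b})" "c \<in> {a<..<b}" "x = \<gamma> c"
    and Pf: "P {a<..<b} (f \<circ> \<gamma>)" using x unfolding regular_point_def by blast
  obtain \<delta> \<epsilon> where d: "0 < \<delta>" "\<epsilon> = 1 \<or> \<epsilon> = -1"
    "\<And>t. \<bar>t\<bar> < \<delta> \<Longrightarrow> c + \<epsilon> * t \<in> {a<..<b}" "\<And>t. \<bar>t\<bar> < \<delta> \<Longrightarrow> \<sigma> t = \<gamma> (c + \<epsilon> * t)"
    using isometric_params_agree[OF g(1-3) \<sigma>(1,2)] \<sigma>(3) g(4) by metis
  have "P {-\<delta><..<\<delta>} (\<lambda>t. (f \<circ> \<gamma>) (c + \<epsilon> * t))"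
    by (rule local_regularityD(2)[OF P Pf d(2)]) (use d(3) in auto)
  then have "P {-\<delta><..<\<delta>} (f \<circ> \<sigma>)"
    by (rule local_regularityD(3)[OF P]) (use d(4) in auto)
  with d that show ?thesis by blast
qed

lemma regular_points_on_segment:
  assumes P: "local_regularity P" and \<gamma>: "isometric_param {a<..<b} \<gamma>"
    and reg: "\<And>t. t \<in> {a<..<b} \<Longrightarrow> regular_point P f (\<gamma> t)"
  shows "P {a<..<b} (f \<circ> \<gamma>)"
proof (rule local_regularityD(1)[OF P])
  fix t assume t: "t \<in> {a<..<b}"
  define \<rho> where "\<rho> = min (t - a) (b - t)"
  have \<rho>: "0 < \<rho>" "\<rho> \<le> t - a" "\<rho> \<le> b - t" using t by (simp_all add: \<rho>_def)
  have iso: "isometric_param {-\<rho><..<\<rho>} (\<lambda>s. \<gamma> (t + s))"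
    by (rule isometric_param_shift[OF \<gamma>]) (use \<rho> in auto)
  obtain \<delta> where d: "0 < \<delta>" "P {-\<delta><..<\<delta>} (f \<circ> (\<lambda>s. \<gamma> (t + s)))"
    by (rule regular_point_param[OF P reg[OF t] iso \<rho>(1)]) auto
  have "P {t - \<delta><..<t + \<delta>} (\<lambda>s. (f \<circ> (\<lambda>s. \<gamma> (t + s))) (- t + 1 * s))"
    by (rule local_regularityD(2)[OF P d(2)]) auto
  then show "\<exists>\<delta>>0. P {t - \<delta><..<t + \<delta>} (f \<circ> \<gamma>)" using d by (auto simp: o_def)
qed

lemma segmentation_regular:
  assumes "local_regularity P" "segmentation V \<E>" "E \<in> \<E>" "segment E \<gamma> l"
    and "\<And>x. x \<notin> V \<Longrightarrow> regular_point P f x"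
  shows "P {0<..<l} (f \<circ> \<gamma>)"
proof (rule regular_points_on_segment[OF assms(1)])
  show "isometric_param {0<..<l} \<gamma>"
    by (rule segment_params(1)[OF assms(4)])
  show "regular_point P f (\<gamma> t)" if "t \<in> {0<..<l}" for t
  proof (rule assms(5))
    have "\<gamma> t \<in> E" using assms(4) that by (auto simp: segment_def)
    then show "\<gamma> t \<notin> V" using assms(2,3) by (auto simp: segmentation_def)
  qed
qed

lemma piecewise_segmentation:
  assumes V: "segmentation V \<E>"
    and P: "\<And>E. E \<in> \<E> \<Longrightarrow> \<exists>\<gamma> l. segment E \<gamma> l \<and> P {0<..<l} (f \<circ> \<gamma>)"
  shows "piecewise P f"
  unfolding piecewise_def
proof (rule exI[of _ V], rule exI[of _ \<E>], intro conjI ballI)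
  show "finite V" "finite \<E>" "- V = \<Union>\<E>" using V by (auto simp: segmentation_def)
  fix E assume E: "E \<in> \<E>"
  obtain \<gamma> l where g: "segment E \<gamma> l" "P {0<..<l} (f \<circ> \<gamma>)" using P[OF E] by blast
  show "open E" using g(1) unfolding segment_def by blast
  have "isometric_param {0<..<l} \<gamma>" by (rule segment_params(1)[OF g(1)])
  then show "\<exists>a b \<gamma>. a < b \<and> isometric_param {a<..<b} \<gamma> \<and> E = \<gamma> ` {a<..<b} \<and> P {a<..<b} (f \<circ> \<gamma>)"
    using g unfolding segment_def by blast
qed

text \<open>
  Used where regularity is known near each point, and no decomposition is at hand.
\<close>

lemma piecewise_local:
  fixes f :: "'a \<Rightarrow> complex"
  assumes P: "local_regularity P" and X: "finite X"
    and loc: "\<And>x \<sigma> \<delta>. \<lbrakk>x \<notin> X; 0 < \<delta>; isometric_param {-\<delta><..<\<delta>} \<sigma>; \<sigma> 0 = x\<rbrakk> \<Longrightarrow> \<exists>\<delta>'>0. P {-\<delta>'<..<\<delta>'} (f \<circ> \<sigma>)"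
  shows "piecewise P f"
proof -
  obtain V \<E> where V: "segmentation V \<E>" "X \<subseteq> V" using segmentation_exists[OF X] by blast
  show ?thesis
  proof (rule piecewise_segmentation[OF V(1)])
    fix E assume E: "E \<in> \<E>"
    then obtain \<gamma> l where g: "segment E \<gamma> l" using V by (auto simp: segmentation_def)
    have "P {0<..<l} (f \<circ> \<gamma>)"
    proof (rule local_regularityD(1)[OF P])
      fix t assume t: "t \<in> {0<..<l}"
      define \<rho> where "\<rho> = min t (l - t)"
      have \<rho>: "0 < \<rho>" "\<rho> \<le> t" "\<rho> \<le> l - t" using t by (simp_all add: \<rho>_def)
      have "isometric_param {0..l} \<gamma>" using g by (simp add: segment_def)
      then have iso: "isometric_param {-\<rho><..<\<rho>} (\<lambda>s. \<gamma> (t + s))"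
        by (rule isometric_param_shift) (use \<rho> in auto)
      have "\<gamma> t \<in> E" using g t by (auto simp: segment_def)
      then have "\<gamma> t \<notin> X" using V E by (auto simp: segmentation_def)
      then obtain \<delta> where d: "0 < \<delta>" "P {-\<delta><..<\<delta>} (f \<circ> (\<lambda>s. \<gamma> (t + s)))"
        using loc[OF _ \<rho>(1) iso, of "\<gamma> t"] by auto
      have "P {t - \<delta><..<t + \<delta>} (\<lambda>s. (f \<circ> (\<lambda>s. \<gamma> (t + s))) (- t + 1 * s))"
        by (rule local_regularityD(2)[OF P d(2)]) auto
      then show "\<exists>\<delta>>0. P {t - \<delta><..<t + \<delta>} (f \<circ> \<gamma>)" using d by (auto simp: o_def)
    qed
    with g show "\<exists>\<gamma> l. segment E \<gamma> l \<and> P {0<..<l} (f \<circ> \<gamma>)" by blast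
  qed
qed

text \<open>
  A decomposition that has the exceptional points of both functions among its endpoints is adapted
  to both.
\<close>

lemma piecewise_combine:
  fixes f g :: "'a \<Rightarrow> complex"
  assumes P: "local_regularity P" and fg: "piecewise P f" "piecewise P g"
    and op: "\<And>a b h k. P {a<..<b} h \<Longrightarrow> P {a<..<b} k \<Longrightarrow> Q {a<..<b} (\<lambda>t. F (h t) (k t))"
  shows "piecewise Q (\<lambda>x. F (f x) (g x))"
proof -
  obtain X Y where X: "finite X" "\<And>x. x \<notin> X \<Longrightarrow> regular_point P f x"
    and Y: "finite Y" "\<And>x. x \<notin> Y \<Longrightarrow> regular_point P g x"
    using piecewise_regular_points[OF fg(1)] piecewise_regular_points[OF fg(2)] by metis
  obtain V \<E> where V: "segmentation V \<E>" "X \<union> Y \<subseteq> V"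
    using segmentation_exists[of "X \<union> Y"] X(1) Y(1) by blast
  show ?thesis
  proof (rule piecewise_segmentation[OF V(1)])
    fix E assume E: "E \<in> \<E>"
    then obtain \<gamma> l where g: "segment E \<gamma> l" using V by (auto simp: segmentation_def)
    have "P {0<..<l} (f \<circ> \<gamma>)" "P {0<..<l} (g \<circ> \<gamma>)"
      using V X Y by (auto intro!: segmentation_regular[OF P V(1) E g])
    from op[OF this] g show "\<exists>\<gamma> l. segment E \<gamma> l \<and> Q {0<..<l} ((\<lambda>x. F (f x) (g x)) \<circ> \<gamma>)"
      by (auto simp: o_def)
  qed
qed

end

lemma C2_on_add: "C2_on {a<..<b} h \<Longrightarrow> C2_on {a<..<b} k \<Longrightarrow> C2_on {a<..<b} (\<lambda>t. h t + k t)"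
  by (rule C2_onI[where h' = "\<lambda>t. deriv1 h t + deriv1 k t" and h'' = "\<lambda>t. deriv1 (deriv1 h) t + deriv1 (deriv1 k) t"])
     (auto intro!: has_vector_derivative_add continuous_on_add C2_on_deriv[of "{a<..<b}"])

lemma C2_on_scale: "C2_on {a<..<b} h \<Longrightarrow> C2_on {a<..<b} (\<lambda>t. c * h t)"
  by (rule C2_onI[where h' = "\<lambda>t. c * deriv1 h t" and h'' = "\<lambda>t. c * deriv1 (deriv1 h) t"])
     (auto intro!: has_vector_derivative_mult_right continuous_on_mult continuous_on_const C2_on_deriv[of "{a<..<b}"])

lemma affine_fun_on_add: "affine_fun_on I h \<Longrightarrow> affine_fun_on I k \<Longrightarrow> affine_fun_on I (\<lambda>t. h t + k t)"
proof -
  assume "affine_fun_on I h" "affine_fun_on I k"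
  then obtain \<alpha> \<beta> \<alpha>' \<beta>' where "\<And>t. t \<in> I \<Longrightarrow> h t = \<alpha> + \<beta> * of_real t" "\<And>t. t \<in> I \<Longrightarrow> k t = \<alpha>' + \<beta>' * of_real t"
    by (auto simp: affine_fun_on_def)
  then have "\<forall>t\<in>I. h t + k t = (\<alpha> + \<alpha>') + (\<beta> + \<beta>') * of_real t" by (simp add: algebra_simps)
  then show ?thesis unfolding affine_fun_on_def by blast
qed

lemma affine_fun_on_scale: "affine_fun_on I h \<Longrightarrow> affine_fun_on I (\<lambda>t. c * h t)"
proof -
  assume "affine_fun_on I h"
  then obtain \<alpha> \<beta> where "\<And>t. t \<in> I \<Longrightarrow> h t = \<alpha> + \<beta> * of_real t" by (auto simp: affine_fun_on_def)
  then have "\<forall>t\<in>I. c * h t = c * \<alpha> + (c * \<beta>) * of_real t" by (simp add: algebra_simps)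
  then show ?thesis unfolding affine_fun_on_def by blast
qed

section \<open>The Dirichlet form on smooth functions\<close>

context graph
begin

text \<open>
  The sign \<open>\<epsilon>\<close> relates the orientation of \<open>\<lambda>t. move x t 1\<close> to that of the given parametrization; it is
  the same for all functions, so it cancels from the product of two derivatives.
\<close>

lemma graph_deriv_on_segment:
  assumes "isometric_param {a<..<b} \<gamma>" "open (\<gamma> ` {a<..<b})" "c \<in> {a<..<b}" "(x :: 'a) = \<gamma> c"
  obtains \<epsilon> where "\<epsilon> = 1 \<or> \<epsilon> = -1"
    "\<And>(f :: 'a \<Rightarrow> complex) d. ((f \<circ> \<gamma>) has_vector_derivative d) (at c) \<Longrightarrow> ((\<lambda>t. f (move x t 1)) has_vector_derivative \<epsilon> *\<^sub>R d) (at 0)"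
    "\<And>f :: 'a \<Rightarrow> complex. C2_on {a<..<b} (f \<circ> \<gamma>) \<Longrightarrow> graph_deriv2 f x = deriv1 (deriv1 (f \<circ> \<gamma>)) c"
proof -
  obtain \<delta> \<epsilon> where d: "0 < \<delta>" "\<epsilon> = 1 \<or> \<epsilon> = -1"
    "\<And>t. \<bar>t\<bar> < \<delta> \<Longrightarrow> c + \<epsilon> * t \<in> {a<..<b}" "\<And>t. \<bar>t\<bar> < \<delta> \<Longrightarrow> move x t 1 = \<gamma> (c + \<epsilon> * t)"
    using move_eq_param[OF assms] by metis
  let ?I = "{-\<delta><..<\<delta>}"
  have D: "((\<lambda>t. f (move x t 1)) has_vector_derivative \<epsilon> *\<^sub>R e) (at s)"
    if "((f \<circ> \<gamma>) has_vector_derivative e) (at (c + \<epsilon> * s))" "s \<in> ?I" for f :: "'a \<Rightarrow> complex" and e s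
    by (rule has_vector_derivative_cong_open[OF open_greaterThanLessThan that(2) _ has_vector_derivative_reparam[OF that(1)]])
       (use d in auto)
  have z: "0 \<in> ?I" using d by simp
  have "graph_deriv2 f x = deriv1 (deriv1 (f \<circ> \<gamma>)) c" if C: "C2_on {a<..<b} (f \<circ> \<gamma>)" for f :: "'a \<Rightarrow> complex"
  proof -
    note C' = C2_on_deriv[OF open_greaterThanLessThan C]
    have v: "vector_derivative (\<lambda>t. f (move x t 1)) (at s) = \<epsilon> *\<^sub>R deriv1 (f \<circ> \<gamma>) (c + \<epsilon> * s)" if "s \<in> ?I" for s
      by (rule vector_derivative_at[OF D[OF C'(1) that]]) (use d that in auto)
    have "((\<lambda>s. deriv1 (f \<circ> \<gamma>) (c + \<epsilon> * s)) has_vector_derivative \<epsilon> *\<^sub>R deriv1 (deriv1 (f \<circ> \<gamma>)) (c + \<epsilon> * 0)) (at 0)"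
      by (rule has_vector_derivative_reparam[OF C'(2)]) (use d(3)[of 0] d(1) in simp)
    then have "((\<lambda>s. \<epsilon> *\<^sub>R deriv1 (f \<circ> \<gamma>) (c + \<epsilon> * s)) has_vector_derivative \<epsilon> *\<^sub>R (\<epsilon> *\<^sub>R deriv1 (deriv1 (f \<circ> \<gamma>)) (c + \<epsilon> * 0))) (at 0)"
      by (rule bounded_linear.has_vector_derivative[OF bounded_linear_scaleR_right])
    then have "((\<lambda>s. vector_derivative (\<lambda>t. f (move x t 1)) (at s)) has_vector_derivative \<epsilon> *\<^sub>R (\<epsilon> *\<^sub>R deriv1 (deriv1 (f \<circ> \<gamma>)) (c + \<epsilon> * 0))) (at 0)"
      by (rule has_vector_derivative_cong_open[OF open_greaterThanLessThan z, rotated]) (simp add: v)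
    then show ?thesis unfolding graph_deriv2_def using d(2) by (auto dest: vector_derivative_at)
  qed
  then show ?thesis using that[of \<epsilon>] d(2) D[OF _ z] by auto
qed

lemma graph_deriv_product:
  assumes "isometric_param {a<..<b} \<gamma>" "open (\<gamma> ` {a<..<b})" "c \<in> {a<..<b}" "(x :: 'a) = \<gamma> c"
    and "((f \<circ> \<gamma>) has_vector_derivative d) (at c)" "((g \<circ> \<gamma>) has_vector_derivative e) (at c)"
  shows "graph_deriv f x * cnj (graph_deriv g x) = d * cnj e" "norm (graph_deriv f x) = norm d"
proof -
  obtain \<epsilon> where \<epsilon>: "\<epsilon> = 1 \<or> \<epsilon> = -1"
    "\<And>(f :: 'a \<Rightarrow> complex) d. ((f \<circ> \<gamma>) has_vector_derivative d) (at c) \<Longrightarrow> ((\<lambda>t. f (move x t 1)) has_vector_derivative \<epsilon> *\<^sub>R d) (at 0)"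
    by (rule graph_deriv_on_segment[OF assms(1-4)]) blast
  have "graph_deriv f x = \<epsilon> *\<^sub>R d" "graph_deriv g x = \<epsilon> *\<^sub>R e"
    unfolding graph_deriv_def using \<epsilon>(2)[OF assms(5)] \<epsilon>(2)[OF assms(6)] by (auto dest: vector_derivative_at)
  then show "graph_deriv f x * cnj (graph_deriv g x) = d * cnj e" "norm (graph_deriv f x) = norm d"
    using \<epsilon>(1) by auto
qed

definition graph_differentiable :: "('a \<Rightarrow> complex) \<Rightarrow> 'a \<Rightarrow> bool" where
  "graph_differentiable f x \<longleftrightarrow> ((\<lambda>t. f (move x t 1)) has_vector_derivative graph_deriv f x) (at 0)"

lemma graph_differentiableI:
  "((\<lambda>t. f (move x t 1)) has_vector_derivative d) (at 0) \<Longrightarrow> graph_differentiable f x \<and> graph_deriv f x = d"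
  unfolding graph_differentiable_def graph_deriv_def by (auto dest: vector_derivative_at)

lemma graph_deriv_add:
  "graph_differentiable f x \<Longrightarrow> graph_differentiable g x \<Longrightarrow> graph_deriv (\<lambda>x. f x + g x) x = graph_deriv f x + graph_deriv g x"
  by (rule conjunct2[OF graph_differentiableI[of "\<lambda>x. f x + g x"]])
     (simp add: graph_differentiable_def has_vector_derivative_add)

lemma graph_deriv_scale:
  "graph_differentiable f x \<Longrightarrow> graph_deriv (\<lambda>x. c * f x) x = c * graph_deriv f x"
  by (rule conjunct2[OF graph_differentiableI[of "\<lambda>x. c * f x"]])
     (simp add: graph_differentiable_def has_vector_derivative_mult_right)

text \<open>
  The derivatives of a function on the graph have no useful description at the vertices, so that their
  measurability has to be obtained from the complement of a finite set.
\<close>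

lemma borel_measurable_off_finite:
  fixes F G :: "'a \<Rightarrow> complex"
  assumes V: "finite V" and G: "G \<in> borel_measurable borel" and FG: "\<And>x. x \<notin> V \<Longrightarrow> F x = G x"
  shows "F \<in> borel_measurable borel"
proof -
  have "(\<lambda>x. if x \<in> V then \<Sum>v\<in>V. indicator {v} x * F v else G x) \<in> borel_measurable borel"
    using V G by (intro measurable_If_set borel_measurable_sum borel_measurable_times) (auto intro: borel_closed finite_imp_closed)
  moreover have "(if x \<in> V then \<Sum>v\<in>V. indicator {v} x * F v else G x) = F x" for x
  proof (cases "x \<in> V")
    case True
    have "(\<Sum>v\<in>V. indicator {v} x * F v) = (\<Sum>v\<in>V. if v = x then F v else 0)"
      by (rule sum.cong) (auto simp: indicator_def)
    then show ?thesis using V True by simp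
  qed (simp add: FG)
  ultimately show ?thesis by simp
qed

lemma borel_measurable_segmentation:
  fixes F :: "'a \<Rightarrow> complex"
  assumes V: "segmentation V \<E>" and \<gamma>: "\<And>E. E \<in> \<E> \<Longrightarrow> segment E (\<gamma> E) (l E)"
    and F: "\<And>E. E \<in> \<E> \<Longrightarrow> continuous_on {0<..<l E} (F \<circ> \<gamma> E)"
  shows "F \<in> borel_measurable borel"
proof (rule measurable_piecewise_restrict)
  let ?C = "\<E> \<union> (\<lambda>v. {v}) ` V"
  have fin: "finite V" "finite \<E>" "\<Union>\<E> = - V" using V by (auto simp: segmentation_def)
  show "countable ?C" using fin by (simp add: countable_finite)
  show "space borel \<subseteq> \<Union>?C" using fin by auto
  fix \<Omega> assume \<Omega>: "\<Omega> \<in> ?C"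
  have op: "open E" if "E \<in> \<E>" for E using \<gamma>[OF that] by (simp add: segment_def)
  show "\<Omega> \<inter> space borel \<in> sets borel" using \<Omega> op by auto
  have "continuous_on \<Omega> F"
  proof (cases "\<Omega> \<in> \<E>")
    case True
    have g: "isometric_param {0..l \<Omega>} (\<gamma> \<Omega>)" "\<Omega> = \<gamma> \<Omega> ` {0<..<l \<Omega>}" using \<gamma>[OF True] by (auto simp: segment_def)
    have memb: "\<exists>t\<in>{0<..<l \<Omega>}. x = \<gamma> \<Omega> t" if "x \<in> \<Omega>" for x
      using subsetD[OF equalityD1[OF g(2)] that] by blast
    have iso: "isometric_param {0<..<l \<Omega>} (\<gamma> \<Omega>)" by (rule isometric_param_subset[OF g(1)]) auto
    have inj: "inj_on (\<gamma> \<Omega>) {0<..<l \<Omega>}" by (rule isometric_param_inj[OF iso])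
    let ?\<tau> = "the_inv_into {0<..<l \<Omega>} (\<gamma> \<Omega>)"
    have \<tau>: "?\<tau> (\<gamma> \<Omega> t) = t" if "t \<in> {0<..<l \<Omega>}" for t using the_inv_into_f_f[OF inj that] .
    have c\<tau>: "continuous_on \<Omega> ?\<tau>"
      unfolding continuous_on_iff
    proof (intro ballI allI impI)
      fix x and e :: real assume x: "x \<in> \<Omega>" "0 < e"
      obtain s where s: "s \<in> {0<..<l \<Omega>}" "x = \<gamma> \<Omega> s" using memb[OF x(1)] by blast
      have "dist (?\<tau> y) (?\<tau> x) = dist y x" if y: "y \<in> \<Omega>" for y
      proof -
        obtain t where "t \<in> {0<..<l \<Omega>}" "y = \<gamma> \<Omega> t" using memb[OF y] by blast
        then show ?thesis using s \<tau> isometric_paramD[OF iso, of t s] by (simp add: dist_real_def)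
      qed
      then show "\<exists>d>0. \<forall>x'\<in>\<Omega>. dist x' x < d \<longrightarrow> dist (?\<tau> x') (?\<tau> x) < e" using x by auto
    qed
    have "?\<tau> x \<in> {0<..<l \<Omega>}" if xO: "x \<in> \<Omega>" for x
    proof -
      obtain t where "t \<in> {0<..<l \<Omega>}" "x = \<gamma> \<Omega> t" using memb[OF xO] by blast
      then show ?thesis using \<tau> by simp
    qed
    then have "?\<tau> ` \<Omega> \<subseteq> {0<..<l \<Omega>}" by (rule image_subsetI)
    then have "continuous_on \<Omega> (\<lambda>x. (F \<circ> \<gamma> \<Omega>) (?\<tau> x))"
      by (rule continuous_on_compose2[OF F[OF True] c\<tau>])
    moreover have "(F \<circ> \<gamma> \<Omega>) (?\<tau> x) = F x" if xO: "x \<in> \<Omega>" for x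
    proof -
      obtain t where "t \<in> {0<..<l \<Omega>}" "x = \<gamma> \<Omega> t" using memb[OF xO] by blast
      then show ?thesis using \<tau> by simp
    qed
    ultimately show ?thesis by (simp cong: continuous_on_cong)
  next
    case False
    then show ?thesis using \<Omega> by auto
  qed
  then show "F \<in> borel_measurable (restrict_space borel \<Omega>)" by (rule borel_measurable_continuous_on_restrict)
qed

lemma ZhD: "f \<in> Zh \<Longrightarrow> continuous_on UNIV f" "f \<in> Zh \<Longrightarrow> piecewise C2_on f"
  "f \<in> Zh \<Longrightarrow> integrable arc_length (graph_deriv2 f)"
  by (auto simp: Zh_def)

text \<open>
  The first derivative differs from its value at the midpoint by an integral of the second one, which
  is integrable up to the endpoints. The bound \<open>K\<close> on the integral of the second derivative is
  needed again for the integration by parts.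
\<close>

lemma Zh_deriv_bounded_on_segment:
  assumes f: "(f :: 'a \<Rightarrow> complex) \<in> Zh" and E: "segment E \<gamma> l" and C: "C2_on {0<..<l} (f \<circ> \<gamma>)"
  obtains B K where "\<And>t. t \<in> {0<..<l} \<Longrightarrow> norm (deriv1 (f \<circ> \<gamma>) t) \<le> B" "0 \<le> B" "0 \<le> K"
    "\<And>s t. \<lbrakk>0 < s; s \<le> t; t < l\<rbrakk> \<Longrightarrow> integral {s..t} (\<lambda>r. norm (deriv1 (deriv1 (f \<circ> \<gamma>)) r)) \<le> K"
proof -
  note p = segment_params[OF E]
  let ?h' = "deriv1 (f \<circ> \<gamma>)" and ?h'' = "deriv1 (deriv1 (f \<circ> \<gamma>))"
  note C' = C2_on_deriv[OF open_greaterThanLessThan C]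
  let ?G = "\<lambda>t. norm (graph_deriv2 f (\<gamma> t))"
  have meas: "graph_deriv2 f \<in> borel_measurable borel"
    using borel_measurable_integrable[OF ZhD(3)[OF f]] by simp
  have "set_integrable arc_length (\<gamma> ` {0..l}) (graph_deriv2 f)"
    unfolding set_integrable_def
    by (rule integrable_mult_indicator[OF _ ZhD(3)[OF f]]) (simp add: isometric_image_borel[OF p(3)])
  then have "set_integrable lborel {0..l} (\<lambda>t. graph_deriv2 f (\<gamma> t))"
    using integral_on_segment(2)[OF less_imp_le[OF p(4)] p(3) meas] by simp
  then have "set_integrable lborel {0..l} ?G" by (rule set_integrable_norm)
  then have G: "?G integrable_on {0..l}" using set_borel_integral_eq_integral(1) by blast
  have eq: "graph_deriv2 f (\<gamma> t) = ?h'' t" if "t \<in> {0<..<l}" for t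
    by (rule graph_deriv_on_segment[OF p(1,2) that refl]) (use C in blast)
  define K where "K = integral {0..l} ?G"
  have K0: "0 \<le> K" unfolding K_def by (rule Henstock_Kurzweil_Integration.integral_nonneg[OF G]) simp
  have K: "integral {s..t} (\<lambda>r. norm (?h'' r)) \<le> K" if st: "0 < s" "s \<le> t" "t < l" for s t
  proof -
    have "integral {s..t} (\<lambda>r. norm (?h'' r)) = integral {s..t} ?G"
      by (rule integral_cong) (use eq st in auto)
    also have "\<dots> \<le> K"
      unfolding K_def by (rule integral_subset_le) (use st G in \<open>auto intro: integrable_on_subinterval\<close>)
    finally show ?thesis .
  qed
  have cont: "continuous_on {s..t} ?h''" if "0 < s" "t < l" for s t
    by (rule continuous_on_subset[OF C'(3)]) (use that in auto)
  have diff: "norm (?h' t - ?h' s) \<le> K" if st: "0 < s" "s \<le> t" "t < l" for s t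
  proof -
    have "(?h'' has_integral (?h' t - ?h' s)) {s..t}"
    proof (rule fundamental_theorem_of_calculus[OF st(2)])
      fix r assume "r \<in> {s..t}"
      then have "r \<in> {0<..<l}" using st by auto
      then show "(?h' has_vector_derivative ?h'' r) (at r within {s..t})"
        by (rule has_vector_derivative_at_within[OF C'(2)])
    qed
    then have "norm (?h' t - ?h' s) = norm (integral {s..t} ?h'')" by (simp add: integral_unique)
    also have "\<dots> \<le> integral {s..t} (\<lambda>r. norm (?h'' r))"
      using cont[OF st(1,3)] by (intro integral_norm_bound_integral integrable_continuous_real continuous_on_norm) auto
    also have "\<dots> \<le> K" by (rule K[OF st])
    finally show ?thesis .
  qed
  have "norm (?h' t) \<le> norm (?h' (l / 2)) + K" if t: "t \<in> {0<..<l}" for t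
  proof -
    have "norm (?h' t - ?h' (l / 2)) \<le> K"
    proof (cases "t \<le> l / 2")
      case True
      then show ?thesis using diff[of t "l / 2"] t by (simp add: norm_minus_commute)
    next
      case False
      then show ?thesis using diff[of "l / 2" t] t by simp
    qed
    then show ?thesis by (metis add.commute norm_triangle_sub order_trans add_left_mono)
  qed
  then show ?thesis using that[of "norm (?h' (l / 2)) + K" K] K K0 by auto
qed

text \<open>
  The exceptional points of the members of \<open>S\<close> are finitely many, so one decomposition serves all of
  them.
\<close>

lemma Zh_adapted:
  assumes "finite S" "S \<subseteq> Zh" "finite F"
  obtains V \<E> \<gamma> l where "segmentation V \<E>" "F \<subseteq> V" "\<And>E. E \<in> \<E> \<Longrightarrow> segment E (\<gamma> E) (l E)"
    "\<And>E f. E \<in> \<E> \<Longrightarrow> f \<in> S \<Longrightarrow> C2_on {0<..<l E} (f \<circ> \<gamma> E)"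
proof -
  have "\<forall>f\<in>S. \<exists>X. finite X \<and> (\<forall>x. x \<notin> X \<longrightarrow> regular_point C2_on f x)"
    using assms(2) ZhD(2) piecewise_regular_points by (metis subsetD)
  then obtain X where X: "\<And>f. f \<in> S \<Longrightarrow> finite (X f)" "\<And>f x. f \<in> S \<Longrightarrow> x \<notin> X f \<Longrightarrow> regular_point C2_on f x"
    by metis
  obtain V \<E> where V: "segmentation V \<E>" "F \<union> \<Union>(X ` S) \<subseteq> V"
    using segmentation_exists[of "F \<union> \<Union>(X ` S)"] assms X(1) by blast
  obtain \<gamma> l where \<gamma>: "\<And>E. E \<in> \<E> \<Longrightarrow> segment E (\<gamma> E) (l E)" using segmentation_choice[OF V(1)] by blast
  have "C2_on {0<..<l E} (f \<circ> \<gamma> E)" if "E \<in> \<E>" "f \<in> S" for E f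
    by (rule segmentation_regular[OF local_regularity_C2 V(1) that(1) \<gamma>[OF that(1)]]) (use X(2) V(2) that in blast)
  moreover have "F \<subseteq> V" using V(2) by blast
  ultimately show ?thesis using that[of V \<E> \<gamma> l] V(1) \<gamma> by simp
qed

lemma segmentation_point:
  assumes V: "segmentation V \<E>" and \<gamma>: "\<And>E. E \<in> \<E> \<Longrightarrow> segment E (\<gamma> E) (l E)" and "x \<notin> V"
  obtains E t where "E \<in> \<E>" "t \<in> {0<..<l E}" "x = \<gamma> E t"
proof -
  obtain E where E: "E \<in> \<E>" "x \<in> E" using V assms(3) by (auto simp: segmentation_def)
  moreover have "E = \<gamma> E ` {0<..<l E}" using \<gamma>[OF E(1)] by (simp add: segment_def)
  ultimately show ?thesis using that by blast
qed

lemma Zh_deriv_bounded: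
  assumes f: "(f :: 'a \<Rightarrow> complex) \<in> Zh"
  obtains X B where "finite X" "\<And>x. x \<notin> X \<Longrightarrow> graph_differentiable f x" "\<And>x. x \<notin> X \<Longrightarrow> norm (graph_deriv f x) \<le> B"
    "\<And>x. x \<notin> X \<Longrightarrow> regular_point C2_on f x"
proof -
  obtain V \<E> \<gamma> l where V: "segmentation V \<E>" and \<gamma>: "\<And>E. E \<in> \<E> \<Longrightarrow> segment E (\<gamma> E) (l E)"
    and Cs: "\<And>E k. E \<in> \<E> \<Longrightarrow> k \<in> {f} \<Longrightarrow> C2_on {0<..<l E} (k \<circ> \<gamma> E)"
    by (rule Zh_adapted[of "{f}" "{}"]) (use f in auto)
  have C: "C2_on {0<..<l E} (f \<circ> \<gamma> E)" if "E \<in> \<E>" for E using Cs[OF that] by simp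
  have fin: "finite V" "finite \<E>" using V by (auto simp: segmentation_def)
  have "\<forall>E\<in>\<E>. \<exists>B. \<forall>t\<in>{0<..<l E}. norm (deriv1 (f \<circ> \<gamma> E) t) \<le> B \<and> 0 \<le> B"
    using Zh_deriv_bounded_on_segment[OF f \<gamma> C] by metis
  then obtain B where B: "\<And>E t. E \<in> \<E> \<Longrightarrow> t \<in> {0<..<l E} \<Longrightarrow> norm (deriv1 (f \<circ> \<gamma> E) t) \<le> B E \<and> 0 \<le> B E"
    by metis
  have "graph_differentiable f x \<and> norm (graph_deriv f x) \<le> (\<Sum>E\<in>\<E>. \<bar>B E\<bar>) \<and> regular_point C2_on f x" if x: "x \<notin> V" for x
  proof -
    obtain E t where E: "E \<in> \<E>" "t \<in> {0<..<l E}" "x = \<gamma> E t" using segmentation_point[OF V \<gamma> x] by blast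
    note p = segment_params[OF \<gamma>[OF E(1)]]
    have D: "((f \<circ> \<gamma> E) has_vector_derivative deriv1 (f \<circ> \<gamma> E) t) (at t)"
      by (rule C2_on_deriv(1)[OF open_greaterThanLessThan C[OF E(1)] E(2)])
    have "norm (graph_deriv f x) = norm (deriv1 (f \<circ> \<gamma> E) t)"
      by (rule graph_deriv_product(2)[OF p(1,2) E(2,3) D D])
    also have "\<dots> \<le> \<bar>B E\<bar>" using B[OF E(1,2)] by simp
    also have "\<dots> \<le> (\<Sum>E\<in>\<E>. \<bar>B E\<bar>)" using E(1) fin(2) by (intro member_le_sum) auto
    finally have "norm (graph_deriv f x) \<le> (\<Sum>E\<in>\<E>. \<bar>B E\<bar>)" .
    moreover have "graph_differentiable f x"
    proof -
      obtain \<epsilon> where "\<And>(f :: 'a \<Rightarrow> complex) d. ((f \<circ> \<gamma> E) has_vector_derivative d) (at t) \<Longrightarrow> ((\<lambda>t. f (move x t 1)) has_vector_derivative \<epsilon> *\<^sub>R d) (at 0)"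
        by (rule graph_deriv_on_segment[OF p(1,2) E(2,3)]) metis
      from graph_differentiableI[OF this[OF D]] show ?thesis by blast
    qed
    moreover have "regular_point C2_on f x" unfolding regular_point_def using p E C[OF E(1)] by blast
    ultimately show ?thesis by blast
  qed
  with fin(1) that show ?thesis by blast
qed

lemma integrable_deriv_product:
  assumes f: "(f :: 'a \<Rightarrow> complex) \<in> Zh" and g: "g \<in> Zh"
  shows "integrable arc_length (\<lambda>x. graph_deriv f x * cnj (graph_deriv g x))"
proof -
  interpret finite_measure "arc_length :: 'a measure" by (rule finite_measure_arc_length)
  obtain X B where X: "finite X" "\<And>x. x \<notin> X \<Longrightarrow> norm (graph_deriv f x) \<le> B"
    using Zh_deriv_bounded[OF f] by metis
  obtain Y C where Y: "finite Y" "\<And>x. x \<notin> Y \<Longrightarrow> norm (graph_deriv g x) \<le> C"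
    using Zh_deriv_bounded[OF g] by metis
  obtain V \<E> \<gamma> l where V: "segmentation V \<E>" and \<gamma>: "\<And>E. E \<in> \<E> \<Longrightarrow> segment E (\<gamma> E) (l E)"
    and C2: "\<And>E k. E \<in> \<E> \<Longrightarrow> k \<in> {f, g} \<Longrightarrow> C2_on {0<..<l E} (k \<circ> \<gamma> E)"
    by (rule Zh_adapted[of "{f, g}" "{}"]) (use f g in auto)
  have "(\<lambda>x. graph_deriv f x * cnj (graph_deriv g x)) \<in> borel_measurable borel"
  proof (rule borel_measurable_segmentation[OF V \<gamma>])
    fix E assume E: "E \<in> \<E>"
    note p = segment_params[OF \<gamma>[OF E]]
    have Ck: "\<And>k. k \<in> {f, g} \<Longrightarrow> C2_on {0<..<l E} (k \<circ> \<gamma> E)" using C2[OF E] .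
    have cont: "continuous_on {0<..<l E} (deriv1 (k \<circ> \<gamma> E))" if "k \<in> {f, g}" for k
      using C2_on_deriv(2)[OF open_greaterThanLessThan Ck[OF that]]
      by (intro continuous_at_imp_continuous_on ballI) (blast intro: has_vector_derivative_continuous)
    have "continuous_on {0<..<l E} (\<lambda>t. deriv1 (f \<circ> \<gamma> E) t * cnj (deriv1 (g \<circ> \<gamma> E) t))"
      by (intro continuous_intros cont) auto
    then show "continuous_on {0<..<l E} ((\<lambda>x. graph_deriv f x * cnj (graph_deriv g x)) \<circ> \<gamma> E)"
    proof (rule continuous_on_eq)
      fix t assume t: "t \<in> {0<..<l E}"
      have "graph_deriv f (\<gamma> E t) * cnj (graph_deriv g (\<gamma> E t)) = deriv1 (f \<circ> \<gamma> E) t * cnj (deriv1 (g \<circ> \<gamma> E) t)"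
        by (rule graph_deriv_product(1)[OF p(1,2) t refl
            C2_on_deriv(1)[OF open_greaterThanLessThan Ck t] C2_on_deriv(1)[OF open_greaterThanLessThan Ck t]]) auto
      then show "deriv1 (f \<circ> \<gamma> E) t * cnj (deriv1 (g \<circ> \<gamma> E) t) = ((\<lambda>x. graph_deriv f x * cnj (graph_deriv g x)) \<circ> \<gamma> E) t"
        unfolding comp_def by (rule sym)
    qed
  qed
  moreover have "AE x in arc_length. norm (graph_deriv f x * cnj (graph_deriv g x)) \<le> \<bar>B\<bar> * \<bar>C\<bar>"
    using AE_not_in_finite[OF X(1)] AE_not_in_finite[OF Y(1)]
  proof eventually_elim
    case (elim x)
    then have "norm (graph_deriv f x) \<le> \<bar>B\<bar>" "norm (graph_deriv g x) \<le> \<bar>C\<bar>" using X(2)[of x] Y(2)[of x] by auto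
    then show ?case by (simp add: norm_mult mult_mono)
  qed
  ultimately show ?thesis by (intro integrable_const_bound[of _ "\<bar>B\<bar> * \<bar>C\<bar>"]) auto
qed

lemma Zh_combine:
  assumes f: "(f :: 'a \<Rightarrow> complex) \<in> Zh" and g: "g \<in> Zh"
  shows "(\<lambda>x. c * f x + d * g x) \<in> Zh"
proof -
  let ?k = "\<lambda>x. c * f x + d * g x"
  obtain V \<E> \<gamma> l where V: "segmentation V \<E>" and \<gamma>: "\<And>E. E \<in> \<E> \<Longrightarrow> segment E (\<gamma> E) (l E)"
    and C2: "\<And>E k. E \<in> \<E> \<Longrightarrow> k \<in> {f, g} \<Longrightarrow> C2_on {0<..<l E} (k \<circ> \<gamma> E)"
    by (rule Zh_adapted[of "{f, g}" "{}"]) (use f g in auto)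
  have finV: "finite V" using V by (simp add: segmentation_def)
  have eq: "graph_deriv2 ?k x = c * graph_deriv2 f x + d * graph_deriv2 g x" if x: "x \<notin> V" for x
  proof -
    obtain E t where E: "E \<in> \<E>" "t \<in> {0<..<l E}" "x = \<gamma> E t" using segmentation_point[OF V \<gamma> x] by blast
    note p = segment_params[OF \<gamma>[OF E(1)]]
    have Cf: "C2_on {0<..<l E} (f \<circ> \<gamma> E)" and Cg: "C2_on {0<..<l E} (g \<circ> \<gamma> E)" using C2[OF E(1)] by auto
    note Df = C2_on_deriv[OF open_greaterThanLessThan Cf] and Dg = C2_on_deriv[OF open_greaterThanLessThan Cg]
    have Ck: "C2_on {0<..<l E} (?k \<circ> \<gamma> E)"
      using C2_on_add[OF C2_on_scale[OF Cf, of c] C2_on_scale[OF Cg, of d]] by (simp add: o_def)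
    have d1: "deriv1 (?k \<circ> \<gamma> E) s = c * deriv1 (f \<circ> \<gamma> E) s + d * deriv1 (g \<circ> \<gamma> E) s" if "s \<in> {0<..<l E}" for s
    proof (rule vector_derivative_at)
      have "((\<lambda>t. c * (f \<circ> \<gamma> E) t + d * (g \<circ> \<gamma> E) t) has_vector_derivative c * deriv1 (f \<circ> \<gamma> E) s + d * deriv1 (g \<circ> \<gamma> E) s) (at s)"
        by (intro has_vector_derivative_add has_vector_derivative_mult_right Df(1) Dg(1) that)
      then show "((?k \<circ> \<gamma> E) has_vector_derivative c * deriv1 (f \<circ> \<gamma> E) s + d * deriv1 (g \<circ> \<gamma> E) s) (at s)"
        by (simp add: o_def)
    qed
    have "(deriv1 (?k \<circ> \<gamma> E) has_vector_derivative c * deriv1 (deriv1 (f \<circ> \<gamma> E)) t + d * deriv1 (deriv1 (g \<circ> \<gamma> E)) t) (at t)"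
    proof (rule has_vector_derivative_cong_open[OF open_greaterThanLessThan E(2)])
      show "((\<lambda>s. c * deriv1 (f \<circ> \<gamma> E) s + d * deriv1 (g \<circ> \<gamma> E) s) has_vector_derivative
          c * deriv1 (deriv1 (f \<circ> \<gamma> E)) t + d * deriv1 (deriv1 (g \<circ> \<gamma> E)) t) (at t)"
        by (intro has_vector_derivative_add has_vector_derivative_mult_right Df(2) Dg(2) E(2))
    qed (simp add: d1)
    then have "deriv1 (deriv1 (?k \<circ> \<gamma> E)) t = c * deriv1 (deriv1 (f \<circ> \<gamma> E)) t + d * deriv1 (deriv1 (g \<circ> \<gamma> E)) t"
      by (rule vector_derivative_at)
    moreover have "graph_deriv2 f x = deriv1 (deriv1 (f \<circ> \<gamma> E)) t" if "C2_on {0<..<l E} (f \<circ> \<gamma> E)" for f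
      by (rule graph_deriv_on_segment[OF p(1,2) E(2,3)]) (use that in blast)
    ultimately show ?thesis using Cf Cg Ck by simp
  qed
  let ?G = "\<lambda>x. c * graph_deriv2 f x + d * graph_deriv2 g x"
  have intG: "integrable arc_length ?G" using ZhD(3)[OF f] ZhD(3)[OF g] by simp
  have Gm: "?G \<in> borel_measurable borel" using borel_measurable_integrable[OF intG] by simp
  have "graph_deriv2 ?k \<in> borel_measurable borel" by (rule borel_measurable_off_finite[OF finV Gm eq])
  then have m: "graph_deriv2 ?k \<in> borel_measurable arc_length" by simp
  have ae: "AE x in arc_length. ?G x = graph_deriv2 ?k x"
    using AE_not_in_finite[OF finV] by eventually_elim (simp add: eq)
  have "integrable arc_length (graph_deriv2 ?k)"
    by (rule integrable_cong_AE_imp[OF intG m ae])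
  moreover have "piecewise C2_on ?k"
    by (rule piecewise_combine[OF local_regularity_C2 ZhD(2)[OF f] ZhD(2)[OF g]])
       (intro C2_on_add C2_on_scale)
  moreover have "continuous_on UNIV ?k" using ZhD(1)[OF f] ZhD(1)[OF g] by (intro continuous_intros)
  ultimately show ?thesis by (simp add: Zh_def)
qed

lemma CPA_D: "f \<in> CPA \<Longrightarrow> continuous_on UNIV f" "f \<in> CPA \<Longrightarrow> piecewise affine_fun_on f"
  by (auto simp: CPA_def)

lemma CPA_subset_Zh: "CPA \<subseteq> (Zh :: ('a \<Rightarrow> complex) set)"
proof
  fix f :: "'a \<Rightarrow> complex" assume f: "f \<in> CPA"
  obtain X where X: "finite X" "\<And>x. x \<notin> X \<Longrightarrow> regular_point affine_fun_on f x"
    using piecewise_regular_points[OF CPA_D(2)[OF f]] by metis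
  have zero: "graph_deriv2 f x = 0" if x: "x \<notin> X" for x
  proof -
    obtain a b c \<gamma> where g: "isometric_param {a<..<b} \<gamma>" "open (\<gamma> ` {a<..<b})" "c \<in> {a<..<b}" "x = \<gamma> c"
      and A: "affine_fun_on {a<..<b} (f \<circ> \<gamma>)" using X(2)[OF x] unfolding regular_point_def by blast
    obtain \<alpha> \<beta> where ab: "\<And>t. t \<in> {a<..<b} \<Longrightarrow> (f \<circ> \<gamma>) t = \<alpha> + \<beta> * of_real t"
      using A unfolding affine_fun_on_def by blast
    have d1: "deriv1 (f \<circ> \<gamma>) t = \<beta>" if "t \<in> {a<..<b}" for t
      by (rule vector_derivative_at, rule has_vector_derivative_cong_open[OF open_greaterThanLessThan that _ has_vector_derivative_affine[of \<alpha>]])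
         (simp add: ab[unfolded o_def])
    have "(deriv1 (f \<circ> \<gamma>) has_vector_derivative 0) (at c)"
    proof (rule has_vector_derivative_cong_open[OF open_greaterThanLessThan g(3)])
      show "\<beta> = deriv1 (f \<circ> \<gamma>) s" if "s \<in> {a<..<b}" for s by (rule d1[OF that, symmetric])
    qed (rule has_vector_derivative_const)
    then have "deriv1 (deriv1 (f \<circ> \<gamma>)) c = 0" by (rule vector_derivative_at)
    moreover have "graph_deriv2 f x = deriv1 (deriv1 (f \<circ> \<gamma>)) c"
      by (rule graph_deriv_on_segment[OF g]) (use affine_imp_C2_on[OF A] in blast)
    ultimately show ?thesis by simp
  qed
  have "graph_deriv2 f \<in> borel_measurable borel"
    by (rule borel_measurable_off_finite[OF X(1), of "\<lambda>_. 0"]) (auto simp: zero)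
  then have m: "graph_deriv2 f \<in> borel_measurable arc_length" by simp
  have ae: "AE x in arc_length. 0 = graph_deriv2 f x"
    using AE_not_in_finite[OF X(1)] by eventually_elim (simp add: zero)
  have "integrable arc_length (graph_deriv2 f)"
    by (rule integrable_cong_AE_imp[OF integrable_zero m ae])
  moreover have "piecewise C2_on f"
    using piecewise_combine[OF local_regularity_affine CPA_D(2)[OF f] CPA_D(2)[OF f], of C2_on "\<lambda>h k. h"] affine_imp_C2_on
    by simp
  ultimately show "f \<in> Zh" using CPA_D(1)[OF f] by (simp add: Zh_def)
qed

lemma CPA_combine:
  assumes f: "(f :: 'a \<Rightarrow> complex) \<in> CPA" and g: "g \<in> CPA"
  shows "(\<lambda>x. c * f x + d * g x) \<in> CPA"
proof -
  have "piecewise affine_fun_on (\<lambda>x. c * f x + d * g x)"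
    by (rule piecewise_combine[OF local_regularity_affine CPA_D(2)[OF f] CPA_D(2)[OF g]])
       (intro affine_fun_on_add affine_fun_on_scale)
  moreover have "continuous_on UNIV (\<lambda>x. c * f x + d * g x)"
    using CPA_D(1)[OF f] CPA_D(1)[OF g] by (intro continuous_intros)
  ultimately show ?thesis by (simp add: CPA_def)
qed

lemma const_CPA: "(\<lambda>x::'a. c) \<in> CPA"
proof -
  obtain V \<E> where V: "segmentation V \<E>" and "({} :: 'a set) \<subseteq> V"
    by (rule segmentation_exists[of "{}"]) simp
  have "piecewise affine_fun_on (\<lambda>x::'a. c)"
  proof (rule piecewise_segmentation[OF V])
    fix E assume "E \<in> \<E>"
    then obtain \<gamma> l where g: "segment E \<gamma> l" using V by (auto simp: segmentation_def)
    have "affine_fun_on {0<..<l} ((\<lambda>x::'a. c) \<circ> \<gamma>)"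
      unfolding affine_fun_on_def by (intro exI[of _ c] exI[of _ 0]) simp
    with g show "\<exists>\<gamma> l. segment E \<gamma> l \<and> affine_fun_on {0<..<l} ((\<lambda>x. c) \<circ> \<gamma>)" by blast
  qed
  then show ?thesis by (simp add: CPA_def)
qed

end

context graph
begin

lemma integral_deriv_cong:
  assumes "finite X" "\<And>x. x \<notin> X \<Longrightarrow> F x = G x" "integrable arc_length F" "integrable arc_length G"
  shows "(LINT x|arc_length. F x) = (LINT x|(arc_length :: 'a measure). G x :: complex)"
proof (rule integral_cong_AE)
  show "AE x in arc_length. F x = G x"
    using AE_not_in_finite[OF assms(1)] by eventually_elim (simp add: assms(2))
qed (use assms in \<open>auto intro: borel_measurable_integrable\<close>)

lemma Dir_inner_Zh_add:
  assumes "(f :: 'a \<Rightarrow> complex) \<in> Zh" "g \<in> Zh" "h \<in> Zh"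
  shows "Dir_inner_Zh (\<lambda>x. f x + g x) h = Dir_inner_Zh f h + Dir_inner_Zh g h"
proof -
  obtain X where X: "finite X" "\<And>x. x \<notin> X \<Longrightarrow> graph_differentiable f x" using Zh_deriv_bounded[OF assms(1)] by metis
  obtain Y where Y: "finite Y" "\<And>x. x \<notin> Y \<Longrightarrow> graph_differentiable g x" using Zh_deriv_bounded[OF assms(2)] by metis
  have fg: "(\<lambda>x. f x + g x) \<in> Zh" using Zh_combine[OF assms(1,2), of 1 1] by simp
  note I = integrable_deriv_product[OF assms(1,3)] integrable_deriv_product[OF assms(2,3)]
  have "Dir_inner_Zh (\<lambda>x. f x + g x) h =
      (LINT x|arc_length. graph_deriv f x * cnj (graph_deriv h x) + graph_deriv g x * cnj (graph_deriv h x))"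
    unfolding Dir_inner_Zh_def
    by (rule integral_deriv_cong[of "X \<union> Y"])
       (use X Y I integrable_deriv_product[OF fg assms(3)] in \<open>auto simp: graph_deriv_add distrib_right\<close>)
  then show ?thesis unfolding Dir_inner_Zh_def by (simp add: I)
qed

lemma Dir_inner_Zh_scale:
  assumes "(f :: 'a \<Rightarrow> complex) \<in> Zh" "h \<in> Zh"
  shows "Dir_inner_Zh (\<lambda>x. c * f x) h = c * Dir_inner_Zh f h"
proof -
  obtain X where X: "finite X" "\<And>x. x \<notin> X \<Longrightarrow> graph_differentiable f x" using Zh_deriv_bounded[OF assms(1)] by metis
  have cf: "(\<lambda>x. c * f x) \<in> Zh" using Zh_combine[OF assms(1,1), of c 0] by simp
  have "Dir_inner_Zh (\<lambda>x. c * f x) h = (LINT x|arc_length. c * (graph_deriv f x * cnj (graph_deriv h x)))"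
    unfolding Dir_inner_Zh_def
    by (rule integral_deriv_cong[of X])
       (use X integrable_deriv_product[OF assms] integrable_deriv_product[OF cf assms(2)] in \<open>auto simp: graph_deriv_scale\<close>)
  then show ?thesis unfolding Dir_inner_Zh_def by simp
qed

sublocale Zh: semi_inner scale_fun "Zh :: ('a \<Rightarrow> complex) set" Dir_inner_Zh
proof unfold_locales
  show "fun_vs.subspace (Zh :: ('a \<Rightarrow> complex) set)"
    unfolding fun_vs.subspace_def
  proof (intro conjI ballI allI)
    show "0 \<in> (Zh :: ('a \<Rightarrow> complex) set)"
      using CPA_subset_Zh const_CPA[of 0] by (auto simp: zero_fun_def)
    fix f g :: "'a \<Rightarrow> complex" and c assume f: "f \<in> Zh"
    show "scale_fun c f \<in> Zh" using Zh_combine[OF f f, of c 0] by (simp add: scale_fun_def)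
    assume "g \<in> Zh"
    then show "f + g \<in> Zh" using Zh_combine[OF f, of g 1 1] by (simp add: plus_fun_def)
  qed
  fix f g h :: "'a \<Rightarrow> complex" and c
  show "f \<in> Zh \<Longrightarrow> g \<in> Zh \<Longrightarrow> h \<in> Zh \<Longrightarrow> Dir_inner_Zh (f + g) h = Dir_inner_Zh f h + Dir_inner_Zh g h"
    unfolding plus_fun_def by (rule Dir_inner_Zh_add)
  show "f \<in> Zh \<Longrightarrow> h \<in> Zh \<Longrightarrow> Dir_inner_Zh (scale_fun c f) h = c * Dir_inner_Zh f h"
    unfolding scale_fun_def by (rule Dir_inner_Zh_scale)
  show "cnj (Dir_inner_Zh f g) = Dir_inner_Zh g f"
    unfolding Dir_inner_Zh_def
    using Bochner_Integration.integral_cnj[of arc_length "\<lambda>x. graph_deriv f x * cnj (graph_deriv g x)"]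
    by (simp add: mult.commute del: Bochner_Integration.integral_cnj)
  assume f: "f \<in> Zh"
  have "Re (Dir_inner_Zh f f) = (LINT x|arc_length. Re (graph_deriv f x * cnj (graph_deriv f x)))"
    using integral_Re[OF integrable_deriv_product[OF f f]] by (simp only: Dir_inner_Zh_def)
  moreover have "0 \<le> (LINT x|arc_length. Re (graph_deriv f x * cnj (graph_deriv f x)))"
    by (rule Bochner_Integration.integral_nonneg) simp
  ultimately show "0 \<le> Re (Dir_inner_Zh f f)" by simp
qed

lemma differentiable_at_regular_point:
  assumes \<gamma>: "isometric_param {a<..<b} \<gamma>" "t \<in> {a<..<b}" and x: "regular_point C2_on f (\<gamma> t)"
  shows "((f \<circ> \<gamma>) has_vector_derivative deriv1 (f \<circ> \<gamma>) t) (at t)"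
proof -
  define \<rho> where "\<rho> = min (t - a) (b - t)"
  have \<rho>: "0 < \<rho>" "\<rho> \<le> t - a" "\<rho> \<le> b - t" using \<gamma>(2) by (simp_all add: \<rho>_def)
  have iso: "isometric_param {-\<rho><..<\<rho>} (\<lambda>s. \<gamma> (t + s))"
    by (rule isometric_param_shift[OF \<gamma>(1)]) (use \<rho> in auto)
  obtain \<delta> where d: "0 < \<delta>" "C2_on {-\<delta><..<\<delta>} (f \<circ> (\<lambda>s. \<gamma> (t + s)))"
    by (rule regular_point_param[OF local_regularity_C2 x iso \<rho>(1)]) auto
  have "((f \<circ> (\<lambda>s. \<gamma> (t + s))) has_vector_derivative deriv1 (f \<circ> (\<lambda>s. \<gamma> (t + s))) 0) (at (- t + 1 * t))"
    using C2_on_deriv(1)[OF open_greaterThanLessThan d(2), of 0] d(1) by simp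
  from has_vector_derivative_reparam[OF this]
  have "((f \<circ> \<gamma>) has_vector_derivative deriv1 (f \<circ> (\<lambda>s. \<gamma> (t + s))) 0) (at t)" by (simp add: o_def)
  then show ?thesis using vector_derivative_at by metis
qed

lemma finite_parameters_in_finite:
  "isometric_param I \<gamma> \<Longrightarrow> finite X \<Longrightarrow> finite {t \<in> I. \<gamma> t \<in> X}"
  using finite_vimage_IntI[OF _ isometric_param_inj] by (auto simp: vimage_def Int_def conj_commute)

lemma deriv_product_integrable_on_segment:
  assumes f: "(f :: 'a \<Rightarrow> complex) \<in> Zh" and h: "h \<in> Zh" and l: "0 < l" and iso: "isometric_param {0..l} \<gamma>"
  defines "F \<equiv> \<lambda>x. graph_deriv f x * cnj (graph_deriv h x)"
  shows "(\<lambda>t. F (\<gamma> t)) integrable_on {0..l}"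
    and "(LINT x:\<gamma> ` {0..l}|arc_length. F x) = integral {0..l} (\<lambda>t. F (\<gamma> t))"
    and "(LINT t:{0..l}|lborel. F (\<gamma> t)) = integral {0..l} (\<lambda>t. F (\<gamma> t))"
    and "set_integrable arc_length (\<gamma> ` {0..l}) F"
proof -
  have I: "integrable arc_length F" unfolding F_def by (rule integrable_deriv_product[OF f h])
  have m: "F \<in> borel_measurable borel" using borel_measurable_integrable[OF I] by simp
  show SI: "set_integrable arc_length (\<gamma> ` {0..l}) F"
    unfolding set_integrable_def
    by (rule integrable_mult_indicator[OF _ I]) (simp add: isometric_image_borel[OF iso])
  have S: "set_integrable lborel {0..l} (\<lambda>t. F (\<gamma> t))"
    using integral_on_segment(2)[OF less_imp_le[OF l] iso m] SI by simp
  show "(\<lambda>t. F (\<gamma> t)) integrable_on {0..l}" by (rule set_borel_integral_eq_integral(1)[OF S])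
  show e: "(LINT t:{0..l}|lborel. F (\<gamma> t)) = integral {0..l} (\<lambda>t. F (\<gamma> t))"
    by (rule set_borel_integral_eq_integral(2)[OF S])
  show "(LINT x:\<gamma> ` {0..l}|arc_length. F x) = integral {0..l} (\<lambda>t. F (\<gamma> t))"
    using integral_on_segment(1)[OF less_imp_le[OF l] iso m] e by simp
qed

text \<open>
  The derivative of \<open>h\<close> is the constant \<open>\<beta>\<close>, so the fundamental theorem of calculus applies to
  \<open>f\<close>, in the version for continuous functions that are differentiable off a finite set.
\<close>

lemma integral_deriv_affine:
  assumes f: "(f :: 'a \<Rightarrow> complex) \<in> Zh" and h: "h \<in> Zh" and l: "0 < l"
    and iso: "isometric_param {0..l} \<gamma>" and op: "open (\<gamma> ` {0<..<l})"
    and aff: "\<And>t. t \<in> {0<..<l} \<Longrightarrow> h (\<gamma> t) = \<alpha> + \<beta> * of_real t"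
  shows "integral {0..l} (\<lambda>t. graph_deriv f (\<gamma> t) * cnj (graph_deriv h (\<gamma> t))) = cnj \<beta> * (f (\<gamma> l) - f (\<gamma> 0))"
proof -
  have iso': "isometric_param {0<..<l} \<gamma>" by (rule isometric_param_subset[OF iso]) auto
  obtain X where X: "finite X" "\<And>x. x \<notin> X \<Longrightarrow> regular_point C2_on f x" using Zh_deriv_bounded[OF f] by metis
  let ?Y = "{t \<in> {0..l}. \<gamma> t \<in> X}"
  have "((\<lambda>t. graph_deriv f (\<gamma> t) * cnj (graph_deriv h (\<gamma> t))) has_integral
      (f (\<gamma> l) * cnj \<beta> - f (\<gamma> 0) * cnj \<beta>)) {0..l}"
  proof (rule fundamental_theorem_of_calculus_interior_strong[OF finite_parameters_in_finite[OF iso X(1)]])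
    show "0 \<le> l" using l by simp
    show "continuous_on {0..l} (\<lambda>t. f (\<gamma> t) * cnj \<beta>)"
      by (intro continuous_on_mult_right continuous_on_compose2[OF ZhD(1)[OF f] isometric_param_continuous[OF iso]]) auto
    fix t assume t: "t \<in> {0<..<l} - ?Y"
    then have t': "t \<in> {0<..<l}" and "\<gamma> t \<notin> X" by auto
    have d: "((f \<circ> \<gamma>) has_vector_derivative deriv1 (f \<circ> \<gamma>) t) (at t)"
      by (rule differentiable_at_regular_point[OF iso' t' X(2)[OF \<open>\<gamma> t \<notin> X\<close>]])
    have e: "((h \<circ> \<gamma>) has_vector_derivative \<beta>) (at t)"
      by (rule has_vector_derivative_cong_open[OF open_greaterThanLessThan t' _ has_vector_derivative_affine[of \<alpha>]])
         (simp add: aff)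
    have "graph_deriv f (\<gamma> t) * cnj (graph_deriv h (\<gamma> t)) = deriv1 (f \<circ> \<gamma>) t * cnj \<beta>"
      by (rule graph_deriv_product(1)[OF iso' op t' refl d e])
    moreover have "((\<lambda>t. (f \<circ> \<gamma>) t * cnj \<beta>) has_vector_derivative deriv1 (f \<circ> \<gamma>) t * cnj \<beta>) (at t)"
      by (rule has_vector_derivative_mult_left[OF d])
    ultimately show "((\<lambda>t. f (\<gamma> t) * cnj \<beta>) has_vector_derivative graph_deriv f (\<gamma> t) * cnj (graph_deriv h (\<gamma> t))) (at t)"
      unfolding comp_apply by simp
  qed
  then show ?thesis by (simp add: integral_unique algebra_simps)
qed

text \<open>
  From \<open>|u'| \<le> (|u'|\<^sup>2 + 1) / 2\<close>. The bound is not homogeneous; it is applied to differences of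
  reproducing kernels, for which the left-hand side is itself the square of the norm.
\<close>

lemma Zh_increment_le:
  assumes u: "(u :: 'a \<Rightarrow> complex) \<in> Zh" and l: "0 < l"
    and iso: "isometric_param {0..l} \<gamma>" and op: "open (\<gamma> ` {0<..<l})"
  shows "norm (u (\<gamma> l) - u (\<gamma> 0)) \<le> ((Zh.nrm u)\<^sup>2 + l) / 2"
proof -
  have iso': "isometric_param {0<..<l} \<gamma>" by (rule isometric_param_subset[OF iso]) auto
  obtain X where X: "finite X" "\<And>x. x \<notin> X \<Longrightarrow> regular_point C2_on u x" using Zh_deriv_bounded[OF u] by metis
  let ?Y = "{t \<in> {0..l}. \<gamma> t \<in> X}"
  define F where "F = (\<lambda>x. graph_deriv u x * cnj (graph_deriv u x))"
  define G where "G = (\<lambda>t. Re (F (\<gamma> t)))"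
  define k where "k t = (if t \<in> {0<..<l} - ?Y then deriv1 (u \<circ> \<gamma>) t else 0)" for t
  have P: "(\<lambda>t. F (\<gamma> t)) integrable_on {0..l}"
    "(LINT x:\<gamma> ` {0..l}|arc_length. F x) = integral {0..l} (\<lambda>t. F (\<gamma> t))"
    "set_integrable arc_length (\<gamma> ` {0..l}) F"
    unfolding F_def by (rule deriv_product_integrable_on_segment[OF u u l iso])+
  have G0: "0 \<le> G t" for t by (simp add: G_def F_def)
  have Gi: "G integrable_on {0..l}"
    unfolding G_def using integrable_linear[OF P(1) bounded_linear_Re] by (simp only: o_def)
  have "(k has_integral ((u \<circ> \<gamma>) l - (u \<circ> \<gamma>) 0)) {0..l}"
  proof (rule fundamental_theorem_of_calculus_interior_strong[OF finite_parameters_in_finite[OF iso X(1)]])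
    show "0 \<le> l" using l by simp
    show "continuous_on {0..l} (u \<circ> \<gamma>)"
      using continuous_on_compose2[OF ZhD(1)[OF u] isometric_param_continuous[OF iso]] by (simp add: o_def)
    fix t assume t: "t \<in> {0<..<l} - ?Y"
    then have "t \<in> {0<..<l}" "\<gamma> t \<notin> X" by auto
    then show "((u \<circ> \<gamma>) has_vector_derivative k t) (at t)"
      using differentiable_at_regular_point[OF iso' _ X(2)] t unfolding k_def by (simp only: if_True)
  qed
  \<comment> \<open>The square \<open>(norm (k t) - 1)\<^sup>2\<close> is nonnegative.\<close>
  moreover have "norm (k t) \<le> (G t + 1) / 2" for t
  proof (cases "t \<in> {0<..<l} - ?Y")
    case True
    then have t': "t \<in> {0<..<l}" and "\<gamma> t \<notin> X" by auto
    have d: "((u \<circ> \<gamma>) has_vector_derivative deriv1 (u \<circ> \<gamma>) t) (at t)"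
      by (rule differentiable_at_regular_point[OF iso' t' X(2)[OF \<open>\<gamma> t \<notin> X\<close>]])
    have "F (\<gamma> t) = k t * cnj (k t)"
      unfolding F_def k_def using True graph_deriv_product(1)[OF iso' op t' refl d d] by (simp only: if_True)
    then have "G t = (norm (k t))\<^sup>2" by (simp add: G_def complex_norm_square[symmetric] del: of_real_power)
    then show ?thesis using zero_le_power2[of "norm (k t) - 1"] by (simp add: power2_eq_square algebra_simps)
  next
    case False
    have "0 \<le> (G t + 1) / 2" using G0[of t] by simp
    then show ?thesis unfolding k_def using False by (simp only: if_False norm_zero)
  qed
  moreover have half: "((\<lambda>t. (G t + 1) / 2) has_integral (integral {0..l} G + l) / 2) {0..l}"
  proof -
    have "((\<lambda>t. (1 / 2) *\<^sub>R (G t + 1)) has_integral (1 / 2) *\<^sub>R (integral {0..l} G + measure lborel {0..l} *\<^sub>R 1)) {0..l}"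
      by (intro has_integral_cmul has_integral_add integrable_integral Gi has_integral_const_real)
    then show ?thesis using l by simp
  qed
  ultimately have "norm ((u \<circ> \<gamma>) l - (u \<circ> \<gamma>) 0) \<le> integral {0..l} (\<lambda>t. (G t + 1) / 2)"
    using integral_norm_bound_integral[of k "{0..l}" "\<lambda>t. (G t + 1) / 2"]
    by (metis has_integral_integrable integral_unique)
  also have "\<dots> = (integral {0..l} G + l) / 2"
    by (rule integral_unique[OF half])
  also have "integral {0..l} G = Re (LINT x:\<gamma> ` {0..l}|arc_length. F x)"
    unfolding P(2) G_def using integral_linear[OF P(1) bounded_linear_Re] by (simp add: o_def)
  also have "\<dots> = (LINT x|arc_length. Re (indicator (\<gamma> ` {0..l}) x *\<^sub>R F x))"
    using P(3) unfolding set_lebesgue_integral_def set_integrable_def by (rule integral_Re[symmetric])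
  also have "\<dots> \<le> (LINT x|arc_length. Re (F x))"
  proof (rule integral_mono)
    show "integrable arc_length (\<lambda>x. Re (indicator (\<gamma> ` {0..l}) x *\<^sub>R F x))"
      using P(3) unfolding set_integrable_def by (rule integrable_Re)
    show "integrable arc_length (\<lambda>x. Re (F x))"
      unfolding F_def by (rule integrable_Re[OF integrable_deriv_product[OF u u]])
  qed (auto simp: indicator_def F_def)
  also have "\<dots> = (Zh.nrm u)\<^sup>2"
    unfolding Zh.nrm_sq[OF u] Dir_inner_Zh_def F_def by (rule integral_Re[OF integrable_deriv_product[OF u u]])
  finally show ?thesis by (simp add: divide_right_mono)
qed

text \<open>
  Integration by parts moves the derivative from \<open>u\<close> to \<open>v\<close>, so that \<open>u\<close> enters only through its size.
  The derivative of \<open>v\<close> need not extend to the endpoints; therefore this is done on compact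
  subintervals \<open>[s, t]\<close> of the open segment, with constants that do not depend on \<open>s\<close> and \<open>t\<close>.
\<close>

lemma Zh_parts_on_segment:
  assumes u: "(u :: 'a \<Rightarrow> complex) \<in> Zh" and v: "v \<in> Zh" and E: "segment E \<gamma> l" and C: "C2_on {0<..<l} (v \<circ> \<gamma>)"
    and B: "\<And>t. t \<in> {0<..<l} \<Longrightarrow> norm (deriv1 (v \<circ> \<gamma>) t) \<le> B"
    and K: "\<And>s t. \<lbrakk>0 < s; s \<le> t; t < l\<rbrakk> \<Longrightarrow> integral {s..t} (\<lambda>r. norm (deriv1 (deriv1 (v \<circ> \<gamma>)) r)) \<le> K"
    and \<epsilon>: "\<And>x. norm (u x) \<le> \<epsilon>"
  shows "norm (integral {0..l} (\<lambda>t. graph_deriv u (\<gamma> t) * cnj (graph_deriv v (\<gamma> t)))) \<le> (2 * B + K) * \<epsilon>"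
proof -
  note p = segment_params[OF E]
  let ?g' = "deriv1 (v \<circ> \<gamma>)" and ?g'' = "deriv1 (deriv1 (v \<circ> \<gamma>))" and ?w = "u \<circ> \<gamma>"
  note C' = C2_on_deriv[OF open_greaterThanLessThan C]
  define P where "P = (\<lambda>t. graph_deriv u (\<gamma> t) * cnj (graph_deriv v (\<gamma> t)))"
  have Pi: "P integrable_on {0..l}"
    unfolding P_def by (rule deriv_product_integrable_on_segment(1)[OF u v p(4,3)])
  obtain X where X: "finite X" "\<And>x. x \<notin> X \<Longrightarrow> regular_point C2_on u x" using Zh_deriv_bounded[OF u] by metis
  let ?Y = "{t \<in> {0..l}. \<gamma> t \<in> X}"
  have \<epsilon>0: "0 \<le> \<epsilon>" using \<epsilon>[of undefined] norm_ge_zero order_trans by blast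
  have wc: "continuous_on {0..l} ?w"
    using continuous_on_compose2[OF ZhD(1)[OF u] isometric_param_continuous[OF p(3)]] by (simp add: o_def)
  have g'c: "continuous_on {0<..<l} ?g'"
    by (intro continuous_at_imp_continuous_on ballI) (rule has_vector_derivative_continuous[OF C'(2)])
  have bound: "norm (integral {s..t} P) \<le> (2 * B + K) * \<epsilon>" if st: "0 < s" "s \<le> t" "t < l" for s t
  proof -
    have sub: "{s..t} \<subseteq> {0<..<l}" "{s..t} \<subseteq> {0..l}" using st by auto
    let ?Q = "\<lambda>r. ?w r * cnj (?g' r)" and ?q = "\<lambda>r. ?w r * cnj (?g'' r)"
    have qc: "continuous_on {s..t} ?q"
      by (intro continuous_on_mult continuous_on_cnj continuous_on_subset[OF wc sub(2)] continuous_on_subset[OF C'(3) sub(1)])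
    have "((\<lambda>r. ?q r + P r) has_integral (?Q t - ?Q s)) {s..t}"
    proof (rule fundamental_theorem_of_calculus_interior_strong[OF finite_parameters_in_finite[OF p(3) X(1)] st(2)])
      show "continuous_on {s..t} ?Q"
        by (intro continuous_on_mult continuous_on_cnj continuous_on_subset[OF wc sub(2)] continuous_on_subset[OF g'c sub(1)])
      fix r assume r: "r \<in> {s<..<t} - ?Y"
      have r': "r \<in> {0<..<l}" and rX: "\<gamma> r \<notin> X" using r st by auto
      have d: "(?w has_vector_derivative deriv1 ?w r) (at r)"
        by (rule differentiable_at_regular_point[OF p(1) r' X(2)[OF rX]])
      have "P r = deriv1 ?w r * cnj (?g' r)"
        unfolding P_def by (rule graph_deriv_product(1)[OF p(1,2) r' refl d C'(1)[OF r']])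
      moreover have "((\<lambda>r. ?w r * cnj (?g' r)) has_vector_derivative (?w r * cnj (?g'' r) + deriv1 ?w r * cnj (?g' r))) (at r)"
        by (rule has_vector_derivative_mult[OF d has_vector_derivative_cnj[OF C'(2)[OF r']]])
      ultimately show "(?Q has_vector_derivative ?q r + P r) (at r)" by simp
    qed
    then have "((\<lambda>r. ?q r + P r - ?q r) has_integral (?Q t - ?Q s - integral {s..t} ?q)) {s..t}"
      by (rule has_integral_diff) (rule integrable_integral[OF integrable_continuous_real[OF qc]])
    then have "(P has_integral (?Q t - ?Q s - integral {s..t} ?q)) {s..t}" by (simp only: add_diff_cancel_left')
    then have eq: "integral {s..t} P = ?Q t - ?Q s - integral {s..t} ?q" by (rule integral_unique)
    have Q: "norm (?Q r) \<le> \<epsilon> * B" if "r \<in> {s..t}" for r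
      unfolding norm_mult complex_mod_cnj
      by (rule mult_mono) (use \<epsilon>[of "\<gamma> r"] B[of r] \<epsilon>0 that sub(1) in auto)
    have g''c: "continuous_on {s..t} (\<lambda>r. norm (?g'' r))"
      by (intro continuous_on_norm continuous_on_subset[OF C'(3) sub(1)])
    have "norm (integral {s..t} ?q) \<le> integral {s..t} (\<lambda>r. \<epsilon> * norm (?g'' r))"
    proof (rule integral_norm_bound_integral)
      show "?q integrable_on {s..t}" by (rule integrable_continuous_real[OF qc])
      show "(\<lambda>r. \<epsilon> * norm (?g'' r)) integrable_on {s..t}"
        by (intro integrable_continuous_real continuous_on_mult_left g''c)
      show "norm (?q r) \<le> \<epsilon> * norm (?g'' r)" for r
        unfolding norm_mult complex_mod_cnj by (rule mult_right_mono) (use \<epsilon>[of "\<gamma> r"] in auto)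
    qed
    also have "\<dots> = \<epsilon> * integral {s..t} (\<lambda>r. norm (?g'' r))" by simp
    also have "\<dots> \<le> \<epsilon> * K" by (rule mult_left_mono[OF K[OF st] \<epsilon>0])
    finally have q: "norm (integral {s..t} ?q) \<le> \<epsilon> * K" .
    have "norm (integral {s..t} P) \<le> norm (?Q t - ?Q s) + norm (integral {s..t} ?q)"
      unfolding eq by (rule norm_triangle_ineq4)
    also have "norm (?Q t - ?Q s) \<le> norm (?Q t) + norm (?Q s)" by (rule norm_triangle_ineq4)
    finally have "norm (integral {s..t} P) \<le> \<epsilon> * B + \<epsilon> * B + \<epsilon> * K"
      using Q[of t] Q[of s] q st(2) by (smt (verit) atLeastAtMost_iff)
    then show ?thesis by (simp add: algebra_simps)
  qed
  define \<phi> where "\<phi> x = integral {0..x} P" for x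
  have \<phi>c: "continuous_on {0..l} \<phi>" unfolding \<phi>_def by (rule indefinite_integral_continuous_1[OF Pi])
  have diff: "\<phi> t - \<phi> s = integral {s..t} P" if "0 \<le> s" "s \<le> t" "t \<le> l" for s t
  proof -
    have "P integrable_on {0..t}" by (rule integrable_on_subinterval[OF Pi]) (use that in auto)
    from Henstock_Kurzweil_Integration.integral_combine[OF that(1,2) this] show ?thesis
      by (simp add: \<phi>_def algebra_simps)
  qed
  \<comment> \<open>Subintervals exhausting the segment; the factor \<open>l / 3\<close> keeps \<open>s n\<close> below \<open>t n\<close>.\<close>
  define s where "s n = l / 3 * inverse (real (Suc n))" for n :: nat
  define t where "t n = l - s n" for n :: nat
  have l3: "0 < s n" "s n \<le> l / 3" for n
  proof -
    have "inverse (real (Suc n)) \<le> 1" by (simp add: field_simps)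
    then show "0 < s n" "s n \<le> l / 3" using p(4) by (simp_all add: s_def)
  qed
  have sl: "s \<longlonglongrightarrow> 0"
    unfolding s_def using tendsto_mult_right_zero[OF LIMSEQ_inverse_real_of_nat, of "l / 3"] by simp
  have tl: "t \<longlonglongrightarrow> l"
    unfolding t_def using tendsto_diff[OF tendsto_const sl, of l] by simp
  have st: "0 < s n" "s n \<le> t n" "t n < l" for n
    using l3[of n] p(4) unfolding t_def by linarith+
  have in_range: "s n \<in> {0..l}" "t n \<in> {0..l}" for n
    using st[of n] by auto
  have s1: "(\<lambda>n. \<phi> (s n)) \<longlonglongrightarrow> \<phi> 0"
    by (rule continuous_on_tendsto_compose[OF \<phi>c sl _ always_eventually[OF allI[OF in_range(1)]]]) (use p(4) in simp)
  have t1: "(\<lambda>n. \<phi> (t n)) \<longlonglongrightarrow> \<phi> l"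
    by (rule continuous_on_tendsto_compose[OF \<phi>c tl _ always_eventually[OF allI[OF in_range(2)]]]) (use p(4) in simp)
  have "norm (\<phi> l - \<phi> 0) \<le> (2 * B + K) * \<epsilon>"
  proof (rule LIMSEQ_le_const2[OF tendsto_norm[OF tendsto_diff[OF t1 s1]]])
    have "norm (\<phi> (t n) - \<phi> (s n)) \<le> (2 * B + K) * \<epsilon>" for n
      using diff[of "s n" "t n"] st[of n] bound[OF st] by simp
    then show "\<exists>N. \<forall>n\<ge>N. norm (\<phi> (t n) - \<phi> (s n)) \<le> (2 * B + K) * \<epsilon>" by blast
  qed
  then show ?thesis by (simp add: \<phi>_def P_def)
qed

text \<open>
  This makes the completion injective: a Dirichlet-Cauchy sequence that tends to \<open>0\<close> uniformly
  tends to \<open>0\<close> in the Dirichlet norm.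
\<close>

lemma Dir_inner_Zh_le_sup:
  assumes v: "(v :: 'a \<Rightarrow> complex) \<in> Zh"
  obtains C where "0 \<le> C" "\<And>u \<epsilon>. u \<in> Zh \<Longrightarrow> (\<And>x. norm (u x) \<le> \<epsilon>) \<Longrightarrow> norm (Dir_inner_Zh u v) \<le> C * \<epsilon>"
proof -
  obtain V \<E> \<gamma> l where V: "segmentation V \<E>" and \<gamma>: "\<And>E. E \<in> \<E> \<Longrightarrow> segment E (\<gamma> E) (l E)"
    and Cs: "\<And>E k. E \<in> \<E> \<Longrightarrow> k \<in> {v} \<Longrightarrow> C2_on {0<..<l E} (k \<circ> \<gamma> E)"
    by (rule Zh_adapted[of "{v}" "{}"]) (use v in auto)
  have C: "C2_on {0<..<l E} (v \<circ> \<gamma> E)" if "E \<in> \<E>" for E using Cs[OF that] by simp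
  have "\<forall>E\<in>\<E>. \<exists>c\<ge>0. \<forall>u\<in>Zh. \<forall>\<epsilon>. (\<forall>x. norm (u x) \<le> \<epsilon>) \<longrightarrow>
      norm (integral {0..l E} (\<lambda>t. graph_deriv u (\<gamma> E t) * cnj (graph_deriv v (\<gamma> E t)))) \<le> c * \<epsilon>"
  proof
    fix E assume E: "E \<in> \<E>"
    obtain B K where BK: "\<And>t. t \<in> {0<..<l E} \<Longrightarrow> norm (deriv1 (v \<circ> \<gamma> E) t) \<le> B" "0 \<le> B" "0 \<le> K"
      "\<And>s t. \<lbrakk>0 < s; s \<le> t; t < l E\<rbrakk> \<Longrightarrow> integral {s..t} (\<lambda>r. norm (deriv1 (deriv1 (v \<circ> \<gamma> E)) r)) \<le> K"
      by (rule Zh_deriv_bounded_on_segment[OF v \<gamma>[OF E] C[OF E]]) (rule that; simp)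
    show "\<exists>c\<ge>0. \<forall>u\<in>Zh. \<forall>\<epsilon>. (\<forall>x. norm (u x) \<le> \<epsilon>) \<longrightarrow>
      norm (integral {0..l E} (\<lambda>t. graph_deriv u (\<gamma> E t) * cnj (graph_deriv v (\<gamma> E t)))) \<le> c * \<epsilon>"
    proof (intro exI[of _ "2 * B + K"] conjI ballI allI impI)
      show "0 \<le> 2 * B + K" using BK by simp
      fix u :: "'a \<Rightarrow> complex" and \<epsilon> assume u: "u \<in> Zh" and e: "\<forall>x. norm (u x) \<le> \<epsilon>"
      show "norm (integral {0..l E} (\<lambda>t. graph_deriv u (\<gamma> E t) * cnj (graph_deriv v (\<gamma> E t)))) \<le> (2 * B + K) * \<epsilon>"
        by (rule Zh_parts_on_segment[OF u v \<gamma>[OF E] C[OF E] BK(1,4)]) (use e in auto)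
    qed
  qed
  then obtain c where c: "\<And>E. E \<in> \<E> \<Longrightarrow> 0 \<le> c E" "\<And>E u \<epsilon>. E \<in> \<E> \<Longrightarrow> u \<in> Zh \<Longrightarrow> (\<And>x. norm (u x) \<le> \<epsilon>) \<Longrightarrow>
      norm (integral {0..l E} (\<lambda>t. graph_deriv u (\<gamma> E t) * cnj (graph_deriv v (\<gamma> E t)))) \<le> c E * \<epsilon>"
    by metis
  show ?thesis
  proof
    show "0 \<le> sum c \<E>" using c(1) by (rule sum_nonneg)
    fix u :: "'a \<Rightarrow> complex" and \<epsilon> assume u: "u \<in> Zh" and e: "\<And>x. norm (u x) \<le> \<epsilon>"
    have "Dir_inner_Zh u v = (\<Sum>E\<in>\<E>. LINT t:{0..l E}|lborel. graph_deriv u (\<gamma> E t) * cnj (graph_deriv v (\<gamma> E t)))"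
      unfolding Dir_inner_Zh_def by (rule integral_segmentation[OF V \<gamma> integrable_deriv_product[OF u v]])
    also have "\<dots> = (\<Sum>E\<in>\<E>. integral {0..l E} (\<lambda>t. graph_deriv u (\<gamma> E t) * cnj (graph_deriv v (\<gamma> E t))))"
      by (rule sum.cong[OF refl])
         (rule deriv_product_integrable_on_segment(3)[OF u v segment_params(4)[OF \<gamma>] segment_params(3)[OF \<gamma>]])
    also have "norm \<dots> \<le> (\<Sum>E\<in>\<E>. c E * \<epsilon>)"
      by (rule sum_norm_le) (rule c(2)[OF _ u e])
    finally show "norm (Dir_inner_Zh u v) \<le> sum c \<E> * \<epsilon>" by (simp add: sum_distrib_right)
  qed
qed

end

section \<open>The reproducing kernel of the Dirichlet form\<close>

context graph
begin

text \<open>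
  The formula is required on the closed segments, so that it fixes the function in terms of its values
  at the endpoints.
\<close>

definition linear_on_segments :: "'a set set \<Rightarrow> ('a set \<Rightarrow> real \<Rightarrow> 'a) \<Rightarrow> ('a set \<Rightarrow> real) \<Rightarrow> ('a \<Rightarrow> complex) \<Rightarrow> bool" where
  "linear_on_segments \<E> \<gamma> l f \<longleftrightarrow> (\<forall>E\<in>\<E>. \<forall>t\<in>{0..l E}.
     f (\<gamma> E t) = f (\<gamma> E 0) + (f (\<gamma> E (l E)) - f (\<gamma> E 0)) / of_real (l E) * of_real t)"

text \<open>
  Continuity holds on each closed segment, and the closed segments and the points of \<open>V\<close> form a
  finite closed cover.
\<close>

lemma interpolation_exists:
  assumes V: "segmentation V \<E>" and \<gamma>: "\<And>E. E \<in> \<E> \<Longrightarrow> segment E (\<gamma> E) (l E)"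
  obtains f :: "'a \<Rightarrow> complex" where "f \<in> CPA" "linear_on_segments \<E> \<gamma> l f" "\<And>v. v \<in> V \<Longrightarrow> f v = u v"
proof -
  have fin: "finite V" "finite \<E>" "disjoint \<E>" "\<Union>\<E> = - V" using V by (auto simp: segmentation_def)
  define aff where "aff E t = u (\<gamma> E 0) + (u (\<gamma> E (l E)) - u (\<gamma> E 0)) / of_real (l E) * complex_of_real t" for E t
  define edge where "edge x = (SOME E. E \<in> \<E> \<and> x \<in> E)" for x
  define f where "f x = (if x \<in> V then u x else aff (edge x) (the_inv_into {0..l (edge x)} (\<gamma> (edge x)) x))" for x
  have fV: "f v = u v" if "v \<in> V" for v using that by (simp add: f_def)
  have edge: "edge x = E" if "E \<in> \<E>" "x \<in> E" for x E
  proof -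
    have "edge x \<in> \<E> \<and> x \<in> edge x" unfolding edge_def by (rule someI[of _ E]) (use that in blast)
    then show ?thesis using fin(3) that unfolding disjoint_def by blast
  qed
  have fE: "f (\<gamma> E t) = aff E t" if E: "E \<in> \<E>" and t: "t \<in> {0..l E}" for E t
  proof -
    note p = segment_params[OF \<gamma>[OF E]]
    consider "t = 0" | "t = l E" | "t \<in> {0<..<l E}" using t by force
    then show ?thesis
    proof cases
      case 1
      then show ?thesis using segment_endpoints(1)[OF V E \<gamma>[OF E]] by (simp add: f_def aff_def)
    next
      case 2
      then show ?thesis using segment_endpoints(2)[OF V E \<gamma>[OF E]] p(4) by (simp add: f_def aff_def)
    next
      case 3
      then have mem: "\<gamma> E t \<in> E" using \<gamma>[OF E] unfolding segment_def by blast
      then have "\<gamma> E t \<notin> V" using fin(4) E by blast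
      moreover have "the_inv_into {0..l E} (\<gamma> E) (\<gamma> E t) = t"
        by (rule the_inv_into_f_f[OF isometric_param_inj[OF p(3)] t])
      ultimately show ?thesis using edge[OF E mem] by (simp add: f_def)
    qed
  qed
  have lin: "linear_on_segments \<E> \<gamma> l f"
    unfolding linear_on_segments_def
  proof (intro ballI)
    fix E t assume E: "E \<in> \<E>" and t: "t \<in> {0..l E}"
    have "0 \<in> {0..l E}" "l E \<in> {0..l E}" using segment_params(4)[OF \<gamma>[OF E]] by auto
    then show "f (\<gamma> E t) = f (\<gamma> E 0) + (f (\<gamma> E (l E)) - f (\<gamma> E 0)) / of_real (l E) * of_real t"
      using fE[OF E t] fV segment_endpoints[OF V E \<gamma>[OF E]] by (simp add: aff_def)
  qed
  have cont: "continuous_on (\<gamma> E ` {0..l E}) f" if E: "E \<in> \<E>" for E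
    unfolding continuous_on_iff
  proof (intro ballI allI impI)
    note p = segment_params[OF \<gamma>[OF E]]
    fix x and e :: real assume x: "x \<in> \<gamma> E ` {0..l E}" and e: "0 < e"
    define c where "c = norm ((u (\<gamma> E (l E)) - u (\<gamma> E 0)) / of_real (l E)) + 1"
    have c: "0 < c" unfolding c_def by (simp add: add_nonneg_pos)
    obtain s where s: "s \<in> {0..l E}" "x = \<gamma> E s" using x by blast
    have lip: "dist (f y) (f x) \<le> c * dist y x" if y: "y \<in> \<gamma> E ` {0..l E}" for y
    proof -
      obtain t where t: "t \<in> {0..l E}" "y = \<gamma> E t" using y by blast
      have "f y - f x = ((u (\<gamma> E (l E)) - u (\<gamma> E 0)) / of_real (l E)) * of_real (t - s)"
        unfolding t(2) s(2) fE[OF E t(1)] fE[OF E s(1)] aff_def of_real_diff right_diff_distrib by simp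
      then have "norm (f y - f x) = norm ((u (\<gamma> E (l E)) - u (\<gamma> E 0)) / of_real (l E)) * \<bar>t - s\<bar>"
        by (simp only: norm_mult norm_of_real)
      also have "\<dots> \<le> c * \<bar>t - s\<bar>" unfolding c_def by (intro mult_right_mono) auto
      also have "\<bar>t - s\<bar> = dist y x" using isometric_paramD[OF p(3) t(1) s(1)] t s by simp
      finally show ?thesis by (simp add: dist_norm)
    qed
    show "\<exists>d>0. \<forall>x'\<in>\<gamma> E ` {0..l E}. dist x' x < d \<longrightarrow> dist (f x') (f x) < e"
    proof (intro exI[of _ "e / c"] conjI ballI impI)
      show "0 < e / c" using e c by simp
      fix y assume y: "y \<in> \<gamma> E ` {0..l E}" "dist y x < e / c"
      then have "c * dist y x < e" using c by (simp add: field_simps)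
      then show "dist (f y) (f x) < e" using lip[OF y(1)] by simp
    qed
  qed
  have "continuous_on ((\<Union>E\<in>\<E>. \<gamma> E ` {0..l E}) \<union> V) f"
  proof (rule continuous_on_closed_Un)
    have cl: "closed (\<gamma> E ` {0..l E})" if "E \<in> \<E>" for E
      using compact_isometric_image[OF segment_params(3)[OF \<gamma>[OF that]]] by (rule compact_imp_closed)
    then show "closed (\<Union>E\<in>\<E>. \<gamma> E ` {0..l E})" using fin(2) by (intro closed_UN) auto
    show "closed V" using fin(1) by (rule finite_imp_closed)
    show "continuous_on (\<Union>E\<in>\<E>. \<gamma> E ` {0..l E}) f"
      by (rule continuous_on_closed_Union[OF fin(2)]) (use cl cont in auto)
    show "continuous_on V f" using fin(1) by (rule continuous_on_finite)
  qed
  moreover have "(\<Union>E\<in>\<E>. \<gamma> E ` {0..l E}) \<union> V = UNIV"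
  proof -
    have "x \<in> (\<Union>E\<in>\<E>. \<gamma> E ` {0..l E})" if x: "x \<notin> V" for x
    proof -
      obtain E t where "E \<in> \<E>" "t \<in> {0<..<l E}" "x = \<gamma> E t" by (rule segmentation_point[OF V \<gamma> x])
      then show ?thesis by force
    qed
    then show ?thesis by blast
  qed
  ultimately have "continuous_on UNIV f" by simp
  moreover have "piecewise affine_fun_on f"
  proof (rule piecewise_segmentation[OF V])
    fix E assume E: "E \<in> \<E>"
    have "\<forall>t\<in>{0<..<l E}. (f \<circ> \<gamma> E) t = u (\<gamma> E 0) + (u (\<gamma> E (l E)) - u (\<gamma> E 0)) / of_real (l E) * of_real t"
      using fE[OF E] by (simp add: aff_def)
    then have "affine_fun_on {0<..<l E} (f \<circ> \<gamma> E)" unfolding affine_fun_on_def by blast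
    with \<gamma>[OF E] show "\<exists>\<gamma> l. segment E \<gamma> l \<and> affine_fun_on {0<..<l} (f \<circ> \<gamma>)" by blast
  qed
  ultimately have "f \<in> CPA" by (simp add: CPA_def)
  with lin fV that show ?thesis by blast
qed

lemma Dir_inner_linear_on_segments:
  assumes V: "segmentation V \<E>" and \<gamma>: "\<And>E. E \<in> \<E> \<Longrightarrow> segment E (\<gamma> E) (l E)"
    and f: "(f :: 'a \<Rightarrow> complex) \<in> Zh" and h: "h \<in> Zh" and lin: "linear_on_segments \<E> \<gamma> l h"
  shows "Dir_inner_Zh f h = (\<Sum>E\<in>\<E>. cnj ((h (\<gamma> E (l E)) - h (\<gamma> E 0)) / of_real (l E)) * (f (\<gamma> E (l E)) - f (\<gamma> E 0)))"
proof -
  have "Dir_inner_Zh f h = (\<Sum>E\<in>\<E>. LINT t:{0..l E}|lborel. graph_deriv f (\<gamma> E t) * cnj (graph_deriv h (\<gamma> E t)))"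
    unfolding Dir_inner_Zh_def by (rule integral_segmentation[OF V \<gamma> integrable_deriv_product[OF f h]])
  also have "\<dots> = (\<Sum>E\<in>\<E>. cnj ((h (\<gamma> E (l E)) - h (\<gamma> E 0)) / of_real (l E)) * (f (\<gamma> E (l E)) - f (\<gamma> E 0)))"
  proof (rule sum.cong[OF refl])
    fix E assume E: "E \<in> \<E>"
    note p = segment_params[OF \<gamma>[OF E]]
    have "h (\<gamma> E t) = h (\<gamma> E 0) + (h (\<gamma> E (l E)) - h (\<gamma> E 0)) / of_real (l E) * of_real t" if "t \<in> {0<..<l E}" for t
    proof -
      have "t \<in> {0..l E}" using that by auto
      then show ?thesis using lin E unfolding linear_on_segments_def by blast
    qed
    from integral_deriv_affine[OF f h p(4,3,2) this]
    show "(LINT t:{0..l E}|lborel. graph_deriv f (\<gamma> E t) * cnj (graph_deriv h (\<gamma> E t))) =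
        cnj ((h (\<gamma> E (l E)) - h (\<gamma> E 0)) / of_real (l E)) * (f (\<gamma> E (l E)) - f (\<gamma> E 0))"
      using deriv_product_integrable_on_segment(3)[OF f h p(4,3)] by simp
  qed
  finally show ?thesis .
qed

text \<open>
  Only the values of \<open>f\<close> at the endpoints enter its Dirichlet product with a function that is affine on
  the segments (\<open>Dir_inner_linear_on_segments\<close>). So the functional
  \<open>f \<mapsto> f y - f \<zeta>\<close> is represented on all of \<open>Zh\<close> by its representative on the finite-dimensional
  space of functions affine on the segments of a decomposition with \<open>y\<close> and \<open>\<zeta>\<close> among the endpoints.
\<close>

theorem kernel_exists:
  obtains k :: "'a \<Rightarrow> complex" where "k \<in> CPA" "k \<zeta> = 0" "\<And>f. f \<in> Zh \<Longrightarrow> Dir_inner_Zh f k = f y - f \<zeta>"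
proof -
  obtain V \<E> where V: "segmentation V \<E>" and yz: "{y, \<zeta>} \<subseteq> V"
    by (rule segmentation_exists[of "{y, \<zeta>}"]) simp
  obtain \<gamma> l where \<gamma>: "\<And>E. E \<in> \<E> \<Longrightarrow> segment E (\<gamma> E) (l E)" using segmentation_choice[OF V] by blast
  have fin: "finite V" "finite \<E>" using V by (auto simp: segmentation_def)
  have "\<forall>w. \<exists>h. h \<in> CPA \<and> linear_on_segments \<E> \<gamma> l h \<and> (\<forall>v\<in>V. h v = (if v = w then 1 else 0))"
  proof
    fix w
    show "\<exists>h. h \<in> CPA \<and> linear_on_segments \<E> \<gamma> l h \<and> (\<forall>v\<in>V. h v = (if v = w then 1 else 0))"
      by (rule interpolation_exists[OF V \<gamma>, where u = "\<lambda>v. if v = w then 1 else 0"]) blast+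
  qed
  then obtain hat where hat: "\<And>w. hat w \<in> CPA" "\<And>w. linear_on_segments \<E> \<gamma> l (hat w)"
    "\<And>w v. v \<in> V \<Longrightarrow> hat w v = (if v = w then 1 else 0)" by metis
  define B where "B = hat ` (V - {\<zeta>})"
  define PL where "PL = {f \<in> CPA. linear_on_segments \<E> \<gamma> l f \<and> f \<zeta> = 0}"
  have subPL: "fun_vs.subspace PL"
    unfolding fun_vs.subspace_def
  proof (intro conjI ballI allI)
    show "0 \<in> PL" using const_CPA[of 0] by (simp add: PL_def linear_on_segments_def zero_fun_def)
    fix f g c assume f: "f \<in> PL"
    have "(\<lambda>x. c * f x + 0 * f x) \<in> CPA" using f by (intro CPA_combine) (auto simp: PL_def)
    moreover have "linear_on_segments \<E> \<gamma> l (scale_fun c f)"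
      unfolding linear_on_segments_def
    proof (intro ballI)
      fix E t assume "E \<in> \<E>" "t \<in> {0..l E}"
      then have *: "f (\<gamma> E t) = f (\<gamma> E 0) + (f (\<gamma> E (l E)) - f (\<gamma> E 0)) / of_real (l E) * of_real t"
        using f unfolding PL_def linear_on_segments_def by blast
      show "scale_fun c f (\<gamma> E t) = scale_fun c f (\<gamma> E 0) + (scale_fun c f (\<gamma> E (l E)) - scale_fun c f (\<gamma> E 0)) / of_real (l E) * of_real t"
        unfolding scale_fun_apply by (subst *) (simp add: algebra_simps diff_divide_distrib)
    qed
    ultimately show "scale_fun c f \<in> PL" using f by (auto simp: PL_def scale_fun_def)
    assume g: "g \<in> PL"
    have "(\<lambda>x. 1 * f x + 1 * g x) \<in> CPA" using f g by (intro CPA_combine) (auto simp: PL_def)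
    then have "f + g \<in> CPA" by (simp add: plus_fun_def)
    moreover have "linear_on_segments \<E> \<gamma> l (f + g)"
      unfolding linear_on_segments_def
    proof (intro ballI)
      fix E t assume E: "E \<in> \<E>" "t \<in> {0..l E}"
      have *: "f (\<gamma> E t) = f (\<gamma> E 0) + (f (\<gamma> E (l E)) - f (\<gamma> E 0)) / of_real (l E) * of_real t"
        using f E unfolding PL_def linear_on_segments_def by blast
      have **: "g (\<gamma> E t) = g (\<gamma> E 0) + (g (\<gamma> E (l E)) - g (\<gamma> E 0)) / of_real (l E) * of_real t"
        using g E unfolding PL_def linear_on_segments_def by blast
      show "(f + g) (\<gamma> E t) = (f + g) (\<gamma> E 0) + ((f + g) (\<gamma> E (l E)) - (f + g) (\<gamma> E 0)) / of_real (l E) * of_real t"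
        unfolding plus_fun_apply by (subst *, subst **) (simp add: algebra_simps diff_divide_distrib add_divide_distrib)
    qed
    ultimately show "f + g \<in> PL" using f g by (simp add: PL_def)
  qed
  have PLZh: "PL \<subseteq> Zh" using CPA_subset_Zh by (auto simp: PL_def)
  have BPL: "B \<subseteq> PL" using hat yz by (auto simp: B_def PL_def)
  then have spanPL: "fun_vs.span B \<subseteq> PL" using subPL by (rule fun_vs.span_minimal)
  \<comment> \<open>A function of norm \<open>0\<close> takes equal values at the ends of each segment, so its range is finite and,
    the graph being connected, consists of one point.\<close>
  have definite: "b = 0" if b: "b \<in> PL" and 0: "Zh.nrm b = 0" for b
  proof -
    have bZ: "b \<in> Zh" and lin: "linear_on_segments \<E> \<gamma> l b" and b\<zeta>: "b \<zeta> = 0"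
      using b PLZh by (auto simp: PL_def)
    have lpos: "0 < l E" if "E \<in> \<E>" for E using segment_params(4)[OF \<gamma>[OF that]] .
    have "Dir_inner_Zh b b = (\<Sum>E\<in>\<E>. cnj ((b (\<gamma> E (l E)) - b (\<gamma> E 0)) / of_real (l E)) * (b (\<gamma> E (l E)) - b (\<gamma> E 0)))"
      by (rule Dir_inner_linear_on_segments[OF V \<gamma> bZ bZ lin])
    also have "\<dots> = (\<Sum>E\<in>\<E>. of_real ((norm (b (\<gamma> E (l E)) - b (\<gamma> E 0)))\<^sup>2 / l E))"
    proof (rule sum.cong[OF refl])
      fix E
      let ?z = "b (\<gamma> E (l E)) - b (\<gamma> E 0)"
      have "cnj (?z / of_real (l E)) * ?z = ?z * cnj ?z / of_real (l E)" by simp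
      also have "\<dots> = of_real ((norm ?z)\<^sup>2 / l E)" by (simp only: complex_norm_square[symmetric] of_real_divide)
      finally show "cnj (?z / of_real (l E)) * ?z = of_real ((norm ?z)\<^sup>2 / l E)" .
    qed
    also have "\<dots> = of_real (\<Sum>E\<in>\<E>. (norm (b (\<gamma> E (l E)) - b (\<gamma> E 0)))\<^sup>2 / l E)" by simp
    finally have "(\<Sum>E\<in>\<E>. (norm (b (\<gamma> E (l E)) - b (\<gamma> E 0)))\<^sup>2 / l E) = 0"
      using Zh.nrm_sq[OF bZ] 0 by simp
    then have "\<forall>E\<in>\<E>. (norm (b (\<gamma> E (l E)) - b (\<gamma> E 0)))\<^sup>2 / l E = 0"
      using fin(2) lpos by (subst (asm) sum_nonneg_eq_0_iff) (auto intro!: divide_nonneg_pos)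
    then have flat: "b (\<gamma> E (l E)) = b (\<gamma> E 0)" if "E \<in> \<E>" for E using that lpos[OF that] by force
    have "b x \<in> b ` V" for x
    proof (cases "x \<in> V")
      case False
      obtain E t where E: "E \<in> \<E>" "t \<in> {0<..<l E}" "x = \<gamma> E t" by (rule segmentation_point[OF V \<gamma> False])
      then have "t \<in> {0..l E}" by auto
      then have "b (\<gamma> E t) = b (\<gamma> E 0) + (b (\<gamma> E (l E)) - b (\<gamma> E 0)) / of_real (l E) * of_real t"
        using lin E(1) unfolding linear_on_segments_def by blast
      then have "b x = b (\<gamma> E 0)" unfolding flat[OF E(1)] E(3) by simp
      then show ?thesis using segment_endpoints(1)[OF V E(1) \<gamma>[OF E(1)]] by (rule image_eqI)
    qed simp
    then have "b ` UNIV \<subseteq> b ` V" by (intro image_subsetI)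
    then have "finite (b ` UNIV)" by (rule finite_subset[OF _ finite_imageI[OF fin(1)]])
    then have "b constant_on UNIV"
      using continuous_finite_range_constant[OF connected_UNIV ZhD(1)[OF bZ]] by simp
    then show "b = 0" using b\<zeta> by (auto simp: constant_on_def fun_eq_iff)
  qed
  obtain k where k: "k \<in> fun_vs.span B" "\<And>f. f \<in> fun_vs.span B \<Longrightarrow> f y = Dir_inner_Zh f k"
  proof (rule Zh.finite_Riesz[of B "\<lambda>f. f y"])
    show "finite B" using fin by (simp add: B_def)
    show "B \<subseteq> Zh" using BPL PLZh by blast
    show "b = 0" if "b \<in> fun_vs.span B" "Zh.nrm b = 0" for b using definite that spanPL by blast
  qed auto
  have kPL: "k \<in> PL" using k spanPL by blast
  then have kZ: "k \<in> Zh" and klin: "linear_on_segments \<E> \<gamma> l k" using PLZh by (auto simp: PL_def)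
  have "Dir_inner_Zh f k = f y - f \<zeta>" if f: "f \<in> Zh" for f
  proof -
    \<comment> \<open>The interpolation of \<open>f - f \<zeta>\<close> at the points of \<open>V\<close>.\<close>
    define I where "I = (\<Sum>v\<in>V - {\<zeta>}. scale_fun (f v - f \<zeta>) (hat v))"
    have Is: "I \<in> fun_vs.span B"
      unfolding I_def by (intro fun_vs.span_sum fun_vs.span_scale fun_vs.span_base) (auto simp: B_def)
    then have IZ: "I \<in> Zh" using spanPL PLZh by blast
    have Iv: "I v = f v - f \<zeta>" if v: "v \<in> V" for v
    proof -
      have "I v = (\<Sum>w\<in>V - {\<zeta>}. if w = v then f w - f \<zeta> else 0)"
        unfolding I_def sum_fun_apply by (rule sum.cong[OF refl]) (use hat(3)[OF v] in auto)
      also have "\<dots> = f v - f \<zeta>" using fin(1) v by simp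
      finally show ?thesis .
    qed
    have "Dir_inner_Zh f k = (\<Sum>E\<in>\<E>. cnj ((k (\<gamma> E (l E)) - k (\<gamma> E 0)) / of_real (l E)) * (f (\<gamma> E (l E)) - f (\<gamma> E 0)))"
      by (rule Dir_inner_linear_on_segments[OF V \<gamma> f kZ klin])
    also have "\<dots> = (\<Sum>E\<in>\<E>. cnj ((k (\<gamma> E (l E)) - k (\<gamma> E 0)) / of_real (l E)) * (I (\<gamma> E (l E)) - I (\<gamma> E 0)))"
      by (rule sum.cong[OF refl]) (use Iv segment_endpoints[OF V _ \<gamma>] in simp)
    also have "\<dots> = Dir_inner_Zh I k"
      by (rule Dir_inner_linear_on_segments[OF V \<gamma> IZ kZ klin, symmetric])
    also have "\<dots> = I y" using k(2)[OF Is] by simp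
    also have "\<dots> = f y - f \<zeta>" using Iv yz by simp
    finally show ?thesis .
  qed
  with kPL that show ?thesis by (auto simp: PL_def)
qed

section \<open>The Laplacian of piecewise affine functions\<close>

text \<open>
  A radius is chosen that avoids the exceptional points other than \<open>p\<close>; the value at \<open>p\<close> itself is
  that of the affine function by continuity.
\<close>

lemma CPA_affine_on_rays:
  assumes f: "(f :: 'a \<Rightarrow> complex) \<in> CPA"
  obtains \<rho> s where "star_radius p \<rho>" "\<And>v t. v \<in> Vec p \<Longrightarrow> t \<in> {0..<\<rho>} \<Longrightarrow> f (move p t v) = f p + s v * of_real t"
proof -
  obtain X where X: "finite X" "\<And>x. x \<notin> X \<Longrightarrow> regular_point affine_fun_on f x"
    using piecewise_regular_points[OF CPA_D(2)[OF f]] by metis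
  obtain d where d: "0 < d" "\<And>x. x \<in> X \<Longrightarrow> x \<noteq> p \<Longrightarrow> d \<le> dist p x"
    using finite_set_avoid[OF X(1), of p] by blast
  obtain \<rho>0 where \<rho>0: "star_radius p \<rho>0" using star_radius_exists by blast
  define \<rho> where "\<rho> = min d \<rho>0"
  have pos: "0 < \<rho>" using d star_radius_pos[OF \<rho>0] by (simp add: \<rho>_def)
  have \<rho>: "star_radius p \<rho>" by (rule star_radius_mono[OF \<rho>0 pos]) (simp add: \<rho>_def)
  have "\<exists>s. \<forall>t\<in>{0..<\<rho>}. f (move p t v) = f p + s * of_real t" if v: "v \<in> Vec p" for v
  proof -
    let ?\<gamma> = "\<lambda>t. move p t v"
    have iso: "isometric_param {0..<\<rho>} ?\<gamma>" by (rule star_ray_isometric[OF \<rho> v])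
    have "affine_fun_on {0<..<\<rho>} (f \<circ> ?\<gamma>)"
    proof (rule regular_points_on_segment[OF local_regularity_affine])
      show "isometric_param {0<..<\<rho>} ?\<gamma>" by (rule isometric_param_subset[OF iso]) auto
      fix t assume t: "t \<in> {0<..<\<rho>}"
      have "dist p (?\<gamma> t) = t" by (rule star_radius_dist_center[OF \<rho> v]) (use t in auto)
      moreover from this have "?\<gamma> t \<noteq> p" using t by auto
      ultimately have "?\<gamma> t \<notin> X" using d(2)[of "?\<gamma> t"] t by (auto simp: \<rho>_def)
      then show "regular_point affine_fun_on f (?\<gamma> t)" by (rule X(2))
    qed
    then obtain \<alpha> \<beta> where ab: "\<And>t. t \<in> {0<..<\<rho>} \<Longrightarrow> f (?\<gamma> t) = \<alpha> + \<beta> * of_real t"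
      by (auto simp: affine_fun_on_def)
    define r where "r n = \<rho> / 2 * inverse (real (Suc n))" for n :: nat
    have r: "r n \<in> {0<..<\<rho>}" for n
    proof -
      have "inverse (real (Suc n)) \<le> 1" by (simp add: field_simps)
      then have "\<rho> / 2 * inverse (real (Suc n)) \<le> \<rho> / 2 * 1" using pos by (intro mult_left_mono) auto
      then show ?thesis using pos by (simp add: r_def)
    qed
    have rl: "r \<longlonglongrightarrow> 0"
      unfolding r_def using tendsto_mult_right_zero[OF LIMSEQ_inverse_real_of_nat, of "\<rho> / 2"] by simp
    have "continuous_on {0..<\<rho>} (\<lambda>t. f (?\<gamma> t))"
      by (rule continuous_on_compose2[OF CPA_D(1)[OF f] isometric_param_continuous[OF iso]]) auto
    then have 1: "(\<lambda>n. f (?\<gamma> (r n))) \<longlonglongrightarrow> f (?\<gamma> 0)"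
      by (rule continuous_on_tendsto_compose[OF _ rl]) (use r pos in \<open>auto intro!: always_eventually less_imp_le\<close>)
    have "(\<lambda>n. \<alpha> + \<beta> * of_real (r n)) \<longlonglongrightarrow> \<alpha> + \<beta> * of_real 0" by (intro tendsto_intros rl)
    then have 2: "(\<lambda>n. f (?\<gamma> (r n))) \<longlonglongrightarrow> \<alpha>" using ab[OF r] by simp
    have "f p = \<alpha>" using LIMSEQ_unique[OF 1 2] by simp
    then have "f (?\<gamma> t) = f p + \<beta> * of_real t" if "t \<in> {0..<\<rho>}" for t
      using ab[of t] that by (cases "t = 0") auto
    then show ?thesis by blast
  qed
  then obtain s where "\<And>v t. v \<in> Vec p \<Longrightarrow> t \<in> {0..<\<rho>} \<Longrightarrow> f (move p t v) = f p + s v * of_real t" by metis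
  with \<rho> that show ?thesis by blast
qed

lemma slope_sum_affine_on_rays:
  assumes "0 < \<rho>" "\<And>v t. v \<in> Vec p \<Longrightarrow> t \<in> {0..<\<rho>} \<Longrightarrow> f (move p t v) = f p + s v * of_real t"
  shows "slope_sum f (p :: 'a) = (\<Sum>v\<in>Vec p. s v)"
  unfolding slope_sum_def
proof (rule sum.cong[OF refl])
  fix v assume v: "v \<in> Vec p"
  have "\<forall>\<^sub>F t in at_right 0. (f (move p t v) - f p) / of_real t = s v"
    using eventually_at_right_real[OF assms(1)]
  proof eventually_elim
    case (elim t)
    then show ?case using assms(2)[OF v, of t] by simp
  qed
  then have "((\<lambda>t. (f (move p t v) - f p) / of_real t) \<longlongrightarrow> s v) (at_right 0)" by (rule tendsto_eventually)
  then show "dir_deriv v f p = s v" unfolding dir_deriv_def by (intro tendsto_Lim) simp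
qed

lemma slope_sum_combine:
  assumes f: "(f :: 'a \<Rightarrow> complex) \<in> CPA" and g: "g \<in> CPA"
  shows "slope_sum (\<lambda>x. c * f x + d * g x) p = c * slope_sum f p + d * slope_sum g p"
proof -
  obtain \<rho>1 s1 where 1: "star_radius p \<rho>1" "\<And>v t. v \<in> Vec p \<Longrightarrow> t \<in> {0..<\<rho>1} \<Longrightarrow> f (move p t v) = f p + s1 v * of_real t"
    using CPA_affine_on_rays[OF f] by metis
  obtain \<rho>2 s2 where 2: "star_radius p \<rho>2" "\<And>v t. v \<in> Vec p \<Longrightarrow> t \<in> {0..<\<rho>2} \<Longrightarrow> g (move p t v) = g p + s2 v * of_real t"
    using CPA_affine_on_rays[OF g] by metis
  note pos = star_radius_pos[OF 1(1)] star_radius_pos[OF 2(1)]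
  have "slope_sum (\<lambda>x. c * f x + d * g x) p = (\<Sum>v\<in>Vec p. c * s1 v + d * s2 v)"
    by (rule slope_sum_affine_on_rays[of "min \<rho>1 \<rho>2"])
       (use pos 1(2) 2(2) in \<open>auto simp: algebra_simps\<close>)
  then show ?thesis
    using slope_sum_affine_on_rays[OF pos(1) 1(2)] slope_sum_affine_on_rays[OF pos(2) 2(2)]
    by (simp add: sum.distrib sum_distrib_left)
qed

text \<open>
  The maximum principle: at a point where the real part is maximal all slopes have nonpositive real
  part, and their sum vanishes, so the real part is constant near this point.
\<close>

lemma harmonic_Re_constant:
  assumes f: "(f :: 'a \<Rightarrow> complex) \<in> CPA" and harmonic: "\<And>p. slope_sum f p = 0"
  shows "Re (f x) = Re (f y)"
proof -
  have cont: "continuous_on UNIV (\<lambda>x. Re (f x))" using CPA_D(1)[OF f] by (intro continuous_intros)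
  obtain m where m: "\<And>x. Re (f x) \<le> Re (f m)"
    using continuous_attains_sup[OF compact_UNIV _ cont] by auto
  let ?S = "{x. Re (f x) = Re (f m)}"
  have "closed ?S" using closed_Collect_eq[OF cont continuous_on_const] by simp
  moreover have "open ?S"
    unfolding open_contains_ball
  proof
    fix p assume "p \<in> ?S"
    then have p: "Re (f p) = Re (f m)" by simp
    obtain \<rho> s where \<rho>: "star_radius p \<rho>" "\<And>v t. v \<in> Vec p \<Longrightarrow> t \<in> {0..<\<rho>} \<Longrightarrow> f (move p t v) = f p + s v * of_real t"
      using CPA_affine_on_rays[OF f] by metis
    note pos = star_radius_pos[OF \<rho>(1)]
    have le: "Re (s v) \<le> 0" if "v \<in> Vec p" for v
    proof -
      have "Re (f (move p (\<rho> / 2) v)) = Re (f p) + Re (s v) * (\<rho> / 2)"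
        using \<rho>(2)[OF that, of "\<rho> / 2"] pos by simp
      then have "Re (s v) * (\<rho> / 2) \<le> 0" using m[of "move p (\<rho> / 2) v"] p by linarith
      then show ?thesis using pos by (simp add: mult_le_0_iff)
    qed
    have "(\<Sum>v\<in>Vec p. s v) = 0" using slope_sum_affine_on_rays[OF pos \<rho>(2)] harmonic[of p] by simp
    then have "(\<Sum>v\<in>Vec p. Re (s v)) = 0" by (metis Re_sum zero_complex.sel(1))
    then have "(\<Sum>v\<in>Vec p. - Re (s v)) = 0" by (simp add: sum_negf)
    then have zero: "Re (s v) = 0" if "v \<in> Vec p" for v
      using that le finite_Vec by (subst (asm) sum_nonneg_eq_0_iff) auto
    have "ball p \<rho> \<subseteq> ?S"
    proof
      fix x assume "x \<in> ball p \<rho>"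
      then have x: "dist p x < \<rho>" by simp
      obtain v where v: "v \<in> Vec p" "x = move p (dist p x) v" by (rule star_radius_ball[OF \<rho>(1) x])
      have "f x = f p + s v * of_real (dist p x)" using \<rho>(2)[OF v(1), of "dist p x"] v(2) x by simp
      then show "x \<in> ?S" using zero[OF v(1)] p by simp
    qed
    then show "\<exists>e>0. ball p e \<subseteq> ?S" using pos by blast
  qed
  moreover have "?S \<noteq> {}" by blast
  ultimately have "?S = UNIV" using connected_UNIV unfolding connected_clopen by (auto simp: open_openin[symmetric])
  then show ?thesis by (metis (mono_tags) UNIV_I mem_Collect_eq)
qed

text \<open>
  The imaginary part of \<open>f\<close> is the real part of \<open>- \<i> f\<close>.
\<close>

lemma harmonic_constant:
  assumes f: "(f :: 'a \<Rightarrow> complex) \<in> CPA" and harmonic: "\<And>p. slope_sum f p = 0"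
  shows "f x = f y"
proof (rule complex_eqI)
  show "Re (f x) = Re (f y)" by (rule harmonic_Re_constant[OF f harmonic])
  have g: "(\<lambda>x. (- \<i>) * f x + 0 * f x) \<in> CPA" by (rule CPA_combine[OF f f])
  have "Re ((- \<i>) * f x + 0 * f x) = Re ((- \<i>) * f y + 0 * f y)"
    by (rule harmonic_Re_constant[OF g], unfold slope_sum_combine[OF f f] harmonic) simp
  then show "Im (f x) = Im (f y)" by simp
qed

definition tent :: "'a \<Rightarrow> real \<Rightarrow> 'a \<Rightarrow> complex" where
  "tent p r x = of_real (max 0 (r - dist p x))"

lemma tent_CPA:
  assumes \<rho>: "star_radius p \<rho>" and r: "0 < r" "r < \<rho>"
  shows "tent p r \<in> CPA"
proof -
  have cont: "continuous_on UNIV (tent p r)" unfolding tent_def[abs_def] by (intro continuous_intros)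
  have "piecewise affine_fun_on (tent p r)"
  proof (rule piecewise_local[OF local_regularity_affine, of "insert p ((\<lambda>v. move p r v) ` Vec p)"])
    show "finite (insert p ((\<lambda>v. move p r v) ` Vec p))" using finite_Vec by simp
    fix x \<sigma> \<delta> assume x: "x \<notin> insert p ((\<lambda>v. move p r v) ` Vec p)" and \<delta>: "0 < \<delta>"
      and \<sigma>: "isometric_param {- \<delta><..<\<delta>} \<sigma>" "\<sigma> 0 = x"
    have "dist p x \<noteq> r"
    proof
      assume e: "dist p x = r"
      obtain v where "v \<in> Vec p" "x = move p (dist p x) v" by (rule star_radius_ball[OF \<rho>, of x]) (use e r in auto)
      then show False using x e by auto
    qed
    then consider "r < dist p x" | "dist p x < r" by linarith
    then show "\<exists>\<delta>'>0. affine_fun_on {- \<delta>'<..<\<delta>'} (tent p r \<circ> \<sigma>)"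
    proof cases
      case 1
      let ?d = "min \<delta> (dist p x - r)"
      have "tent p r (\<sigma> t) = 0" if t: "t \<in> {- ?d<..<?d}" for t
      proof -
        have "dist x (\<sigma> t) = \<bar>0 - t\<bar>" unfolding \<sigma>(2)[symmetric] by (rule isometric_paramD[OF \<sigma>(1)]) (use t \<delta> in auto)
        moreover have "\<bar>t\<bar> < ?d" using t by auto
        ultimately have "dist (\<sigma> t) x < dist p x - r" by (simp add: dist_commute)
        then have "r < dist p (\<sigma> t)" using dist_triangle[of p x "\<sigma> t"] by linarith
        then show ?thesis by (simp add: tent_def)
      qed
      then have "\<forall>t\<in>{- ?d<..<?d}. (tent p r \<circ> \<sigma>) t = 0 + 0 * of_real t" by simp
      then have "affine_fun_on {- ?d<..<?d} (tent p r \<circ> \<sigma>)" unfolding affine_fun_on_def by blast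
      moreover have "0 < ?d" using \<delta> 1 by simp
      ultimately show ?thesis by blast
    next
      case 2
      obtain v where v: "v \<in> Vec p" "x = move p (dist p x) v" by (rule star_radius_ball[OF \<rho>, of x]) (use 2 r in auto)
      let ?\<gamma> = "\<lambda>t. move p t v"
      have iso: "isometric_param {0<..<r} ?\<gamma>"
        by (rule isometric_param_subset[OF star_ray_isometric[OF \<rho> v(1)]]) (use r in auto)
      have op: "open (?\<gamma> ` {0<..<r})" by (rule open_star_ray[OF \<rho> v(1)]) (use r in simp)
      have mem: "dist p x \<in> {0<..<r}" using 2 x by auto
      obtain \<delta>' \<epsilon> where d: "0 < \<delta>'" "\<epsilon> = 1 \<or> \<epsilon> = -1" "\<And>t. \<bar>t\<bar> < \<delta>' \<Longrightarrow> dist p x + \<epsilon> * t \<in> {0<..<r}"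
        "\<And>t. \<bar>t\<bar> < \<delta>' \<Longrightarrow> \<sigma> t = ?\<gamma> (dist p x + \<epsilon> * t)"
        using isometric_params_agree[OF iso op mem \<sigma>(1) \<delta>] \<sigma>(2) v(2) by metis
      have "tent p r (\<sigma> t) = of_real (r - dist p x) + of_real (- \<epsilon>) * of_real t" if t: "t \<in> {- \<delta>'<..<\<delta>'}" for t
      proof -
        have t': "\<bar>t\<bar> < \<delta>'" using t by auto
        have "dist p (\<sigma> t) = dist p x + \<epsilon> * t"
          unfolding d(4)[OF t'] by (rule star_radius_dist_center[OF \<rho> v(1)]) (use d(3)[OF t'] r in auto)
        then have "tent p r (\<sigma> t) = of_real (r - (dist p x + \<epsilon> * t))" using d(3)[OF t'] by (simp add: tent_def)
        then show ?thesis by simp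
      qed
      then have "affine_fun_on {- \<delta>'<..<\<delta>'} (tent p r \<circ> \<sigma>)" unfolding affine_fun_on_def comp_apply by blast
      then show ?thesis using d(1) by blast
    qed
  qed
  with cont show ?thesis by (simp add: CPA_def)
qed

lemma graph_deriv_tent_outside:
  assumes x: "regular_point C2_on (tent p r) x" and far: "r < dist p x"
  shows "graph_deriv (tent p r) x = 0"
proof -
  obtain a b c \<gamma> where g: "isometric_param {a<..<b} \<gamma>" "open (\<gamma> ` {a<..<b})" "c \<in> {a<..<b}" "x = \<gamma> c"
    using x unfolding regular_point_def by blast
  define d where "d = Min {dist p x - r, c - a, b - c}"
  have d: "0 < d" "d \<le> dist p x - r" "d \<le> c - a" "d \<le> b - c" using far g(3) by (auto simp: d_def)
  have "((tent p r \<circ> \<gamma>) has_vector_derivative 0) (at c)"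
  proof (rule has_vector_derivative_cong_open[of "{c - d<..<c + d}" c "\<lambda>_. 0"])
    fix s assume s: "s \<in> {c - d<..<c + d}"
    have "dist (\<gamma> s) x = \<bar>s - c\<bar>"
      unfolding g(4) by (rule isometric_paramD[OF g(1)]) (use s d g(3) in auto)
    also have "\<dots> < d" using s by auto
    finally have "r < dist p (\<gamma> s)" using d(2) dist_triangle[of p x "\<gamma> s"] by linarith
    then show "0 = (tent p r \<circ> \<gamma>) s" by (simp add: tent_def)
  qed (use d in auto)
  from graph_deriv_product(2)[OF g this this] show ?thesis by simp
qed

text \<open>
  The slopes of a reproducing function at \<open>p\<close> are read off by testing it against a small tent at \<open>p\<close>,
  whose Dirichlet product with it is computed on the rays at \<open>p\<close>.
\<close>

lemma slope_sum_of_reproducing: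
  assumes k: "(k :: 'a \<Rightarrow> complex) \<in> CPA" and rep: "\<And>f. f \<in> Zh \<Longrightarrow> Dir_inner_Zh f k = f y - f \<zeta>"
  shows "slope_sum k p = (if p = \<zeta> then 1 else 0) - (if p = y then 1 else 0)"
proof -
  obtain \<rho> s where \<rho>: "star_radius p \<rho>" "\<And>v t. v \<in> Vec p \<Longrightarrow> t \<in> {0..<\<rho>} \<Longrightarrow> k (move p t v) = k p + s v * of_real t"
    using CPA_affine_on_rays[OF k] by metis
  note pos = star_radius_pos[OF \<rho>(1)]
  obtain d where d: "0 < d" "\<And>x. x \<in> {y, \<zeta>} \<Longrightarrow> x \<noteq> p \<Longrightarrow> d \<le> dist p x"
    using finite_set_avoid[of "{y, \<zeta>}" p] by blast
  define r where "r = min d (\<rho> / 2)"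
  have r: "0 < r" "r < \<rho>" "r \<le> d" using d pos by (auto simp: r_def min_def)
  define T where "T = tent p r"
  have TZ: "T \<in> Zh" unfolding T_def using tent_CPA[OF \<rho>(1) r(1,2)] CPA_subset_Zh by blast
  have kZ: "k \<in> Zh" using k CPA_subset_Zh by blast
  have Tval: "T x = (if p = x then of_real r else 0)" if "x \<in> {y, \<zeta>}" for x
    using d(2)[OF that] r by (auto simp: T_def tent_def)
  define F where "F = (\<lambda>x. graph_deriv T x * cnj (graph_deriv k x))"
  have FI: "integrable arc_length F" unfolding F_def by (rule integrable_deriv_product[OF TZ kZ])
  define K where "K v = (\<lambda>t. move p t v) ` {0..r}" for v
  have iso: "isometric_param {0..r} (\<lambda>t. move p t v)" if "v \<in> Vec p" for v
    by (rule isometric_param_subset[OF star_ray_isometric[OF \<rho>(1) that]]) (use r in auto)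
  obtain X where X: "finite X" "\<And>x. x \<notin> X \<Longrightarrow> regular_point C2_on T x" using Zh_deriv_bounded[OF TZ] by metis
  have FK: "F x = (\<Sum>v\<in>Vec p. indicator (K v) x *\<^sub>R F x)" if x: "x \<notin> insert p X" for x
  proof (cases "dist p x \<le> r")
    case True
    obtain v where v: "v \<in> Vec p" "x = move p (dist p x) v"
      by (rule star_radius_ball[OF \<rho>(1), of x]) (use True r in auto)
    have "indicator (K w) x *\<^sub>R F x = (if w = v then F x else 0)" if w: "w \<in> Vec p" for w
    proof (cases "w = v")
      case True
      then have "x \<in> K w" unfolding K_def using v \<open>dist p x \<le> r\<close> by (intro image_eqI[of _ _ "dist p x"]) auto
      then show ?thesis using True by simp
    next
      case False
      have "x \<notin> K w"
      proof
        assume "x \<in> K w"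
        then obtain t where t: "t \<in> {0..r}" "x = move p t w" by (auto simp: K_def)
        have "dist x x = t + dist p x"
          using star_radius_dist[OF \<rho>(1) w v(1), of t "dist p x"] t v(2) True r False by simp
        then show False using t x by (auto simp: add_nonneg_eq_0_iff)
      qed
      then show ?thesis using False by simp
    qed
    then have "(\<Sum>w\<in>Vec p. indicator (K w) x *\<^sub>R F x) = (\<Sum>w\<in>Vec p. if w = v then F x else 0)"
      by (rule sum.cong[OF refl])
    also have "\<dots> = F x" using v(1) finite_Vec by simp
    finally show ?thesis by simp
  next
    case False
    have "F x = 0" unfolding F_def T_def
      using graph_deriv_tent_outside[of p r x] X(2)[of x] x False by (simp add: T_def)
    then show ?thesis by simp
  qed
  have int: "integrable arc_length (\<lambda>x. indicator (K v) x *\<^sub>R F x)" if "v \<in> Vec p" for v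
    by (rule integrable_mult_indicator[OF _ FI]) (simp add: K_def isometric_image_borel[OF iso[OF that]])
  have "Dir_inner_Zh T k = (LINT x|arc_length. (\<Sum>v\<in>Vec p. indicator (K v) x *\<^sub>R F x))"
    unfolding Dir_inner_Zh_def
  proof (rule integral_deriv_cong[of "insert p X"])
    show "graph_deriv T x * cnj (graph_deriv k x) = (\<Sum>v\<in>Vec p. indicator (K v) x *\<^sub>R F x)" if "x \<notin> insert p X" for x
      using FK[OF that] by (simp add: F_def)
    show "integrable arc_length (\<lambda>x. graph_deriv T x * cnj (graph_deriv k x))" using FI by (simp add: F_def)
    show "integrable arc_length (\<lambda>x. \<Sum>v\<in>Vec p. indicator (K v) x *\<^sub>R F x)"
      by (rule Bochner_Integration.integrable_sum[OF int])
  qed (use X in simp)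
  also have "\<dots> = (\<Sum>v\<in>Vec p. LINT x:K v|arc_length. F x)"
    unfolding set_lebesgue_integral_def by (rule Bochner_Integration.integral_sum[OF int])
  also have "\<dots> = (\<Sum>v\<in>Vec p. cnj (s v) * - of_real r)"
  proof (rule sum.cong[OF refl])
    fix v assume v: "v \<in> Vec p"
    have op: "open ((\<lambda>t. move p t v) ` {0<..<r})" by (rule open_star_ray[OF \<rho>(1) v]) (use r in simp)
    have "(LINT x:K v|arc_length. F x) = integral {0..r} (\<lambda>t. F (move p t v))"
      unfolding K_def F_def by (rule deriv_product_integrable_on_segment(2)[OF TZ kZ r(1) iso[OF v]])
    also have "\<dots> = cnj (s v) * (T (move p r v) - T (move p 0 v))"
      unfolding F_def by (rule integral_deriv_affine[OF TZ kZ r(1) iso[OF v] op, where \<alpha> = "k p" and \<beta> = "s v"]) (use \<rho>(2)[OF v] r in auto)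
    also have "T (move p r v) = 0" using star_radius_dist_center[OF \<rho>(1) v, of r] r by (simp add: T_def tent_def)
    also have "T (move p 0 v) = of_real r" using r by (simp add: T_def tent_def)
    finally show "(LINT x:K v|arc_length. F x) = cnj (s v) * - of_real r" by simp
  qed
  also have "\<dots> = - of_real r * cnj (\<Sum>v\<in>Vec p. s v)"
    by (simp add: sum_distrib_left cnj_sum mult.commute sum_negf)
  also have "(\<Sum>v\<in>Vec p. s v) = slope_sum k p"
    by (rule slope_sum_affine_on_rays[OF pos, symmetric]) (rule \<rho>(2))
  finally have "- of_real r * cnj (slope_sum k p) = T y - T \<zeta>" using rep[OF TZ] by simp
  also have "\<dots> = - of_real r * ((if p = \<zeta> then 1 else 0) - (if p = y then 1 else 0))" using Tval by auto
  finally have "cnj (slope_sum k p) = (if p = \<zeta> then 1 else 0) - (if p = y then 1 else 0)"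
    using r(1) by (subst (asm) mult_left_cancel) auto
  then have "cnj (cnj (slope_sum k p)) = cnj ((if p = \<zeta> then 1 else 0) - (if p = y then 1 else 0))" by simp
  then show ?thesis by (auto split: if_splits)
qed

section \<open>Regularity of the kernel\<close>

text \<open>
  An arbitrary point, at which the kernel is normalized to be \<open>0\<close>.
\<close>

definition base :: 'a where "base = (SOME x. True)"

definition ker :: "'a \<Rightarrow> 'a \<Rightarrow> complex" where
  "ker y = (SOME k. k \<in> CPA \<and> k base = 0 \<and> (\<forall>f\<in>Zh. Dir_inner_Zh f k = f y - f base))"

lemma ker: "ker y \<in> CPA" "ker y base = 0" "f \<in> Zh \<Longrightarrow> Dir_inner_Zh f (ker y) = f y - f base"
proof -
  have "\<exists>k. k \<in> CPA \<and> k base = 0 \<and> (\<forall>f\<in>Zh. Dir_inner_Zh f k = f y - f base)"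
    by (rule kernel_exists[of base y]) blast
  then have "ker y \<in> CPA \<and> ker y base = 0 \<and> (\<forall>f\<in>Zh. Dir_inner_Zh f (ker y) = f y - f base)"
    unfolding ker_def by (rule someI_ex)
  then show "ker y \<in> CPA" "ker y base = 0" "f \<in> Zh \<Longrightarrow> Dir_inner_Zh f (ker y) = f y - f base" by auto
qed

lemma ker_Zh [simp]: "ker y \<in> Zh"
  using ker(1) CPA_subset_Zh by blast

lemma ker_inner: "Dir_inner_Zh (ker x) (ker y) = ker x y"
  using ker(3)[OF ker_Zh] ker(2) by simp

lemma ker_cnj: "cnj (ker x y) = ker y x"
  using Zh.ip_cnj[OF ker_Zh ker_Zh] by (simp add: ker_inner)

lemma ker_self: "ker x x = of_real ((Zh.nrm (ker x))\<^sup>2)"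
  using Zh.ip_self[OF ker_Zh] by (simp add: ker_inner)

lemma ker_diff_inner: "f \<in> Zh \<Longrightarrow> Dir_inner_Zh f (ker x - ker y) = f x - f y"
  by (simp add: Zh.ip_diff_right ker(3))

lemma increment_le_ker: "f \<in> Zh \<Longrightarrow> norm (f x - f y) \<le> Zh.nrm f * Zh.nrm (ker x - ker y)"
  using Zh.Cauchy_Schwarz[of f "ker x - ker y"] by (simp add: ker_diff_inner)

text \<open>
  The squared norm of \<open>ker x - ker y\<close> is its own increment from \<open>y\<close> to \<open>x\<close>, to which \<open>Zh_increment_le\<close>
  applies with the segment from \<open>x\<close> to \<open>y\<close>; half of the squared norm is absorbed on the left.
\<close>

lemma nrm_ker_diff:
  assumes \<rho>: "star_radius x \<rho>" and y: "dist x y < \<rho>"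
  shows "(Zh.nrm (ker x - ker y))\<^sup>2 \<le> dist x y"
proof (cases "x = y")
  case False
  let ?u = "ker x - ker y" and ?d = "dist x y"
  have uZ: "?u \<in> Zh" by (intro Zh.W_simps ker_Zh)
  obtain v where v: "v \<in> Vec x" "y = move x ?d v" by (rule star_radius_ball[OF \<rho> y])
  have d: "0 < ?d" using False by simp
  have iso: "isometric_param {0..?d} (\<lambda>t. move x t v)"
    by (rule isometric_param_subset[OF star_ray_isometric[OF \<rho> v(1)]]) (use y in auto)
  have op: "open ((\<lambda>t. move x t v) ` {0<..<?d})" by (rule open_star_ray[OF \<rho> v(1)]) (use y in simp)
  have "(Zh.nrm ?u)\<^sup>2 = Re (?u x - ?u y)"
    using Zh.nrm_sq[OF uZ] ker_diff_inner[OF uZ] by simp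
  also have "\<dots> \<le> norm (?u y - ?u x)" using complex_Re_le_cmod by (metis norm_minus_commute)
  also have "\<dots> = norm (?u (move x ?d v) - ?u (move x 0 v))" by (simp only: v(2)[symmetric] move_0)
  also have "\<dots> \<le> ((Zh.nrm ?u)\<^sup>2 + ?d) / 2" by (rule Zh_increment_le[OF uZ d iso op])
  finally show ?thesis by simp
qed simp

lemma ker_continuous_in_norm:
  assumes "0 < e"
  obtains d where "0 < d" "\<And>y. dist x y < d \<Longrightarrow> Zh.nrm (ker x - ker y) < e"
proof -
  obtain \<rho> where \<rho>: "star_radius x \<rho>" using star_radius_exists by blast
  show ?thesis
  proof
    show "0 < min \<rho> (e\<^sup>2)" using star_radius_pos[OF \<rho>] assms by simp
    fix y assume "dist x y < min \<rho> (e\<^sup>2)"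
    then have "(Zh.nrm (ker x - ker y))\<^sup>2 < e\<^sup>2" using nrm_ker_diff[OF \<rho>, of y] by simp
    then show "Zh.nrm (ker x - ker y) < e" using assms by (simp add: power_less_imp_less_base)
  qed
qed

lemma continuous_nrm_ker: "continuous_on UNIV (\<lambda>x. Zh.nrm (ker x))"
  unfolding continuous_on_iff
proof (intro ballI allI impI)
  fix x :: 'a and e :: real assume "0 < e"
  then obtain d where d: "0 < d" "\<And>y. dist x y < d \<Longrightarrow> Zh.nrm (ker x - ker y) < e"
    using ker_continuous_in_norm[of e x] by blast
  have "dist (Zh.nrm (ker y)) (Zh.nrm (ker x)) < e" if "dist y x < d" for y
  proof -
    have "Zh.nrm (ker x - ker y) < e" using d(2) that by (simp add: dist_commute)
    then show ?thesis
      using Zh.nrm_triangle_diff[OF ker_Zh ker_Zh, of x y] Zh.nrm_triangle_diff[OF ker_Zh ker_Zh, of y x]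
        Zh.nrm_minus_commute[OF ker_Zh ker_Zh, of x y] by (simp add: dist_real_def abs_less_iff)
  qed
  then show "\<exists>d>0. \<forall>x'\<in>UNIV. dist x' x < d \<longrightarrow> dist (Zh.nrm (ker x')) (Zh.nrm (ker x)) < e" using d(1) by blast
qed

lemma nrm_ker_bounded:
  obtains K where "0 \<le> K" "\<And>x. Zh.nrm (ker x) \<le> K"
proof -
  obtain m where m: "\<And>x. Zh.nrm (ker x) \<le> Zh.nrm (ker m)"
    using continuous_attains_sup[OF compact_UNIV _ continuous_nrm_ker] by auto
  show ?thesis using that[of "Zh.nrm (ker m)"] m by simp
qed

lemma continuous_ker: "continuous_on UNIV (ker y)" "continuous_on UNIV (\<lambda>y. ker y x)"
  "continuous_on UNIV (\<lambda>x. ker x x)"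
proof -
  show c: "continuous_on UNIV (ker y)" for y by (rule ZhD(1)[OF ker_Zh])
  have "continuous_on UNIV (\<lambda>y. cnj (ker x y))" by (intro continuous_on_cnj c)
  then show "continuous_on UNIV (\<lambda>y. ker y x)" by (simp add: ker_cnj)
  show "continuous_on UNIV (\<lambda>x. ker x x)"
    unfolding ker_self by (intro continuous_intros continuous_nrm_ker)
qed

lemma Dir_inner_Zh_const: "Dir_inner_Zh f (\<lambda>x::'a. c) = 0"
  by (simp add: Dir_inner_Zh_def graph_deriv_def vector_derivative_const_at)

lemma Laplacian_determines_slopes:
  assumes "\<forall>A\<in>sets borel. Laplacian_CPA h A = indicator A y - indicator A \<zeta>"
  shows "slope_sum h p = (if p = \<zeta> then 1 else 0) - (if p = (y :: 'a) then 1 else 0)"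
proof -
  have "Laplacian_CPA h {p} = indicator {p} y - indicator {p} \<zeta>" using assms by simp
  moreover have "Laplacian_CPA h {p} = - slope_sum h p"
  proof (cases "slope_sum h p = 0")
    case False
    then have "{q \<in> {p}. slope_sum h q \<noteq> 0} = {p}" by auto
    then show ?thesis by (simp add: Laplacian_CPA_def)
  next
    case True
    then have "{q \<in> {p}. slope_sum h q \<noteq> 0} = {}" by auto
    then show ?thesis using True by (simp only: Laplacian_CPA_def sum.empty)
  qed
  ultimately have "- slope_sum h p = indicator {p} y - indicator {p} \<zeta>" by simp
  then have "slope_sum h p = indicator {p} \<zeta> - indicator {p} y" by (metis minus_diff_eq minus_minus)
  then show ?thesis by (auto simp: indicator_def)
qed

lemma Laplacian_of_slopes:
  assumes s: "\<And>p. slope_sum h p = (if p = \<zeta> then 1 else 0) - (if p = (y :: 'a) then 1 else 0)"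
  shows "Laplacian_CPA h A = indicator A y - indicator A \<zeta>"
proof -
  have "(\<Sum>p\<in>{p\<in>A. slope_sum h p \<noteq> 0}. slope_sum h p) = (\<Sum>p\<in>A \<inter> {y, \<zeta>}. slope_sum h p)"
    by (rule sum.mono_neutral_left) (auto simp: s)
  also have "\<dots> = indicator A \<zeta> - indicator A y"
    by (cases "y = \<zeta>"; cases "y \<in> A"; cases "\<zeta> \<in> A") (auto simp: s Int_insert_right)
  finally show ?thesis by (simp add: Laplacian_CPA_def)
qed

text \<open>
  The right-hand side, as a function of \<open>x\<close>, is \<open>ker y - ker \<zeta>\<close> up to a constant, so it represents
  \<open>f \<mapsto> f y - f \<zeta>\<close> and has the required Laplacian. Another function with this Laplacian differs by a
  harmonic function, which is constant by the maximum principle and vanishes at \<open>\<zeta>\<close>.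
\<close>

lemma j_kernel_eq: "j_kernel \<zeta> x y = ker y x - ker \<zeta> x - ker y \<zeta> + ker \<zeta> (\<zeta> :: 'a)"
proof -
  let ?c = "ker y \<zeta> - ker \<zeta> \<zeta>"
  let ?h = "\<lambda>x. ker y x - ker \<zeta> x - ker y \<zeta> + ker \<zeta> \<zeta>"
  let ?Q = "\<lambda>h. h \<in> CPA \<and> (\<forall>A\<in>sets borel. Laplacian_CPA h A = indicator A y - indicator A \<zeta>) \<and> h \<zeta> = 0"
  have d: "(\<lambda>x. 1 * ker y x + (-1) * ker \<zeta> x) \<in> CPA" by (rule CPA_combine[OF ker(1) ker(1)])
  have h: "?h = (\<lambda>x. 1 * (1 * ker y x + (-1) * ker \<zeta> x) + (-1) * ?c)" by (simp add: algebra_simps)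
  have hC: "?h \<in> CPA" unfolding h by (rule CPA_combine[OF d const_CPA])
  have "Dir_inner_Zh f ?h = f y - f \<zeta>" if f: "f \<in> Zh" for f
  proof -
    have cZ: "(\<lambda>x::'a. - ?c) \<in> Zh" using const_CPA CPA_subset_Zh by blast
    have "?h = (ker y - ker \<zeta>) + (\<lambda>x. - ?c)" by (simp add: fun_eq_iff)
    moreover have "Dir_inner_Zh f (\<lambda>x. - ?c) = 0" by (rule Dir_inner_Zh_const)
    ultimately show ?thesis using f cZ by (simp add: Zh.ip_add_right ker_diff_inner)
  qed
  then have slope: "slope_sum ?h p = (if p = \<zeta> then 1 else 0) - (if p = y then 1 else 0)" for p
    by (rule slope_sum_of_reproducing[OF hC])
  have "?Q ?h" using hC Laplacian_of_slopes[OF slope] by simp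
  moreover have "h = ?h" if Q: "?Q h" for h
  proof
    fix x
    let ?d = "\<lambda>x. 1 * h x + (-1) * ?h x"
    have dC: "?d \<in> CPA" using CPA_combine[of h ?h 1 "-1"] Q hC by blast
    have "slope_sum ?d p = 0" for p
      using slope_sum_combine[of h ?h 1 "-1" p] Laplacian_determines_slopes[of h y \<zeta> p] slope Q hC by simp
    then have "?d x = ?d \<zeta>" by (rule harmonic_constant[OF dC])
    also have "?d \<zeta> = 0" using Q by simp
    finally show "h x = ?h x" by algebra
  qed
  ultimately have "(THE h. ?Q h) = ?h" by (rule the_equality)
  then show ?thesis unfolding j_kernel_def by (simp only:)
qed

end

section \<open>Uniform convergence of the eigenfunction series\<close>

text \<open>
  Dini's theorem, for the limit \<open>0\<close>: the open sets on which \<open>s N < \<epsilon>\<close> increase with \<open>N\<close> and cover the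
  space, so one of them is the whole space.
\<close>

lemma Dini_decreasing_to_zero:
  fixes s :: "nat \<Rightarrow> 'a::topological_space \<Rightarrow> real"
  assumes compact: "compact (UNIV :: 'a set)" and cont: "\<And>n. continuous_on UNIV (s n)"
    and decr: "\<And>m n x. m \<le> n \<Longrightarrow> s n x \<le> s m x" and lim: "\<And>x. (\<lambda>n. s n x) \<longlonglongrightarrow> 0" and "0 < \<epsilon>"
  obtains N where "\<And>n x. N \<le> n \<Longrightarrow> s n x < \<epsilon>"
proof -
  have "\<exists>N. s N x < \<epsilon>" for x
    using order_tendstoD(2)[OF lim[of x] \<open>0 < \<epsilon>\<close>] by (auto simp: eventually_sequentially)
  then have cover: "UNIV \<subseteq> (\<Union>N\<in>UNIV. {x. s N x < \<epsilon>})" by auto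
  have op: "open {x. s N x < \<epsilon>}" for N by (rule open_Collect_less[OF cont continuous_on_const])
  obtain I where I: "finite I" "UNIV \<subseteq> (\<Union>N\<in>I. {x. s N x < \<epsilon>})"
    by (rule compactE_image[OF compact, of UNIV "\<lambda>N. {x. s N x < \<epsilon>}"]) (use op cover in auto)
  have "s n x < \<epsilon>" if "Max I \<le> n" for n x
  proof -
    obtain N where N: "N \<in> I" "s N x < \<epsilon>" using I(2) by blast
    then have "N \<le> n" using Max_ge[OF I(1)] that order_trans by blast
    then show ?thesis using decr[of N n x] N by linarith
  qed
  with that show ?thesis by blast
qed

context eigenbasis
begin

definition partial :: "nat \<Rightarrow> 'a \<Rightarrow> real" where "partial N x = (\<Sum>n<N. (norm (e n x))\<^sup>2)"

definition tail :: "nat \<Rightarrow> 'a \<Rightarrow> real" where "tail N x = (\<Sum>n. (norm (e n x))\<^sup>2) - partial N x"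

lemma summable_norm_e_sq: "summable (\<lambda>n. (norm (e n x))\<^sup>2)"
  by (rule summableI_nonneg_bounded[OF _ sum_norm_e_sq_le]) simp

lemma partial_mono: "K \<le> N \<Longrightarrow> partial K x \<le> partial N x"
  unfolding partial_def by (rule sum_mono2) auto

lemma partial_le: "partial N x \<le> (\<Sum>n. (norm (e n x))\<^sup>2)"
  unfolding partial_def by (rule sum_le_suminf[OF summable_norm_e_sq]) auto

lemma tail_bounds: "0 \<le> tail N x" "tail N x \<le> C\<^sup>2"
proof -
  show "0 \<le> tail N x" using partial_le by (simp add: tail_def)
  have "(\<Sum>n. (norm (e n x))\<^sup>2) \<le> C\<^sup>2" by (rule suminf_le_const[OF summable_norm_e_sq sum_norm_e_sq_le])
  moreover have "0 \<le> partial N x" by (simp add: partial_def sum_nonneg)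
  ultimately show "tail N x \<le> C\<^sup>2" by (simp add: tail_def)
qed

lemma tail_tendsto: "(\<lambda>N. tail N x) \<longlonglongrightarrow> 0"
proof -
  have "(\<lambda>N. partial N x) \<longlonglongrightarrow> (\<Sum>n. (norm (e n x))\<^sup>2)"
    unfolding partial_def by (rule summable_LIMSEQ[OF summable_norm_e_sq])
  then have "(\<lambda>N. (\<Sum>n. (norm (e n x))\<^sup>2) - partial N x) \<longlonglongrightarrow> (\<Sum>n. (norm (e n x))\<^sup>2) - (\<Sum>n. (norm (e n x))\<^sup>2)"
    by (intro tendsto_intros)
  then show ?thesis by (simp add: tail_def)
qed

lemma tail_decreasing: "K \<le> N \<Longrightarrow> tail N x \<le> tail K x"
  using partial_mono by (simp add: tail_def)

definition series :: "nat \<Rightarrow> 'a \<Rightarrow> 'a \<Rightarrow> complex" where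
  "series N x y = (\<Sum>n<N. e n x * cnj (e n y))"

text \<open>
  That the limit exists is shown in \<open>series_tendsto\<close>.
\<close>

definition kernel :: "'a \<Rightarrow> 'a \<Rightarrow> complex" where
  "kernel x y = lim (\<lambda>N. series N x y)"

text \<open>
  The Cauchy-Schwarz inequality for the terms with \<open>N \<le> n < K\<close>.
\<close>

lemma series_increment:
  assumes "N \<le> K"
  shows "norm (series K x y - series N x y) \<le> sqrt (tail N x) * sqrt (tail N y)"
proof -
  have d: "sum g {..<K} - sum g {..<N} = sum g {N..<K}" for g :: "nat \<Rightarrow> 'b::ab_group_add"
  proof -
    have "sum g {..<K} - sum g {..<N} = sum g ({..<K} - {..<N})" by (rule sum_diff[symmetric]) (use assms in auto)
    moreover have "{..<K} - {..<N} = {N..<K}" by auto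
    ultimately show ?thesis by simp
  qed
  have le: "L2_set (\<lambda>n. norm (e n z)) {N..<K} \<le> sqrt (tail N z)" for z
    unfolding L2_set_def using d[of "\<lambda>n. (norm (e n z))\<^sup>2"] partial_le[of K z] by (simp add: tail_def partial_def)
  have "norm (series K x y - series N x y) = norm (\<Sum>n=N..<K. e n x * cnj (e n y))"
    unfolding series_def d ..
  also have "\<dots> \<le> (\<Sum>n=N..<K. \<bar>norm (e n x)\<bar> * \<bar>norm (e n y)\<bar>)"
    by (rule order_trans[OF norm_sum]) (simp add: norm_mult)
  also have "\<dots> \<le> L2_set (\<lambda>n. norm (e n x)) {N..<K} * L2_set (\<lambda>n. norm (e n y)) {N..<K}"
    by (rule L2_set_mult_ineq)
  also have "\<dots> \<le> sqrt (tail N x) * sqrt (tail N y)"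
    by (intro mult_mono le) (auto simp: L2_set_nonneg tail_bounds)
  finally show ?thesis .
qed

lemma series_tendsto: "(\<lambda>N. series N x y) \<longlonglongrightarrow> kernel x y"
proof -
  have "Cauchy (\<lambda>N. series N x y)"
  proof (rule CauchyI)
    fix r :: real assume r: "0 < r"
    have "(\<lambda>N. sqrt (tail N x) * sqrt (tail N y)) \<longlonglongrightarrow> sqrt 0 * sqrt 0"
      by (intro tendsto_intros tail_tendsto)
    then obtain N where N: "\<And>n. n \<ge> N \<Longrightarrow> sqrt (tail n x) * sqrt (tail n y) < r"
      using order_tendstoD(2)[of "\<lambda>N. sqrt (tail N x) * sqrt (tail N y)" "sqrt 0 * sqrt 0" sequentially r] r
      by (auto simp: eventually_sequentially)
    have 1: "norm (series n x y - series m x y) < r" if "N \<le> m" "m \<le> n" for m n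
      using series_increment[OF that(2), of x y] N[OF that(1)] by linarith
    have "norm (series m x y - series n x y) < r" if "N \<le> m" "N \<le> n" for m n
    proof (cases "m \<le> n")
      case True
      show ?thesis using 1[OF that(1) True] by (simp only: norm_minus_commute)
    next
      case False
      then show ?thesis using 1[OF that(2), of m] by simp
    qed
    then show "\<exists>K. \<forall>m\<ge>K. \<forall>n\<ge>K. norm (series m x y - series n x y) < r" by blast
  qed
  then show ?thesis unfolding kernel_def by (simp add: Cauchy_convergent_iff convergent_LIMSEQ_iff)
qed

lemma series_error: "norm (series N x y - kernel x y) \<le> sqrt (tail N x) * sqrt (tail N y)"
proof -
  have "(\<lambda>K. norm (series K x y - series N x y)) \<longlonglongrightarrow> norm (kernel x y - series N x y)"
    by (intro tendsto_intros series_tendsto)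
  then have "norm (kernel x y - series N x y) \<le> sqrt (tail N x) * sqrt (tail N y)"
    by (rule LIMSEQ_le_const2) (use series_increment in blast)
  then show ?thesis by (simp add: norm_minus_commute)
qed

text \<open>
  For fixed \<open>x\<close> the tail at \<open>x\<close> tends to \<open>0\<close>, while the tail at \<open>y\<close> is bounded by \<open>C\<^sup>2\<close>. This weaker
  uniformity makes the sum continuous in each variable and allows means to be taken termwise; from these
  the sum is identified, and only then known to be continuous on the diagonal.
\<close>

lemma series_uniform_in_second: "uniform_limit UNIV (\<lambda>N y. series N x y) (kernel x) sequentially"
proof (rule uniform_limitI)
  fix r :: real assume r: "0 < r"
  have "(\<lambda>N. sqrt (tail N x) * C) \<longlonglongrightarrow> sqrt 0 * C" by (intro tendsto_intros tail_tendsto)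
  then have "\<forall>\<^sub>F N in sequentially. sqrt (tail N x) * C < r" using r by (intro order_tendstoD(2)) auto
  then show "\<forall>\<^sub>F N in sequentially. \<forall>y\<in>UNIV. dist (series N x y) (kernel x y) < r"
  proof eventually_elim
    case (elim N)
    have "dist (series N x y) (kernel x y) < r" for y
    proof -
      have "sqrt (tail N y) \<le> C" using tail_bounds(2)[of N y] C_nonneg by (simp add: real_le_lsqrt)
      then have "sqrt (tail N x) * sqrt (tail N y) \<le> sqrt (tail N x) * C"
        by (intro mult_left_mono) (simp_all add: tail_bounds)
      then show ?thesis using series_error[of N x y] elim by (simp add: dist_norm)
    qed
    then show ?case by blast
  qed
qed

lemma continuous_e: "continuous_on UNIV (e n)"
  by (rule H_continuous) simp

lemma continuous_kernel: "continuous_on UNIV (kernel x)"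
  by (rule uniform_limit_theorem[OF _ series_uniform_in_second])
     (auto intro!: always_eventually continuous_intros continuous_e simp: series_def)

lemma kernel_cnj: "cnj (kernel x y) = kernel y x"
proof -
  have eq: "cnj (series N x y) = series N y x" for N
    by (simp add: series_def cnj_sum mult.commute)
  have "(\<lambda>N. cnj (series N x y)) \<longlonglongrightarrow> cnj (kernel x y)" by (intro tendsto_cnj series_tendsto)
  then show ?thesis unfolding eq by (rule LIMSEQ_unique) (rule series_tendsto)
qed

lemma kernel_diagonal: "kernel x x = of_real (\<Sum>n. (norm (e n x))\<^sup>2)"
proof -
  have eq: "series N x x = of_real (partial N x)" for N
    unfolding series_def partial_def of_real_sum by (rule sum.cong[OF refl]) (simp only: complex_norm_square)
  have "(\<lambda>N. complex_of_real (partial N x)) \<longlonglongrightarrow> of_real (\<Sum>n. (norm (e n x))\<^sup>2)"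
    unfolding partial_def by (intro tendsto_of_real summable_LIMSEQ[OF summable_norm_e_sq])
  then show ?thesis using series_tendsto[of x x] unfolding eq using LIMSEQ_unique by blast
qed

text \<open>
  As in Mercer's theorem: continuity of the limit on the diagonal makes the convergence there uniform
  by Dini's theorem, and the Cauchy-Schwarz inequality carries this to all pairs.
\<close>

lemma series_uniform:
  assumes diag: "continuous_on UNIV (\<lambda>x. kernel x x)"
  shows "uniform_limit UNIV (\<lambda>N (x, y). series N x y) (\<lambda>(x, y). kernel x y) sequentially"
proof (rule uniform_limitI)
  fix r :: real assume r: "0 < r"
  have cont: "continuous_on UNIV (tail N)" for N
  proof -
    have "tail N = (\<lambda>x. Re (kernel x x) - partial N x)" by (simp add: fun_eq_iff tail_def kernel_diagonal)
    moreover have "continuous_on UNIV (\<lambda>x. Re (kernel x x) - partial N x)"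
      unfolding partial_def by (intro continuous_intros diag continuous_e)
    ultimately show ?thesis by simp
  qed
  obtain N where N: "\<And>n x. N \<le> n \<Longrightarrow> tail n x < r"
    using Dini_decreasing_to_zero[OF compact_UNIV cont tail_decreasing tail_tendsto r] by blast
  have "dist (series n x y) (kernel x y) < r" if "N \<le> n" for n x y
  proof -
    have "sqrt (tail n x) * sqrt (tail n y) < sqrt r * sqrt r"
      by (intro mult_strict_mono) (use N[OF that] r tail_bounds(1) in auto)
    then show ?thesis using series_error[of n x y] r by (simp add: dist_norm)
  qed
  then show "\<forall>\<^sub>F n in sequentially. \<forall>z\<in>UNIV. dist (case z of (x, y) \<Rightarrow> series n x y) (case z of (x, y) \<Rightarrow> kernel x y) < r"
    unfolding eventually_sequentially by auto
qed

end

section \<open>The completion of the smooth functions\<close>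

locale graph_measure = graph ty + S: signed_probability \<mu>
  for ty :: "'a::metric_space itself" and \<mu> :: "'a set \<Rightarrow> real"
begin

lemma Zh_mu_Zh: "f \<in> Zh_mu \<mu> \<Longrightarrow> f \<in> Zh" and Zh_mu_mean: "f \<in> Zh_mu \<mu> \<Longrightarrow> S.sint f = 0"
  by (auto simp: Zh_mu_def)

lemma subspace_Zh_mu: "fun_vs.subspace (Zh_mu \<mu>)"
  unfolding fun_vs.subspace_def
proof (intro conjI ballI allI)
  show "0 \<in> Zh_mu \<mu>" using S.sint_const[of 0] by (simp add: Zh_mu_def zero_fun_def[symmetric])
  fix f g c assume f: "f \<in> Zh_mu \<mu>"
  have "S.sint (scale_fun c f) = c * S.sint f" unfolding scale_fun_def by (rule S.sint_scale)
  then show "scale_fun c f \<in> Zh_mu \<mu>" using f by (auto simp: Zh_mu_def)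
  assume g: "g \<in> Zh_mu \<mu>"
  have "S.sint (f + g) = S.sint f + S.sint g"
    unfolding plus_fun_def by (rule S.sint_add) (use f g Zh_mu_Zh ZhD(1) in auto)
  then show "f + g \<in> Zh_mu \<mu>" using f g by (auto simp: Zh_mu_def)
qed

lemmas Zh_mu_diff = fun_vs.subspace_diff[OF subspace_Zh_mu]

text \<open>
  The choice of a bound is a constant of the locale because \<open>eval_const\<close> is a parameter of \<open>rkhs_L2\<close>.
\<close>

definition ker_bound :: real where
  "ker_bound = (SOME K. 0 \<le> K \<and> (\<forall>x. Zh.nrm (ker x) \<le> K))"

lemma ker_bound: "0 \<le> ker_bound" "Zh.nrm (ker x) \<le> ker_bound"
proof -
  have "\<exists>K. 0 \<le> K \<and> (\<forall>x. Zh.nrm (ker x) \<le> K)" by (rule nrm_ker_bounded) blast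
  then have "0 \<le> ker_bound \<and> (\<forall>x. Zh.nrm (ker x) \<le> ker_bound)" unfolding ker_bound_def by (rule someI_ex)
  then show "0 \<le> ker_bound" "Zh.nrm (ker x) \<le> ker_bound" by auto
qed

definition eval_const :: real where "eval_const = S.variation * (2 * ker_bound)"

lemma eval_const_nonneg: "0 \<le> eval_const"
  using S.variation_nonneg ker_bound(1) by (simp add: eval_const_def)

text \<open>A function of mean \<open>0\<close> is the mean of its increments \<open>f x - f y\<close>, which the kernel bounds.\<close>

lemma Zh_mu_eval:
  assumes f: "f \<in> Zh_mu \<mu>"
  shows "norm (f x) \<le> eval_const * Zh.nrm f"
proof -
  have fZ: "f \<in> Zh" by (rule Zh_mu_Zh[OF f])
  have cont: "continuous_on UNIV f" by (rule ZhD(1)[OF fZ])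
  have "S.sint (\<lambda>y. f x - f y) = f x"
    using S.sint_diff[OF continuous_on_const cont, of "f x"] S.sint_const Zh_mu_mean[OF f] by simp
  moreover have "norm (S.sint (\<lambda>y. f x - f y)) \<le> S.variation * (Zh.nrm f * (2 * ker_bound))"
  proof (rule S.norm_sint_le)
    show "continuous_on UNIV (\<lambda>y. f x - f y)" by (intro continuous_intros cont)
    fix y
    have "norm (f x - f y) \<le> Zh.nrm f * Zh.nrm (ker x - ker y)" by (rule increment_le_ker[OF fZ])
    also have "Zh.nrm (ker x - ker y) \<le> Zh.nrm (ker x) + Zh.nrm (ker y)"
      using Zh.nrm_triangle[of "ker x" "- ker y"] Zh.nrm_neg[OF ker_Zh] Zh.W_simps(5)[OF ker_Zh] by simp
    also have "\<dots> \<le> 2 * ker_bound" using ker_bound(2)[of x] ker_bound(2)[of y] by simp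
    finally show "norm (f x - f y) \<le> Zh.nrm f * (2 * ker_bound)"
      using fZ by (simp add: mult_left_mono)
  qed
  ultimately show ?thesis by (simp add: eval_const_def mult.commute mult.left_commute)
qed

lemma Zh_equicontinuous:
  assumes e: "0 < e"
  obtains d where "0 < d" "\<And>y f. dist x y < d \<Longrightarrow> f \<in> Zh \<Longrightarrow> norm (f x - f y) \<le> e * Zh.nrm f"
proof -
  obtain d where d: "0 < d" "\<And>y. dist x y < d \<Longrightarrow> Zh.nrm (ker x - ker y) < e"
    using ker_continuous_in_norm[OF e] by blast
  have "norm (f x - f y) \<le> e * Zh.nrm f" if "dist x y < d" and f: "f \<in> Zh" for y f
  proof -
    have "norm (f x - f y) \<le> Zh.nrm f * Zh.nrm (ker x - ker y)" by (rule increment_le_ker[OF f])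
    also have "\<dots> \<le> Zh.nrm f * e" using d(2)[OF that(1)] f by (intro mult_left_mono) auto
    finally show ?thesis by (simp add: mult.commute)
  qed
  with d(1) that show ?thesis by blast
qed

lemma Dir_approx_iff:
  "Dir_approx \<mu> F f \<longleftrightarrow> (\<forall>n. F n \<in> Zh_mu \<mu>) \<and>
     (\<forall>e>0. \<exists>N. \<forall>m\<ge>N. \<forall>n\<ge>N. Zh.nrm (F m - F n) < e) \<and> uniform_limit UNIV F f sequentially"
  unfolding Dir_approx_def Dir_norm_Zh_def Zh.nrm_def fun_diff_def ..

lemma Dir_approx_mem: "Dir_approx \<mu> F f \<Longrightarrow> F n \<in> Zh_mu \<mu>"
  and Dir_approx_Zh: "Dir_approx \<mu> F f \<Longrightarrow> F n \<in> Zh"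
  and Dir_approx_Cauchy: "Dir_approx \<mu> F f \<Longrightarrow> 0 < e \<Longrightarrow> \<exists>N. \<forall>m\<ge>N. \<forall>n\<ge>N. Zh.nrm (F m - F n) < e"
  and Dir_approx_uniform: "Dir_approx \<mu> F f \<Longrightarrow> uniform_limit UNIV F f sequentially"
  unfolding Dir_approx_iff using Zh_mu_Zh by blast+

lemma Dir_approx_pointwise: "Dir_approx \<mu> F f \<Longrightarrow> (\<lambda>n. F n x) \<longlonglongrightarrow> f x"
  using tendsto_uniform_limitI[OF Dir_approx_uniform] by blast

lemma Dir_approx_const: "f \<in> Zh_mu \<mu> \<Longrightarrow> Dir_approx \<mu> (\<lambda>_. f) f"
  unfolding Dir_approx_iff by (auto intro: uniform_limit_const)

lemma Dir_approx_add:
  assumes F: "Dir_approx \<mu> F f" and G: "Dir_approx \<mu> G g"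
  shows "Dir_approx \<mu> (\<lambda>n. F n + G n) (f + g)"
  unfolding Dir_approx_iff
proof (intro conjI allI impI)
  show "F n + G n \<in> Zh_mu \<mu>" for n
    using fun_vs.subspace_add[OF subspace_Zh_mu] Dir_approx_mem F G by blast
  fix e :: real assume "0 < e"
  then have e: "0 < e / 2" by simp
  obtain N where N: "\<And>m n. N \<le> m \<Longrightarrow> N \<le> n \<Longrightarrow> Zh.nrm (F m - F n) < e / 2" using Dir_approx_Cauchy[OF F e] by blast
  obtain M where M: "\<And>m n. M \<le> m \<Longrightarrow> M \<le> n \<Longrightarrow> Zh.nrm (G m - G n) < e / 2" using Dir_approx_Cauchy[OF G e] by blast
  have "Zh.nrm ((F m + G m) - (F n + G n)) < e" if "max N M \<le> m" "max N M \<le> n" for m n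
  proof -
    have "Zh.nrm ((F m - F n) + (G m - G n)) \<le> Zh.nrm (F m - F n) + Zh.nrm (G m - G n)"
      by (intro Zh.nrm_triangle Zh.W_simps(3) Dir_approx_Zh[OF F] Dir_approx_Zh[OF G])
    then show ?thesis using N[of m n] M[of m n] that by (simp add: algebra_simps)
  qed
  then show "\<exists>N. \<forall>m\<ge>N. \<forall>n\<ge>N. Zh.nrm ((F m + G m) - (F n + G n)) < e" by blast
next
  show "uniform_limit UNIV (\<lambda>n. F n + G n) (f + g) sequentially"
    unfolding plus_fun_def by (intro uniform_limit_add Dir_approx_uniform F G)
qed

lemma Dir_approx_scale:
  assumes F: "Dir_approx \<mu> F f"
  shows "Dir_approx \<mu> (\<lambda>n. scale_fun c (F n)) (scale_fun c f)"
  unfolding Dir_approx_iff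
proof (intro conjI allI impI)
  show "scale_fun c (F n) \<in> Zh_mu \<mu>" for n
    using fun_vs.subspace_scale[OF subspace_Zh_mu] Dir_approx_mem F by blast
  fix e :: real assume "0 < e"
  then have e: "0 < e / (norm c + 1)" by (simp add: add_nonneg_pos)
  obtain N where N: "\<And>m n. N \<le> m \<Longrightarrow> N \<le> n \<Longrightarrow> Zh.nrm (F m - F n) < e / (norm c + 1)" using Dir_approx_Cauchy[OF F e] by blast
  have "Zh.nrm (scale_fun c (F m) - scale_fun c (F n)) < e" if "N \<le> m" "N \<le> n" for m n
  proof -
    have Z: "F m - F n \<in> Zh" by (intro Zh.W_simps(3) Dir_approx_Zh[OF F])
    have "scale_fun c (F m) - scale_fun c (F n) = scale_fun c (F m - F n)"
      by (simp add: fun_vs.scale_right_diff_distrib)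
    then have "Zh.nrm (scale_fun c (F m) - scale_fun c (F n)) = norm c * Zh.nrm (F m - F n)"
      using Zh.nrm_scale[OF Z] by simp
    also have "\<dots> \<le> (norm c + 1) * Zh.nrm (F m - F n)" using Z by (intro mult_right_mono) auto
    also have "\<dots> < (norm c + 1) * (e / (norm c + 1))"
      by (rule mult_strict_left_mono[OF N[OF that]]) (simp add: add_nonneg_pos)
    also have "\<dots> = e" using norm_ge_zero[of c] by (simp add: nonzero_mult_div_cancel_left add_nonneg_eq_0_iff)
    finally show ?thesis .
  qed
  then show "\<exists>N. \<forall>m\<ge>N. \<forall>n\<ge>N. Zh.nrm (scale_fun c (F m) - scale_fun c (F n)) < e" by blast
next
  show "uniform_limit UNIV (\<lambda>n. scale_fun c (F n)) (scale_fun c f) sequentially"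
    unfolding scale_fun_def
    by (rule bounded_linear.uniform_limit[OF bounded_linear_mult_right Dir_approx_uniform[OF F]])
qed

lemma Dir_approx_diff:
  assumes F: "Dir_approx \<mu> F f" and G: "Dir_approx \<mu> G g"
  shows "Dir_approx \<mu> (\<lambda>n. F n - G n) (f - g)"
proof -
  have "scale_fun (-1) h = - h" for h :: "'a \<Rightarrow> complex" by (simp add: fun_eq_iff)
  then show ?thesis using Dir_approx_add[OF F Dir_approx_scale[OF G, of "-1"]] by simp
qed

text \<open>
  For fixed \<open>n\<close>, \<open>|F n|\<^sup>2\<close> differs by little from the product of \<open>F m\<close> and \<open>F n\<close>, which tends to \<open>0\<close> as
  \<open>m\<close> grows because \<open>F m\<close> does so uniformly.
\<close>

lemma Dir_approx_zero:
  assumes F: "Dir_approx \<mu> F 0"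
  shows "(\<lambda>n. Zh.nrm (F n)) \<longlonglongrightarrow> 0"
proof (rule LIMSEQ_I)
  fix r :: real assume r: "0 < r"
  then have r2: "0 < r / 2" by simp
  obtain N where N: "\<And>m n. N \<le> m \<Longrightarrow> N \<le> n \<Longrightarrow> Zh.nrm (F m - F n) < r / 2" using Dir_approx_Cauchy[OF F r2] by blast
  note FZ = Dir_approx_Zh[OF F]
  have "Zh.nrm (F n) < r" if n: "N \<le> n" for n
  proof -
    obtain c where c: "0 \<le> c" "\<And>u \<epsilon>. u \<in> Zh \<Longrightarrow> (\<And>x. norm (u x) \<le> \<epsilon>) \<Longrightarrow> norm (Dir_inner_Zh u (F n)) \<le> c * \<epsilon>"
      using Dir_inner_Zh_le_sup[OF FZ] by blast
    have "(Zh.nrm (F n))\<^sup>2 \<le> r / 2 * Zh.nrm (F n) + \<delta>" if \<delta>: "0 < \<delta>" for \<delta>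
    proof -
      have "0 < \<delta> / (c + 1)" using \<delta> c by simp
      then have "\<forall>\<^sub>F m in sequentially. \<forall>x\<in>UNIV. dist (F m x) (0 x) < \<delta> / (c + 1)"
        using uniform_limitD[OF Dir_approx_uniform[OF F]] by blast
      then obtain M where M: "\<And>m x. M \<le> m \<Longrightarrow> dist (F m x) (0 x) < \<delta> / (c + 1)"
        unfolding eventually_sequentially by blast
      define m where "m = max M N"
      have "norm (Dir_inner_Zh (F m) (F n)) \<le> c * (\<delta> / (c + 1))"
        by (rule c(2)[OF FZ]) (use M[of m] in \<open>auto simp: m_def intro: less_imp_le\<close>)
      also have "\<dots> \<le> \<delta>" using c(1) \<delta> by (simp add: field_simps)
      finally have 1: "norm (Dir_inner_Zh (F m) (F n)) \<le> \<delta>" .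
      have "norm (Dir_inner_Zh (F n - F m) (F n)) \<le> Zh.nrm (F n - F m) * Zh.nrm (F n)"
        by (intro Zh.Cauchy_Schwarz Zh.W_simps(3) FZ)
      also have "\<dots> \<le> r / 2 * Zh.nrm (F n)"
        using N[OF n, of m] FZ[of n] by (intro mult_right_mono) (auto simp: m_def)
      finally have 2: "norm (Dir_inner_Zh (F n - F m) (F n)) \<le> r / 2 * Zh.nrm (F n)" .
      have "(Zh.nrm (F n))\<^sup>2 = Re (Dir_inner_Zh (F n - F m) (F n)) + Re (Dir_inner_Zh (F m) (F n))"
        using FZ by (simp add: Zh.nrm_sq Zh.ip_diff)
      then show ?thesis
        using 1 2 complex_Re_le_cmod[of "Dir_inner_Zh (F n - F m) (F n)"] complex_Re_le_cmod[of "Dir_inner_Zh (F m) (F n)"]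
        by linarith
    qed
    then have "(Zh.nrm (F n))\<^sup>2 \<le> r / 2 * Zh.nrm (F n)" by (rule field_le_epsilon)
    then have "Zh.nrm (F n) \<le> r / 2"
      using Zh.nrm_nonneg[OF FZ, of n] r by (cases "Zh.nrm (F n) = 0") (auto simp: power2_eq_square)
    then show ?thesis using r by simp
  qed
  then show "\<exists>N. \<forall>n\<ge>N. norm (Zh.nrm (F n) - 0) < r"
    using Zh.nrm_nonneg[OF FZ] by auto
qed

lemma Dir_approx_bounded:
  assumes F: "Dir_approx \<mu> F f"
  obtains N B where "0 < B" "\<And>n. N \<le> n \<Longrightarrow> Zh.nrm (F n) \<le> B"
proof -
  obtain N where N: "\<And>m n. N \<le> m \<Longrightarrow> N \<le> n \<Longrightarrow> Zh.nrm (F m - F n) < 1" using Dir_approx_Cauchy[OF F, of 1] by auto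
  show ?thesis
  proof
    show "0 < Zh.nrm (F N) + 1" using Zh.nrm_nonneg[OF Dir_approx_Zh[OF F], of N] by simp
    fix n assume "N \<le> n"
    then show "Zh.nrm (F n) \<le> Zh.nrm (F N) + 1"
      using Zh.nrm_triangle_diff[OF Dir_approx_Zh[OF F] Dir_approx_Zh[OF F], of n N] N[of n N] by simp
  qed
qed

lemma Dir_inner_Zh_diff_le:
  assumes "f \<in> Zh" "f' \<in> Zh" "g \<in> Zh" "g' \<in> Zh"
  shows "norm (Dir_inner_Zh f g - Dir_inner_Zh f' g') \<le> Zh.nrm (f - f') * Zh.nrm g + Zh.nrm f' * Zh.nrm (g - g')"
proof -
  have "Dir_inner_Zh f g - Dir_inner_Zh f' g' = Dir_inner_Zh (f - f') g + Dir_inner_Zh f' (g - g')"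
    using assms by (simp add: Zh.ip_simps)
  also have "norm \<dots> \<le> norm (Dir_inner_Zh (f - f') g) + norm (Dir_inner_Zh f' (g - g'))" by (rule norm_triangle_ineq)
  also have "\<dots> \<le> Zh.nrm (f - f') * Zh.nrm g + Zh.nrm f' * Zh.nrm (g - g')"
    using assms by (intro add_mono Zh.Cauchy_Schwarz Zh.W_simps(3))
  finally show ?thesis .
qed

lemma Dir_inner_Zh_convergent:
  assumes F: "Dir_approx \<mu> F f" and G: "Dir_approx \<mu> G g"
  shows "convergent (\<lambda>n. Dir_inner_Zh (F n) (G n))"
proof -
  note FZ = Dir_approx_Zh[OF F] and GZ = Dir_approx_Zh[OF G]
  obtain N1 A where A: "0 < A" "\<And>n. N1 \<le> n \<Longrightarrow> Zh.nrm (F n) \<le> A" using Dir_approx_bounded[OF F] by blast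
  obtain N2 B where B: "0 < B" "\<And>n. N2 \<le> n \<Longrightarrow> Zh.nrm (G n) \<le> B" using Dir_approx_bounded[OF G] by blast
  have "Cauchy (\<lambda>n. Dir_inner_Zh (F n) (G n))"
  proof (rule CauchyI)
    fix r :: real assume r: "0 < r"
    obtain N3 where N3: "\<And>m n. N3 \<le> m \<Longrightarrow> N3 \<le> n \<Longrightarrow> Zh.nrm (F m - F n) < r / (2 * B)"
      using Dir_approx_Cauchy[OF F, of "r / (2 * B)"] r B(1) by auto
    obtain N4 where N4: "\<And>m n. N4 \<le> m \<Longrightarrow> N4 \<le> n \<Longrightarrow> Zh.nrm (G m - G n) < r / (2 * A)"
      using Dir_approx_Cauchy[OF G, of "r / (2 * A)"] r A(1) by auto
    define N where "N = Max {N1, N2, N3, N4}"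
    have N: "N1 \<le> N" "N2 \<le> N" "N3 \<le> N" "N4 \<le> N" by (auto simp: N_def)
    have "norm (Dir_inner_Zh (F m) (G m) - Dir_inner_Zh (F n) (G n)) < r" if mn: "N \<le> m" "N \<le> n" for m n
    proof -
      have "Zh.nrm (F m - F n) * Zh.nrm (G m) \<le> Zh.nrm (F m - F n) * B"
        using B(2)[of m] mn N Zh.nrm_nonneg[OF Zh.W_simps(3)[OF FZ FZ], of m n] by (intro mult_left_mono) auto
      also have "\<dots> < r / (2 * B) * B" using N3[of m n] mn N B(1) by (intro mult_strict_right_mono) auto
      finally have 1: "Zh.nrm (F m - F n) * Zh.nrm (G m) < r / 2" using B(1) by simp
      have "Zh.nrm (F n) * Zh.nrm (G m - G n) \<le> A * Zh.nrm (G m - G n)"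
        using A(2)[of n] mn N Zh.nrm_nonneg[OF Zh.W_simps(3)[OF GZ GZ], of m n] by (intro mult_right_mono) auto
      also have "\<dots> < A * (r / (2 * A))" using N4[of m n] mn N A(1) by (intro mult_strict_left_mono) auto
      finally have 2: "Zh.nrm (F n) * Zh.nrm (G m - G n) < r / 2" using A(1) by simp
      show ?thesis using Dir_inner_Zh_diff_le[OF FZ FZ GZ GZ, of m m n n] 1 2 by linarith
    qed
    then show "\<exists>M. \<forall>m\<ge>M. \<forall>n\<ge>M. norm (Dir_inner_Zh (F m) (G m) - Dir_inner_Zh (F n) (G n)) < r" by blast
  qed
  then show ?thesis by (simp add: Cauchy_convergent_iff)
qed

text \<open>
  The differences \<open>F' n - F n\<close> tend to \<open>0\<close> uniformly and so, by \<open>Dir_approx_zero\<close>, in the Dirichlet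
  norm.
\<close>

lemma Dir_inner_Zh_limits_agree:
  assumes F: "Dir_approx \<mu> F f" and G: "Dir_approx \<mu> G g" and F': "Dir_approx \<mu> F' f" and G': "Dir_approx \<mu> G' g"
    and lim: "(\<lambda>n. Dir_inner_Zh (F n) (G n)) \<longlonglongrightarrow> c"
  shows "(\<lambda>n. Dir_inner_Zh (F' n) (G' n)) \<longlonglongrightarrow> c"
proof -
  obtain N1 A where A: "0 < A" "\<And>n. N1 \<le> n \<Longrightarrow> Zh.nrm (F n) \<le> A" using Dir_approx_bounded[OF F] by blast
  obtain N2 B where B: "0 < B" "\<And>n. N2 \<le> n \<Longrightarrow> Zh.nrm (G' n) \<le> B" using Dir_approx_bounded[OF G'] by blast
  have n1: "(\<lambda>n. Zh.nrm (F' n - F n)) \<longlonglongrightarrow> 0" using Dir_approx_zero Dir_approx_diff[OF F' F] by simp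
  have n2: "(\<lambda>n. Zh.nrm (G' n - G n)) \<longlonglongrightarrow> 0" using Dir_approx_zero Dir_approx_diff[OF G' G] by simp
  have "(\<lambda>n. Zh.nrm (F' n - F n) * B + A * Zh.nrm (G' n - G n)) \<longlonglongrightarrow> 0 * B + A * 0"
    by (intro tendsto_intros n1 n2)
  then have b: "(\<lambda>n. Zh.nrm (F' n - F n) * B + A * Zh.nrm (G' n - G n)) \<longlonglongrightarrow> 0" by simp
  have "(\<lambda>n. Dir_inner_Zh (F' n) (G' n) - Dir_inner_Zh (F n) (G n)) \<longlonglongrightarrow> 0"
  proof (rule Lim_null_comparison[OF _ b])
    show "\<forall>\<^sub>F n in sequentially. norm (Dir_inner_Zh (F' n) (G' n) - Dir_inner_Zh (F n) (G n)) \<le>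
        Zh.nrm (F' n - F n) * B + A * Zh.nrm (G' n - G n)"
      using eventually_ge_at_top[of N1] eventually_ge_at_top[of N2]
    proof eventually_elim
      case (elim n)
      note Z = Dir_approx_Zh[OF F] Dir_approx_Zh[OF G] Dir_approx_Zh[OF F'] Dir_approx_Zh[OF G']
      have "Zh.nrm (F' n - F n) * Zh.nrm (G' n) \<le> Zh.nrm (F' n - F n) * B"
        using B(2)[OF elim(2)] Zh.nrm_nonneg[OF Zh.W_simps(3)[OF Z(3) Z(1)], of n n] by (intro mult_left_mono) auto
      moreover have "Zh.nrm (F n) * Zh.nrm (G' n - G n) \<le> A * Zh.nrm (G' n - G n)"
        using A(2)[OF elim(1)] Zh.nrm_nonneg[OF Zh.W_simps(3)[OF Z(4) Z(2)], of n n] by (intro mult_right_mono) auto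
      ultimately show ?case using Dir_inner_Zh_diff_le[OF Z(3) Z(1) Z(4) Z(2), of n n n n] by linarith
    qed
  qed
  from tendsto_add[OF this lim] show ?thesis by simp
qed

lemma tendsto_Dir_inner:
  assumes F: "Dir_approx \<mu> F f" and G: "Dir_approx \<mu> G g"
  shows "(\<lambda>n. Dir_inner_Zh (F n) (G n)) \<longlonglongrightarrow> Dir_inner \<mu> f g"
proof -
  obtain c where c: "(\<lambda>n. Dir_inner_Zh (F n) (G n)) \<longlonglongrightarrow> c"
    using Dir_inner_Zh_convergent[OF F G] by (auto simp: convergent_def)
  have "Dir_inner \<mu> f g = c"
    unfolding Dir_inner_def
  proof (rule the_equality)
    show "\<forall>F G. Dir_approx \<mu> F f \<and> Dir_approx \<mu> G g \<longrightarrow> (\<lambda>n. Dir_inner_Zh (F n) (G n)) \<longlonglongrightarrow> c"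
      using Dir_inner_Zh_limits_agree[OF F G _ _ c] by blast
    fix d assume "\<forall>F G. Dir_approx \<mu> F f \<and> Dir_approx \<mu> G g \<longrightarrow> (\<lambda>n. Dir_inner_Zh (F n) (G n)) \<longlonglongrightarrow> d"
    then have "(\<lambda>n. Dir_inner_Zh (F n) (G n)) \<longlonglongrightarrow> d" using F G by blast
    then show "d = c" using c by (rule LIMSEQ_unique)
  qed
  with c show ?thesis by simp
qed

lemma Dir_mu_approx: "f \<in> Dir_mu \<mu> \<Longrightarrow> \<exists>F. Dir_approx \<mu> F f"
  by (simp add: Dir_mu_def)

lemma Dir_muI: "Dir_approx \<mu> F f \<Longrightarrow> f \<in> Dir_mu \<mu>"
  by (auto simp: Dir_mu_def)

sublocale Dir: semi_inner scale_fun "Dir_mu \<mu>" "Dir_inner \<mu>"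
proof unfold_locales
  show "fun_vs.subspace (Dir_mu \<mu>)"
    unfolding fun_vs.subspace_def
  proof (intro conjI ballI allI)
    show "0 \<in> Dir_mu \<mu>" using Dir_approx_const[OF fun_vs.subspace_0[OF subspace_Zh_mu]] by (rule Dir_muI)
    fix f g c assume f: "f \<in> Dir_mu \<mu>"
    show "scale_fun c f \<in> Dir_mu \<mu>" using Dir_mu_approx[OF f] Dir_approx_scale Dir_muI by blast
    assume g: "g \<in> Dir_mu \<mu>"
    show "f + g \<in> Dir_mu \<mu>" using Dir_mu_approx[OF f] Dir_mu_approx[OF g] Dir_approx_add Dir_muI by blast
  qed
  fix f g h c
  assume "f \<in> Dir_mu \<mu>"
  then obtain F where F: "Dir_approx \<mu> F f" using Dir_mu_approx by blast
  note FZ = Dir_approx_Zh[OF F]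
  { assume "h \<in> Dir_mu \<mu>"
    then obtain K where K: "Dir_approx \<mu> K h" using Dir_mu_approx by blast
    have "Dir_inner_Zh (scale_fun c (F n)) (K n) = c * Dir_inner_Zh (F n) (K n)" for n
      by (rule Zh.ip_scale[OF FZ Dir_approx_Zh[OF K]])
    then have "(\<lambda>n. c * Dir_inner_Zh (F n) (K n)) \<longlonglongrightarrow> Dir_inner \<mu> (scale_fun c f) h"
      using tendsto_Dir_inner[OF Dir_approx_scale[OF F] K, of c] by simp
    then show "Dir_inner \<mu> (scale_fun c f) h = c * Dir_inner \<mu> f h"
      by (rule LIMSEQ_unique) (intro tendsto_mult_left tendsto_Dir_inner[OF F K]) }
  { assume "g \<in> Dir_mu \<mu>"
    then obtain G where G: "Dir_approx \<mu> G g" using Dir_mu_approx by blast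
    have "cnj (Dir_inner_Zh (F n) (G n)) = Dir_inner_Zh (G n) (F n)" for n
      by (rule Zh.ip_cnj[OF FZ Dir_approx_Zh[OF G]])
    then have "(\<lambda>n. Dir_inner_Zh (G n) (F n)) \<longlonglongrightarrow> cnj (Dir_inner \<mu> f g)"
      using tendsto_cnj[OF tendsto_Dir_inner[OF F G]] by simp
    then show "cnj (Dir_inner \<mu> f g) = Dir_inner \<mu> g f"
      by (rule LIMSEQ_unique) (rule tendsto_Dir_inner[OF G F]) }
  { assume "g \<in> Dir_mu \<mu>" "h \<in> Dir_mu \<mu>"
    then obtain G K where G: "Dir_approx \<mu> G g" and K: "Dir_approx \<mu> K h" using Dir_mu_approx by blast
    have "Dir_inner_Zh (F n + G n) (K n) = Dir_inner_Zh (F n) (K n) + Dir_inner_Zh (G n) (K n)" for n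
      by (rule Zh.ip_add[OF FZ Dir_approx_Zh[OF G] Dir_approx_Zh[OF K]])
    then have "(\<lambda>n. Dir_inner_Zh (F n) (K n) + Dir_inner_Zh (G n) (K n)) \<longlonglongrightarrow> Dir_inner \<mu> (f + g) h"
      using tendsto_Dir_inner[OF Dir_approx_add[OF F G] K] by simp
    then show "Dir_inner \<mu> (f + g) h = Dir_inner \<mu> f h + Dir_inner \<mu> g h"
      by (rule LIMSEQ_unique) (intro tendsto_add tendsto_Dir_inner[OF F K] tendsto_Dir_inner[OF G K]) }
  show "0 \<le> Re (Dir_inner \<mu> f f)"
    using tendsto_Re[OF tendsto_Dir_inner[OF F F]] by (rule LIMSEQ_le_const) (use Zh.ip_nonneg[OF FZ] in auto)
qed

lemma tendsto_Dir_nrm: "Dir_approx \<mu> F f \<Longrightarrow> (\<lambda>n. Zh.nrm (F n)) \<longlonglongrightarrow> Dir.nrm f"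
  unfolding Zh.nrm_def Dir.nrm_def by (intro tendsto_real_sqrt tendsto_Re tendsto_Dir_inner)

lemma Zh_mu_Dir_mu: "f \<in> Zh_mu \<mu> \<Longrightarrow> f \<in> Dir_mu \<mu>"
  by (rule Dir_muI[OF Dir_approx_const])

lemma Dir_nrm_Zh_mu: "f \<in> Zh_mu \<mu> \<Longrightarrow> Dir.nrm f = Zh.nrm f"
  using tendsto_Dir_nrm[OF Dir_approx_const] by (simp add: LIMSEQ_const_iff)

lemma Dir_approx_converges:
  assumes F: "Dir_approx \<mu> F f"
  shows "(\<lambda>n. Dir.nrm (F n - f)) \<longlonglongrightarrow> 0"
proof (rule LIMSEQ_I)
  fix r :: real assume r: "0 < r"
  obtain N where N: "\<And>m n. N \<le> m \<Longrightarrow> N \<le> n \<Longrightarrow> Zh.nrm (F m - F n) < r / 2"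
    using Dir_approx_Cauchy[OF F, of "r / 2"] r by auto
  have "Dir.nrm (F n - f) < r" if n: "N \<le> n" for n
  proof -
    have "(\<lambda>m. Zh.nrm (F n - F m)) \<longlonglongrightarrow> Dir.nrm (F n - f)"
      by (rule tendsto_Dir_nrm[OF Dir_approx_diff[OF Dir_approx_const[OF Dir_approx_mem[OF F]] F]])
    then have "Dir.nrm (F n - f) \<le> r / 2"
      by (rule LIMSEQ_le_const2) (use N[OF n] less_imp_le in blast)
    then show ?thesis using r by simp
  qed
  moreover have "F n - f \<in> Dir_mu \<mu>" for n
    by (intro Dir.W_simps(3) Dir_muI[OF F] Zh_mu_Dir_mu Dir_approx_mem[OF F])
  ultimately show "\<exists>N. \<forall>n\<ge>N. norm (Dir.nrm (F n - f) - 0) < r" by auto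
qed

text \<open>
  Each \<open>F n\<close> is replaced by a smooth \<open>G n\<close> at distance less than \<open>1 / (n + 1)\<close>. The sequence \<open>G\<close> is
  Cauchy, and by the bound on evaluations it converges uniformly.
\<close>

lemma Dir_complete:
  assumes F: "\<And>n. F n \<in> Dir_mu \<mu>" and Cauchy: "\<And>e. 0 < e \<Longrightarrow> \<exists>N. \<forall>m\<ge>N. \<forall>n\<ge>N. Dir.nrm (F m - F n) < e"
  shows "\<exists>f\<in>Dir_mu \<mu>. (\<lambda>n::nat. Dir.nrm (F n - f)) \<longlonglongrightarrow> 0"
proof -
  have "\<exists>g. g \<in> Zh_mu \<mu> \<and> Dir.nrm (F n - g) < inverse (real (Suc n))" for n
  proof -
    obtain G where G: "Dir_approx \<mu> G (F n)" using Dir_mu_approx[OF F] by blast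
    have "0 < inverse (real (Suc n))" by simp
    then obtain N where "norm (Dir.nrm (G N - F n) - 0) < inverse (real (Suc n))"
      using LIMSEQ_D[OF Dir_approx_converges[OF G]] by blast
    moreover have "Dir.nrm (G N - F n) = Dir.nrm (F n - G N)"
      by (rule Dir.nrm_minus_commute[OF Zh_mu_Dir_mu[OF Dir_approx_mem[OF G]] F])
    ultimately have "Dir.nrm (F n - G N) < inverse (real (Suc n))" by (simp add: abs_less_iff)
    then show ?thesis using Dir_approx_mem[OF G] by blast
  qed
  then obtain G where G: "\<And>n. G n \<in> Zh_mu \<mu>" "\<And>n. Dir.nrm (F n - G n) < inverse (real (Suc n))" by metis
  note GD = Zh_mu_Dir_mu[OF G(1)] and GZ = Zh_mu_Zh[OF G(1)]
  have GC: "\<exists>N. \<forall>m\<ge>N. \<forall>n\<ge>N. Zh.nrm (G m - G n) < e" if e: "0 < e" for e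
  proof -
    obtain N1 where N1: "\<And>m n. N1 \<le> m \<Longrightarrow> N1 \<le> n \<Longrightarrow> Dir.nrm (F m - F n) < e / 3" using Cauchy[of "e / 3"] e by auto
    obtain N2 where N2: "inverse (real (Suc N2)) < e / 3" using reals_Archimedean[of "e / 3"] e by auto
    have "Zh.nrm (G m - G n) < e" if mn: "max N1 N2 \<le> m" "max N1 N2 \<le> n" for m n
    proof -
      have s: "Dir.nrm (F k - G k) < e / 3" if "N2 \<le> k" for k
      proof -
        have "inverse (real (Suc k)) \<le> inverse (real (Suc N2))" using that by (intro le_imp_inverse_le) auto
        then show ?thesis using G(2)[of k] N2 by linarith
      qed
      have "Zh.nrm (G m - G n) = Dir.nrm (G m - G n)"
        by (rule Dir_nrm_Zh_mu[symmetric]) (intro Zh_mu_diff G)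
      moreover have "Dir.nrm (G m - G n) \<le> Dir.nrm (G m - F m) + Dir.nrm (F m - G n)" by (rule Dir.nrm_triangle3[OF GD GD F])
      moreover have "Dir.nrm (F m - G n) \<le> Dir.nrm (F m - F n) + Dir.nrm (F n - G n)" by (rule Dir.nrm_triangle3[OF F GD F])
      moreover have "Dir.nrm (G m - F m) = Dir.nrm (F m - G m)" by (rule Dir.nrm_minus_commute[OF GD F])
      moreover have "Dir.nrm (F m - G m) < e / 3" "Dir.nrm (F n - G n) < e / 3" "Dir.nrm (F m - F n) < e / 3"
        using s[of m] s[of n] N1[of m n] mn by simp_all
      ultimately show ?thesis by linarith
    qed
    then show ?thesis by blast
  qed
  have "uniformly_Cauchy_on UNIV G"
  proof (rule uniformly_Cauchy_onI)
    fix e :: real assume e: "0 < e"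
    then have "0 < e / (eval_const + 1)" using eval_const_nonneg by simp
    then obtain N where N: "\<And>m n. N \<le> m \<Longrightarrow> N \<le> n \<Longrightarrow> Zh.nrm (G m - G n) < e / (eval_const + 1)" using GC by blast
    have "dist (G m x) (G n x) < e" if "N \<le> m" "N \<le> n" for m n x
    proof -
      have "norm ((G m - G n) x) \<le> eval_const * Zh.nrm (G m - G n)"
        by (rule Zh_mu_eval) (intro Zh_mu_diff G)
      also have "\<dots> \<le> (eval_const + 1) * Zh.nrm (G m - G n)"
        using Zh.nrm_nonneg[OF Zh.W_simps(3)[OF GZ GZ], of m n] by (intro mult_right_mono) auto
      also have "\<dots> < e" using N[OF that] eval_const_nonneg by (simp add: field_simps)
      finally show ?thesis by (simp add: dist_norm)
    qed
    then show "\<exists>M. \<forall>x\<in>UNIV. \<forall>m\<ge>M. \<forall>n\<ge>M. dist (G m x) (G n x) < e" by blast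
  qed
  then obtain f where f: "uniform_limit UNIV G f sequentially"
    using Cauchy_uniformly_convergent by (auto simp: uniformly_convergent_on_def)
  have A: "Dir_approx \<mu> G f" unfolding Dir_approx_iff using G(1) GC f by blast
  have fD: "f \<in> Dir_mu \<mu>" by (rule Dir_muI[OF A])
  have "(\<lambda>n. inverse (real (Suc n)) + Dir.nrm (G n - f)) \<longlonglongrightarrow> 0 + 0"
    by (intro tendsto_add LIMSEQ_inverse_real_of_nat Dir_approx_converges[OF A])
  then have b: "(\<lambda>n. inverse (real (Suc n)) + Dir.nrm (G n - f)) \<longlonglongrightarrow> 0" by simp
  have "norm (Dir.nrm (F n - f)) \<le> inverse (real (Suc n)) + Dir.nrm (G n - f)" for n
    using Dir.nrm_triangle3[OF F fD GD, of n n] G(2)[of n] Dir.nrm_nonneg[OF Dir.W_simps(3)[OF F fD], of n] by simp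
  then have "(\<lambda>n. Dir.nrm (F n - f)) \<longlonglongrightarrow> 0"
    by (intro Lim_null_comparison[OF always_eventually[OF allI] b])
  then show ?thesis using fD by blast
qed

sublocale rkhs_L2 "Dir_mu \<mu>" "Dir_inner \<mu>" eval_const "arc_length :: 'a measure"
proof -
  interpret M: finite_measure "arc_length :: 'a measure" by (rule finite_measure_arc_length)
  show "rkhs_L2 (Dir_mu \<mu>) (Dir_inner \<mu>) eval_const (arc_length :: 'a measure)"
  proof unfold_locales
    fix f x assume "f \<in> Dir_mu \<mu>"
    then obtain F where F: "Dir_approx \<mu> F f" using Dir_mu_approx by blast
    show "norm (f x) \<le> eval_const * Dir.nrm f"
      by (rule LIMSEQ_le[OF tendsto_norm[OF Dir_approx_pointwise[OF F]] tendsto_mult_left[OF tendsto_Dir_nrm[OF F]]])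
         (use Zh_mu_eval[OF Dir_approx_mem[OF F]] in blast)
  next
    fix x :: 'a and e :: real assume e: "0 < e"
    obtain d where d: "0 < d" "\<And>y f. dist x y < d \<Longrightarrow> f \<in> Zh \<Longrightarrow> norm (f x - f y) \<le> e * Zh.nrm f"
      using Zh_equicontinuous[OF e] by blast
    have "norm (f x - f y) \<le> e * Dir.nrm f" if xy: "dist x y < d" and fD: "f \<in> Dir_mu \<mu>" for y f
    proof -
      obtain F where F: "Dir_approx \<mu> F f" using Dir_mu_approx[OF fD] by blast
      have l: "(\<lambda>n. norm (F n x - F n y)) \<longlonglongrightarrow> norm (f x - f y)"
        by (intro tendsto_norm tendsto_diff Dir_approx_pointwise[OF F])
      show ?thesis
        by (rule LIMSEQ_le[OF l tendsto_mult_left[OF tendsto_Dir_nrm[OF F]]])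
           (use d(2)[OF xy Dir_approx_Zh[OF F]] in blast)
    qed
    then show "\<exists>d>0. \<forall>y. dist x y < d \<longrightarrow> (\<forall>f\<in>Dir_mu \<mu>. norm (f x - f y) \<le> e * Dir.nrm f)" using d(1) by blast
  next
    show "0 \<le> eval_const" by (rule eval_const_nonneg)
    show "compact (UNIV :: 'a set)" by (rule S.compact_UNIV)
    show "sets (arc_length :: 'a measure) = sets borel" by (rule sets_arc_length)
    show "emeasure arc_length U \<noteq> 0" if "open U" "U \<noteq> {}" for U :: "'a set" by (rule arc_length_open_pos[OF that])
  qed (rule Dir_complete)
qed

lemma L2_eq_L2_inner: "L2 = L2_inner"
  by (simp add: fun_eq_iff L2_def L2_inner_def)

lemma eig_iff_eigenfunction: "eig l g \<longleftrightarrow> eigenfunction \<mu> l g"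
  by (simp add: eig_def eigenfunction_def L2_eq_L2_inner zero_fun_def)

lemma dim_eigenspace: "fun_vs.dim (eigenspace l) = eigenvalue_mult \<mu> l"
  by (simp add: eigenspace_def eigenvalue_mult_def eig_iff_eigenfunction zero_fun_def)

lemma Dir_mu_mean: "f \<in> Dir_mu \<mu> \<Longrightarrow> S.sint f = 0"
proof -
  assume "f \<in> Dir_mu \<mu>"
  then obtain F where F: "Dir_approx \<mu> F f" using Dir_mu_approx by blast
  have "(\<lambda>n. S.sint (F n)) \<longlonglongrightarrow> S.sint f"
    by (rule S.tendsto_sint[OF ZhD(1)[OF Dir_approx_Zh[OF F]] Dir_approx_uniform[OF F]])
  then show "S.sint f = 0" using Zh_mu_mean[OF Dir_approx_mem[OF F]] by (simp add: LIMSEQ_const_iff)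
qed

definition ker_mean :: "'a \<Rightarrow> complex" where "ker_mean z = S.sint (ker z)"

text \<open>
  The kernel \<open>ker z\<close> vanishes at the base point, and in general its mean is not \<open>0\<close>; subtracting a constant puts it
  into \<open>Zh_mu\<close> without changing Dirichlet products.
\<close>

definition centred_ker :: "'a \<Rightarrow> 'a \<Rightarrow> complex" where "centred_ker z = (\<lambda>x. ker z x - ker_mean z)"

lemma centred_ker_Zh_mu: "centred_ker z \<in> Zh_mu \<mu>"
proof -
  have "(\<lambda>x. 1 * ker z x + (- ker_mean z) * 1) \<in> Zh"
    by (rule Zh_combine[OF ker_Zh]) (use const_CPA CPA_subset_Zh in blast)
  then have "centred_ker z \<in> Zh" by (simp add: centred_ker_def)
  moreover have "S.sint (centred_ker z) = 0"
    unfolding centred_ker_def using S.sint_diff[OF ZhD(1)[OF ker_Zh] continuous_on_const] S.sint_const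
    by (simp add: ker_mean_def)
  ultimately show ?thesis by (simp add: Zh_mu_def)
qed

lemma centred_ker_inner:
  assumes "h \<in> Dir_mu \<mu>"
  shows "Dir_inner \<mu> (centred_ker z) h = cnj (h z) - cnj (h base)"
proof -
  obtain F where F: "Dir_approx \<mu> F h" using Dir_mu_approx[OF assms] by blast
  have eq: "Dir_inner_Zh (centred_ker z) (F n) = cnj (F n z - F n base)" for n
  proof -
    have FZ: "F n \<in> Zh" by (rule Dir_approx_Zh[OF F])
    have cZ: "(\<lambda>x::'a. - ker_mean z) \<in> Zh" using const_CPA CPA_subset_Zh by blast
    have "centred_ker z = ker z + (\<lambda>x. - ker_mean z)" by (simp add: centred_ker_def fun_eq_iff)
    then have "Dir_inner_Zh (F n) (centred_ker z) = F n z - F n base"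
      using FZ cZ by (simp add: Zh.ip_add_right Dir_inner_Zh_const ker(3))
    then show ?thesis using Zh.ip_cnj[OF FZ Zh_mu_Zh[OF centred_ker_Zh_mu], of z] by simp
  qed
  have "(\<lambda>n. Dir_inner_Zh (centred_ker z) (F n)) \<longlonglongrightarrow> Dir_inner \<mu> (centred_ker z) h"
    by (rule tendsto_Dir_inner[OF Dir_approx_const[OF centred_ker_Zh_mu] F])
  moreover have "(\<lambda>n. Dir_inner_Zh (centred_ker z) (F n)) \<longlonglongrightarrow> cnj (h z - h base)"
    unfolding eq by (intro tendsto_cnj tendsto_diff Dir_approx_pointwise[OF F])
  ultimately show ?thesis using LIMSEQ_unique by (metis complex_cnj_diff)
qed

end

section \<open>The kernel of the measure\<close>

context graph_measure
begin

text \<open>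
  Expanding the centred kernel in eigenfunctions determines the sum \<open>R y z\<close> of the series up to the
  term \<open>R y base\<close>; taking the mean over \<open>z\<close>, and then over \<open>y\<close>, determines the rest.
\<close>

lemma eigenfunction_series_uniform:
  assumes basis: "eigenbasis (Dir_mu \<mu>) (Dir_inner \<mu>) eval_const arc_length lam f"
  shows "uniform_limit UNIV (\<lambda>N (x, y). \<Sum>n<N. f n x * cnj (f n y) / of_real (lam n))
    (\<lambda>(x, y). g_mu \<mu> x y) sequentially"
proof -
  interpret E: eigenbasis "Dir_mu \<mu>" "Dir_inner \<mu>" eval_const "arc_length :: 'a measure" lam f by (rule basis)
  let ?e = E.e and ?R = E.kernel
  have expand: "centred_ker z y = ?R y z - ?R y base" for y z
  proof -
    have "(\<Sum>n<N. Dir_inner \<mu> (centred_ker z) (?e n) * ?e n y) = E.series N y z - E.series N y base" for N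
      unfolding E.series_def sum_subtractf[symmetric]
      by (rule sum.cong[OF refl]) (simp add: centred_ker_inner[OF E.e_H] algebra_simps)
    then have "(\<lambda>N. E.series N y z - E.series N y base) \<longlonglongrightarrow> centred_ker z y"
      using E.expansion[OF Zh_mu_Dir_mu[OF centred_ker_Zh_mu], of z y] by simp
    moreover have "(\<lambda>N. E.series N y z - E.series N y base) \<longlonglongrightarrow> ?R y z - ?R y base"
      by (intro tendsto_diff E.series_tendsto)
    ultimately show ?thesis by (rule LIMSEQ_unique)
  qed
  have mean_R: "S.sint (?R y) = 0" for y
  proof -
    have cont: "continuous_on UNIV (\<lambda>z. ?e n y * cnj (?e n z))" for n
      by (intro continuous_intros E.continuous_e)
    have "S.sint (E.series N y) = (\<Sum>n<N. S.sint (\<lambda>z. ?e n y * cnj (?e n z)))" for N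
      unfolding E.series_def[abs_def] by (rule S.sint_sum[OF cont])
    moreover have "S.sint (\<lambda>z. ?e n y * cnj (?e n z)) = 0" for n
      using S.sint_scale[of "?e n y" "\<lambda>z. cnj (?e n z)"] S.sint_cnj[of "?e n"] Dir_mu_mean[OF E.e_H, of n] by simp
    ultimately have z: "S.sint (E.series N y) = 0" for N by simp
    have cs: "continuous_on UNIV (E.series N y)" for N
      unfolding E.series_def[abs_def] by (intro continuous_on_sum cont)
    have "(\<lambda>N. S.sint (E.series N y)) \<longlonglongrightarrow> S.sint (?R y)"
      by (rule S.tendsto_sint[OF cs E.series_uniform_in_second])
    then show ?thesis unfolding z by (simp add: LIMSEQ_const_iff)
  qed
  have cR: "continuous_on UNIV (?R y)" "continuous_on UNIV (\<lambda>x. ?R x y)" for y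
  proof -
    show c: "continuous_on UNIV (?R y)" for y by (rule E.continuous_kernel)
    have "continuous_on UNIV (\<lambda>x. cnj (?R y x))" by (intro continuous_on_cnj c)
    then show "continuous_on UNIV (\<lambda>x. ?R x y)" by (simp add: E.kernel_cnj)
  qed
  \<comment> \<open>\<open>ker_mean\<close> and \<open>K2\<close> are the means of the kernel over its two variables, and \<open>m\<close> is the double mean.\<close>
  define K2 where "K2 y = S.sint (\<lambda>z. ker z y)" for y
  define m where "m = S.sint ker_mean"
  have mean_eq: "ker_mean z = ?R base base - ?R base z" for z
    using expand[of z base] ker(2)[of z] by (simp add: centred_ker_def algebra_simps)
  have c_mean: "continuous_on UNIV ker_mean"
    unfolding mean_eq[abs_def] by (intro continuous_intros cR)
  have R_base: "?R y base = m - K2 y" for y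
  proof -
    have "S.sint (\<lambda>z. ker z y - ker_mean z) = K2 y - m"
      unfolding K2_def m_def by (rule S.sint_diff[OF continuous_ker(2) c_mean])
    moreover have "S.sint (\<lambda>z. ?R y z - ?R y base) = 0 - ?R y base"
      using S.sint_diff[OF cR(1)[of y] continuous_on_const, of "?R y base"] mean_R[of y] S.sint_const by simp
    moreover have "(\<lambda>z. ker z y - ker_mean z) = (\<lambda>z. ?R y z - ?R y base)"
      using expand[of _ y] by (simp add: centred_ker_def)
    ultimately show ?thesis by (simp add: algebra_simps)
  qed
  have R_eq: "?R y z = ker z y - ker_mean z - K2 y + m" for y z
    using expand[of z y] R_base[of y] by (simp add: centred_ker_def algebra_simps)
  have K2_eq: "K2 y = m - ?R y base" for y using R_base[of y] by (simp add: algebra_simps)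
  have c_K2: "continuous_on UNIV K2" unfolding K2_eq[abs_def] by (intro continuous_intros cR)
  \<comment> \<open>Equality of the two iterated means, without Fubini's theorem: \<open>R\<close> has mean \<open>0\<close> in both variables.\<close>
  have mean_K2: "S.sint K2 = m"
  proof -
    have "S.sint (\<lambda>y. ?R y z) = 0" for z
    proof -
      have "S.sint (\<lambda>y. cnj (?R z y)) = cnj (S.sint (?R z))" by (rule S.sint_cnj)
      then show ?thesis by (simp add: E.kernel_cnj mean_R)
    qed
    moreover have "S.sint (\<lambda>y. ker base y - ker_mean base - K2 y + m) = ker_mean base - ker_mean base - S.sint K2 + m"
    proof -
      have c1: "continuous_on UNIV (\<lambda>y. ker base y - ker_mean base)" by (intro continuous_intros continuous_ker)
      have c2: "continuous_on UNIV (\<lambda>y. ker base y - ker_mean base - K2 y)" by (intro continuous_on_diff c1 c_K2)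
      show ?thesis
        using S.sint_add[OF c2 continuous_on_const, of m] S.sint_diff[OF c1 c_K2]
          S.sint_diff[OF continuous_ker(1) continuous_on_const, of base "ker_mean base"] S.sint_const
        by (simp add: ker_mean_def)
    qed
    ultimately show ?thesis unfolding R_eq by (simp add: algebra_simps)
  qed
  define c where "c = S.sint (\<lambda>\<zeta>. ker \<zeta> \<zeta>)"
  have j_eq: "j_mu \<mu> x y = ker y x - K2 x - ker_mean y + c" for x y
  proof -
    have c1: "continuous_on UNIV (\<lambda>\<zeta>. ker y x - ker \<zeta> x)" by (intro continuous_intros continuous_ker)
    have c2: "continuous_on UNIV (\<lambda>\<zeta>. ker y x - ker \<zeta> x - ker y \<zeta>)" by (intro continuous_on_diff c1 continuous_ker)
    show ?thesis
      unfolding j_mu_def j_kernel_eq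
      using S.sint_add[OF c2 continuous_ker(3)] S.sint_diff[OF c1 continuous_ker(1), of y]
        S.sint_diff[OF continuous_on_const continuous_ker(2), of "ker y x" x] S.sint_const
      by (simp add: K2_def ker_mean_def c_def)
  qed
  have mean_j: "S.sint (\<lambda>x. j_mu \<mu> x y) = c - m" for y
  proof -
    have c1: "continuous_on UNIV (\<lambda>x. ker y x - K2 x)" by (intro continuous_on_diff continuous_ker c_K2)
    have c2: "continuous_on UNIV (\<lambda>x. ker y x - K2 x - ker_mean y)" by (intro continuous_on_diff c1 continuous_on_const)
    show ?thesis
      unfolding j_eq
      using S.sint_add[OF c2 continuous_on_const, of c] S.sint_diff[OF c1 continuous_on_const, of "ker_mean y"]
        S.sint_diff[OF continuous_ker(1) c_K2, of y] S.sint_const mean_K2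
      by (simp add: ker_mean_def)
  qed
  have "c_mu \<mu> = c - m"
    unfolding c_mu_def by (rule the_equality) (use mean_j in auto)
  then have g_eq: "g_mu \<mu> x y = ?R x y" for x y
    by (simp add: g_mu_def j_eq R_eq)
  have diag: "continuous_on UNIV (\<lambda>x. ?R x x)"
    unfolding R_eq by (intro continuous_intros continuous_ker c_mean c_K2)
  have series: "E.series N x y = (\<Sum>n<N. f n x * cnj (f n y) / of_real (lam n))" for N x y
    unfolding E.series_def
  proof (rule sum.cong[OF refl])
    fix n
    have "complex_of_real (sqrt (lam n)) * of_real (sqrt (lam n)) = of_real (lam n)"
      using E.lam_pos[of n] by (simp flip: of_real_mult)
    then show "?e n x * cnj (?e n y) = f n x * cnj (f n y) / of_real (lam n)"
      by (simp add: E.e_def)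
  qed
  show ?thesis using E.series_uniform[OF diag] unfolding series g_eq .
qed

end

section \<open>Expansion of the kernel in eigenfunctions\<close>

theorem proposition1p5:
  fixes \<mu> :: "'a::metric_space set \<Rightarrow> real"
    and lam :: "nat \<Rightarrow> real"
    and f :: "nat \<Rightarrow> 'a \<Rightarrow> complex"
  assumes "metrized_graph TYPE('a)"
    and "signed_borel_measure \<mu>"
    and "\<mu> UNIV = 1"
    and "total_variation \<mu> UNIV < \<infinity>"
    and "0 < lam 0"
    and "mono lam"
    and "\<And>n. eigenfunction \<mu> (of_real (lam n)) (f n)"
    and "\<And>l. eigenvalue \<mu> l \<Longrightarrow> card {n. of_real (lam n) = l} = eigenvalue_mult \<mu> l"
    and "\<And>m n. L2_inner (f m) (f n) = (if m = n then 1 else 0)"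
  shows "uniform_limit UNIV
    (\<lambda>N (x, y). \<Sum>n<N. f n x * cnj (f n y) / of_real (lam n))
    (\<lambda>(x, y). g_mu \<mu> x y) sequentially"
proof -
  have "compact (UNIV :: 'a set)" using assms(1) by (simp add: metrized_graph_def)
  then interpret graph_measure "TYPE('a)" \<mu>
    by unfold_locales (use assms in auto)
  have "eigenbasis (Dir_mu \<mu>) (Dir_inner \<mu>) eval_const arc_length lam f"
  proof unfold_locales
    show "eig (of_real (lam n)) (f n)" for n using assms(7) by (simp add: eig_iff_eigenfunction)
    show "0 < lam n" for n using monoD[OF assms(6), of 0 n] assms(5) by simp
    show "L2 (f m) (f n) = (if m = n then 1 else 0)" for m n using assms(9) by (simp add: L2_eq_L2_inner)
    show "card {n. of_real (lam n) = l} = fun_vs.dim (eigenspace l)" if "eig l g" for l g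
      using that assms(8)[of l] by (auto simp: dim_eigenspace eig_iff_eigenfunction eigenvalue_def)
  qed
  then show ?thesis by (rule eigenfunction_series_uniform)
qed

end
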